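(* Let $K$ be a field of characteristic zero, let $Q$ be a finite quiver, let $\alpha$ be a super-dimension vector for $Q$ and let $b\in\mathbb{Z}_2^{Q_0}$ be a parity vector. Then the superalgebra $\mathsf{SI}_Q(\alpha,b)$ of polynomial invariants is generated by the invariants $\mathrm{str}(\Pi^bX(p))$, where $p$ runs over the closed paths in $Q$.
   Context: **Super conventions.** $K$ is a field of characteristic zero. A superspace is a $\mathbb{Z}_2$-graded vector space $V=V_0\oplus V_1$, with parity $|v|=i$ for $0\neq v\in V_i$; its super-dimension is $\dim V_0|\dim V_1$. The parity shift $\Pi V$ is given by $(\Pi V)_i=V_{i+1 \bmod 2}$; a homogeneous $v\in V$ viewed in $\Pi V$ is written $\Pi v$. $\mathrm{Sym}(V)$ is the free super-commutative superalgebra on $V$ (tensor superalgebra modulo $vw=(-1)^{|v||w|}wv$). For a superspace $V$ of super-dimension $m|n$, $\mathrm{GL}(V)=\mathrm{GL}(m|n)$ is the affine supergroup assigning to each super-commutative $K$-superalgebra $A$ the group of even $A$-linear automorphisms of $V\otimes A$. Duals, tensor products, parity shifts and symmetric superalgebras of supermodules over a supergroup are supermodules in the standard way (with the sign rule). **Quivers.** $Q=(Q_0,Q_1,t,h)$ is a finite quiver with vertex set $Q_0$, edge set $Q_1$, tail $t$ and head $h$. A path $p$ is a sequence of edges $e_1,\dots,e_k$ with $h(e_{i+1})=t(e_i)$ for $1\le i\le k-1$; it is closed if $h(e_1)=t(e_k)$. A super-dimension vector $\alpha$ assigns to each $a\in Q_0$ a pair $\alpha(a)=\alpha(a)_0|\alpha(a)_1$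 of non-negative integers; $d_\alpha(a)=\alpha(a)_0+\alpha(a)_1$. Put $\mathrm{GL}(\alpha)=\prod_{a\in Q_0}\mathrm{GL}(\alpha(a))$. **Coordinate superalgebra and invariants.** For each $a\in Q_0$ fix a superspace $V(a)$ of super-dimension $\alpha(a)$ with homogeneous basis $v_1(a),\dots,v_{d_\alpha(a)}(a)$, the first $\alpha(a)_0$ vectors being even and the others odd, and let $v_i^*(a)$ be the dual basis of $V(a)^*$. For $b\in\mathbb{Z}_2^{Q_0}$ let $\Pi^b\alpha$ be the super-dimension vector with $(\Pi^b\alpha)(a)_i=\alpha(a)_{i+b(a)\bmod 2}$. The $\mathrm{GL}(\alpha)$-supermodule superalgebra $$K[\mathsf{SRep}_{\Pi^b\alpha}(Q)]=\mathrm{Sym}\Big(\bigoplus_{e\in Q_1}\Pi^{b(h(e))}V(h(e))^*\otimes\Pi^{b(t(e))}V(t(e))\Big)$$ is the polynomial superalgebra freely generated by $\Pi^bx_{ij}(e)=\Pi^{b(h(e))}v_i^*(h(e))\otimes\Pi^{b(t(e))}v_j(t(e))$ ($e\in Q_1$, $1\le i\le d_\alpha(h(e))$, $1\le j\le d_\alpha(t(e))$); it is the coordinate superalgebra of the affine superscheme of super-representations of $Q$ of super-dimension $\Pi^b\alpha$, on which $g=(g(a))_a$ acts by $M(e)\mapsto g(h(e))M(e)g(t(e))^{-1}$. $\mathsf{SI}_Q(\alpha,b)=K[\mathsf{SRep}_{\Pi^b\alpha}(Q)]^{\mathrm{GL}(\alpha)}$ denotes the superalgebra of polynomial invariants. Let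 $\Pi^bX(e)=(\Pi^bx_{ij}(e))_{i,j}$ be the generic matrix. **Supertraces.** For a path $p=(e_1,\dots,e_k)$ put $\Pi^bX(p)=\Pi^bX(e_1)\cdots\Pi^bX(e_k)$. For a closed path $p$ at a vertex $a$, $\mathrm{str}(\Pi^bX(p))$ is the supertrace with respect to the grading of $\Pi^{b(a)}V(a)$: the sum of the diagonal entries indexed by even basis vectors $\Pi^{b(a)}v_i(a)$ minus the sum of those indexed by odd ones. *)

theory Defs
  imports "HOL-Algebra.QuotRing" "HOL-Algebra.Module" "HOL-Library.Z2" "Graph_Theory.Digraph"
begin

section \<open>Superalgebras over a field\<close>

text \<open>
  Parities are elements of the two-element field \<^typ>\<open>bit\<close>. The ground field is the type
  \<open>'k\<close>; superalgebras over it are carrier-based, and \<open>homog A p\<close> is the homogeneous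
  component of parity \<open>p\<close>.
\<close>

record ('k, 'a) salg = "('k, 'a) module" +
  homog :: "bit \<Rightarrow> 'a set"

definition koszul :: "bit \<Rightarrow> 'k::field" where
  "koszul p = (if p = 1 then - 1 else 1)"

locale superalgebra = ring A for A :: "('k::field, 'a, 'm) salg_scheme" (structure) +
  assumes smult_closed: "x \<in> carrier A \<Longrightarrow> c \<odot> x \<in> carrier A"
    and smult_l_distr: "x \<in> carrier A \<Longrightarrow> (c + d) \<odot> x = (c \<odot> x) \<oplus> (d \<odot> x)"
    and smult_r_distr: "x \<in> carrier A \<Longrightarrow> y \<in> carrier A \<Longrightarrow> c \<odot> (x \<oplus> y) = (c \<odot> x) \<oplus> (c \<odot> y)"
    and smult_assoc: "x \<in> carrier A \<Longrightarrow> (c * d) \<odot> x = c \<odot> (d \<odot> x)"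
    and smult_one: "x \<in> carrier A \<Longrightarrow> 1 \<odot> x = x"
    and smult_mult_left: "x \<in> carrier A \<Longrightarrow> y \<in> carrier A \<Longrightarrow> (c \<odot> x) \<otimes> y = c \<odot> (x \<otimes> y)"
    and smult_mult_right: "x \<in> carrier A \<Longrightarrow> y \<in> carrier A \<Longrightarrow> x \<otimes> (c \<odot> y) = c \<odot> (x \<otimes> y)"
    and homog_subgroup: "additive_subgroup (homog A p) A"
    and homog_smult: "x \<in> homog A p \<Longrightarrow> c \<odot> x \<in> homog A p"
    and homog_decomp: "x \<in> carrier A \<Longrightarrow> \<exists>y\<in>homog A 0. \<exists>z\<in>homog A 1. x = y \<oplus> z"
    and homog_direct: "homog A 0 \<inter> homog A 1 = {\<zero>}"
    and homog_one: "\<one> \<in> homog A 0"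
    and homog_mult: "x \<in> homog A p \<Longrightarrow> y \<in> homog A q \<Longrightarrow> x \<otimes> y \<in> homog A (p + q)"

locale supercommutative_superalgebra = superalgebra +
  assumes supercommute:
    "x \<in> homog A p \<Longrightarrow> y \<in> homog A q \<Longrightarrow> x \<otimes> y = koszul (p * q) \<odot> (y \<otimes> x)"

definition salg_hom ::
  "('k, 'a, 'm) salg_scheme \<Rightarrow> ('k, 'b, 'n) salg_scheme \<Rightarrow> ('a \<Rightarrow> 'b) set" where
  "salg_hom A B = {\<phi> \<in> ring_hom A B.
     (\<forall>c. \<forall>x\<in>carrier A. \<phi> (c \<odot>\<^bsub>A\<^esub> x) = c \<odot>\<^bsub>B\<^esub> \<phi> x) \<and> (\<forall>p. \<phi> ` homog A p \<subseteq> homog B p)}"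

inductive_set generated_subalgebra :: "('k, 'a, 'm) salg_scheme \<Rightarrow> 'a set \<Rightarrow> 'a set"
  for A (structure) and S where
  one: "\<one> \<in> generated_subalgebra A S"
| gen: "x \<in> S \<Longrightarrow> x \<in> generated_subalgebra A S"
| add: "x \<in> generated_subalgebra A S \<Longrightarrow> y \<in> generated_subalgebra A S \<Longrightarrow>
    x \<oplus> y \<in> generated_subalgebra A S"
| mult: "x \<in> generated_subalgebra A S \<Longrightarrow> y \<in> generated_subalgebra A S \<Longrightarrow>
    x \<otimes> y \<in> generated_subalgebra A S"
| smult: "x \<in> generated_subalgebra A S \<Longrightarrow> c \<odot> x \<in> generated_subalgebra A S"


section \<open>The free supercommutative superalgebra\<close>

text \<open>
  The tensor superalgebra of the superspace with homogeneous basis \<open>X\<close>, where \<open>x\<close> has parity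
  \<open>par x\<close>: finitely supported functions on the words over \<open>X\<close>, multiplied by convolution along
  concatenation of words.
\<close>

definition conv :: "('x list \<Rightarrow> 'k::field) \<Rightarrow> ('x list \<Rightarrow> 'k) \<Rightarrow> 'x list \<Rightarrow> 'k" where
  "conv f g w = (\<Sum>i\<le>length w. f (take i w) * g (drop i w))"

definition tensor_salg :: "'x set \<Rightarrow> ('x \<Rightarrow> bit) \<Rightarrow> ('k::field, 'x list \<Rightarrow> 'k) salg" where
  "tensor_salg X par =
    (let C = {f. finite {w. f w \<noteq> 0} \<and> {w. f w \<noteq> 0} \<subseteq> lists X} in
     \<lparr>carrier = C,
      mult = conv,
      one = (\<lambda>w. if w = [] then 1 else 0),
      zero = (\<lambda>w. 0),
      add = (\<lambda>f g w. f w + g w),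
      smult = (\<lambda>c f w. c * f w),
      homog = (\<lambda>p. {f \<in> C. \<forall>w. f w \<noteq> 0 \<longrightarrow> sum_list (map par w) = p})\<rparr>)"

definition word :: "'x list \<Rightarrow> 'x list \<Rightarrow> 'k::field" where
  "word w = (\<lambda>u. if u = w then 1 else 0)"

definition supercommutator_ideal :: "'x set \<Rightarrow> ('x \<Rightarrow> bit) \<Rightarrow> ('x list \<Rightarrow> 'k::field) set" where
  "supercommutator_ideal X par = genideal (tensor_salg X par)
     {(\<lambda>u. word [x, y] u - koszul (par x * par y) * word [y, x] u) | x y. x \<in> X \<and> y \<in> X}"

definition Sym_salg :: "'x set \<Rightarrow> ('x \<Rightarrow> bit) \<Rightarrow> ('k::field, ('x list \<Rightarrow> 'k) set) salg" where
  "Sym_salg X par =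
    (let T = tensor_salg X par; J = supercommutator_ideal X par; R = T Quot J in
     \<lparr>carrier = carrier R, mult = mult R, one = one R, zero = zero R, add = add R,
      smult = (\<lambda>c F. \<Union>f\<in>F. J +>\<^bsub>T\<^esub> (c \<odot>\<^bsub>T\<^esub> f)),
      homog = (\<lambda>p. (\<lambda>f. J +>\<^bsub>T\<^esub> f) ` homog T p)\<rparr>)"

definition Sym_gen :: "'x set \<Rightarrow> ('x \<Rightarrow> bit) \<Rightarrow> 'x \<Rightarrow> ('x list \<Rightarrow> 'k::field) set" where
  "Sym_gen X par x = supercommutator_ideal X par +>\<^bsub>tensor_salg X par\<^esub> word [x]"


section \<open>Matrices over a superalgebra\<close>

text \<open>
  An \<open>m\<close> by \<open>n\<close> matrix is a function of which only the values at \<open>(i, j)\<close> with \<open>i < m\<close> and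
  \<open>j < n\<close> matter.
\<close>

definition mat_mult ::
  "('a, 'm) ring_scheme \<Rightarrow> nat \<Rightarrow> (nat \<Rightarrow> nat \<Rightarrow> 'a) \<Rightarrow> (nat \<Rightarrow> nat \<Rightarrow> 'a) \<Rightarrow> nat \<Rightarrow> nat \<Rightarrow> 'a" where
  "mat_mult A n M N i j = (\<Oplus>\<^bsub>A\<^esub>k\<in>{..<n}. M i k \<otimes>\<^bsub>A\<^esub> N k j)"

definition mat_one :: "('a, 'm) ring_scheme \<Rightarrow> nat \<Rightarrow> nat \<Rightarrow> 'a" where
  "mat_one A i j = (if i = j then \<one>\<^bsub>A\<^esub> else \<zero>\<^bsub>A\<^esub>)"

definition mat_eq :: "nat \<Rightarrow> nat \<Rightarrow> (nat \<Rightarrow> nat \<Rightarrow> 'a) \<Rightarrow> (nat \<Rightarrow> nat \<Rightarrow> 'a) \<Rightarrow> bool" where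
  "mat_eq m n M N \<longleftrightarrow> (\<forall>i<m. \<forall>j<n. M i j = N i j)"


section \<open>Super-dimension vectors and the supergroup GL\<close>

type_synonym 'v superdim = "'v \<Rightarrow> nat \<times> nat"

definition sdim :: "'v superdim \<Rightarrow> 'v \<Rightarrow> nat" where
  "sdim \<alpha> a = fst (\<alpha> a) + snd (\<alpha> a)"

text \<open>
  Basis vectors are numbered from 0. The parity of \<open>\<Pi>\<^bsup>b(a)\<^esup> v\<^sub>i(a)\<close>, and of its dual vector:
\<close>

definition basis_parity :: "'v superdim \<Rightarrow> ('v \<Rightarrow> bit) \<Rightarrow> 'v \<Rightarrow> nat \<Rightarrow> bit" where
  "basis_parity \<alpha> b a i = (if i < fst (\<alpha> a) then 0 else 1) + b a"

text \<open>
  Matrices of the even \<open>A\<close>-linear endomorphisms of \<open>V(a) \<otimes> A\<close>, regarded as a right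
  \<open>A\<close>-module: \<open>v\<^sub>j \<mapsto> \<Sum>\<^sub>i v\<^sub>i M\<^sub>i\<^sub>j\<close>. The same matrix then describes the induced endomorphism of
  \<open>\<Pi>V(a) \<otimes> A\<close>, without signs.
\<close>

definition even_endo ::
  "('k, 'a, 'm) salg_scheme \<Rightarrow> 'v superdim \<Rightarrow> 'v \<Rightarrow> (nat \<Rightarrow> nat \<Rightarrow> 'a) \<Rightarrow> bool" where
  "even_endo A \<alpha> a M \<longleftrightarrow> (\<forall>i<sdim \<alpha> a. \<forall>j<sdim \<alpha> a.
     M i j \<in> homog A (basis_parity \<alpha> (\<lambda>_. 0) a i + basis_parity \<alpha> (\<lambda>_. 0) a j))"

text \<open>The \<open>A\<close>-points of \<open>GL(\<alpha>)\<close>; a point \<open>g\<close> is given together with its inverse \<open>h\<close>.\<close>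

definition GL_points ::
  "('k, 'a, 'm) salg_scheme \<Rightarrow> ('v, 'e) pre_digraph \<Rightarrow> 'v superdim \<Rightarrow>
    (('v \<Rightarrow> nat \<Rightarrow> nat \<Rightarrow> 'a) \<times> ('v \<Rightarrow> nat \<Rightarrow> nat \<Rightarrow> 'a)) set" where
  "GL_points A Q \<alpha> = {(g, h). \<forall>a\<in>verts Q. let n = sdim \<alpha> a in
     even_endo A \<alpha> a (g a) \<and> even_endo A \<alpha> a (h a) \<and>
     mat_eq n n (mat_mult A n (g a) (h a)) (mat_one A) \<and>
     mat_eq n n (mat_mult A n (h a) (g a)) (mat_one A)}"


section \<open>Super-representations of a quiver and their invariants\<close>

text \<open>The triple \<open>(e, i, j)\<close> stands for the generator \<open>\<Pi>\<^sup>b x\<^sub>i\<^sub>j(e)\<close>.\<close>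

definition rep_gens :: "('v, 'e) pre_digraph \<Rightarrow> 'v superdim \<Rightarrow> ('e \<times> nat \<times> nat) set" where
  "rep_gens Q \<alpha> =
    {(e, i, j). e \<in> arcs Q \<and> i < sdim \<alpha> (head Q e) \<and> j < sdim \<alpha> (tail Q e)}"

definition rep_parity ::
  "('v, 'e) pre_digraph \<Rightarrow> 'v superdim \<Rightarrow> ('v \<Rightarrow> bit) \<Rightarrow> 'e \<times> nat \<times> nat \<Rightarrow> bit" where
  "rep_parity Q \<alpha> b =
    (\<lambda>(e, i, j). basis_parity \<alpha> b (head Q e) i + basis_parity \<alpha> b (tail Q e) j)"

type_synonym ('k, 'e) rep_fun = "('e \<times> nat \<times> nat) list \<Rightarrow> 'k"

definition K_SRep ::
  "('v, 'e) pre_digraph \<Rightarrow> 'v superdim \<Rightarrow> ('v \<Rightarrow> bit) \<Rightarrow> ('k::field, ('k, 'e) rep_fun set) salg" where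
  "K_SRep Q \<alpha> b = Sym_salg (rep_gens Q \<alpha>) (rep_parity Q \<alpha> b)"

definition generic_matrix ::
  "('v, 'e) pre_digraph \<Rightarrow> 'v superdim \<Rightarrow> ('v \<Rightarrow> bit) \<Rightarrow> 'e \<Rightarrow> nat \<Rightarrow> nat \<Rightarrow>
    ('k::field, 'e) rep_fun set" where
  "generic_matrix Q \<alpha> b e i j = Sym_gen (rep_gens Q \<alpha>) (rep_parity Q \<alpha> b) (e, i, j)"

text \<open>
  \<open>GL(\<alpha>)\<close> acts on the affine superscheme \<open>SRep\<close> represented by \<^const>\<open>K_SRep\<close>. An \<open>A\<close>-point of
  \<open>SRep\<close> is a superalgebra morphism \<open>\<phi>\<close> from \<^const>\<open>K_SRep\<close> to \<open>A\<close>; the corresponding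
  representation assigns to \<open>e\<close> the matrix \<open>M(e)\<close> with entries \<open>\<phi> (\<Pi>\<^sup>b x\<^sub>i\<^sub>j(e))\<close>. The point \<open>\<psi>\<close>
  is the transform of \<open>\<phi>\<close> under \<open>g\<close> if its matrices are \<open>g(h(e)) M(e) g(t(e))\<inverse>\<close>. An element
  \<open>F\<close> is invariant if it takes the same value at \<open>\<phi>\<close> and at \<open>g \<cdot> \<phi>\<close>, for all
  supercommutative \<open>A\<close>, all \<open>A\<close>-points \<open>\<phi>\<close> and all \<open>g\<close> in \<open>GL(\<alpha>)(A)\<close>. (For the point
  \<open>f \<mapsto> f \<otimes> 1\<close> of \<^const>\<open>K_SRep\<close> \<open>\<otimes> A\<close> this says that \<open>F \<otimes> 1\<close> is fixed by every
  \<open>g\<close> in \<open>GL(\<alpha>)(A)\<close>.)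
\<close>

definition is_transform ::
  "('k::field, 'a, 'm) salg_scheme \<Rightarrow> ('v, 'e) pre_digraph \<Rightarrow> 'v superdim \<Rightarrow> ('v \<Rightarrow> bit) \<Rightarrow>
    ('v \<Rightarrow> nat \<Rightarrow> nat \<Rightarrow> 'a) \<times> ('v \<Rightarrow> nat \<Rightarrow> nat \<Rightarrow> 'a) \<Rightarrow>
    (('k, 'e) rep_fun set \<Rightarrow> 'a) \<Rightarrow> (('k, 'e) rep_fun set \<Rightarrow> 'a) \<Rightarrow> bool" where
  "is_transform A Q \<alpha> b = (\<lambda>(g, h) \<phi> \<psi>. \<forall>e\<in>arcs Q.
     mat_eq (sdim \<alpha> (head Q e)) (sdim \<alpha> (tail Q e))
       (\<lambda>i j. \<psi> (generic_matrix Q \<alpha> b e i j))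
       (mat_mult A (sdim \<alpha> (head Q e)) (g (head Q e))
         (mat_mult A (sdim \<alpha> (tail Q e)) (\<lambda>i j. \<phi> (generic_matrix Q \<alpha> b e i j)) (h (tail Q e)))))"

definition invariant_over ::
  "'a itself \<Rightarrow> ('v, 'e) pre_digraph \<Rightarrow> 'v superdim \<Rightarrow> ('v \<Rightarrow> bit) \<Rightarrow>
    ('k::field, 'e) rep_fun set \<Rightarrow> bool" where
  "invariant_over (_ :: 'a itself) Q \<alpha> b F \<longleftrightarrow>
    (\<forall>A :: ('k, 'a) salg. supercommutative_superalgebra A \<longrightarrow>
      (\<forall>\<phi>\<in>salg_hom (K_SRep Q \<alpha> b) A. \<forall>\<psi>\<in>salg_hom (K_SRep Q \<alpha> b) A. \<forall>g\<in>GL_points A Q \<alpha>.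
        is_transform A Q \<alpha> b g \<phi> \<psi> \<longrightarrow> \<psi> F = \<phi> F))"

text \<open>
  The superalgebras \<open>A\<close> over which invariance is tested have a carrier of type
  \<^typ>\<open>nat \<Rightarrow> 'k\<close>. This is no restriction, see \<open>invariant_over_any\<close> below: only
  finitely many elements of \<open>A\<close> are involved, and a finitely generated superalgebra
  has an isomorphic copy with such a carrier.
\<close>

definition SI ::
  "('v, 'e) pre_digraph \<Rightarrow> 'v superdim \<Rightarrow> ('v \<Rightarrow> bit) \<Rightarrow> ('k::field, 'e) rep_fun set set" where
  "SI Q \<alpha> b = {F \<in> carrier (K_SRep Q \<alpha> b :: ('k, ('k, 'e) rep_fun set) salg).
     invariant_over TYPE(nat \<Rightarrow> 'k) Q \<alpha> b F}"


section \<open>Supertraces along closed paths\<close>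

text \<open>Paths compose as maps do: the edge traversed first comes last.\<close>

definition quiver_path :: "('v, 'e) pre_digraph \<Rightarrow> 'e list \<Rightarrow> bool" where
  "quiver_path Q p \<longleftrightarrow> p \<noteq> [] \<and> set p \<subseteq> arcs Q \<and>
     (\<forall>i. Suc i < length p \<longrightarrow> head Q (p ! Suc i) = tail Q (p ! i))"

definition closed_path :: "('v, 'e) pre_digraph \<Rightarrow> 'e list \<Rightarrow> bool" where
  "closed_path Q p \<longleftrightarrow> quiver_path Q p \<and> head Q (hd p) = tail Q (last p)"

primrec path_matrix ::
  "('v, 'e) pre_digraph \<Rightarrow> 'v superdim \<Rightarrow> ('v \<Rightarrow> bit) \<Rightarrow> 'e list \<Rightarrow> nat \<Rightarrow> nat \<Rightarrow>
    ('k::field, 'e) rep_fun set" where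
  "path_matrix Q \<alpha> b [] = mat_one (K_SRep Q \<alpha> b)"
| "path_matrix Q \<alpha> b (e # p) = mat_mult (K_SRep Q \<alpha> b) (sdim \<alpha> (tail Q e))
     (generic_matrix Q \<alpha> b e) (path_matrix Q \<alpha> b p)"

definition path_str ::
  "('v, 'e) pre_digraph \<Rightarrow> 'v superdim \<Rightarrow> ('v \<Rightarrow> bit) \<Rightarrow> 'e list \<Rightarrow> ('k::field, 'e) rep_fun set" where
  "path_str Q \<alpha> b p = (let a = head Q (hd p); S = K_SRep Q \<alpha> b in
     \<Oplus>\<^bsub>S\<^esub>i\<in>{..<sdim \<alpha> a}. koszul (basis_parity \<alpha> b a i) \<odot>\<^bsub>S\<^esub> path_matrix Q \<alpha> b p i i)"


section \<open>Invariants and superalgebras of arbitrary size\<close>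

text \<open>
  The rest of the theory proves that an element of \<^const>\<open>SI\<close> is invariant over superalgebras
  with carrier of any type.
\<close>

subsection \<open>The tensor superalgebra\<close>

lemma conv_Nil: "conv f g [] = f [] * g []"
  by (simp add: conv_def)

lemma conv_Cons: "conv f g (a # w) = f [] * g (a # w) + conv (\<lambda>u. f (a # u)) g w"
  unfolding conv_def by (simp add: sum.atMost_Suc_shift del: sum.atMost_Suc)

lemma conv_add_left: "conv (\<lambda>u. f u + g u) h w = conv f h w + conv g h w"
  by (simp add: conv_def sum.distrib algebra_simps)

lemma conv_add_right: "conv h (\<lambda>u. f u + g u) w = conv h f w + conv h g w"
  by (simp add: conv_def sum.distrib algebra_simps)

lemma conv_scale_left: "conv (\<lambda>u. c * f u) h w = c * conv f h w"
  by (simp add: conv_def sum_distrib_left algebra_simps)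

lemma conv_scale_right: "conv h (\<lambda>u. c * f u) w = c * conv h f w"
  by (simp add: conv_def sum_distrib_left algebra_simps)

lemma conv_assoc: "conv (conv f g) h w = conv f (conv g h) w"
proof (induction w arbitrary: f)
  case Nil
  then show ?case by (simp add: conv_Nil mult.assoc)
next
  case (Cons a w)
  have "(\<lambda>u. conv f g (a # u)) = (\<lambda>u. f [] * g (a # u) + conv (\<lambda>u. f (a # u)) g u)"
    by (simp add: conv_Cons)
  then have "conv (\<lambda>u. conv f g (a # u)) h w
      = f [] * conv (\<lambda>u. g (a # u)) h w + conv (conv (\<lambda>u. f (a # u)) g) h w"
    by (simp add: conv_add_left conv_scale_left)
  then show ?case
    by (simp add: conv_Cons[of "conv f g"] conv_Cons[of f "conv g h"] conv_Cons[of g]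
        Cons.IH conv_Nil algebra_simps)
qed

lemma conv_nz: "conv f g w \<noteq> 0 \<Longrightarrow> \<exists>u v. w = u @ v \<and> f u \<noteq> 0 \<and> g v \<noteq> 0"
  unfolding conv_def by (metis (no_types, lifting) append_take_drop_id mult_eq_0_iff sum.neutral)

lemma conv_one_left: "conv (\<lambda>w. if w = [] then 1 else 0) f w = f w"
proof (cases w)
  case (Cons a v)
  then show ?thesis by (simp add: conv_Cons) (simp add: conv_def)
qed (simp add: conv_Nil)

lemma conv_one_right: "conv f (\<lambda>w. if w = [] then 1 else 0) w = f w"
  by (induction w arbitrary: f) (simp_all add: conv_Cons conv_Nil)

lemma tensor_salg_simps:
  "carrier (tensor_salg X par) = {f. finite {w. f w \<noteq> 0} \<and> {w. f w \<noteq> 0} \<subseteq> lists X}"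
  "mult (tensor_salg X par) = conv"
  "one (tensor_salg X par) = (\<lambda>w. if w = [] then 1 else 0)"
  "zero (tensor_salg X par) = (\<lambda>w. 0)"
  "add (tensor_salg X par) = (\<lambda>f g w. f w + g w)"
  "smult (tensor_salg X par) = (\<lambda>c f w. c * f w)"
  "homog (tensor_salg X par) p =
    {f \<in> carrier (tensor_salg X par). \<forall>w. f w \<noteq> 0 \<longrightarrow> sum_list (map par w) = p}"
  by (auto simp: tensor_salg_def conv_def fun_eq_iff)

lemma conv_closed:
  assumes "f \<in> carrier (tensor_salg X par)" "g \<in> carrier (tensor_salg X par)"
  shows "conv f g \<in> carrier (tensor_salg X par)"
proof -
  let ?S = "(\<lambda>(u, v). u @ v) ` ({w. f w \<noteq> 0} \<times> {w. g w \<noteq> 0})"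
  have sub: "{w. conv f g w \<noteq> 0} \<subseteq> ?S"
    using conv_nz by fastforce
  moreover have "finite ?S"
    using assms by (auto simp: tensor_salg_simps)
  moreover have "?S \<subseteq> lists X"
    using assms unfolding tensor_salg_simps by (fastforce simp: lists_eq_set)
  ultimately show ?thesis
    by (auto simp: tensor_salg_simps intro: finite_subset)
qed

lemma tensor_add_closed:
  assumes "f \<in> carrier (tensor_salg X par)" "g \<in> carrier (tensor_salg X par)"
  shows "(\<lambda>w. f w + g w) \<in> carrier (tensor_salg X par)"
proof -
  have "{w. f w + g w \<noteq> 0} \<subseteq> {w. f w \<noteq> 0} \<union> {w. g w \<noteq> 0}" by auto
  then show ?thesis
    using assms by (auto simp: tensor_salg_simps intro: finite_subset)
qed

lemma tensor_scale_closed: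
  assumes "f \<in> carrier (tensor_salg X par)"
  shows "(\<lambda>w. c * f w) \<in> carrier (tensor_salg X par)"
proof -
  have "{w. c * f w \<noteq> 0} \<subseteq> {w. f w \<noteq> 0}" by auto
  then show ?thesis
    using assms by (auto simp: tensor_salg_simps intro: finite_subset)
qed

lemma word_closed: "w \<in> lists X \<Longrightarrow> word w \<in> carrier (tensor_salg X par)"
  by (auto simp: tensor_salg_simps word_def)

lemma ring_tensor_salg: "ring (tensor_salg X par :: ('k::field, 'x list \<Rightarrow> 'k) salg)"
proof (rule ringI)
  let ?T = "tensor_salg X par :: ('k, 'x list \<Rightarrow> 'k) salg"
  show "abelian_group ?T"
  proof (rule abelian_groupI)
    fix f assume f: "f \<in> carrier ?T"
    show "\<exists>g\<in>carrier ?T. g \<oplus>\<^bsub>?T\<^esub> f = \<zero>\<^bsub>?T\<^esub>"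
      using tensor_scale_closed[OF f, of "-1"]
      by (intro bexI[of _ "\<lambda>w. - 1 * f w"]) (auto simp: tensor_salg_simps)
  next
    show "f \<oplus>\<^bsub>?T\<^esub> g \<in> carrier ?T" if "f \<in> carrier ?T" "g \<in> carrier ?T" for f g
      using tensor_add_closed[OF that] by (simp add: tensor_salg_simps(5))
  qed (auto simp: tensor_salg_simps algebra_simps)
  show "monoid ?T"
    by (rule monoidI)
      (use conv_closed[of _ X par] word_closed[of "[]" X par] in
        \<open>auto simp: tensor_salg_simps(2,3) conv_assoc conv_one_left conv_one_right word_def fun_eq_iff
          cong: if_cong\<close>)
qed (auto simp: tensor_salg_simps(2,5) conv_add_left conv_add_right fun_eq_iff)

lemma ideal_supercommutator:
  "ideal (supercommutator_ideal X par) (tensor_salg X par :: ('k::field, 'x list \<Rightarrow> 'k) salg)"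
proof -
  let ?T = "tensor_salg X par :: ('k, 'x list \<Rightarrow> 'k) salg"
  have "(\<lambda>u. word [x, y] u - koszul (par x * par y) * word [y, x] u) \<in> carrier ?T"
    if "x \<in> X" "y \<in> X" for x y
  proof -
    have 1: "word [x, y] \<in> carrier ?T" "word [y, x] \<in> carrier ?T"
      using that by (auto intro!: word_closed)
    from tensor_add_closed[OF 1(1) tensor_scale_closed[OF 1(2), of "- koszul (par x * par y)"]]
    show ?thesis by (simp del: mult_bit_eq_and)
  qed
  then show ?thesis
    unfolding supercommutator_ideal_def
    by (intro ring.genideal_ideal[OF ring_tensor_salg]) blast
qed



subsection \<open>Generated subalgebras\<close>

lemma (in superalgebra) smult_zero: "x \<in> carrier A \<Longrightarrow> 0 \<odot> x = \<zero>"
  using smult_l_distr[of x 0 0] smult_closed[of x 0] by simp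

lemma (in superalgebra) smult_neg: "x \<in> carrier A \<Longrightarrow> (- 1) \<odot> x = \<ominus> x"
  using smult_l_distr[of x 1 "-1"] smult_closed[of x "-1"] smult_one[of x] smult_zero[of x]
  by (metis minus_equality a_comm add.right_inverse)

lemma (in superalgebra) homog_carrier: "x \<in> homog A p \<Longrightarrow> x \<in> carrier A"
  using additive_subgroup.a_Hcarr[OF homog_subgroup] .

lemma (in superalgebra) homog_add: "x \<in> homog A p \<Longrightarrow> y \<in> homog A p \<Longrightarrow> x \<oplus> y \<in> homog A p"
  using additive_subgroup.a_closed[OF homog_subgroup] .

lemma (in superalgebra) homog_zero: "\<zero> \<in> homog A p"
  using additive_subgroup.zero_closed[OF homog_subgroup] .

lemma (in superalgebra) generated_carrier:
  assumes "S \<subseteq> carrier A" "x \<in> generated_subalgebra A S"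
  shows "x \<in> carrier A"
  using assms(2) by induction (use assms(1) smult_closed in auto)

lemma (in superalgebra) generated_zero: "\<zero> \<in> generated_subalgebra A S"
  using generated_subalgebra.smult[where c = 0 and A = A and S = S, OF generated_subalgebra.one] by (simp add: smult_zero)

lemma generated_mono:
  assumes "x \<in> generated_subalgebra A S" "S \<subseteq> S'"
  shows "x \<in> generated_subalgebra A S'"
  using assms(1) by induction (use assms(2) in \<open>auto intro: generated_subalgebra.intros\<close>)

lemma (in superalgebra) generated_decomp:
  assumes "S \<subseteq> (\<Union>p. homog A p)" "x \<in> generated_subalgebra A S"
  shows "\<exists>y\<in>homog A 0 \<inter> generated_subalgebra A S. \<exists>z\<in>homog A 1 \<inter> generated_subalgebra A S. x = y \<oplus> z"
  using assms(2)
proof induction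
  case one
  show ?case
    by (intro bexI[of _ \<one>] bexI[of _ \<zero>])
      (auto intro: homog_one homog_zero generated_zero generated_subalgebra.intros)
next
  case (gen x)
  then obtain p where p: "x \<in> homog A p" using assms(1) by auto
  show ?case
  proof (cases "p = 0")
    case True
    then show ?thesis using p gen homog_carrier[OF p]
      by (intro bexI[of _ x] bexI[of _ \<zero>])
        (auto intro: homog_zero generated_zero generated_subalgebra.intros)
  next
    case False
    then have "p = 1" using bit_not_zero_iff by blast
    then show ?thesis using p gen homog_carrier[OF p]
      by (intro bexI[of _ \<zero>] bexI[of _ x])
        (auto intro: homog_zero generated_zero generated_subalgebra.intros)
  qed
next
  case (add x y)
  then obtain x0 x1 y0 y1 where *:
    "x0 \<in> homog A 0 \<inter> generated_subalgebra A S" "x1 \<in> homog A 1 \<inter> generated_subalgebra A S"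
    "y0 \<in> homog A 0 \<inter> generated_subalgebra A S" "y1 \<in> homog A 1 \<inter> generated_subalgebra A S"
    "x = x0 \<oplus> x1" "y = y0 \<oplus> y1" by blast
  then have "x0 \<in> carrier A" "x1 \<in> carrier A" "y0 \<in> carrier A" "y1 \<in> carrier A"
    by (auto intro: homog_carrier)
  then have "x \<oplus> y = (x0 \<oplus> y0) \<oplus> (x1 \<oplus> y1)" using *(5,6) by (simp add: a_ac)
  then show ?case using *(1-4) by (blast intro: homog_add generated_subalgebra.intros)
next
  case (mult x y)
  then obtain x0 x1 y0 y1 where *:
    "x0 \<in> homog A 0 \<inter> generated_subalgebra A S" "x1 \<in> homog A 1 \<inter> generated_subalgebra A S"
    "y0 \<in> homog A 0 \<inter> generated_subalgebra A S" "y1 \<in> homog A 1 \<inter> generated_subalgebra A S"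
    "x = x0 \<oplus> x1" "y = y0 \<oplus> y1" by blast
  then have "x0 \<in> carrier A" "x1 \<in> carrier A" "y0 \<in> carrier A" "y1 \<in> carrier A"
    by (auto intro: homog_carrier)
  then have "x \<otimes> y = (x0 \<otimes> y0 \<oplus> x1 \<otimes> y1) \<oplus> (x0 \<otimes> y1 \<oplus> x1 \<otimes> y0)"
    using *(5,6) by (simp add: a_ac l_distr r_distr)
  moreover have "x0 \<otimes> y0 \<oplus> x1 \<otimes> y1 \<in> homog A 0" "x0 \<otimes> y1 \<oplus> x1 \<otimes> y0 \<in> homog A 1"
    using homog_mult[of x0 0 y0 0] homog_mult[of x1 1 y1 1] homog_mult[of x0 0 y1 1]
      homog_mult[of x1 1 y0 0] * by (auto intro: homog_add)
  ultimately show ?case using *(1-4) by (blast intro: generated_subalgebra.intros)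
next
  case (smult x c)
  then obtain x0 x1 where *:
    "x0 \<in> homog A 0 \<inter> generated_subalgebra A S" "x1 \<in> homog A 1 \<inter> generated_subalgebra A S"
    "x = x0 \<oplus> x1" by blast
  then have "c \<odot> x = c \<odot> x0 \<oplus> c \<odot> x1"
    by (auto intro: homog_carrier smult_r_distr)
  then show ?case using *(1,2) by (blast intro: homog_smult generated_subalgebra.intros)
qed


subsection \<open>Morphisms out of the symmetric superalgebra\<close>

lemma Sym_facts:
  fixes X par
  defines "T \<equiv> tensor_salg X par :: ('k::field, 'x list \<Rightarrow> 'k) salg"
    and "J \<equiv> supercommutator_ideal X par :: ('x list \<Rightarrow> 'k) set"
    and "S \<equiv> Sym_salg X par :: ('k, ('x list \<Rightarrow> 'k) set) salg"
  shows "carrier S = (\<lambda>f. J +>\<^bsub>T\<^esub> f) ` carrier T"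
    and "J +>\<^bsub>T\<^esub> \<one>\<^bsub>T\<^esub> = \<one>\<^bsub>S\<^esub>"
    and "f \<in> carrier T \<Longrightarrow> g \<in> carrier T \<Longrightarrow> J +>\<^bsub>T\<^esub> conv f g = (J +>\<^bsub>T\<^esub> f) \<otimes>\<^bsub>S\<^esub> (J +>\<^bsub>T\<^esub> g)"
    and "f \<in> carrier T \<Longrightarrow> g \<in> carrier T \<Longrightarrow>
      J +>\<^bsub>T\<^esub> (\<lambda>w. f w + g w) = (J +>\<^bsub>T\<^esub> f) \<oplus>\<^bsub>S\<^esub> (J +>\<^bsub>T\<^esub> g)"
    and "f \<in> carrier T \<Longrightarrow> J +>\<^bsub>T\<^esub> (\<lambda>w. c * f w) = c \<odot>\<^bsub>S\<^esub> (J +>\<^bsub>T\<^esub> f)"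
    and "homog S p = (\<lambda>f. J +>\<^bsub>T\<^esub> f) ` homog T p"
proof -
  interpret J: ideal J T unfolding J_def T_def by (rule ideal_supercommutator)
  have S: "S = \<lparr>carrier = carrier (T Quot J), mult = mult (T Quot J), one = one (T Quot J),
      zero = zero (T Quot J), add = add (T Quot J),
      smult = (\<lambda>c F. \<Union>f\<in>F. J +>\<^bsub>T\<^esub> (c \<odot>\<^bsub>T\<^esub> f)),
      homog = (\<lambda>p. (\<lambda>f. J +>\<^bsub>T\<^esub> f) ` homog T p)\<rparr>"
    by (simp add: S_def Sym_salg_def T_def J_def Let_def)
  have T: "mult T = conv" "add T = (\<lambda>f g w. f w + g w)" "smult T = (\<lambda>c f w. c * f w)"
    by (simp_all add: T_def tensor_salg_simps)
  show "carrier S = (\<lambda>f. J +>\<^bsub>T\<^esub> f) ` carrier T"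
    by (auto simp: S FactRing_simps)
  show "J +>\<^bsub>T\<^esub> \<one>\<^bsub>T\<^esub> = \<one>\<^bsub>S\<^esub>"
    by (simp add: S FactRing_def)
  show "homog S p = (\<lambda>f. J +>\<^bsub>T\<^esub> f) ` homog T p" by (simp add: S)
  show "J +>\<^bsub>T\<^esub> conv f g = (J +>\<^bsub>T\<^esub> f) \<otimes>\<^bsub>S\<^esub> (J +>\<^bsub>T\<^esub> g)"
    if "f \<in> carrier T" "g \<in> carrier T"
    using J.rcoset_mult_add[OF that] by (simp add: S FactRing_def T)
  show "J +>\<^bsub>T\<^esub> (\<lambda>w. f w + g w) = (J +>\<^bsub>T\<^esub> f) \<oplus>\<^bsub>S\<^esub> (J +>\<^bsub>T\<^esub> g)"
    if "f \<in> carrier T" "g \<in> carrier T"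
    using J.a_rcos_sum[OF that] by (simp add: S FactRing_def T)
  show "J +>\<^bsub>T\<^esub> (\<lambda>w. c * f w) = c \<odot>\<^bsub>S\<^esub> (J +>\<^bsub>T\<^esub> f)" if f: "f \<in> carrier T" for f
  proof -
    have "J +>\<^bsub>T\<^esub> (c \<odot>\<^bsub>T\<^esub> h) = J +>\<^bsub>T\<^esub> (c \<odot>\<^bsub>T\<^esub> f)" if h: "h \<in> J +>\<^bsub>T\<^esub> f" for h
    proof -
      obtain j where j: "j \<in> J" "h = j \<oplus>\<^bsub>T\<^esub> f"
        using h by (auto simp: a_r_coset_def')
      have 1: "(\<lambda>w. c * (if w = [] then 1 else 0)) \<in> carrier T"
        using tensor_scale_closed[OF word_closed[of "[]" X par], of c]
        by (simp add: T_def word_def)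
      have "conv (\<lambda>w. c * (if w = [] then 1 else 0)) j \<in> J"
        using J.I_l_closed[OF j(1) 1] by (simp add: T)
      moreover have "conv (\<lambda>w. c * (if w = [] then 1 else 0)) j = (\<lambda>w. c * j w)"
        using conv_scale_left[of c "\<lambda>w. if w = [] then 1 else 0" j]
        by (simp only: conv_one_left fun_eq_iff) simp
      ultimately have cj: "c \<odot>\<^bsub>T\<^esub> j \<in> J" by (simp add: T)
      have cf: "c \<odot>\<^bsub>T\<^esub> f \<in> carrier T"
        using tensor_scale_closed[of f X par c] f unfolding T unfolding T_def by simp
      have "c \<odot>\<^bsub>T\<^esub> h = (c \<odot>\<^bsub>T\<^esub> j) \<oplus>\<^bsub>T\<^esub> (c \<odot>\<^bsub>T\<^esub> f)"
        by (simp add: T j algebra_simps)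
      then have "c \<odot>\<^bsub>T\<^esub> h \<in> J +>\<^bsub>T\<^esub> (c \<odot>\<^bsub>T\<^esub> f)"
        using cj by (auto simp: a_r_coset_def')
      then show ?thesis using J.a_repr_independence'[OF _ cf] by simp
    qed
    moreover have "f \<in> J +>\<^bsub>T\<^esub> f" using J.a_rcos_self[OF f] .
    ultimately have "(\<Union>h\<in>J +>\<^bsub>T\<^esub> f. J +>\<^bsub>T\<^esub> (c \<odot>\<^bsub>T\<^esub> h)) = J +>\<^bsub>T\<^esub> (c \<odot>\<^bsub>T\<^esub> f)"
      by blast
    then show ?thesis by (simp add: S T)
  qed
qed

lemma word_Cons: "(word (x # w) :: 'x list \<Rightarrow> 'k::field) = conv (word [x]) (word w)"
proof
  fix u
  have 1: "conv (\<lambda>_. 0) (word w) v = (0 :: 'k)" for v by (simp add: conv_def)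
  show "word (x # w) u = (conv (word [x]) (word w) u :: 'k)"
  proof (cases u)
    case Nil
    then show ?thesis by (simp add: conv_Nil word_def)
  next
    case (Cons a v)
    have "(\<lambda>u. word [x] (a # u)) = (if a = x then (\<lambda>u. if u = [] then 1 else 0) else (\<lambda>_. 0 :: 'k))"
      by (auto simp: word_def)
    then have "conv (word [x]) (word w) (a # v) = (if a = x then word w v else (0 :: 'k))"
      unfolding conv_Cons by (simp add: conv_one_left 1) (simp add: word_def)
    then show ?thesis by (simp add: Cons word_def)
  qed
qed

lemma Sym_gen_homog: "x \<in> X \<Longrightarrow> Sym_gen X par x \<in> homog (Sym_salg X par) (par x)"
  unfolding Sym_gen_def Sym_facts(6)
  by (rule imageI) (simp add: tensor_salg_simps(7) word_closed, simp add: word_def)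

lemma Sym_hom_generated:
  fixes A :: "('k::field, 'a, 'm) salg_scheme" and X :: "'x set"
  assumes A: "superalgebra A" and \<phi>: "\<phi> \<in> salg_hom (Sym_salg X par) A"
    and F: "F \<in> carrier (Sym_salg X par)"
  shows "\<phi> F \<in> generated_subalgebra A ((\<lambda>x. \<phi> (Sym_gen X par x)) ` X)"
proof -
  define T where "T = (tensor_salg X par :: ('k, 'x list \<Rightarrow> 'k) salg)"
  define J where "J = (supercommutator_ideal X par :: ('x list \<Rightarrow> 'k) set)"
  define q where "q = (\<lambda>f. J +>\<^bsub>T\<^esub> f)"
  let ?G = "generated_subalgebra A ((\<lambda>x. \<phi> (Sym_gen X par x)) ` X)"
  note SF = Sym_facts[where X = X and par = par and ?'k = 'k, folded T_def J_def, folded q_def]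
  have mem: "q f \<in> carrier (Sym_salg X par)" if "f \<in> carrier T" for f
    using that by (simp add: SF(1))
  have h: "\<phi> (x \<oplus>\<^bsub>Sym_salg X par\<^esub> y) = \<phi> x \<oplus>\<^bsub>A\<^esub> \<phi> y"
     "\<phi> (x \<otimes>\<^bsub>Sym_salg X par\<^esub> y) = \<phi> x \<otimes>\<^bsub>A\<^esub> \<phi> y"
     "\<phi> (c \<odot>\<^bsub>Sym_salg X par\<^esub> x) = c \<odot>\<^bsub>A\<^esub> \<phi> x"
     "\<phi> \<one>\<^bsub>Sym_salg X par\<^esub> = \<one>\<^bsub>A\<^esub>"
    if "x \<in> carrier (Sym_salg X par)" "y \<in> carrier (Sym_salg X par)" for x y c
    using \<phi> that by (auto simp: salg_hom_def ring_hom_def)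
  have w: "\<phi> (q (word w)) \<in> ?G" if "w \<in> lists X" for w
    using that
  proof induction
    case Nil
    have "q (word []) = \<one>\<^bsub>Sym_salg X par\<^esub>"
      unfolding SF(2)[symmetric] by (simp add: word_def T_def tensor_salg_simps)
    then show ?case using h(4)[OF F F] by (auto intro: generated_subalgebra.one)
  next
    case (Cons x w)
    have 1: "word [x] \<in> carrier T" "word w \<in> carrier T"
      using Cons by (auto simp: T_def intro!: word_closed)
    have "\<phi> (q (word [x])) \<in> ?G"
      using Cons by (auto simp: q_def T_def J_def Sym_gen_def[symmetric] intro: generated_subalgebra.gen)
    then show ?case
      using Cons 1 by (simp add: word_Cons[of x w] SF(3) h(2) mem generated_subalgebra.mult)
  qed
  have "\<phi> (q f) \<in> ?G" if "f \<in> carrier T" for f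
    using that
  proof (induction "card {w. f w \<noteq> 0}" arbitrary: f)
    case 0
    then have "f = (\<lambda>w. 0 * word [] w)"
      by (auto simp: T_def tensor_salg_simps)
    moreover have "word [] \<in> carrier T" by (simp add: T_def word_closed)
    ultimately have "\<phi> (q f) = 0 \<odot>\<^bsub>A\<^esub> \<phi> (q (word []))"
      by (simp only: SF(5)) (simp add: h(3)[OF mem F])
    then show ?case by (auto intro: generated_subalgebra.smult w)
  next
    case (Suc n)
    then have fin: "finite {w. f w \<noteq> 0}" and sub: "{w. f w \<noteq> 0} \<subseteq> lists X"
      by (auto simp: T_def tensor_salg_simps)
    obtain v where v: "f v \<noteq> 0" using Suc.hyps(2) by fastforce
    let ?g = "\<lambda>w. if w = v then 0 else f w"
    have supp: "{w. ?g w \<noteq> 0} = {w. f w \<noteq> 0} - {v}" by auto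
    have g: "?g \<in> carrier T"
      using fin sub unfolding T_def tensor_salg_simps mem_Collect_eq supp by auto
    have vX: "v \<in> lists X" using v sub by auto
    have wv: "word v \<in> carrier T" using vX by (simp add: T_def word_closed)
    have cw: "(\<lambda>w. f v * word v w) \<in> carrier T"
      using tensor_scale_closed wv unfolding T_def by blast
    have "card {w. ?g w \<noteq> 0} = n" using Suc.hyps(2) v fin unfolding supp by simp
    then have 1: "\<phi> (q ?g) \<in> ?G" using Suc.hyps(1)[of ?g] g by simp
    have "f = (\<lambda>w. f v * word v w + ?g w)" by (auto simp: word_def)
    then have "q f = f v \<odot>\<^bsub>Sym_salg X par\<^esub> q (word v) \<oplus>\<^bsub>Sym_salg X par\<^esub> q ?g"
      using SF(4)[OF cw g] SF(5)[OF wv] by simp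
    moreover have "f v \<odot>\<^bsub>Sym_salg X par\<^esub> q (word v) \<in> carrier (Sym_salg X par)"
      using SF(5)[OF wv, of "f v"] mem[OF cw] by simp
    ultimately have "\<phi> (q f) = f v \<odot>\<^bsub>A\<^esub> \<phi> (q (word v)) \<oplus>\<^bsub>A\<^esub> \<phi> (q ?g)"
      using g wv by (simp add: h(1) h(3)[OF mem F] mem)
    then show ?case using 1 w[OF vX] by (auto intro: generated_subalgebra.intros)
  qed
  then show ?thesis using F by (auto simp: SF(1))
qed



subsection \<open>Transport to a smaller carrier\<close>

datatype 'k aterm = TOne | TGen nat | TAdd "'k aterm" "'k aterm" | TMult "'k aterm" "'k aterm"
  | TSmult 'k "'k aterm"

primrec aterm_code :: "'k::field_char_0 aterm \<Rightarrow> nat \<Rightarrow> 'k" where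
  "aterm_code TOne = case_nat 0 (\<lambda>_. 0)"
| "aterm_code (TGen n) = case_nat 1 (\<lambda>_. of_nat n)"
| "aterm_code (TAdd s t) =
    case_nat 2 (\<lambda>n. if even n then aterm_code s (n div 2) else aterm_code t (n div 2))"
| "aterm_code (TMult s t) =
    case_nat 3 (\<lambda>n. if even n then aterm_code s (n div 2) else aterm_code t (n div 2))"
| "aterm_code (TSmult c t) = case_nat 4 (case_nat c (aterm_code t))"

lemma case_nat_inject: "case_nat a f = case_nat b g \<longleftrightarrow> a = b \<and> f = g"
  by (auto simp: fun_eq_iff split: nat.splits)

lemma interleave_inject:
  "(\<lambda>n. if even n then f (n div 2) else g (n div 2)) = (\<lambda>n. if even n then f' (n div 2) else g' (n div 2))
    \<longleftrightarrow> f = f' \<and> g = g'" for f :: "nat \<Rightarrow> 'a"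
proof
  assume *: "(\<lambda>n. if even n then f (n div 2) else g (n div 2)) =
    (\<lambda>n. if even n then f' (n div 2) else g' (n div 2))"
  have "f n = f' n" "g n = g' n" for n
    using fun_cong[OF *, of "2 * n"] fun_cong[OF *, of "2 * n + 1"] by simp_all
  then show "f = f' \<and> g = g'" by blast
qed (elim conjE, simp only:)

lemma inj_aterm_code: "inj (aterm_code :: 'k::field_char_0 aterm \<Rightarrow> _)"
proof (rule injI)
  fix s t :: "'k aterm"
  show "aterm_code s = aterm_code t \<Longrightarrow> s = t"
  proof (induction s arbitrary: t)
    case TOne
    then show ?case by (cases t) (auto simp: case_nat_inject)
  next
    case (TGen n)
    then show ?case by (cases t) (auto simp: case_nat_inject dest: fun_cong)
  next
    case (TAdd s1 s2)
    show ?case using TAdd.prems by (cases t) (auto simp: case_nat_inject interleave_inject dest: TAdd.IH)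
  next
    case (TMult s1 s2)
    show ?case using TMult.prems by (cases t) (auto simp: case_nat_inject interleave_inject dest: TMult.IH)
  next
    case (TSmult c s)
    show ?case using TSmult.prems by (cases t) (auto simp: case_nat_inject dest: TSmult.IH)
  qed
qed

lemma generated_embeds:
  fixes A :: "('k::field_char_0, 'a, 'm) salg_scheme"
  assumes "countable S"
  shows "\<exists>\<iota> :: 'a \<Rightarrow> nat \<Rightarrow> 'k. inj_on \<iota> (generated_subalgebra A S)"
proof -
  define ev where "ev = rec_aterm \<one>\<^bsub>A\<^esub> (from_nat_into S) (\<lambda>_ _ x y. x \<oplus>\<^bsub>A\<^esub> y) (\<lambda>_ _ x y. x \<otimes>\<^bsub>A\<^esub> y)
    (\<lambda>c _ x. c \<odot>\<^bsub>A\<^esub> x)"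
  have ev: "ev TOne = \<one>\<^bsub>A\<^esub>" "ev (TGen n) = from_nat_into S n" "ev (TAdd s t) = ev s \<oplus>\<^bsub>A\<^esub> ev t"
    "ev (TMult s t) = ev s \<otimes>\<^bsub>A\<^esub> ev t" "ev (TSmult c t) = c \<odot>\<^bsub>A\<^esub> ev t" for n s t c
    by (simp_all add: ev_def)
  have "x \<in> range ev" if "x \<in> generated_subalgebra A S" for x
    using that
  proof induction
    case (gen x)
    then show ?case using from_nat_into_to_nat_on[OF assms, of x] ev(2)[of "to_nat_on S x"] by (metis rangeI)
  next
    case one
    show ?case unfolding ev(1)[symmetric] by (rule rangeI)
  next
    case (add x y)
    then obtain s t where "x = ev s" "y = ev t" by blast
    then show ?case by (simp only: ev(3)[symmetric] rangeI)
  next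
    case (mult x y)
    then obtain s t where "x = ev s" "y = ev t" by blast
    then show ?case by (simp only: ev(4)[symmetric] rangeI)
  next
    case (smult x c)
    then obtain s where "x = ev s" by blast
    then show ?case by (simp only: ev(5)[symmetric] rangeI)
  qed
  then have "inj_on (\<lambda>x. aterm_code (inv_into UNIV ev x)) (generated_subalgebra A S)"
    by (auto intro!: inj_onI dest!: injD[OF inj_aterm_code] dest: inv_into_injective)
  then show ?thesis by blast
qed

lemma (in superalgebra) generated_sub_ring_facts:
  assumes "S \<subseteq> (\<Union>p. homog A p)"
  defines "G \<equiv> generated_subalgebra A S"
  shows "G \<subseteq> carrier A" "\<zero> \<in> G" "\<one> \<in> G" "x \<in> G \<Longrightarrow> y \<in> G \<Longrightarrow> x \<oplus> y \<in> G"
    "x \<in> G \<Longrightarrow> y \<in> G \<Longrightarrow> x \<otimes> y \<in> G" "x \<in> G \<Longrightarrow> c \<odot> x \<in> G" "x \<in> G \<Longrightarrow> \<ominus> x \<in> G"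
proof -
  have S: "S \<subseteq> carrier A" using assms(1) homog_carrier by blast
  show 1: "G \<subseteq> carrier A" using generated_carrier[OF S] unfolding G_def by blast
  show "\<zero> \<in> G" unfolding G_def by (rule generated_zero)
  show "\<one> \<in> G" unfolding G_def by (rule generated_subalgebra.one)
  show "x \<oplus> y \<in> G" if "x \<in> G" "y \<in> G"
    using that unfolding G_def by (rule generated_subalgebra.add)
  show "x \<otimes> y \<in> G" if "x \<in> G" "y \<in> G"
    using that unfolding G_def by (rule generated_subalgebra.mult)
  have 2: "c \<odot>\<^bsub>A\<^esub> x \<in> G" if "x \<in> G" for c x
    using that unfolding G_def by (rule generated_subalgebra.smult)
  show "c \<odot> x \<in> G" if "x \<in> G" using 2[OF that] .
  show "\<ominus> x \<in> G" if "x \<in> G" using 2[OF that, of "-1"] smult_neg[of x] 1 that by auto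
qed

definition transport_salg ::
  "('k, 'a, 'm) salg_scheme \<Rightarrow> 'a set \<Rightarrow> ('a \<Rightarrow> 'b) \<Rightarrow> ('k, 'b) salg" where
  "transport_salg A G \<iota> =
    \<lparr>carrier = \<iota> ` G,
     mult = (\<lambda>x y. \<iota> (inv_into G \<iota> x \<otimes>\<^bsub>A\<^esub> inv_into G \<iota> y)),
     one = \<iota> \<one>\<^bsub>A\<^esub>, zero = \<iota> \<zero>\<^bsub>A\<^esub>,
     add = (\<lambda>x y. \<iota> (inv_into G \<iota> x \<oplus>\<^bsub>A\<^esub> inv_into G \<iota> y)),
     smult = (\<lambda>c x. \<iota> (c \<odot>\<^bsub>A\<^esub> inv_into G \<iota> x)),
     homog = (\<lambda>p. \<iota> ` (homog A p \<inter> G))\<rparr>"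

lemma transport_supercommutative:
  fixes A :: "('k::field, 'a, 'm) salg_scheme"
  assumes A: "supercommutative_superalgebra A"
    and S: "S \<subseteq> (\<Union>p. homog A p)"
    and inj: "inj_on \<iota> (generated_subalgebra A S)"
  shows "supercommutative_superalgebra (transport_salg A (generated_subalgebra A S) \<iota>)"
proof -
  interpret A: supercommutative_superalgebra A by (rule A)
  define G where "G = generated_subalgebra A S"
  let ?B = "transport_salg A G \<iota>"
  note G = A.generated_sub_ring_facts[OF S, folded G_def]
  have Gc: "x \<in> G \<Longrightarrow> x \<in> carrier A" for x using G(1) by blast
  have j: "inv_into G \<iota> (\<iota> x) = x" if "x \<in> G" for x
    using inj that by (simp add: G_def)
  have B: "carrier ?B = \<iota> ` G" "one ?B = \<iota> \<one>\<^bsub>A\<^esub>" "zero ?B = \<iota> \<zero>\<^bsub>A\<^esub>" "homog ?B p = \<iota> ` (homog A p \<inter> G)"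
    and B': "x \<in> G \<Longrightarrow> y \<in> G \<Longrightarrow> \<iota> x \<oplus>\<^bsub>?B\<^esub> \<iota> y = \<iota> (x \<oplus>\<^bsub>A\<^esub> y)"
    "x \<in> G \<Longrightarrow> y \<in> G \<Longrightarrow> \<iota> x \<otimes>\<^bsub>?B\<^esub> \<iota> y = \<iota> (x \<otimes>\<^bsub>A\<^esub> y)"
    "x \<in> G \<Longrightarrow> c \<odot>\<^bsub>?B\<^esub> \<iota> x = \<iota> (c \<odot>\<^bsub>A\<^esub> x)" for x y c p
    by (simp_all add: transport_salg_def j)
  note simps = B B' G Gc
  have abel: "abelian_group ?B"
  proof (rule abelian_groupI)
    show "\<exists>y\<in>carrier ?B. y \<oplus>\<^bsub>?B\<^esub> x = \<zero>\<^bsub>?B\<^esub>" if x: "x \<in> carrier ?B" for x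
    proof -
      obtain s where "s \<in> G" "x = \<iota> s" using x by (auto simp: B)
      then show ?thesis by (intro bexI[of _ "\<iota> (\<ominus>\<^bsub>A\<^esub> s)"]) (auto simp: simps A.l_neg)
    qed
  qed (auto simp: simps A.a_ac)
  have mon: "monoid ?B"
    by (rule monoidI) (auto simp: simps A.m_assoc)
  have ring: "ring ?B"
    by (rule ringI) (auto simp: simps A.l_distr A.r_distr intro: abel mon)
  interpret B: ring ?B by (rule ring)
  have hc: "x \<in> homog A p \<Longrightarrow> x \<in> carrier A" for x p by (rule A.homog_carrier)
  have "superalgebra_axioms ?B"
  proof (rule superalgebra_axioms.intro, goal_cases)
    case (8 p)
    have sub: "\<iota> ` (homog A p \<inter> G) \<subseteq> carrier ?B" by (auto simp: B)
    have "subgroup (\<iota> ` (homog A p \<inter> G)) (add_monoid ?B)"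
    proof (rule group.subgroupI)
      show "group (add_monoid ?B)" by (rule B.a_group)
      show "\<iota> ` (homog A p \<inter> G) \<noteq> {}" using A.homog_zero G(2) by blast
      fix a assume a: "a \<in> \<iota> ` (homog A p \<inter> G)"
      then obtain x where x: "x \<in> homog A p" "x \<in> G" "a = \<iota> x" by blast
      have n: "\<ominus>\<^bsub>A\<^esub> x \<in> homog A p"
        using A.homog_smult[OF x(1), of "-1"] A.smult_neg[OF hc[OF x(1)]] by simp
      have "\<ominus>\<^bsub>?B\<^esub> a = \<iota> (\<ominus>\<^bsub>A\<^esub> x)"
        by (rule B.minus_equality) (use x in \<open>auto simp: simps A.l_neg\<close>)
      then show "inv\<^bsub>add_monoid ?B\<^esub> a \<in> \<iota> ` (homog A p \<inter> G)"
        using n G(7)[OF x(2)] by (auto simp: a_inv_def)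
    qed (use sub in \<open>auto simp: simps intro!: imageI A.homog_add\<close>)
    then show ?case unfolding additive_subgroup_def B(4) .
  next
    case (10 x)
    then obtain s where s: "s \<in> G" "x = \<iota> s" by (auto simp: B)
    then obtain y z where "y \<in> homog A 0 \<inter> G" "z \<in> homog A 1 \<inter> G" "s = y \<oplus>\<^bsub>A\<^esub> z"
      using A.generated_decomp[OF S, folded G_def] by blast
    then show ?case using s by (auto simp: simps intro!: bexI[of _ "\<iota> y"] bexI[of _ "\<iota> z"])
  next
    case 11
    have "x = \<zero>\<^bsub>A\<^esub>" if "x \<in> homog A 0 \<inter> G" "y \<in> homog A 1 \<inter> G" "\<iota> x = \<iota> y" for x y
      using inj_onD[OF inj that(3)] that A.homog_direct unfolding G_def by blast
    then show ?case using A.homog_zero G(2) by (auto simp: B)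
  next
    case (13 x p y q)
    then obtain s t where "s \<in> homog A p" "s \<in> G" "x = \<iota> s" "t \<in> homog A q" "t \<in> G" "y = \<iota> t"
      by (auto simp: B)
    then show ?case unfolding B(4) using A.homog_mult[of s p t q] G(5)[of s t]
      by (simp only: B' IntI imageI)
  qed (auto simp: simps A.smult_l_distr A.smult_r_distr A.smult_assoc A.smult_one
      A.smult_mult_left A.smult_mult_right A.homog_one
      intro!: imageI A.homog_smult)
  moreover have "supercommutative_superalgebra_axioms ?B"
  proof (rule supercommutative_superalgebra_axioms.intro)
    fix x y p q assume "x \<in> homog ?B p" "y \<in> homog ?B q"
    then obtain s t where "s \<in> homog A p" "s \<in> G" "x = \<iota> s" "t \<in> homog A q" "t \<in> G" "y = \<iota> t"
      by (auto simp: B)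
    then show "x \<otimes>\<^bsub>?B\<^esub> y = koszul (p * q) \<odot>\<^bsub>?B\<^esub> (y \<otimes>\<^bsub>?B\<^esub> x)"
      using A.supercommute[of s p t q] by (simp add: simps del: mult_bit_eq_and)
  qed
  ultimately have "supercommutative_superalgebra ?B"
    using ring by (simp add: supercommutative_superalgebra_def superalgebra_def)
  then show ?thesis by (simp add: G_def)
qed


lemma transport_mat_mult:
  fixes A :: "('k::field, 'a, 'm) salg_scheme"
  assumes A: "supercommutative_superalgebra A"
    and S: "S \<subseteq> (\<Union>p. homog A p)"
    and inj: "inj_on \<iota> (generated_subalgebra A S)"
    and M: "\<And>k. k < n \<Longrightarrow> M i k \<in> generated_subalgebra A S"
    and N: "\<And>k. k < n \<Longrightarrow> N k j \<in> generated_subalgebra A S"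
  shows "mat_mult A n M N i j \<in> generated_subalgebra A S"
    and "mat_mult (transport_salg A (generated_subalgebra A S) \<iota>) n
      (\<lambda>i j. \<iota> (M i j)) (\<lambda>i j. \<iota> (N i j)) i j = \<iota> (mat_mult A n M N i j)"
proof -
  interpret A: supercommutative_superalgebra A by (rule A)
  define G where "G = generated_subalgebra A S"
  let ?B = "transport_salg A G \<iota>"
  interpret B: supercommutative_superalgebra ?B
    using transport_supercommutative[OF A S inj] by (simp add: G_def)
  note G = A.generated_sub_ring_facts[OF S, folded G_def]
  have j: "inv_into G \<iota> (\<iota> x) = x" if "x \<in> G" for x
    using inj that by (simp add: G_def)
  have B: "carrier ?B = \<iota> ` G" "zero ?B = \<iota> \<zero>\<^bsub>A\<^esub>"
    "x \<in> G \<Longrightarrow> y \<in> G \<Longrightarrow> \<iota> x \<oplus>\<^bsub>?B\<^esub> \<iota> y = \<iota> (x \<oplus>\<^bsub>A\<^esub> y)"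
    "x \<in> G \<Longrightarrow> y \<in> G \<Longrightarrow> \<iota> x \<otimes>\<^bsub>?B\<^esub> \<iota> y = \<iota> (x \<otimes>\<^bsub>A\<^esub> y)" for x y
    by (simp_all add: transport_salg_def j)
  have "(\<Oplus>\<^bsub>A\<^esub>k\<in>{..<m}. M i k \<otimes>\<^bsub>A\<^esub> N k j) \<in> G \<and>
      (\<Oplus>\<^bsub>?B\<^esub>k\<in>{..<m}. \<iota> (M i k) \<otimes>\<^bsub>?B\<^esub> \<iota> (N k j)) = \<iota> (\<Oplus>\<^bsub>A\<^esub>k\<in>{..<m}. M i k \<otimes>\<^bsub>A\<^esub> N k j)"
    if "m \<le> n" for m
    using that
  proof (induction m)
    case 0
    then show ?case by (simp add: G(2) B)
  next
    case (Suc m)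
    have t: "M i k \<otimes>\<^bsub>A\<^esub> N k j \<in> G" "\<iota> (M i k) \<otimes>\<^bsub>?B\<^esub> \<iota> (N k j) = \<iota> (M i k \<otimes>\<^bsub>A\<^esub> N k j)" if "k \<le> m" for k
      using M[of k] N[of k] that Suc.prems by (auto simp: G_def[symmetric] G B)
    have tA: "M i k \<otimes>\<^bsub>A\<^esub> N k j \<in> carrier A" if "k \<le> m" for k using t(1)[OF that] G(1) by blast
    have tB: "\<iota> (M i k) \<otimes>\<^bsub>?B\<^esub> \<iota> (N k j) \<in> carrier ?B" if "k \<le> m" for k
      using t[OF that] by (simp add: B)
    have "(\<Oplus>\<^bsub>A\<^esub>k\<in>{..<Suc m}. M i k \<otimes>\<^bsub>A\<^esub> N k j)
        = (M i m \<otimes>\<^bsub>A\<^esub> N m j) \<oplus>\<^bsub>A\<^esub> (\<Oplus>\<^bsub>A\<^esub>k\<in>{..<m}. M i k \<otimes>\<^bsub>A\<^esub> N k j)"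
      unfolding lessThan_Suc by (rule A.finsum_insert) (auto intro: tA)
    moreover have "(\<Oplus>\<^bsub>?B\<^esub>k\<in>{..<Suc m}. \<iota> (M i k) \<otimes>\<^bsub>?B\<^esub> \<iota> (N k j))
        = (\<iota> (M i m) \<otimes>\<^bsub>?B\<^esub> \<iota> (N m j)) \<oplus>\<^bsub>?B\<^esub> (\<Oplus>\<^bsub>?B\<^esub>k\<in>{..<m}. \<iota> (M i k) \<otimes>\<^bsub>?B\<^esub> \<iota> (N k j))"
      unfolding lessThan_Suc by (rule B.finsum_insert) (auto intro: tB)
    ultimately show ?case using Suc t[of m] by (simp add: G B)
  qed
  from this[of n] show "mat_mult A n M N i j \<in> generated_subalgebra A S"
    "mat_mult (transport_salg A (generated_subalgebra A S) \<iota>) n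
      (\<lambda>i j. \<iota> (M i j)) (\<lambda>i j. \<iota> (N i j)) i j = \<iota> (mat_mult A n M N i j)"
    by (simp_all add: mat_mult_def G_def)
qed

lemma rep_parity_homog:
  assumes "(e, i, j) \<in> rep_gens Q \<alpha>" "\<phi> \<in> salg_hom (K_SRep Q \<alpha> b) A"
  shows "\<phi> (generic_matrix Q \<alpha> b e i j) \<in> homog A (rep_parity Q \<alpha> b (e, i, j))"
  using Sym_gen_homog[OF assms(1), of "rep_parity Q \<alpha> b"] assms(2)
  unfolding salg_hom_def K_SRep_def generic_matrix_def by blast

lemma transport_salg_hom:
  fixes A :: "('k::field, 'a, 'm) salg_scheme"
  assumes A: "superalgebra A"
    and inj: "inj_on \<iota> G"
    and \<phi>: "\<phi> \<in> salg_hom C A" and im: "\<phi> ` carrier C \<subseteq> G"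
    and hC: "\<And>p. homog C p \<subseteq> carrier C"
  shows "(\<lambda>x. \<iota> (\<phi> x)) \<in> salg_hom C (transport_salg A G \<iota>)"
proof -
  have j: "inv_into G \<iota> (\<iota> (\<phi> x)) = \<phi> x" if "x \<in> carrier C" for x
    using inj that im by auto
  show ?thesis
    using \<phi> im hC unfolding salg_hom_def ring_hom_def
    by (fastforce simp: transport_salg_def j)
qed

subsection \<open>The size restriction is harmless\<close>

theorem invariant_over_any:
  fixes F :: "('k::field_char_0, 'e) rep_fun set"
  assumes Q: "fin_digraph Q" and F: "F \<in> SI Q \<alpha> b"
  shows "invariant_over TYPE('a) Q \<alpha> b F"
  unfolding invariant_over_def
proof (intro allI impI ballI)
  fix A :: "('k, 'a) salg" and \<phi> \<psi> gh
  let ?C = "K_SRep Q \<alpha> b :: ('k, ('k, 'e) rep_fun set) salg"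
  let ?X = "\<lambda>e i j. generic_matrix Q \<alpha> b e i j :: ('k, 'e) rep_fun set"
  assume A: "supercommutative_superalgebra A"
    and \<phi>: "\<phi> \<in> salg_hom ?C A" and \<psi>: "\<psi> \<in> salg_hom ?C A"
    and gh: "gh \<in> GL_points A Q \<alpha>" and tr: "is_transform A Q \<alpha> b gh \<phi> \<psi>"
  obtain g h where gh_eq: "gh = (g, h)" by (cases gh)
  interpret fin_digraph Q by (rule Q)
  interpret A: supercommutative_superalgebra A by (rule A)
  define S where "S = (\<Union>(e, i, j)\<in>rep_gens Q \<alpha>. {\<phi> (?X e i j), \<psi> (?X e i j)}) \<union>
    (\<Union>a\<in>verts Q. \<Union>i<sdim \<alpha> a. \<Union>j<sdim \<alpha> a. {g a i j, h a i j})"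
  define G where "G = generated_subalgebra A S"
  have "rep_gens Q \<alpha> =
    (\<Union>e\<in>arcs Q. \<Union>i<sdim \<alpha> (head Q e). \<Union>j<sdim \<alpha> (tail Q e). {(e, i, j)})"
    by (auto simp: rep_gens_def)
  then have "finite (rep_gens Q \<alpha>)" by simp
  then have "finite S" unfolding S_def by auto
  then have "countable S" by (rule countable_finite)
  then obtain \<iota> :: "'a \<Rightarrow> nat \<Rightarrow> 'k" where inj: "inj_on \<iota> G"
    using generated_embeds unfolding G_def by blast
  have ghE: "even_endo A \<alpha> a (g a)" "even_endo A \<alpha> a (h a)"
    "mat_eq (sdim \<alpha> a) (sdim \<alpha> a) (mat_mult A (sdim \<alpha> a) (g a) (h a)) (mat_one A)"
    "mat_eq (sdim \<alpha> a) (sdim \<alpha> a) (mat_mult A (sdim \<alpha> a) (h a) (g a)) (mat_one A)"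
    if "a \<in> verts Q" for a
    using gh that by (auto simp: GL_points_def gh_eq Let_def)
  have S: "S \<subseteq> (\<Union>p. homog A p)"
    unfolding S_def
  proof (intro Un_least UN_least, goal_cases)
    case (1 x)
    obtain e i j where x: "x = (e, i, j)" using prod_cases3 by blast
    have "\<phi> (?X e i j) \<in> (\<Union>p. homog A p)" "\<psi> (?X e i j) \<in> (\<Union>p. homog A p)"
      using rep_parity_homog[OF 1[unfolded x] \<phi>] rep_parity_homog[OF 1[unfolded x] \<psi>] by blast+
    then show ?case by (simp add: x)
  next
    case (2 a i j)
    have "g a i j \<in> (\<Union>p. homog A p)" "h a i j \<in> (\<Union>p. homog A p)"
      using ghE(1,2)[OF 2(1)] 2(2,3) unfolding even_endo_def lessThan_iff by blast+
    then show ?case by simp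
  qed
  note G = A.generated_sub_ring_facts[OF S, folded G_def]
  have SG: "S \<subseteq> G" unfolding G_def by (auto intro: generated_subalgebra.gen)
  have gG: "g a i j \<in> G" "h a i j \<in> G" if "a \<in> verts Q" "i < sdim \<alpha> a" "j < sdim \<alpha> a" for a i j
    using SG that unfolding S_def by blast+
  have XG: "\<phi> (?X e i j) \<in> G" "\<psi> (?X e i j) \<in> G" if "(e, i, j) \<in> rep_gens Q \<alpha>" for e i j
    using SG that unfolding S_def by blast+
  have im: "\<chi> ` carrier ?C \<subseteq> G" if \<chi>: "\<chi> \<in> salg_hom ?C A"
    and sub: "\<And>e i j. (e, i, j) \<in> rep_gens Q \<alpha> \<Longrightarrow> \<chi> (?X e i j) \<in> S" for \<chi>
  proof
    fix y assume "y \<in> \<chi> ` carrier ?C"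
    then obtain x where "x \<in> carrier ?C" "y = \<chi> x" by blast
    then have "y \<in> generated_subalgebra A
        ((\<lambda>x. \<chi> (Sym_gen (rep_gens Q \<alpha>) (rep_parity Q \<alpha> b) x)) ` rep_gens Q \<alpha>)"
      using Sym_hom_generated[OF A.superalgebra_axioms \<chi>[unfolded K_SRep_def]]
      by (simp add: K_SRep_def)
    then show "y \<in> G" unfolding G_def
      by (rule generated_mono) (use sub in \<open>auto simp: generic_matrix_def\<close>)
  qed
  let ?B = "transport_salg A G \<iota>"
  have B: "supercommutative_superalgebra ?B"
    using transport_supercommutative[OF A S] inj unfolding G_def by blast
  interpret B: supercommutative_superalgebra ?B by (rule B)
  have cB: "\<iota> x \<in> carrier ?B" if "x \<in> G" for x
    using that by (simp add: transport_salg_def)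
  have hC: "homog ?C p \<subseteq> carrier ?C" for p
    unfolding K_SRep_def Sym_facts(1,6) by (auto simp: tensor_salg_simps(7))
  have "\<And>e i j. (e, i, j) \<in> rep_gens Q \<alpha> \<Longrightarrow> \<phi> (?X e i j) \<in> S"
    "\<And>e i j. (e, i, j) \<in> rep_gens Q \<alpha> \<Longrightarrow> \<psi> (?X e i j) \<in> S"
    unfolding S_def by blast+
  then have im\<phi>: "\<phi> ` carrier ?C \<subseteq> G" and im\<psi>: "\<psi> ` carrier ?C \<subseteq> G"
    using im \<phi> \<psi> by blast+
  have \<phi>': "(\<lambda>x. \<iota> (\<phi> x)) \<in> salg_hom ?C ?B" and \<psi>': "(\<lambda>x. \<iota> (\<psi> x)) \<in> salg_hom ?C ?B"
    using transport_salg_hom[OF A.superalgebra_axioms inj _ _ hC]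
      \<phi> \<psi> im\<phi> im\<psi> by blast+
  note mm = transport_mat_mult[OF A S inj[unfolded G_def], folded G_def]
  have one: "mat_one ?B i j = \<iota> (mat_one A i j)" for i j
    by (simp add: mat_one_def transport_salg_def)
  have "(\<lambda>a i j. \<iota> (g a i j), \<lambda>a i j. \<iota> (h a i j)) \<in> GL_points ?B Q \<alpha>"
    unfolding GL_points_def Let_def
  proof (clarify, intro conjI)
    fix a assume a: "a \<in> verts Q"
    show "even_endo ?B \<alpha> a (\<lambda>i j. \<iota> (g a i j))" "even_endo ?B \<alpha> a (\<lambda>i j. \<iota> (h a i j))"
      using ghE(1,2)[OF a] gG[OF a] by (auto simp: even_endo_def transport_salg_def)
    show "mat_eq (sdim \<alpha> a) (sdim \<alpha> a)
        (mat_mult ?B (sdim \<alpha> a) (\<lambda>i j. \<iota> (g a i j)) (\<lambda>i j. \<iota> (h a i j))) (mat_one ?B)"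
      "mat_eq (sdim \<alpha> a) (sdim \<alpha> a)
        (mat_mult ?B (sdim \<alpha> a) (\<lambda>i j. \<iota> (h a i j)) (\<lambda>i j. \<iota> (g a i j))) (mat_one ?B)"
      using ghE(3,4)[OF a] gG[OF a] by (simp_all add: mat_eq_def mm one)
  qed
  moreover have "is_transform ?B Q \<alpha> b (\<lambda>a i j. \<iota> (g a i j), \<lambda>a i j. \<iota> (h a i j))
      (\<lambda>x. \<iota> (\<phi> x)) (\<lambda>x. \<iota> (\<psi> x))"
    unfolding is_transform_def prod.case mat_eq_def
  proof (intro ballI allI impI)
    fix e i j assume e: "e \<in> arcs Q" and ij: "i < sdim \<alpha> (head Q e)" "j < sdim \<alpha> (tail Q e)"
    let ?n = "sdim \<alpha> (tail Q e)" and ?m = "sdim \<alpha> (head Q e)"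
    let ?N = "mat_mult A ?n (\<lambda>i j. \<phi> (?X e i j)) (h (tail Q e))"
    have XG': "\<phi> (?X e i j) \<in> G" if "i < ?m" "j < ?n" for i j
      by (rule XG(1)) (use e that in \<open>simp add: rep_gens_def\<close>)
    have N: "?N k j \<in> G"
      "mat_mult ?B ?n (\<lambda>i j. \<iota> (\<phi> (?X e i j))) (\<lambda>i j. \<iota> (h (tail Q e) i j)) k j = \<iota> (?N k j)"
      if "k < ?m" for k
      using e ij that XG' gG by (auto intro!: mm)
    have "mat_mult ?B ?m (\<lambda>i j. \<iota> (g (head Q e) i j))
        (mat_mult ?B ?n (\<lambda>i j. \<iota> (\<phi> (?X e i j))) (\<lambda>i j. \<iota> (h (tail Q e) i j))) i j
      = mat_mult ?B ?m (\<lambda>i j. \<iota> (g (head Q e) i j)) (\<lambda>i j. \<iota> (?N i j)) i j"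
      unfolding mat_mult_def[of ?B ?m]
    proof (rule B.finsum_cong')
      fix k assume "k \<in> {..<?m}"
      then show "\<iota> (g (head Q e) i k) \<otimes>\<^bsub>?B\<^esub>
          mat_mult ?B ?n (\<lambda>i j. \<iota> (\<phi> (?X e i j))) (\<lambda>i j. \<iota> (h (tail Q e) i j)) k j =
        \<iota> (g (head Q e) i k) \<otimes>\<^bsub>?B\<^esub> \<iota> (?N k j)"
        using N(2) by simp
    qed (use e ij gG N(1) in \<open>auto intro!: B.m_closed cB\<close>)
    also have "\<dots> = \<iota> (mat_mult A ?m (g (head Q e)) ?N i j)"
      by (rule mm(2)) (use e ij N(1) gG in auto)
    also have "mat_mult A ?m (g (head Q e)) ?N i j = \<psi> (?X e i j)"
      using tr e ij by (auto simp: is_transform_def gh_eq mat_eq_def)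
    finally show "\<iota> (\<psi> (?X e i j)) = mat_mult ?B ?m (\<lambda>i j. \<iota> (g (head Q e) i j))
        (mat_mult ?B ?n (\<lambda>i j. \<iota> (\<phi> (?X e i j))) (\<lambda>i j. \<iota> (h (tail Q e) i j))) i j" by simp
  qed
  ultimately have "\<iota> (\<psi> F) = \<iota> (\<phi> F)"
    using F B \<phi>' \<psi>' unfolding SI_def invariant_over_def by blast
  moreover have "F \<in> carrier ?C" using F by (simp add: SI_def)
  ultimately show "\<psi> F = \<phi> F"
    using inj im\<phi> im\<psi> by (meson image_subset_iff inj_onD)
qed

end

theory Submission
  imports Defs "HOL-Combinatorics.Cycles" "HOL-Library.FuncSet" "HOL-Algebra.UnivPoly"
begin

text \<open>
  The first fundamental theorem of invariant theory for \<open>GL(\<alpha>)\<close>, in the form needed for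
  representations of a quiver.

  \<^emph>\<open>Supertraces are invariant.\<close> A group element \<open>g\<close> multiplies the matrix of a path \<open>p\<close> by the component
  of \<open>g\<close> at the head of \<open>p\<close> from the left and by the inverse of its component at the tail from the
  right, because the factors at the interior vertices cancel. For a closed path this is a
  conjugation, and the supertrace does not see it (\<open>generated_subset_SI\<close>).

  \<^emph>\<open>Supertraces generate.\<close> Let \<open>f\<close> be a noncommutative polynomial which represents an invariant.
  Its component of degree \<open>r\<close> is recovered, in characteristic zero, from its full polarizations,
  one for every word \<open>e\<^sub>0, \<dots>, e\<^sub>r\<^sub>-\<^sub>1\<close> of edges. Up to signs, such a polarization is the matrix
  \<open>T\<close> of a linear map from \<open>V(t(e\<^sub>0)) \<otimes> \<dots> \<otimes> V(t(e\<^sub>r\<^sub>-\<^sub>1))\<close> to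
  \<open>V(h(e\<^sub>0)) \<otimes> \<dots> \<otimes> V(h(e\<^sub>r\<^sub>-\<^sub>1))\<close>; its entries are indexed by words of basis vectors.

  Invariance is tested over one Grassmann algebra whose generators, even or odd, have square
  zero. Evaluated at the representation \<open>\<Sum>\<^sub>k y\<^sub>k z\<^sub>k E\<close> (\<open>E\<close> the matrix unit \<open>i\<^sub>k j\<^sub>k\<close> at \<open>e\<^sub>k\<close>)
  and at the group element \<open>1 + \<Sum>\<^sub>l P\<^sub>l Q\<^sub>l E\<close> (\<open>E\<close> the matrix unit \<open>p\<^sub>l q\<^sub>l\<close>), the
  coefficient of the product of all generators says that \<open>T\<close> commutes with the signed
  symmetrization of \<open>E\<^bsub>p\<^sub>0q\<^sub>0\<^esub> \<otimes> \<dots>\<close> (\<open>invariant_commutes\<close>). Group elements over the Grassmann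
  algebra treat the even and the odd directions alike.

  The symmetrized matrix units span the commutant of the symmetric group in its signed action on
  words, so that \<open>T\<close> is a linear combination of signed permutations
  (\<open>double_centralizer\<close>, \<open>invariant_tensor_permutations\<close>). The contraction of
  \<open>X(e\<^sub>0) \<otimes> \<dots> \<otimes> X(e\<^sub>r\<^sub>-\<^sub>1)\<close> along a permutation is, up to sign, the product over its cycles of the
  supertraces along the closed paths which the cycles trace out
  (\<open>permutation_contraction_represents\<close>).

  Every sign is the factor that relates two orderings of a product of homogeneous elements.
  An identity between signs is proved by reordering one product of Grassmann generators in two
  ways and comparing coefficients.
\<close>

section \<open>Koszul signs\<close>

text \<open>
  Parities are added and multiplied as in a field; rewriting \<open>+\<close> and \<open>*\<close> on \<^typ>\<open>bit\<close> to
  exclusive disjunction and conjunction would hide this.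
\<close>

declare mult_bit_eq_and [simp del] add_bit_eq_xor [simp del]

lemma koszul_add: "koszul (p + q) = (koszul p * koszul q :: 'k::field)"
  by (cases p; cases q) (auto simp: koszul_def)

lemma koszul_square [simp]: "koszul p * koszul p = (1 :: 'k::field)"
  by (simp add: koszul_def)

lemma koszul_square_left [simp]: "koszul p * (koszul p * x) = (x :: 'k::field)"
  by (simp add: koszul_def)

lemma bit_mult_self [simp]: "p * p = (p :: bit)"
  by (cases p) auto

lemma bit_add_self [simp]: "p + p = (0 :: bit)" "p + (p + q) = (q :: bit)"
  by (cases p; cases q; auto)+

lemma koszul_0 [simp]: "koszul 0 = 1" by (simp add: koszul_def)

text \<open>
  The sign which arises when a product of factors \<open>b k\<close> of parities \<open>p k\<close>, taken in the order of
  the list, is rearranged into increasing order; see \<open>lprod_reorder\<close>. Each pair in the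
  wrong order contributes once.
\<close>

primrec koszul_sign :: "('i::linorder \<Rightarrow> bit) \<Rightarrow> 'i list \<Rightarrow> 'k::field" where
  "koszul_sign p [] = 1"
| "koszul_sign p (x # w) = (\<Prod>y\<leftarrow>w. if y < x then koszul (p x * p y) else 1) * koszul_sign p w"

lemma prod_list_sign_square:
  "(\<And>y. y \<in> set w \<Longrightarrow> f y * f y = (1::'k::field)) \<Longrightarrow> (\<Prod>y\<leftarrow>w. f y) * (\<Prod>y\<leftarrow>w. f y) = 1"
proof (induction w)
  case (Cons a w)
  have "(\<Prod>y\<leftarrow>a # w. f y) * (\<Prod>y\<leftarrow>a # w. f y) = (f a * f a) * ((\<Prod>y\<leftarrow>w. f y) * (\<Prod>y\<leftarrow>w. f y))"
    by (simp add: mult_ac)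
  then show ?case using Cons by simp
qed simp

lemma koszul_sign_square: "koszul_sign p w * koszul_sign p w = (1 :: 'k::field)"
proof (induction w)
  case (Cons x w)
  let ?a = "(\<Prod>y\<leftarrow>w. if y < x then koszul (p x * p y) else 1) :: 'k"
  have "?a * ?a = 1" by (rule prod_list_sign_square) simp
  then have "(?a * ?a) * (koszul_sign p w * koszul_sign p w) = (1 :: 'k)" using Cons by simp
  then show ?case by (simp add: mult_ac)
qed simp

lemma koszul_sign_cong: "(\<And>x. x \<in> set w \<Longrightarrow> p x = q x) \<Longrightarrow> koszul_sign p w = koszul_sign q w"
  by (induction w) (auto intro!: arg_cong[of _ _ prod_list])

lemma koszul_sign_sorted: "sorted w \<Longrightarrow> koszul_sign p w = 1"
proof (induction w)
  case (Cons x w)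
  then have "(\<Prod>y\<leftarrow>w. if y < x then koszul (p x * p y) else 1) = (\<Prod>y\<leftarrow>w. 1)"
    by (intro arg_cong[of _ _ prod_list]) auto
  then show ?case using Cons by (simp add: map_replicate_const)
qed simp

text \<open>
  Insertion sort by adjacent transpositions. The function \<open>h\<close> is arbitrary because two kinds of
  products are rearranged below: products in a supercommutative superalgebra, and
  classes of words in the free one.
\<close>

lemma koszul_sign_reorder:
  fixes h :: "'i::linorder list \<Rightarrow> 'm" and scale :: "'k::field \<Rightarrow> 'm \<Rightarrow> 'm"
  assumes swap: "\<And>a x y b. distinct (a @ x # y # b) \<Longrightarrow> set (a @ x # y # b) \<subseteq> I \<Longrightarrow>
      h (a @ x # y # b) = scale (koszul (p x * p y)) (h (a @ y # x # b))"
    and assoc: "\<And>c d w. set w \<subseteq> I \<Longrightarrow> scale c (scale d (h w)) = scale (c * d) (h w)"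
    and one: "\<And>w. set w \<subseteq> I \<Longrightarrow> scale 1 (h w) = h w"
    and "distinct w" "set w \<subseteq> I"
  shows "h w = scale (koszul_sign p w) (h (sort w))"
proof -
  have ins: "h (a @ x # w) =
      scale (\<Prod>y\<leftarrow>w. if y < x then koszul (p x * p y) else 1) (h (a @ insort x w))"
    if "distinct (a @ x # w)" "sorted w" "set (a @ x # w) \<subseteq> I" for a x w
    using that
  proof (induction w arbitrary: a)
    case Nil
    then show ?case by (simp add: one)
  next
    case (Cons y w)
    let ?c = "\<lambda>y. if y < x then koszul (p x * p y) else (1 :: 'k)"
    show ?case
    proof (cases "x \<le> y")
      case True
      then have "(\<Prod>y\<leftarrow>y # w. ?c y) = (\<Prod>y\<leftarrow>y # w. 1)"
        using Cons.prems(2) by (intro arg_cong[of _ _ prod_list]) auto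
      then show ?thesis using True Cons.prems by (simp add: one map_replicate_const)
    next
      case False
      have "h (a @ x # y # w) = scale (koszul (p x * p y)) (h ((a @ [y]) @ x # w))"
        using Cons.prems swap[of a x y w] by simp
      also have "h ((a @ [y]) @ x # w) = scale (\<Prod>y\<leftarrow>w. ?c y) (h ((a @ [y]) @ insort x w))"
        by (rule Cons.IH) (use Cons.prems in auto)
      finally show ?thesis using False Cons.prems
        by (subst (asm) assoc) (auto simp: set_insort_key)
    qed
  qed
  have "h (a @ w) = scale (koszul_sign p w) (h (a @ sort w))"
    if "distinct (a @ w)" "set (a @ w) \<subseteq> I" for a
    using that
  proof (induction w arbitrary: a)
    case Nil
    then show ?case by (simp add: one)
  next
    case (Cons x w)
    have "h (a @ x # w) = scale (koszul_sign p w) (h ((a @ [x]) @ sort w))"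
      using Cons.prems Cons.IH[of "a @ [x]"] by simp
    also have "h ((a @ [x]) @ sort w) =
        scale (\<Prod>y\<leftarrow>sort w. if y < x then koszul (p x * p y) else 1) (h (a @ insort x (sort w)))"
      using ins[of a x "sort w"] Cons.prems by simp
    also have "(\<Prod>y\<leftarrow>sort w. if y < x then koszul (p x * p y) else 1) =
        ((\<Prod>y\<leftarrow>w. if y < x then koszul (p x * p y) else 1) :: 'k)"
      by (simp flip: prod_mset_prod_list)
    finally show ?case using Cons.prems
      by (subst (asm) assoc) (auto simp: set_insort_key mult_ac)
  qed
  from this[of "[]"] assms(4,5) show ?thesis by simp
qed

primrec lprod :: "('a, 'm) monoid_scheme \<Rightarrow> 'a list \<Rightarrow> 'a" where
  "lprod A [] = \<one>\<^bsub>A\<^esub>"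
| "lprod A (x # xs) = x \<otimes>\<^bsub>A\<^esub> lprod A xs"

lemma (in monoid) lprod_closed [simp, intro]: "set xs \<subseteq> carrier G \<Longrightarrow> lprod G xs \<in> carrier G"
  by (induction xs) auto

lemma (in monoid) lprod_append:
  "set xs \<subseteq> carrier G \<Longrightarrow> set ys \<subseteq> carrier G \<Longrightarrow> lprod G (xs @ ys) = lprod G xs \<otimes> lprod G ys"
  by (induction xs) (auto simp: m_assoc)

lemma (in monoid) lprod_concat:
  "(\<And>xs. xs \<in> set xss \<Longrightarrow> set xs \<subseteq> carrier G) \<Longrightarrow> lprod G (concat xss) = lprod G (map (lprod G) xss)"
  by (induction xss) (auto simp: lprod_append UN_subset_iff)

context superalgebra
begin

lemma lprod_homog:
  "(\<And>k. k \<in> set w \<Longrightarrow> b k \<in> homog A (p k)) \<Longrightarrow> lprod A (map b w) \<in> homog A (\<Sum>k\<leftarrow>w. p k)"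
  by (induction w) (auto intro: homog_one homog_mult)

end

text \<open>
  The sign which separates a product of pairs \<open>y\<^sub>0 z\<^sub>0 y\<^sub>1 z\<^sub>1 \<dots>\<close> into \<open>y\<^sub>0 y\<^sub>1 \<dots> z\<^sub>0 z\<^sub>1 \<dots>\<close>, where \<open>y k\<close> and
  \<open>z k\<close> have the parities \<open>p k\<close> and \<open>q k\<close>; see \<open>lprod_shuffle\<close>.
\<close>

primrec shuffle_sign :: "('i \<Rightarrow> bit) \<Rightarrow> ('i \<Rightarrow> bit) \<Rightarrow> 'i list \<Rightarrow> 'k::field" where
  "shuffle_sign p q [] = 1"
| "shuffle_sign p q (k # ks) = koszul (q k * (\<Sum>i\<leftarrow>ks. p i)) * shuffle_sign p q ks"

lemma shuffle_sign_square: "shuffle_sign p q ks * shuffle_sign p q ks = (1::'k::field)"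
proof (induction ks)
  case (Cons k ks)
  have "shuffle_sign p q (k # ks) * shuffle_sign p q (k # ks) =
    (koszul (q k * (\<Sum>i\<leftarrow>ks. p i)) * koszul (q k * (\<Sum>i\<leftarrow>ks. p i))) * (shuffle_sign p q ks * shuffle_sign p q ks :: 'k)"
    by (simp only: shuffle_sign.simps mult_ac)
  then show ?case using Cons by simp
qed simp

context supercommutative_superalgebra
begin

lemma even_commute:
  assumes "c \<in> homog A 0" "x \<in> carrier A"
  shows "c \<otimes> x = x \<otimes> c"
proof -
  obtain y z where yz: "y \<in> homog A 0" "z \<in> homog A 1" "x = y \<oplus> z"
    using homog_decomp[OF assms(2)] by blast
  then have "c \<otimes> y = y \<otimes> c" "c \<otimes> z = z \<otimes> c"
    using supercommute[OF assms(1), of y 0] supercommute[OF assms(1), of z 1] assms(1)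
    by (simp_all add: smult_one homog_carrier)
  then show ?thesis using yz assms by (simp add: homog_carrier l_distr r_distr)
qed

lemma lprod_reorder:
  assumes "distinct w" "\<And>k. k \<in> set w \<Longrightarrow> b k \<in> homog A (p k)"
  shows "lprod A (map b w) = koszul_sign p w \<odot> lprod A (map b (sort w))"
proof -
  note hc = homog_carrier[OF assms(2)]
  show ?thesis
  proof (rule koszul_sign_reorder[where h = "\<lambda>w. lprod A (map b w)" and I = "set w" and scale = "smult A"])
    fix a x y v assume *: "distinct (a @ x # y # v)" "set (a @ x # y # v) \<subseteq> set w"
    have c: "set (map b a) \<subseteq> carrier A" "set (map b v) \<subseteq> carrier A" "b x \<in> carrier A" "b y \<in> carrier A"
      using * hc by auto
    have "b x \<otimes> (b y \<otimes> lprod A (map b v)) = (koszul (p x * p y) \<odot> (b y \<otimes> b x)) \<otimes> lprod A (map b v)"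
      using supercommute[OF assms(2) assms(2), of x y] c * by (simp add: m_assoc[symmetric])
    also have "\<dots> = koszul (p x * p y) \<odot> (b y \<otimes> (b x \<otimes> lprod A (map b v)))"
      using c by (simp add: smult_mult_left m_assoc)
    finally show "lprod A (map b (a @ x # y # v)) = koszul (p x * p y) \<odot> lprod A (map b (a @ y # x # v))"
      using c by (simp add: lprod_append smult_mult_right)
  next
    fix v assume v: "set v \<subseteq> set w"
    then have "lprod A (map b v) \<in> carrier A" using hc by (intro lprod_closed) auto
    then show "c \<odot> (d \<odot> lprod A (map b v)) = (c * d) \<odot> lprod A (map b v)"
      "1 \<odot> lprod A (map b v) = lprod A (map b v)" for c d
      by (simp_all add: smult_assoc smult_one)
  qed (use assms in auto)
qed

lemma lprod_pull_even:
  assumes "\<And>k. k \<in> set ks \<Longrightarrow> a k \<in> carrier A" "\<And>k. k \<in> set ks \<Longrightarrow> b k \<in> carrier A"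
    "\<And>k. k \<in> set ks \<Longrightarrow> c k \<in> homog A 0"
  shows "lprod A (map (\<lambda>k. a k \<otimes> (c k \<otimes> b k)) ks) =
    lprod A (map c ks) \<otimes> lprod A (map (\<lambda>k. a k \<otimes> b k) ks)"
  using assms
proof (induction ks)
  case (Cons k ks)
  let ?C = "lprod A (map c ks)" and ?R = "lprod A (map (\<lambda>k. a k \<otimes> b k) ks)"
  have cc: "\<And>k. k \<in> set ks \<Longrightarrow> c k \<in> carrier A" using Cons.prems(3) homog_carrier by auto
  have C0: "?C \<in> homog A 0" using lprod_homog[of ks c "\<lambda>_. 0"] Cons.prems(3) by simp
  have car: "a k \<in> carrier A" "b k \<in> carrier A" "c k \<in> carrier A" "?C \<in> carrier A" "?R \<in> carrier A"
    using Cons.prems cc homog_carrier[OF C0] homog_carrier[OF Cons.prems(3)]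
    by (auto intro!: lprod_closed)
  have "lprod A (map (\<lambda>k. a k \<otimes> (c k \<otimes> b k)) (k # ks)) = (a k \<otimes> (c k \<otimes> b k)) \<otimes> (?C \<otimes> ?R)"
    using Cons by simp
  also have "a k \<otimes> (c k \<otimes> b k) = c k \<otimes> (a k \<otimes> b k)"
    using even_commute[of "c k" "a k"] Cons.prems(3) car by (simp add: m_assoc[symmetric])
  also have "c k \<otimes> (a k \<otimes> b k) \<otimes> (?C \<otimes> ?R) = c k \<otimes> (((a k \<otimes> b k) \<otimes> ?C) \<otimes> ?R)"
    using car by (simp add: m_assoc)
  also have "(a k \<otimes> b k) \<otimes> ?C = ?C \<otimes> (a k \<otimes> b k)"
    using even_commute[OF C0] car by simp
  finally show ?case using car by (simp add: m_assoc)
qed simp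

lemma lprod_shuffle:
  assumes "\<And>k. k \<in> set ks \<Longrightarrow> y k \<in> homog A (p k)" "\<And>k. k \<in> set ks \<Longrightarrow> z k \<in> homog A (q k)"
  shows "lprod A (map (\<lambda>k. y k \<otimes> z k) ks) =
    shuffle_sign p q ks \<odot> (lprod A (map y ks) \<otimes> lprod A (map z ks))"
  using assms
proof (induction ks)
  case Nil
  then show ?case by (simp add: smult_one)
next
  case (Cons k ks)
  let ?Y = "lprod A (map y ks)" and ?Z = "lprod A (map z ks)" and ?s = "shuffle_sign p q ks"
  let ?P = "\<Sum>i\<leftarrow>ks. p i"
  have Y: "?Y \<in> homog A ?P" using lprod_homog[of ks y p] Cons.prems by simp
  have car: "y k \<in> carrier A" "z k \<in> carrier A" "?Y \<in> carrier A" "?Z \<in> carrier A"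
    using Cons.prems[THEN homog_carrier] by (auto intro!: lprod_closed)
  have "lprod A (map (\<lambda>k. y k \<otimes> z k) (k # ks)) = (y k \<otimes> z k) \<otimes> (?s \<odot> (?Y \<otimes> ?Z))"
    using Cons by simp
  also have "\<dots> = ?s \<odot> (y k \<otimes> ((z k \<otimes> ?Y) \<otimes> ?Z))"
    using car by (simp add: smult_mult_right m_assoc)
  also have "z k \<otimes> ?Y = koszul (q k * ?P) \<odot> (?Y \<otimes> z k)"
    using supercommute[OF _ Y] Cons.prems by simp
  finally show ?case using car
    by (simp add: smult_mult_right smult_mult_left m_assoc smult_assoc[symmetric] mult_ac)
qed

end

section \<open>Grassmann algebras\<close>

definition split_sign :: "('i::linorder \<Rightarrow> bit) \<Rightarrow> 'i set \<Rightarrow> 'i set \<Rightarrow> 'k::field" where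
  "split_sign p A B = (\<Prod>a\<in>A. \<Prod>b\<in>B. if b < a then koszul (p a * p b) else 1)"

text \<open>
  The supercommutative superalgebra on generators of parity \<open>p k\<close>, all of square zero, the even
  ones too. The coefficient \<open>f S\<close> belongs to the product of the generators in \<open>S\<close> in
  increasing order. Since every generator occurs at most once in a monomial, the coefficient of the
  product of all generators extracts the multilinear part of a polynomial function.
\<close>

definition grassmann :: "'i::linorder set \<Rightarrow> ('i \<Rightarrow> bit) \<Rightarrow> ('k::field, 'i set \<Rightarrow> 'k) salg" where
  "grassmann I p =
    (let C = {f. \<forall>S. f S \<noteq> 0 \<longrightarrow> S \<subseteq> I} in
     \<lparr>carrier = C,
      monoid.mult = (\<lambda>f g S. \<Sum>A\<in>Pow S. split_sign p A (S - A) * f A * g (S - A)),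
      one = (\<lambda>S. if S = {} then 1 else 0),
      zero = (\<lambda>S. 0),
      add = (\<lambda>f g S. f S + g S),
      smult = (\<lambda>c f S. c * f S),
      homog = (\<lambda>q. {f \<in> C. \<forall>S. f S \<noteq> 0 \<longrightarrow> (\<Sum>k\<in>S. p k) = q})\<rparr>)"

lemma grassmann_simps:
  "carrier (grassmann I p) = {f. \<forall>S. f S \<noteq> 0 \<longrightarrow> S \<subseteq> I}"
  "monoid.mult (grassmann I p) = (\<lambda>f g S. \<Sum>A\<in>Pow S. split_sign p A (S - A) * f A * g (S - A))"
  "one (grassmann I p) = (\<lambda>S. if S = {} then 1 else 0)"
  "zero (grassmann I p) = (\<lambda>S. 0)"
  "add (grassmann I p) = (\<lambda>f g S. f S + g S)"
  "smult (grassmann I p) = (\<lambda>c f S. c * f S)"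
  "homog (grassmann I p) q =
    {f \<in> carrier (grassmann I p). \<forall>S. f S \<noteq> 0 \<longrightarrow> (\<Sum>k\<in>S. p k) = q}"
  by (auto simp: grassmann_def)

lemma koszul_sum: "koszul (\<Sum>k\<in>A. f k) = (\<Prod>k\<in>A. koszul (f k) :: 'k::field)"
  by (induction A rule: infinite_finite_induct) (auto simp: koszul_add)

lemma split_sign_Un_left:
  "finite A \<Longrightarrow> finite B \<Longrightarrow> A \<inter> B = {} \<Longrightarrow> split_sign p (A \<union> B) D = split_sign p A D * split_sign p B D"
  by (simp add: split_sign_def prod.union_disjoint)

lemma split_sign_Un_right:
  "finite B \<Longrightarrow> finite D \<Longrightarrow> B \<inter> D = {} \<Longrightarrow> split_sign p A (B \<union> D) = split_sign p A B * split_sign p A D"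
  by (simp add: split_sign_def prod.union_disjoint prod.distrib)

lemma split_sign_empty [simp]: "split_sign p {} B = 1" "split_sign p A {} = 1"
  by (simp_all add: split_sign_def)

lemma split_sign_swap:
  assumes "finite A" "finite B" "A \<inter> B = {}"
  shows "split_sign p A B = koszul ((\<Sum>k\<in>A. p k) * (\<Sum>k\<in>B. p k)) * (split_sign p B A :: 'k::field)"
proof -
  have 1: "split_sign p B A = (\<Prod>a\<in>A. \<Prod>b\<in>B. if a < b then koszul (p a * p b) else (1 :: 'k))"
    unfolding split_sign_def by (subst prod.swap) (intro prod.cong refl, simp add: mult.commute)
  have 2: "split_sign p B A * split_sign p B A = (1 :: 'k)"
    unfolding split_sign_def prod.distrib[symmetric] by (intro prod.neutral ballI) simp
  have "split_sign p A B * split_sign p B A = (\<Prod>a\<in>A. \<Prod>b\<in>B. koszul (p a * p b) :: 'k)"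
    unfolding 1 unfolding split_sign_def prod.distrib[symmetric]
    using assms(3) by (intro prod.cong refl) auto
  also have "\<dots> = koszul ((\<Sum>k\<in>A. p k) * (\<Sum>k\<in>B. p k))"
    by (simp add: sum_distrib_left sum_distrib_right koszul_sum) (rule prod.swap)
  finally show ?thesis using 2 by (metis (no_types) mult.assoc mult.right_neutral)
qed

lemma grassmann_mult_nz:
  assumes "monoid.mult (grassmann I p) f g S \<noteq> 0"
  obtains A where "A \<subseteq> S" "finite S" "f A \<noteq> 0" "g (S - A) \<noteq> 0"
proof -
  have "finite S"
    using assms by (rule contrapos_np) (simp add: grassmann_simps)
  moreover have "\<exists>A\<in>Pow S. split_sign p A (S - A) * f A * g (S - A) \<noteq> 0"
    using assms unfolding grassmann_simps by (rule contrapos_np) (simp add: sum.neutral)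
  ultimately show ?thesis using that by auto
qed

lemma grassmann_closed:
  "f \<in> carrier (grassmann I p) \<Longrightarrow> g \<in> carrier (grassmann I p) \<Longrightarrow>
    monoid.mult (grassmann I p) f g \<in> carrier (grassmann I p)"
  unfolding grassmann_simps(1)
  by (safe elim!: grassmann_mult_nz) blast

lemma grassmann_assoc:
  "monoid.mult (grassmann I p) (monoid.mult (grassmann I p) f g) h S =
   (monoid.mult (grassmann I p) f (monoid.mult (grassmann I p) g h) S :: 'k::field)"
proof (cases "finite S")
  case True
  let ?s = "split_sign p :: _ \<Rightarrow> _ \<Rightarrow> 'k"
  have fin: "finite A" if "A \<subseteq> S" for A using True that finite_subset by blast
  have "monoid.mult (grassmann I p) (monoid.mult (grassmann I p) f g) h S =
    (\<Sum>C\<in>Pow S. \<Sum>A\<in>Pow C. ?s C (S - C) * ?s A (C - A) * f A * g (C - A) * h (S - C))"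
    by (simp add: grassmann_simps sum_distrib_left sum_distrib_right mult_ac)
  also have "\<dots> = (\<Sum>(C, A)\<in>Sigma (Pow S) Pow. ?s C (S - C) * ?s A (C - A) * f A * g (C - A) * h (S - C))"
    by (rule sum.Sigma) (use fin in auto)
  also have "\<dots> = (\<Sum>(A, B)\<in>Sigma (Pow S) (\<lambda>A. Pow (S - A)).
      ?s A (S - A) * ?s B (S - A - B) * f A * g B * h (S - A - B))"
  proof (rule sum.reindex_bij_witness[of _ "\<lambda>(A, B). (A \<union> B, A)" "\<lambda>(C, A). (A, C - A)"], goal_cases)
    case (5 x)
    then obtain C A where x: "x = (C, A)" "A \<subseteq> C" "C \<subseteq> S" by auto
    define B D where "B = C - A" "D = S - C"
    have e: "C = A \<union> B" "S - A = B \<union> D" "S - A - B = D" using x by (auto simp: B_D_def)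
    have f: "finite A" "finite B" "finite D" "A \<inter> B = {}" "B \<inter> D = {}"
      using x fin[of A] fin[of B] fin[of D] by (auto simp: B_D_def)
    have "?s A (B \<union> D) * ?s B D = ?s (A \<union> B) D * ?s A B"
      using f by (simp add: split_sign_Un_left split_sign_Un_right mult_ac)
    then have "?s A (S - A) * ?s B (S - A - B) = ?s C D * ?s A B"
      unfolding e(3) unfolding e(1,2) .
    then show ?case unfolding x(1) prod.case B_D_def[symmetric] e(3) by simp
  qed auto
  also have "\<dots> = (\<Sum>A\<in>Pow S. \<Sum>B\<in>Pow (S - A). ?s A (S - A) * ?s B (S - A - B) * f A * g B * h (S - A - B))"
    by (rule sum.Sigma[symmetric]) (use fin in auto)
  also have "\<dots> = monoid.mult (grassmann I p) f (monoid.mult (grassmann I p) g h) S"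
    by (simp add: grassmann_simps sum_distrib_left sum_distrib_right mult_ac)
  finally show ?thesis .
qed (auto simp: grassmann_simps)

lemma grassmann_one_left:
  assumes "finite I" "f \<in> carrier (grassmann I p)"
  shows "monoid.mult (grassmann I p) (one (grassmann I p)) f = f"
proof
  fix S
  show "monoid.mult (grassmann I p) (one (grassmann I p)) f S = f S"
  proof (cases "finite S")
    case True
    have "(\<Sum>A\<in>Pow S. split_sign p A (S - A) * (if A = {} then 1 else 0) * f (S - A)) =
        (\<Sum>A\<in>Pow S. if A = {} then f S else 0)"
      by (intro sum.cong) auto
    then show ?thesis using True by (simp add: grassmann_simps)
  next
    case False
    then have "f S = 0" using assms finite_subset unfolding grassmann_simps(1) by blast
    then show ?thesis using False by (simp add: grassmann_simps)
  qed
qed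

lemma grassmann_one_right:
  assumes "finite I" "f \<in> carrier (grassmann I p)"
  shows "monoid.mult (grassmann I p) f (one (grassmann I p)) = f"
proof
  fix S
  show "monoid.mult (grassmann I p) f (one (grassmann I p)) S = f S"
  proof (cases "finite S")
    case True
    have "(\<Sum>A\<in>Pow S. split_sign p A (S - A) * f A * (if S - A = {} then 1 else 0)) =
        (\<Sum>A\<in>Pow S. if A = S then f S else 0)"
      by (intro sum.cong) auto
    then show ?thesis using True by (simp add: grassmann_simps)
  next
    case False
    then have "f S = 0" using assms finite_subset unfolding grassmann_simps(1) by blast
    then show ?thesis using False by (simp add: grassmann_simps)
  qed
qed

lemma grassmann_add_closed:
  "f \<in> carrier (grassmann I p) \<Longrightarrow> g \<in> carrier (grassmann I p) \<Longrightarrow>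
    (\<lambda>S. f S + g S) \<in> carrier (grassmann I p)"
  unfolding grassmann_simps(1) by clarsimp (metis add.right_neutral subsetD)

lemma supercommutative_grassmann:
  assumes I: "finite I"
  shows "supercommutative_superalgebra (grassmann I p :: ('k::field, 'i::linorder set \<Rightarrow> 'k) salg)"
proof -
  let ?A = "grassmann I p :: ('k, 'i set \<Rightarrow> 'k) salg"
  note linear = grassmann_simps(1,3-6)
  have ab: "abelian_group ?A"
  proof (rule abelian_groupI)
    show "\<exists>g\<in>carrier ?A. g \<oplus>\<^bsub>?A\<^esub> f = \<zero>\<^bsub>?A\<^esub>" if "f \<in> carrier ?A" for f
      using that by (intro bexI[of _ "\<lambda>S. - f S"]) (auto simp: linear)
  next
    show "f \<oplus>\<^bsub>?A\<^esub> g \<in> carrier ?A" if "f \<in> carrier ?A" "g \<in> carrier ?A" for f g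
      using grassmann_add_closed[OF that] by (simp add: linear(4))
  qed (auto simp: linear algebra_simps)
  have mon: "monoid ?A"
  proof (rule monoidI)
    show "\<one>\<^bsub>?A\<^esub> \<in> carrier ?A" by (simp add: linear)
    show "(f \<otimes>\<^bsub>?A\<^esub> g) \<otimes>\<^bsub>?A\<^esub> h = f \<otimes>\<^bsub>?A\<^esub> (g \<otimes>\<^bsub>?A\<^esub> h)" for f g h
      by (rule ext) (rule grassmann_assoc)
  qed (simp_all add: grassmann_closed grassmann_one_left[OF I] grassmann_one_right[OF I])
  have ring: "ring ?A"
    by (rule ringI[OF ab mon])
      (auto simp: grassmann_simps(2,5) algebra_simps sum.distrib)
  interpret ring ?A by (rule ring)
  have sub: "additive_subgroup (homog ?A q) ?A" for q
  proof -
    have "subgroup (homog ?A q) (add_monoid ?A)"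
    proof (rule group.subgroupI)
      show "group (add_monoid ?A)" by (rule a_group)
      show "homog ?A q \<noteq> {}" by (auto simp: grassmann_simps intro!: exI[of _ "\<lambda>_. 0"])
      fix f assume f: "f \<in> homog ?A q"
      have "\<ominus>\<^bsub>?A\<^esub> f = (\<lambda>S. - f S)"
        by (rule minus_equality) (use f in \<open>auto simp: grassmann_simps\<close>)
      then show "inv\<^bsub>add_monoid ?A\<^esub> f \<in> homog ?A q"
        using f by (auto simp: a_inv_def grassmann_simps)
    next
      fix f g assume "f \<in> homog ?A q" "g \<in> homog ?A q"
      then show "f \<otimes>\<^bsub>add_monoid ?A\<^esub> g \<in> homog ?A q"
        using grassmann_add_closed[of f I p g] unfolding grassmann_simps(7)
        by (auto simp: linear(4)) (metis add.right_neutral)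
    qed (auto simp: grassmann_simps)
    then show ?thesis by (simp add: additive_subgroup_def)
  qed
  have "superalgebra ?A"
  proof (intro superalgebra.intro ring superalgebra_axioms.intro, goal_cases)
    case (10 f)
    then show ?case
      by (intro bexI[of _ "\<lambda>S. if (\<Sum>k\<in>S. p k) = 0 then f S else 0"]
          bexI[of _ "\<lambda>S. if (\<Sum>k\<in>S. p k) = 0 then 0 else f S"])
        (auto simp: grassmann_simps)
  next
    case 11
    show ?case by (auto simp: grassmann_simps fun_eq_iff)
  next
    case (13 f q g q')
    have f: "f \<in> carrier ?A" "g \<in> carrier ?A" using 13 unfolding grassmann_simps(7) by auto
    have "(\<Sum>k\<in>S. p k) = q + q'" if nz: "monoid.mult ?A f g S \<noteq> 0" for S
    proof -
      obtain A where A: "A \<subseteq> S" "finite S" "f A \<noteq> 0" "g (S - A) \<noteq> 0"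
        using nz by (rule grassmann_mult_nz)
      then have "(\<Sum>k\<in>A. p k) = q" "(\<Sum>k\<in>S - A. p k) = q'"
        using 13 unfolding grassmann_simps(7) by auto
      then show ?thesis using sum.subset_diff[OF A(1,2), of p] by (simp add: add.commute)
    qed
    then show ?case using grassmann_closed[OF f] unfolding grassmann_simps(7) by auto
  qed (use sub in \<open>auto simp: grassmann_simps algebra_simps sum_distrib_left\<close>)
  then interpret superalgebra ?A .
  show ?thesis
  proof (intro supercommutative_superalgebra.intro supercommutative_superalgebra_axioms.intro)
    fix f g q q' assume fg: "f \<in> homog ?A q" "g \<in> homog ?A q'"
    show "f \<otimes>\<^bsub>?A\<^esub> g = koszul (q * q') \<odot>\<^bsub>?A\<^esub> (g \<otimes>\<^bsub>?A\<^esub> f)"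
    proof
      fix S
      show "(f \<otimes>\<^bsub>?A\<^esub> g) S = (koszul (q * q') \<odot>\<^bsub>?A\<^esub> (g \<otimes>\<^bsub>?A\<^esub> f)) S"
      proof (cases "finite S")
        case True
        have "(f \<otimes>\<^bsub>?A\<^esub> g) S = (\<Sum>A\<in>Pow S. split_sign p A (S - A) * f A * g (S - A))"
          by (simp add: grassmann_simps)
        also have "\<dots> = (\<Sum>B\<in>Pow S. koszul (q * q') * (split_sign p B (S - B) * g B * f (S - B)))"
        proof (rule sum.reindex_bij_witness[of _ "\<lambda>A. S - A" "\<lambda>A. S - A"], goal_cases)
          case (5 A)
          then have A: "A \<subseteq> S" "finite A" "finite (S - A)" "S - (S - A) = A"
            using True finite_subset by auto
          show ?case
          proof (cases "f A = 0 \<or> g (S - A) = 0")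
            case False
            then have "(\<Sum>k\<in>A. p k) = q" "(\<Sum>k\<in>S - A. p k) = q'"
              using fg unfolding grassmann_simps(7) by auto
            then have "split_sign p A (S - A) = koszul (q * q') * (split_sign p (S - A) A :: 'k)"
              using split_sign_swap[OF A(2,3)] by auto
            then show ?thesis unfolding A(4) by simp
          qed (auto simp: A(4))
        qed auto
        also have "\<dots> = (koszul (q * q') \<odot>\<^bsub>?A\<^esub> (g \<otimes>\<^bsub>?A\<^esub> f)) S"
          by (simp add: grassmann_simps sum_distrib_left)
        finally show ?thesis .
      qed (simp add: grassmann_simps)
    qed
  qed (rule superalgebra_axioms)
qed

definition gvar :: "'i \<Rightarrow> 'i set \<Rightarrow> 'k::field" where
  "gvar k S = (if S = {k} then 1 else 0)"

lemma gvar_homog: "k \<in> I \<Longrightarrow> gvar k \<in> homog (grassmann I p) (p k)"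
  by (auto simp: grassmann_simps gvar_def)

lemma gvar_mult_indicator:
  assumes "finite W"
  shows "monoid.mult (grassmann I p) (gvar x) (\<lambda>S. if S = W then c else 0) =
    (\<lambda>S. if x \<notin> W \<and> S = insert x W then split_sign p {x} W * c else (0 :: 'k::field))"
proof
  fix S
  show "monoid.mult (grassmann I p) (gvar x) (\<lambda>S. if S = W then c else 0) S =
    (if x \<notin> W \<and> S = insert x W then split_sign p {x} W * c else (0 :: 'k::field))"
  proof (cases "finite S")
    case True
    have "monoid.mult (grassmann I p) (gvar x) (\<lambda>S. if S = W then c else 0) S =
      (\<Sum>A\<in>Pow S. if A = {x} then (if S - {x} = W then split_sign p {x} W * c else 0) else 0)"
      unfolding grassmann_simps gvar_def by (intro sum.cong) auto
    also have "\<dots> = (if x \<in> S then (if S - {x} = W then split_sign p {x} W * c else 0) else 0)"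
      using True by simp
    also have "\<dots> = (if x \<notin> W \<and> S = insert x W then split_sign p {x} W * c else 0)" by auto
    finally show ?thesis .
  next
    case False
    then show ?thesis using assms by (auto simp: grassmann_simps)
  qed
qed

text \<open>
  A product of distinct generators is a single monomial with a Koszul sign. Conversely, the
  coefficient of a monomial turns an identity between products into one between signs.
\<close>

lemma lprod_gvar:
  "lprod (grassmann I p) (map gvar w) =
    (\<lambda>S. if distinct w \<and> S = set w then koszul_sign p w else (0 :: 'k::field))"
proof (induction w)
  case Nil
  then show ?case by (auto simp: grassmann_simps)
next
  case (Cons x w)
  have "lprod (grassmann I p) (map gvar w) =
      (\<lambda>S. if S = set w then (if distinct w then koszul_sign p w else 0) else (0 :: 'k))"
    unfolding Cons.IH by auto
  then have "lprod (grassmann I p) (map gvar (x # w)) = (\<lambda>S. if x \<notin> set w \<and> S = insert x (set w)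
      then split_sign p {x} (set w) * (if distinct w then koszul_sign p w else 0) else (0 :: 'k))"
    by (simp add: gvar_mult_indicator)
  moreover have "split_sign p {x} (set w) = ((\<Prod>y\<leftarrow>w. if y < x then koszul (p x * p y) else 1) :: 'k)"
    if "distinct w"
    using that by (simp add: split_sign_def prod.distinct_set_conv_list)
  ultimately show ?case by auto
qed

lemma grassmann_finsum:
  assumes I: "finite I" and "finite N" and "\<And>n. n \<in> N \<Longrightarrow> f n \<in> carrier (grassmann I p)"
  shows "finsum (grassmann I p) f N = (\<lambda>S. \<Sum>n\<in>N. f n S :: 'k::field)"
proof -
  interpret supercommutative_superalgebra "grassmann I p :: ('k, _) salg"
    by (rule supercommutative_grassmann[OF I])
  show ?thesis
    using assms(2,3)
  proof (induction N rule: finite_induct)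
    case empty
    then show ?case by (simp add: grassmann_simps)
  next
    case (insert n N)
    then show ?case by (subst finsum_insert) (auto simp: grassmann_simps(5))
  qed
qed

section \<open>The universal property of the free supercommutative superalgebra\<close>

definition sym_class :: "'x set \<Rightarrow> ('x \<Rightarrow> bit) \<Rightarrow> ('x list \<Rightarrow> 'k::field) \<Rightarrow> ('x list \<Rightarrow> 'k) set" where
  "sym_class X par f = supercommutator_ideal X par +>\<^bsub>tensor_salg X par\<^esub> f"

lemmas sym_class_simps = Sym_facts(1-5)[folded sym_class_def]

lemma word_append: "(word (v @ w) :: 'x list \<Rightarrow> 'k::field) = conv (word v) (word w)"
proof (induction v)
  case Nil
  then show ?case using conv_one_left[of "word w :: _ \<Rightarrow> 'k"] by (simp add: word_def fun_eq_iff)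
next
  case (Cons x v)
  have "(word ((x # v) @ w) :: 'x list \<Rightarrow> 'k) = conv (word [x]) (conv (word v) (word w))"
    by (simp add: word_Cons[of x "v @ w"] Cons)
  also have "\<dots> = conv (conv (word [x]) (word v)) (word w)"
    by (simp add: conv_assoc fun_eq_iff)
  finally show ?case by (simp add: word_Cons[symmetric])
qed

lemma tensor_induct [consumes 1, case_names zero word add]:
  fixes f :: "'x list \<Rightarrow> 'k::field"
  assumes "f \<in> carrier (tensor_salg X par)"
    and zero: "P (\<lambda>w. 0)"
    and word: "\<And>c w. w \<in> lists X \<Longrightarrow> P (\<lambda>u. c * word w u)"
    and add: "\<And>f g. f \<in> carrier (tensor_salg X par) \<Longrightarrow> g \<in> carrier (tensor_salg X par) \<Longrightarrow>
      P f \<Longrightarrow> P g \<Longrightarrow> P (\<lambda>w. f w + g w)"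
  shows "P f"
  using assms(1)
proof (induction "card {w. f w \<noteq> 0}" arbitrary: f)
  case 0
  then have "f = (\<lambda>w. 0)" by (auto simp: tensor_salg_simps)
  then show ?case using zero by simp
next
  case (Suc n)
  then have fin: "finite {w. f w \<noteq> 0}" and sub: "{w. f w \<noteq> 0} \<subseteq> lists X"
    by (auto simp: tensor_salg_simps)
  obtain v where v: "f v \<noteq> 0" using Suc.hyps(2) by fastforce
  let ?g = "\<lambda>w. if w = v then 0 else f w"
  have supp: "{w. ?g w \<noteq> 0} = {w. f w \<noteq> 0} - {v}" by auto
  have g: "?g \<in> carrier (tensor_salg X par)"
    using fin sub unfolding tensor_salg_simps mem_Collect_eq supp by auto
  have vX: "v \<in> lists X" using v sub by auto
  have "card {w. ?g w \<noteq> 0} = n" using Suc.hyps(2) v fin unfolding supp by simp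
  then have "P ?g" using Suc.hyps(1)[of ?g] g by simp
  then have "P (\<lambda>w. f v * word v w + ?g w)"
    using add[OF tensor_scale_closed[OF word_closed[OF vX]] g word[OF vX]] by blast
  moreover have "f = (\<lambda>w. f v * word v w + ?g w)" by (auto simp: word_def)
  ultimately show ?case by simp
qed

lemma ring_Sym: "ring (Sym_salg X par :: ('k::field, ('x list \<Rightarrow> 'k) set) salg)"
proof -
  let ?S = "Sym_salg X par :: ('k, ('x list \<Rightarrow> 'k) set) salg"
  let ?R = "tensor_salg X par Quot supercommutator_ideal X par :: ('x list \<Rightarrow> 'k) set ring"
  interpret R: ring ?R using ideal.quotient_is_ring[OF ideal_supercommutator] .
  have fields: "carrier ?S = carrier ?R" "monoid.mult ?S = monoid.mult ?R" "one ?S = one ?R"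
    "zero ?S = zero ?R" "add ?S = add ?R"
    by (simp_all add: Sym_salg_def Let_def)
  show ?thesis
  proof (rule ringI)
    show "abelian_group ?S"
    proof (rule abelian_groupI)
      show "\<exists>y\<in>carrier ?S. y \<oplus>\<^bsub>?S\<^esub> x = \<zero>\<^bsub>?S\<^esub>" if "x \<in> carrier ?S" for x
        using that R.l_neg[of x] R.a_inv_closed[of x] unfolding fields by blast
    qed (simp_all add: fields R.a_ac)
    show "monoid ?S" by (rule monoidI) (simp_all add: fields R.m_assoc)
  qed (simp_all add: fields R.l_distr R.r_distr)
qed

lemma sym_class_closed: "f \<in> carrier (tensor_salg X par) \<Longrightarrow> sym_class X par f \<in> carrier (Sym_salg X par)"
  by (simp add: sym_class_simps)

lemma Sym_smult_closed:
  "F \<in> carrier (Sym_salg X par) \<Longrightarrow> c \<odot>\<^bsub>Sym_salg X par\<^esub> F \<in> carrier (Sym_salg X par)"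
  unfolding sym_class_simps(1) by (auto simp: sym_class_simps(5)[symmetric] tensor_scale_closed intro!: imageI)

lemma sym_class_ideal:
  assumes "f \<in> supercommutator_ideal X par"
  shows "sym_class X par f = \<zero>\<^bsub>Sym_salg X par\<^esub>"
proof -
  interpret ideal "supercommutator_ideal X par" "tensor_salg X par" by (rule ideal_supercommutator)
  show ?thesis using a_coset_join2[OF a_Hcarr[OF assms] _ assms] is_additive_subgroup
    by (simp add: sym_class_def Sym_salg_def Let_def FactRing_def a_rcos_const[OF assms])
qed

lemma sym_class_word_swap:
  fixes par :: "'x \<Rightarrow> bit"
  assumes "a \<in> lists X" "b \<in> lists X" "x \<in> X" "y \<in> X"
  shows "(sym_class X par (word (a @ x # y # b)) :: ('x list \<Rightarrow> 'k::field) set) =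
    koszul (par x * par y) \<odot>\<^bsub>Sym_salg X par\<^esub> sym_class X par (word (a @ y # x # b))"
proof -
  let ?S = "Sym_salg X par :: ('k, ('x list \<Rightarrow> 'k) set) salg"
  let ?T = "tensor_salg X par :: ('k, 'x list \<Rightarrow> 'k) salg"
  let ?k = "koszul (par x * par y) :: 'k"
  interpret ideal "supercommutator_ideal X par" ?T by (rule ideal_supercommutator)
  interpret S: ring ?S by (rule ring_Sym)
  have w: "word a \<in> carrier ?T" "word b \<in> carrier ?T" "word [x, y] \<in> carrier ?T" "word [y, x] \<in> carrier ?T"
    using assms by (auto intro!: word_closed)
  let ?d = "\<lambda>u. word [x, y] u - ?k * word [y, x] u"
  have gens: "{\<lambda>u. word [x, y] u - koszul (par x * par y) * word [y, x] u |x y. x \<in> X \<and> y \<in> X} \<subseteq> carrier ?T"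
  proof clarify
    fix x y assume "x \<in> X" "y \<in> X"
    then have 1: "word [x, y] \<in> carrier ?T" "word [y, x] \<in> carrier ?T"
      by (auto intro!: word_closed)
    from tensor_add_closed[OF 1(1) tensor_scale_closed[OF 1(2), of "- koszul (par x * par y)"]]
    show "(\<lambda>u. word [x, y] u - koszul (par x * par y) * word [y, x] u) \<in> carrier ?T" by simp
  qed
  have d: "?d \<in> supercommutator_ideal X par"
    unfolding supercommutator_ideal_def
    by (rule subsetD[OF ring.genideal_self[OF ring_tensor_salg gens]]) (use assms in blast)
  have "sym_class X par (word [x, y]) = sym_class X par (\<lambda>u. ?d u + ?k * word [y, x] u)" by simp
  also have "\<dots> = ?k \<odot>\<^bsub>?S\<^esub> sym_class X par (word [y, x])"
    using a_Hcarr[OF d] w sym_class_closed[OF tensor_scale_closed[OF w(4)], of ?k]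
    by (subst sym_class_simps(4))
      (auto simp: sym_class_ideal[OF d] tensor_scale_closed sym_class_simps(5))
  finally have 1: "sym_class X par (word [x, y]) = ?k \<odot>\<^bsub>?S\<^esub> sym_class X par (word [y, x])" .
  have e: "word (a @ [s, t] @ b) = (conv (word a) (conv (word [s, t]) (word b)) :: _ \<Rightarrow> 'k)" for s t
    by (simp only: word_append)
  have "sym_class X par (word (a @ [x, y] @ b)) = sym_class X par (word a) \<otimes>\<^bsub>?S\<^esub>
      ((?k \<odot>\<^bsub>?S\<^esub> sym_class X par (word [y, x])) \<otimes>\<^bsub>?S\<^esub> sym_class X par (word b))"
    unfolding e using w by (simp add: sym_class_simps(3) conv_closed 1)
  also have "\<dots> = sym_class X par (conv (word a) (conv (\<lambda>u. ?k * word [y, x] u) (word b)))"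
    using w by (simp add: sym_class_simps(3) conv_closed tensor_scale_closed sym_class_simps(5))
  also have "conv (word a) (conv (\<lambda>u. ?k * word [y, x] u) (word b)) = (\<lambda>u. ?k * word (a @ [y, x] @ b) u)"
    unfolding e by (simp add: conv_scale_left conv_scale_right fun_eq_iff)
      (simp add: conv_def conv_scale_left sum_distrib_left mult_ac)
  also have "sym_class X par \<dots> = ?k \<odot>\<^bsub>?S\<^esub> sym_class X par (word (a @ [y, x] @ b))"
    using assms by (subst sym_class_simps(5)) (auto intro!: word_closed)
  finally show ?thesis by simp
qed

text \<open>
  In \<open>Sym\<close>, letters may be rearranged at the price of a Koszul sign. The letters are
  labelled by the positions in \<open>w\<close>, as a letter may occur several times.
\<close>

lemma sym_class_word_reorder:
  fixes u :: "'i::linorder \<Rightarrow> 'x"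
  assumes "distinct w" "u ` set w \<subseteq> X"
  shows "(sym_class X par (word (map u w)) :: ('x list \<Rightarrow> 'k::field) set) =
    koszul_sign (\<lambda>k. par (u k)) w \<odot>\<^bsub>Sym_salg X par\<^esub> sym_class X par (word (map u (sort w)))"
proof (rule koszul_sign_reorder[where h = "\<lambda>w. sym_class X par (word (map u w))" and I = "set w"
      and scale = "smult (Sym_salg X par)"])
  fix v c d assume "set v \<subseteq> set w"
  then have v: "(word (map u v) :: 'x list \<Rightarrow> 'k) \<in> carrier (tensor_salg X par)"
    using assms(2) by (intro word_closed) (auto simp: image_subset_iff subset_iff)
  show "c \<odot>\<^bsub>Sym_salg X par\<^esub> (d \<odot>\<^bsub>Sym_salg X par\<^esub> sym_class X par (word (map u v))) =
    (c * d :: 'k) \<odot>\<^bsub>Sym_salg X par\<^esub> sym_class X par (word (map u v))"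
    using v by (simp add: sym_class_simps(5)[symmetric] tensor_scale_closed mult.assoc)
  show "(1 :: 'k) \<odot>\<^bsub>Sym_salg X par\<^esub> sym_class X par (word (map u v)) = sym_class X par (word (map u v))"
    using v by (simp add: sym_class_simps(5)[symmetric])
next
  fix a x y b assume "set (a @ x # y # b) \<subseteq> set w"
  then have "map u a \<in> lists X" "map u b \<in> lists X" "u x \<in> X" "u y \<in> X"
    using assms(2) by (auto simp: image_subset_iff subset_iff)
  from sym_class_word_swap[OF this, of par] show "sym_class X par (word (map u (a @ x # y # b))) =
    (koszul (par (u x) * par (u y)) :: 'k) \<odot>\<^bsub>Sym_salg X par\<^esub> sym_class X par (word (map u (a @ y # x # b)))"
    by simp
qed (use assms in auto)

definition tensor_eval ::
  "('k::field, 'a, 'm) salg_scheme \<Rightarrow> ('x \<Rightarrow> 'a) \<Rightarrow> ('x list \<Rightarrow> 'k) \<Rightarrow> 'a" where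
  "tensor_eval A b f = (\<Oplus>\<^bsub>A\<^esub>w\<in>{w. f w \<noteq> 0}. f w \<odot>\<^bsub>A\<^esub> lprod A (map b w))"

text \<open>
  The chosen representative is immaterial once the \<open>b x\<close> supercommute, by \<open>sym_lift_class\<close>.
\<close>

definition sym_lift ::
  "('k::field, 'a, 'm) salg_scheme \<Rightarrow> ('x \<Rightarrow> 'a) \<Rightarrow> ('x list \<Rightarrow> 'k) set \<Rightarrow> 'a" where
  "sym_lift A b F = tensor_eval A b (SOME f. f \<in> F)"

context superalgebra
begin

lemma finsum_smult:
  assumes "finite N" "\<And>n. n \<in> N \<Longrightarrow> f n \<in> carrier A"
  shows "c \<odot> (\<Oplus>n\<in>N. f n) = (\<Oplus>n\<in>N. c \<odot> f n)"
  using assms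
proof (induction N rule: finite_induct)
  case empty
  have "c \<odot> \<zero> = \<zero>" using smult_assoc[of \<zero> c 0] smult_zero[of \<zero>] by simp
  then show ?case by simp
next
  case (insert n N)
  then have "(\<Oplus>n\<in>N. f n) \<in> carrier A" by (intro finsum_closed) auto
  moreover have "(\<lambda>n. c \<odot> f n) \<in> N \<rightarrow> carrier A" "f \<in> N \<rightarrow> carrier A"
    using insert.prems smult_closed by auto
  ultimately show ?case using insert by (simp add: smult_r_distr smult_closed)
qed

lemma finsum_homog:
  assumes "finite N" "\<And>n. n \<in> N \<Longrightarrow> f n \<in> homog A p"
  shows "(\<Oplus>n\<in>N. f n) \<in> homog A p"
  using assms
proof (induction N rule: finite_induct)
  case (insert n N)
  then have "f \<in> N \<rightarrow> carrier A" "f n \<in> carrier A" by (auto intro: homog_carrier)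
  then show ?case using insert by (simp add: homog_add)
qed (simp add: homog_zero)

context
  fixes X :: "'x set" and par :: "'x \<Rightarrow> bit" and b :: "'x \<Rightarrow> 'a"
  assumes bX: "\<forall>x\<in>X. b x \<in> homog A (par x)"
begin

private lemmas b = bX[rule_format]

lemma lprod_word_closed: "w \<in> lists X \<Longrightarrow> lprod A (map b w) \<in> carrier A"
  using homog_carrier[OF b] by (intro lprod_closed) (auto simp: in_lists_conv_set)

lemma tensor_eval_superset:
  assumes "f \<in> carrier (tensor_salg X par)" "{w. f w \<noteq> 0} \<subseteq> U" "U \<subseteq> lists X" "finite U"
  shows "tensor_eval A b f = (\<Oplus>w\<in>U. f w \<odot> lprod A (map b w))"
  unfolding tensor_eval_def
  by (rule add.finprod_mono_neutral_cong_left)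
    (use assms in \<open>auto simp: smult_zero lprod_word_closed smult_closed subset_iff\<close>)

lemma tensor_eval_word: "w \<in> lists X \<Longrightarrow> tensor_eval A b (\<lambda>u. c * word w u) = c \<odot> lprod A (map b w)"
  using lprod_word_closed[of w]
  by (subst tensor_eval_superset[OF tensor_scale_closed[OF word_closed], where U = "{w}"])
    (auto simp: word_def smult_closed split: if_splits)

lemma tensor_eval_zero: "tensor_eval A b (\<lambda>w. 0) = \<zero>"
  by (simp add: tensor_eval_def)

lemma tensor_eval_closed: "f \<in> carrier (tensor_salg X par) \<Longrightarrow> tensor_eval A b f \<in> carrier A"
  unfolding tensor_eval_def
  by (rule finsum_closed)
    (use lprod_word_closed in \<open>auto simp: tensor_salg_simps intro!: smult_closed\<close>)

lemma tensor_eval_add: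
  assumes "f \<in> carrier (tensor_salg X par)" "g \<in> carrier (tensor_salg X par)"
  shows "tensor_eval A b (\<lambda>w. f w + g w) = tensor_eval A b f \<oplus> tensor_eval A b g"
proof -
  let ?U = "{w. f w \<noteq> 0} \<union> {w. g w \<noteq> 0}"
  have U: "finite ?U" "?U \<subseteq> lists X" using assms by (auto simp: tensor_salg_simps)
  have c: "lprod A (map b w) \<in> carrier A" if "w \<in> ?U" for w
    using that U(2) lprod_word_closed by blast
  have "tensor_eval A b (\<lambda>w. f w + g w) = (\<Oplus>w\<in>?U. (f w + g w) \<odot> lprod A (map b w))"
    by (rule tensor_eval_superset) (use assms U in \<open>auto simp: tensor_add_closed\<close>)
  also have "\<dots> = (\<Oplus>w\<in>?U. (f w \<odot> lprod A (map b w)) \<oplus> (g w \<odot> lprod A (map b w)))"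
    by (rule finsum_cong') (use c in \<open>auto simp: smult_l_distr smult_closed\<close>)
  also have "\<dots> = (\<Oplus>w\<in>?U. f w \<odot> lprod A (map b w)) \<oplus> (\<Oplus>w\<in>?U. g w \<odot> lprod A (map b w))"
    by (rule finsum_addf) (use c in \<open>auto simp: smult_closed\<close>)
  also have "(\<Oplus>w\<in>?U. f w \<odot> lprod A (map b w)) = tensor_eval A b f"
    by (rule tensor_eval_superset[symmetric]) (use assms U in auto)
  also have "(\<Oplus>w\<in>?U. g w \<odot> lprod A (map b w)) = tensor_eval A b g"
    by (rule tensor_eval_superset[symmetric]) (use assms U in auto)
  finally show ?thesis .
qed

lemma tensor_eval_smult:
  assumes "f \<in> carrier (tensor_salg X par)"
  shows "tensor_eval A b (\<lambda>w. c * f w) = c \<odot> tensor_eval A b f"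
proof -
  let ?U = "{w. f w \<noteq> 0}"
  have U: "finite ?U" "?U \<subseteq> lists X" using assms by (auto simp: tensor_salg_simps)
  have l: "lprod A (map b w) \<in> carrier A" if "w \<in> ?U" for w
    using that U(2) lprod_word_closed by blast
  have "tensor_eval A b (\<lambda>w. c * f w) = (\<Oplus>w\<in>?U. (c * f w) \<odot> lprod A (map b w))"
    by (rule tensor_eval_superset) (use assms U in \<open>auto simp: tensor_scale_closed\<close>)
  also have "\<dots> = (\<Oplus>w\<in>?U. c \<odot> (f w \<odot> lprod A (map b w)))"
    by (rule finsum_cong') (use l in \<open>auto simp: smult_assoc smult_closed\<close>)
  also have "\<dots> = c \<odot> tensor_eval A b f"
    unfolding tensor_eval_def by (rule finsum_smult[symmetric]) (use U l in \<open>auto simp: smult_closed\<close>)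
  finally show ?thesis .
qed

lemma tensor_eval_conv:
  assumes "f \<in> carrier (tensor_salg X par)" "g \<in> carrier (tensor_salg X par)"
  shows "tensor_eval A b (conv f g) = tensor_eval A b f \<otimes> tensor_eval A b g"
  using assms(1)
proof (induction rule: tensor_induct)
  case zero
  then show ?case using tensor_eval_closed[OF assms(2)]
    by (simp add: tensor_eval_zero conv_def)
next
  case (add f f')
  have e: "conv (\<lambda>w. f w + f' w) g = (\<lambda>w. conv f g w + conv f' g w)"
    by (simp add: conv_add_left fun_eq_iff)
  show ?case using add assms(2)
    by (simp add: e tensor_eval_add conv_closed tensor_eval_closed l_distr)
next
  case (word c u)
  show ?case using assms(2)
  proof (induction rule: tensor_induct)
    case zero
    then show ?case using tensor_eval_closed[OF tensor_scale_closed[OF word_closed[OF word]]]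
      by (simp add: tensor_eval_zero conv_def)
  next
    case (add g g')
    have e: "conv h (\<lambda>w. g w + g' w) = (\<lambda>w. conv h g w + conv h g' w)" for h
      by (simp add: conv_add_right fun_eq_iff)
    have "(\<lambda>w. c * word u w) \<in> carrier (tensor_salg X par)"
      using word by (intro tensor_scale_closed word_closed)
    then show ?case using add
      by (simp add: e tensor_eval_add conv_closed tensor_eval_closed r_distr)
  next
    case (word d v)
    have "conv (\<lambda>w. c * word u w) (\<lambda>w. d * word v w) = (\<lambda>w. (c * d) * word (u @ v) w)"
      by (simp add: conv_scale_left conv_scale_right word_append fun_eq_iff mult.assoc)
    moreover have "u @ v \<in> lists X" using word \<open>u \<in> lists X\<close> by simp
    moreover have "set (map b u) \<subseteq> carrier A" "set (map b v) \<subseteq> carrier A"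
      using word \<open>u \<in> lists X\<close> homog_carrier[OF b] by (auto simp: in_lists_conv_set)
    ultimately show ?case using word \<open>u \<in> lists X\<close>
      by (simp only: tensor_eval_word map_append lprod_append)
        (simp add: smult_mult_left smult_mult_right smult_assoc[symmetric] lprod_closed smult_closed mult.commute)
  qed
qed

end
end

text \<open>
  The kernel of evaluation is an ideal which contains the supercommutators of the generators.
\<close>

lemma sym_lift_class:
  fixes A :: "('k::field, 'a, 'm) salg_scheme" (structure) and X :: "'x set"
  assumes A: "supercommutative_superalgebra A"
    and bX: "\<forall>x\<in>X. b x \<in> homog A (par x)" and f: "f \<in> carrier (tensor_salg X par)"
  shows "sym_lift A b (sym_class X par f) = tensor_eval A b f"
proof -
  let ?T = "tensor_salg X par :: ('k, 'x list \<Rightarrow> 'k) salg"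
  let ?ev = "tensor_eval A b" and ?J = "supercommutator_ideal X par"
  interpret supercommutative_superalgebra A by (rule A)
  note b = bX[rule_format]
  interpret T: ring ?T by (rule ring_tensor_salg)
  interpret J: ideal ?J ?T by (rule ideal_supercommutator)
  note ev = tensor_eval_add[of X b par, OF bX] tensor_eval_conv[of X b par, OF bX] tensor_eval_word[of X b par, OF bX]
    tensor_eval_closed[of X b par, OF bX] tensor_eval_smult[of X b par, OF bX]
  have "ring_hom_ring ?T A ?ev"
  proof (rule ring_hom_ringI2)
    show "?ev \<in> ring_hom ?T A"
      unfolding ring_hom_def using ev(3)[of "[]" 1]
      by (auto simp: tensor_salg_simps(2-) word_def ev smult_one)
  qed (rule ring_tensor_salg, rule ring_axioms)
  then have "ideal (a_kernel ?T A ?ev) ?T" by (rule ring_hom_ring.kernel_is_ideal)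
  moreover have "{\<lambda>u. word [x, y] u - koszul (par x * par y) * word [y, x] u |x y. x \<in> X \<and> y \<in> X} \<subseteq>
      a_kernel ?T A ?ev"
  proof clarify
    fix x y assume xy: "x \<in> X" "y \<in> X"
    let ?k = "koszul (par x * par y) :: 'k"
    have w: "[x, y] \<in> lists X" "[y, x] \<in> lists X" using xy by auto
    have e: "(\<lambda>u. word [x, y] u - ?k * word [y, x] u) = (\<lambda>u. 1 * word [x, y] u + (- ?k) * word [y, x] u)"
      by simp
    have c: "b x \<in> carrier A" "b y \<in> carrier A" using xy b homog_carrier by auto
    have "(\<lambda>u. word [x, y] u - ?k * word [y, x] u) \<in> carrier ?T"
      unfolding e using w by (intro tensor_add_closed tensor_scale_closed word_closed)
    moreover have "?ev (\<lambda>u. word [x, y] u - ?k * word [y, x] u) =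
        (1 \<odot> (b x \<otimes> b y)) \<oplus> ((- ?k) \<odot> (b y \<otimes> b x))"
      unfolding e using w c
      by (subst ev(1)) (simp_all only: ev(3) tensor_scale_closed word_closed list.map lprod.simps r_one)
    moreover have "\<dots> = \<zero>"
      using supercommute[OF b[OF xy(1)] b[OF xy(2)]] c smult_l_distr[of "b y \<otimes> b x" ?k "- ?k"]
      by (simp add: smult_one smult_zero smult_closed)
    ultimately show "(\<lambda>u. word [x, y] u - ?k * word [y, x] u) \<in> a_kernel ?T A ?ev"
      by (simp add: a_kernel_def')
  qed
  ultimately have "?J \<subseteq> a_kernel ?T A ?ev"
    unfolding supercommutator_ideal_def by (rule T.genideal_minimal)
  then have J: "?ev j = \<zero>" if "j \<in> ?J" for j using that by (auto simp: a_kernel_def')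
  have same: "?ev g = ?ev f" if g: "g \<in> sym_class X par f" for g
  proof -
    obtain j where j: "j \<in> ?J" "g = (\<lambda>w. j w + f w)"
      using g by (auto simp: sym_class_def a_r_coset_def' tensor_salg_simps(5))
    then show ?thesis using ev(1)[OF J.a_Hcarr[OF j(1)] f] J[OF j(1)] ev(4)[OF f] by simp
  qed
  have "f \<in> sym_class X par f" unfolding sym_class_def using J.a_rcos_self[OF f] .
  then show ?thesis unfolding sym_lift_def by (rule someI2[where P = "\<lambda>g. g \<in> sym_class X par f"]) (rule same)
qed

text \<open>
  Homogeneous values of the generators define a point of the affine superscheme represented by
  \<open>Sym\<close>; this is how test points for invariance are constructed.
\<close>

theorem sym_lift_hom:
  fixes A :: "('k::field, 'a, 'm) salg_scheme" (structure) and X :: "'x set"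
  assumes A: "supercommutative_superalgebra A"
    and bX: "\<forall>x\<in>X. b x \<in> homog A (par x)"
  shows "sym_lift A b \<in> salg_hom (Sym_salg X par) A"
    and "x \<in> X \<Longrightarrow> sym_lift A b (Sym_gen X par x) = b x"
proof -
  let ?T = "tensor_salg X par :: ('k, 'x list \<Rightarrow> 'k) salg"
  interpret supercommutative_superalgebra A by (rule A)
  note b = bX[rule_format]
  note lift = sym_lift_class[OF A, of X b par, OF bX]
  note ev = tensor_eval_add[of X b par, OF bX] tensor_eval_conv[of X b par, OF bX] tensor_eval_word[of X b par, OF bX]
    tensor_eval_closed[of X b par, OF bX] tensor_eval_smult[of X b par, OF bX]
  have one: "word [] \<in> carrier ?T" by (simp add: word_closed)
  have one': "\<one>\<^bsub>Sym_salg X par\<^esub> = sym_class X par (word [] :: _ \<Rightarrow> 'k)"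
    unfolding sym_class_simps(2)[symmetric] by (simp add: tensor_salg_simps word_def)
  have homog: "tensor_eval A b f \<in> homog A p" if f: "f \<in> homog ?T p" for f p
    unfolding tensor_eval_def
  proof (rule finsum_homog)
    show "finite {w. f w \<noteq> 0}" using f by (simp add: tensor_salg_simps)
    fix w assume w: "w \<in> {w. f w \<noteq> 0}"
    then have "w \<in> lists X" "(\<Sum>x\<leftarrow>w. par x) = p" using f by (auto simp: tensor_salg_simps)
    then show "f w \<odot> lprod A (map b w) \<in> homog A p"
      using lprod_homog[of w b par] b by (auto intro!: homog_smult)
  qed
  show "sym_lift A b \<in> salg_hom (Sym_salg X par) A"
    unfolding salg_hom_def ring_hom_def
  proof (safe, goal_cases)
    case (4)
    then show ?case using ev(3)[of "[]" 1] lift[OF one] by (simp add: one' smult_one)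
  next
    case (6 p y F)
    then obtain f where "f \<in> homog ?T p" "F = sym_class X par f"
      unfolding Sym_facts(6) by (auto simp: sym_class_def)
    then show ?case using homog lift[of f] by (simp add: tensor_salg_simps(7))
  qed (auto simp: sym_class_simps(1) lift ev conv_closed tensor_add_closed tensor_scale_closed
      sym_class_simps(3-5)[symmetric])
  show "sym_lift A b (Sym_gen X par x) = b x" if x: "x \<in> X"
  proof -
    have "Sym_gen X par x = sym_class X par (\<lambda>u. 1 * word [x] u :: 'k)"
      by (simp add: Sym_gen_def sym_class_def)
    then show ?thesis using lift[OF tensor_scale_closed[OF word_closed[of "[x]"]], of 1] ev(3)[of "[x]" 1] x b[OF x]
      by (auto simp: smult_one homog_carrier)
  qed
qed

section \<open>Supertraces along closed paths are invariant\<close>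

definition mat_over :: "('a, 'm) ring_scheme \<Rightarrow> nat \<Rightarrow> nat \<Rightarrow> (nat \<Rightarrow> nat \<Rightarrow> 'a) \<Rightarrow> bool" where
  "mat_over A m n M \<longleftrightarrow> (\<forall>i<m. \<forall>j<n. M i j \<in> carrier A)"

lemma mat_overD: "mat_over A m n M \<Longrightarrow> i < m \<Longrightarrow> j < n \<Longrightarrow> M i j \<in> carrier A"
  by (simp add: mat_over_def)

lemma mat_eq_refl [simp]: "mat_eq m n M M"
  by (simp add: mat_eq_def)

lemma mat_eq_sym: "mat_eq m n M N \<Longrightarrow> mat_eq m n N M"
  by (simp add: mat_eq_def)

lemma mat_eq_trans [trans]: "mat_eq m n M N \<Longrightarrow> mat_eq m n N P \<Longrightarrow> mat_eq m n M P"
  by (simp add: mat_eq_def)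

lemma mat_over_cong: "mat_eq m n M N \<Longrightarrow> mat_over A m n N \<Longrightarrow> mat_over A m n M"
  by (simp add: mat_eq_def mat_over_def)

context ring
begin

lemma finsum_swap:
  assumes "finite S" "finite T" "\<And>i j. i \<in> S \<Longrightarrow> j \<in> T \<Longrightarrow> f i j \<in> carrier R"
  shows "(\<Oplus>i\<in>S. \<Oplus>j\<in>T. f i j) = (\<Oplus>j\<in>T. \<Oplus>i\<in>S. f i j)"
  using assms(1,3)
proof (induction S rule: finite_induct)
  case empty
  then show ?case by simp
next
  case (insert x S)
  have "(\<Oplus>j\<in>T. \<Oplus>i\<in>insert x S. f i j) = (\<Oplus>j\<in>T. f x j \<oplus> (\<Oplus>i\<in>S. f i j))"
    by (rule finsum_cong') (use insert in \<open>auto intro!: finsum_closed finsum_insert\<close>)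
  also have "\<dots> = (\<Oplus>j\<in>T. f x j) \<oplus> (\<Oplus>j\<in>T. \<Oplus>i\<in>S. f i j)"
    by (rule finsum_addf) (use insert in \<open>auto intro!: finsum_closed\<close>)
  also have "(\<Oplus>j\<in>T. \<Oplus>i\<in>S. f i j) = (\<Oplus>i\<in>S. \<Oplus>j\<in>T. f i j)"
    using insert by simp
  also have "(\<Oplus>j\<in>T. f x j) \<oplus> \<dots> = (\<Oplus>i\<in>insert x S. \<Oplus>j\<in>T. f i j)"
    by (rule finsum_insert[symmetric]) (use insert in \<open>auto intro!: finsum_closed\<close>)
  finally show ?case by simp
qed

lemma mat_over_one [simp]: "mat_over R m n (mat_one R)"
  by (simp add: mat_over_def mat_one_def)

lemma mat_over_mult: "mat_over R m n M \<Longrightarrow> mat_over R n k N \<Longrightarrow> mat_over R m k (mat_mult R n M N)"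
  by (auto simp: mat_over_def mat_mult_def intro!: finsum_closed)

lemma mat_mult_cong:
  assumes "mat_eq m n M M'" "mat_eq n k N N'" "mat_over R m n M'" "mat_over R n k N'"
  shows "mat_eq m k (mat_mult R n M N) (mat_mult R n M' N')"
  unfolding mat_eq_def mat_mult_def
  using assms by (auto simp: mat_eq_def mat_over_def intro!: finsum_cong')

lemma mat_mult_assoc:
  assumes M: "mat_over R m n M" and N: "mat_over R n k N" and P: "mat_over R k l P"
  shows "mat_eq m l (mat_mult R k (mat_mult R n M N) P) (mat_mult R n M (mat_mult R k N P))"
  unfolding mat_eq_def
proof (intro allI impI)
  fix i j assume ij: "i < m" "j < l"
  note c = mat_overD[OF M ij(1)] mat_overD[OF N] mat_overD[OF P _ ij(2)]
  have "mat_mult R k (mat_mult R n M N) P i j =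
      (\<Oplus>s\<in>{..<k}. \<Oplus>r\<in>{..<n}. M i r \<otimes> (N r s \<otimes> P s j))"
    unfolding mat_mult_def
  proof (rule finsum_cong')
    fix s assume s: "s \<in> {..<k}"
    have "(\<Oplus>r\<in>{..<n}. M i r \<otimes> N r s) \<otimes> P s j = (\<Oplus>r\<in>{..<n}. (M i r \<otimes> N r s) \<otimes> P s j)"
      by (rule finsum_ldistr) (use c s in auto)
    also have "\<dots> = (\<Oplus>r\<in>{..<n}. M i r \<otimes> (N r s \<otimes> P s j))"
      by (rule finsum_cong') (use c s in \<open>auto simp: m_assoc\<close>)
    finally show "(\<Oplus>r\<in>{..<n}. M i r \<otimes> N r s) \<otimes> P s j = (\<Oplus>r\<in>{..<n}. M i r \<otimes> (N r s \<otimes> P s j))" .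
  qed (use c in \<open>auto intro!: finsum_closed\<close>)
  also have "\<dots> = (\<Oplus>r\<in>{..<n}. \<Oplus>s\<in>{..<k}. M i r \<otimes> (N r s \<otimes> P s j))"
    by (rule finsum_swap) (use c in auto)
  also have "\<dots> = mat_mult R n M (mat_mult R k N P) i j"
    unfolding mat_mult_def
    by (rule finsum_cong') (use c in \<open>auto intro!: finsum_closed finsum_rdistr[symmetric]\<close>)
  finally show "mat_mult R k (mat_mult R n M N) P i j = mat_mult R n M (mat_mult R k N P) i j" .
qed

lemma mat_mult_one_right:
  assumes "mat_over R m n M"
  shows "mat_eq m n (mat_mult R n M (mat_one R)) M"
  unfolding mat_eq_def
proof (intro allI impI)
  fix i j assume ij: "i < m" "j < n"
  have "mat_mult R n M (mat_one R) i j = (\<Oplus>k\<in>{..<n}. if j = k then M i k else \<zero>)"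
    unfolding mat_mult_def mat_one_def
    by (rule finsum_cong') (use assms ij in \<open>auto simp: mat_over_def\<close>)
  also have "\<dots> = M i j"
    by (rule finsum_singleton) (use assms ij in \<open>auto simp: mat_over_def\<close>)
  finally show "mat_mult R n M (mat_one R) i j = M i j" .
qed

lemma mat_mult_one_left:
  assumes "mat_over R m n M"
  shows "mat_eq m n (mat_mult R m (mat_one R) M) M"
  unfolding mat_eq_def
proof (intro allI impI)
  fix i j assume ij: "i < m" "j < n"
  have "mat_mult R m (mat_one R) M i j = (\<Oplus>k\<in>{..<m}. if i = k then M k j else \<zero>)"
    unfolding mat_mult_def mat_one_def
    by (rule finsum_cong') (use assms ij in \<open>auto simp: mat_over_def\<close>)
  also have "\<dots> = M i j"
    by (rule finsum_singleton) (use assms ij in \<open>auto simp: mat_over_def\<close>)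
  finally show "mat_mult R m (mat_one R) M i j = M i j" .
qed

text \<open>
  The inner factors \<open>H\<close> and \<open>G'\<close> cancel. Along a path, they are the group element at an interior
  vertex and its inverse.
\<close>

lemma mat_mult_conjugates:
  assumes G: "mat_over R m m G" and M: "mat_over R m n M" and H: "mat_over R n n H"
    and G': "mat_over R n n G'" and N: "mat_over R n k N" and H': "mat_over R k k H'"
    and HG: "mat_eq n n (mat_mult R n H G') (mat_one R)"
  shows "mat_eq m k
    (mat_mult R n (mat_mult R m G (mat_mult R n M H)) (mat_mult R n G' (mat_mult R k N H')))
    (mat_mult R m G (mat_mult R k (mat_mult R n M N) H'))"
proof -
  let ?NH = "mat_mult R k N H'"
  have NH: "mat_over R n k ?NH" using N H' by (rule mat_over_mult)
  have GNH: "mat_over R n k (mat_mult R n G' ?NH)" using G' NH by (rule mat_over_mult)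
  have MH: "mat_over R m n (mat_mult R n M H)" using M H by (rule mat_over_mult)
  have "mat_eq n k (mat_mult R n H (mat_mult R n G' ?NH)) (mat_mult R n (mat_mult R n H G') ?NH)"
    using mat_mult_assoc[OF H G' NH] by (rule mat_eq_sym)
  also have "mat_eq n k \<dots> (mat_mult R n (mat_one R) ?NH)"
    by (rule mat_mult_cong[OF HG]) (simp_all add: NH)
  also have "mat_eq n k \<dots> ?NH" by (rule mat_mult_one_left[OF NH])
  finally have 1: "mat_eq n k (mat_mult R n H (mat_mult R n G' ?NH)) ?NH" .
  have "mat_eq m k (mat_mult R n (mat_mult R n M H) (mat_mult R n G' ?NH))
      (mat_mult R n M (mat_mult R n H (mat_mult R n G' ?NH)))"
    by (rule mat_mult_assoc[OF M H GNH])
  also have "mat_eq m k \<dots> (mat_mult R n M ?NH)"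
    by (rule mat_mult_cong[OF mat_eq_refl 1 M NH])
  also have "mat_eq m k \<dots> (mat_mult R k (mat_mult R n M N) H')"
    using mat_mult_assoc[OF M N H'] by (rule mat_eq_sym)
  finally have 2: "mat_eq m k (mat_mult R n (mat_mult R n M H) (mat_mult R n G' ?NH))
      (mat_mult R k (mat_mult R n M N) H')" .
  have "mat_eq m k (mat_mult R n (mat_mult R m G (mat_mult R n M H)) (mat_mult R n G' ?NH))
      (mat_mult R m G (mat_mult R n (mat_mult R n M H) (mat_mult R n G' ?NH)))"
    by (rule mat_mult_assoc[OF G MH GNH])
  also have "mat_eq m k \<dots> (mat_mult R m G (mat_mult R k (mat_mult R n M N) H'))"
    by (rule mat_mult_cong[OF mat_eq_refl 2 G mat_over_mult[OF mat_over_mult[OF M N] H']])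
  finally show ?thesis .
qed

end

definition supertrace ::
  "('k::field, 'a, 'm) salg_scheme \<Rightarrow> nat \<Rightarrow> (nat \<Rightarrow> bit) \<Rightarrow> (nat \<Rightarrow> nat \<Rightarrow> 'a) \<Rightarrow> 'a" where
  "supertrace A n p M = (\<Oplus>\<^bsub>A\<^esub>i\<in>{..<n}. koszul (p i) \<odot>\<^bsub>A\<^esub> M i i)"

lemma (in superalgebra) supertrace_cong:
  "mat_eq n n M N \<Longrightarrow> mat_over A n n N \<Longrightarrow> supertrace A n p M = supertrace A n p N"
  unfolding supertrace_def
  by (rule finsum_cong') (auto simp: mat_eq_def mat_over_def smult_closed)

lemma (in superalgebra) mat_mult_homog:
  assumes "\<And>k. k < n \<Longrightarrow> M i k \<in> homog A (s + p k)" "\<And>k. k < n \<Longrightarrow> N k j \<in> homog A (p k + t)"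
  shows "mat_mult A n M N i j \<in> homog A (s + t)"
  unfolding mat_mult_def
proof (rule finsum_homog)
  fix k assume "k \<in> {..<n}"
  then have "M i k \<otimes> N k j \<in> homog A ((s + p k) + (p k + t))"
    using assms by (intro homog_mult) auto
  then show "M i k \<otimes> N k j \<in> homog A (s + t)" by (simp add: add.assoc)
qed simp

text \<open>
  Exchanging \<open>M i k\<close> and \<open>N k i\<close> costs the sign of \<open>(p i + p k)\<^sup>2 = p i + p k\<close>, which turns the weight
  of \<open>i\<close> into the weight of \<open>k\<close>.
\<close>

lemma (in supercommutative_superalgebra) supertrace_commute:
  assumes M: "\<And>i k. i < n \<Longrightarrow> k < n \<Longrightarrow> M i k \<in> homog A (p i + p k)"
    and N: "\<And>i k. i < n \<Longrightarrow> k < n \<Longrightarrow> N i k \<in> homog A (p i + p k)"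
  shows "supertrace A n p (mat_mult A n M N) = supertrace A n p (mat_mult A n N M)"
proof -
  have c: "M i k \<in> carrier A" "N i k \<in> carrier A" if "i < n" "k < n" for i k
    using M[OF that] N[OF that] homog_carrier by auto
  have "supertrace A n p (mat_mult A n M N) = (\<Oplus>i\<in>{..<n}. \<Oplus>k\<in>{..<n}. koszul (p i) \<odot> (M i k \<otimes> N k i))"
    unfolding supertrace_def mat_mult_def
    by (rule finsum_cong') (use c in \<open>auto intro!: finsum_smult smult_closed finsum_closed\<close>)
  also have "\<dots> = (\<Oplus>i\<in>{..<n}. \<Oplus>k\<in>{..<n}. koszul (p k) \<odot> (N k i \<otimes> M i k))"
  proof (intro finsum_cong' refl)
    fix i k assume "i \<in> {..<n}" "k \<in> {..<n}"
    then have ik: "i < n" "k < n" by auto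
    have "koszul (p i) \<odot> (M i k \<otimes> N k i) =
        koszul (p i) \<odot> (koszul ((p i + p k) * (p k + p i)) \<odot> (N k i \<otimes> M i k))"
      using supercommute[OF M[OF ik] N[OF ik(2,1)]] by simp
    also have "\<dots> = koszul (p k) \<odot> (N k i \<otimes> M i k)"
      using c ik by (simp add: smult_assoc[symmetric] add.commute[of "p k"] koszul_add)
    finally show "koszul (p i) \<odot> (M i k \<otimes> N k i) = koszul (p k) \<odot> (N k i \<otimes> M i k)" .
  qed (use c in \<open>auto intro!: finsum_closed smult_closed\<close>)
  also have "\<dots> = (\<Oplus>k\<in>{..<n}. \<Oplus>i\<in>{..<n}. koszul (p k) \<odot> (N k i \<otimes> M i k))"
    by (rule finsum_swap) (use c in \<open>auto intro!: smult_closed\<close>)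
  also have "\<dots> = supertrace A n p (mat_mult A n N M)"
    unfolding supertrace_def mat_mult_def
    by (rule finsum_cong') (use c in \<open>auto intro!: finsum_smult[symmetric] smult_closed finsum_closed\<close>)
  finally show ?thesis .
qed

lemma salg_hom_ring: "\<phi> \<in> salg_hom A B \<Longrightarrow> \<phi> \<in> ring_hom A B"
  by (simp add: salg_hom_def)

lemma salg_hom_smult: "\<phi> \<in> salg_hom A B \<Longrightarrow> x \<in> carrier A \<Longrightarrow> \<phi> (c \<odot>\<^bsub>A\<^esub> x) = c \<odot>\<^bsub>B\<^esub> \<phi> x"
  by (simp add: salg_hom_def)

lemma salg_hom_finsum:
  assumes "ring A" "ring B" "\<phi> \<in> salg_hom A B" "f \<in> N \<rightarrow> carrier A"
  shows "\<phi> (finsum A f N) = finsum B (\<lambda>n. \<phi> (f n)) N"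
proof -
  interpret ring_hom_ring A B \<phi>
    by (intro ring_hom_ringI2 assms(1,2) salg_hom_ring[OF assms(3)])
  show ?thesis using hom_finsum[OF assms(4)] by (simp add: o_def)
qed

lemma salg_hom_mat_mult:
  assumes "ring A" "ring B" "\<phi> \<in> salg_hom A B"
    "\<And>k. k < n \<Longrightarrow> M i k \<in> carrier A" "\<And>k. k < n \<Longrightarrow> N k j \<in> carrier A"
  shows "\<phi> (mat_mult A n M N i j) = mat_mult B n (\<lambda>i j. \<phi> (M i j)) (\<lambda>i j. \<phi> (N i j)) i j"
proof -
  interpret A: ring A by (rule assms(1))
  interpret B: ring B by (rule assms(2))
  interpret ring_hom_ring A B \<phi>
    by (intro ring_hom_ringI2 assms(1,2) salg_hom_ring[OF assms(3)])
  show ?thesis unfolding mat_mult_def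
    using assms(4,5) by (subst salg_hom_finsum[OF assms(1-3)]) (auto intro!: B.finsum_cong')
qed

context
  fixes Q :: "('v, 'e) pre_digraph" and \<alpha> :: "'v superdim" and b :: "'v \<Rightarrow> bit"
begin

lemma ring_K_SRep: "ring (K_SRep Q \<alpha> b :: ('k::field, ('k, 'e) rep_fun set) salg)"
  unfolding K_SRep_def by (rule ring_Sym)

lemma generic_matrix_closed:
  assumes "e \<in> arcs Q"
  shows "mat_over (K_SRep Q \<alpha> b :: ('k::field, ('k, 'e) rep_fun set) salg)
    (sdim \<alpha> (head Q e)) (sdim \<alpha> (tail Q e)) (generic_matrix Q \<alpha> b e)"
  unfolding mat_over_def
proof (intro allI impI)
  fix i j assume "i < sdim \<alpha> (head Q e)" "j < sdim \<alpha> (tail Q e)"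
  then have "[(e, i, j)] \<in> lists (rep_gens Q \<alpha>)" using assms by (simp add: rep_gens_def)
  then show "generic_matrix Q \<alpha> b e i j \<in> carrier (K_SRep Q \<alpha> b :: ('k::field, ('k, 'e) rep_fun set) salg)"
    unfolding generic_matrix_def K_SRep_def Sym_gen_def sym_class_def[symmetric]
    by (intro sym_class_closed word_closed)
qed

lemma quiver_path_Cons:
  "p \<noteq> [] \<Longrightarrow> quiver_path Q (e # p) \<longleftrightarrow> e \<in> arcs Q \<and> head Q (hd p) = tail Q e \<and> quiver_path Q p"
  by (cases p) (auto simp: quiver_path_def nth_Cons split: nat.splits)

lemma path_matrix_closed:
  assumes "p \<noteq> []" "quiver_path Q p"
  shows "mat_over (K_SRep Q \<alpha> b :: ('k::field, ('k, 'e) rep_fun set) salg)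
    (sdim \<alpha> (head Q (hd p))) (sdim \<alpha> (tail Q (last p))) (path_matrix Q \<alpha> b p)"
  using assms
proof (induction p rule: list_nonempty_induct)
  case (single e)
  interpret ring "K_SRep Q \<alpha> b :: ('k, ('k, 'e) rep_fun set) salg" by (rule ring_K_SRep)
  from single show ?case
    by (auto simp: quiver_path_def intro!: mat_over_mult generic_matrix_closed)
next
  case (cons e p)
  interpret ring "K_SRep Q \<alpha> b :: ('k, ('k, 'e) rep_fun set) salg" by (rule ring_K_SRep)
  from cons show ?case
    by (auto simp: quiver_path_Cons intro!: mat_over_mult generic_matrix_closed)
qed

context
  fixes A :: "('k::field, 'a, 'm) salg_scheme" and \<phi>
  assumes A: "supercommutative_superalgebra A" and \<phi>: "\<phi> \<in> salg_hom (K_SRep Q \<alpha> b) A"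
begin

interpretation supercommutative_superalgebra A by (rule A)

lemma eval_path_matrix_Cons:
  assumes "p \<noteq> []" "quiver_path Q (e # p)"
  shows "mat_eq (sdim \<alpha> (head Q e)) (sdim \<alpha> (tail Q (last p)))
    (\<lambda>i j. \<phi> (path_matrix Q \<alpha> b (e # p) i j))
    (mat_mult A (sdim \<alpha> (tail Q e)) (\<lambda>i j. \<phi> (generic_matrix Q \<alpha> b e i j))
      (\<lambda>i j. \<phi> (path_matrix Q \<alpha> b p i j)))"
  using assms generic_matrix_closed[of e] path_matrix_closed[of p]
  by (auto simp: mat_eq_def mat_over_def quiver_path_Cons intro!: salg_hom_mat_mult[OF ring_K_SRep ring_axioms \<phi>])

lemma eval_path_matrix_single:
  assumes "e \<in> arcs Q"
  shows "mat_eq (sdim \<alpha> (head Q e)) (sdim \<alpha> (tail Q e))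
    (\<lambda>i j. \<phi> (path_matrix Q \<alpha> b [e] i j)) (\<lambda>i j. \<phi> (generic_matrix Q \<alpha> b e i j))"
proof -
  interpret P: ring "K_SRep Q \<alpha> b :: ('k, ('k, 'e) rep_fun set) salg" by (rule ring_K_SRep)
  show ?thesis
    using P.mat_mult_one_right[OF generic_matrix_closed[OF assms]] by (simp add: mat_eq_def)
qed

lemma eval_generic_matrix_homog:
  assumes "e \<in> arcs Q" "i < sdim \<alpha> (head Q e)" "j < sdim \<alpha> (tail Q e)"
  shows "\<phi> (generic_matrix Q \<alpha> b e i j) \<in>
    homog A (basis_parity \<alpha> b (head Q e) i + basis_parity \<alpha> b (tail Q e) j)"
  using rep_parity_homog[of e i j Q \<alpha> \<phi> b A] assms \<phi> by (simp add: rep_gens_def rep_parity_def)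

lemma eval_path_matrix_homog:
  assumes "p \<noteq> []" "quiver_path Q p" "i < sdim \<alpha> (head Q (hd p))" "j < sdim \<alpha> (tail Q (last p))"
  shows "\<phi> (path_matrix Q \<alpha> b p i j) \<in>
    homog A (basis_parity \<alpha> b (head Q (hd p)) i + basis_parity \<alpha> b (tail Q (last p)) j)"
  using assms
proof (induction p arbitrary: i rule: list_nonempty_induct)
  case (single e)
  then show ?case using eval_path_matrix_single[of e] eval_generic_matrix_homog[of e i j]
    by (simp add: mat_eq_def quiver_path_def)
next
  case (cons e p)
  have q: "e \<in> arcs Q" "head Q (hd p) = tail Q e" "quiver_path Q p" "last (e # p) = last p"
    using cons.prems(1) cons.hyps by (auto simp: quiver_path_Cons)
  have "\<phi> (path_matrix Q \<alpha> b (e # p) i j) = mat_mult A (sdim \<alpha> (tail Q e))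
      (\<lambda>i j. \<phi> (generic_matrix Q \<alpha> b e i j)) (\<lambda>i j. \<phi> (path_matrix Q \<alpha> b p i j)) i j"
    using eval_path_matrix_Cons[OF cons.hyps(1) cons.prems(1)] cons.prems(2,3) q(4)
    by (simp add: mat_eq_def)
  also have "\<dots> \<in> homog A (basis_parity \<alpha> b (head Q e) i + basis_parity \<alpha> b (tail Q (last p)) j)"
    by (rule mat_mult_homog[where p = "basis_parity \<alpha> b (tail Q e)"])
      (use cons q eval_generic_matrix_homog in auto)
  finally show ?case using q(4) by simp
qed

lemma eval_path_str:
  assumes "closed_path Q p"
  shows "\<phi> (path_str Q \<alpha> b p) = supertrace A (sdim \<alpha> (head Q (hd p)))
    (basis_parity \<alpha> b (head Q (hd p))) (\<lambda>i j. \<phi> (path_matrix Q \<alpha> b p i j))"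
proof -
  have p: "p \<noteq> []" "quiver_path Q p" "head Q (hd p) = tail Q (last p)"
    using assms by (auto simp: closed_path_def quiver_path_def)
  note c = mat_overD[OF path_matrix_closed[OF p(1,2)], folded p(3)]
  interpret P: ring "K_SRep Q \<alpha> b :: ('k, ('k, 'e) rep_fun set) salg" by (rule ring_K_SRep)
  have s: "c \<odot>\<^bsub>K_SRep Q \<alpha> b\<^esub> F \<in> carrier (K_SRep Q \<alpha> b)"
    if "F \<in> carrier (K_SRep Q \<alpha> b)" for c :: 'k and F
    using that Sym_smult_closed unfolding K_SRep_def by blast
  have \<phi>c: "\<phi> F \<in> carrier A" if "F \<in> carrier (K_SRep Q \<alpha> b)" for F
    using that \<phi> by (auto simp: salg_hom_def ring_hom_def)
  show ?thesis unfolding path_str_def Let_def supertrace_def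
    using c by (subst salg_hom_finsum[OF ring_K_SRep ring_axioms \<phi>])
      (auto intro!: s finsum_cong' \<phi>c smult_closed simp: salg_hom_smult[OF \<phi>])
qed

end

lemma path_str_closed:
  assumes "closed_path Q p"
  shows "path_str Q \<alpha> b p \<in> carrier (K_SRep Q \<alpha> b :: ('k::field, ('k, 'e) rep_fun set) salg)"
proof -
  interpret P: ring "K_SRep Q \<alpha> b :: ('k, ('k, 'e) rep_fun set) salg" by (rule ring_K_SRep)
  have p: "p \<noteq> []" "quiver_path Q p" "head Q (hd p) = tail Q (last p)"
    using assms by (auto simp: closed_path_def quiver_path_def)
  have s: "c \<odot>\<^bsub>K_SRep Q \<alpha> b\<^esub> F \<in> carrier (K_SRep Q \<alpha> b)"
    if "F \<in> carrier (K_SRep Q \<alpha> b)" for c :: 'k and F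
    using that Sym_smult_closed unfolding K_SRep_def by blast
  show ?thesis unfolding path_str_def Let_def
    using mat_overD[OF path_matrix_closed[OF p(1,2)], folded p(3)]
    by (auto intro!: P.finsum_closed s)
qed

lemma generated_closed:
  assumes "F \<in> generated_subalgebra (K_SRep Q \<alpha> b :: ('k::field, ('k, 'e) rep_fun set) salg)
    {path_str Q \<alpha> b p | p. closed_path Q p}"
  shows "F \<in> carrier (K_SRep Q \<alpha> b)"
proof -
  interpret P: ring "K_SRep Q \<alpha> b :: ('k, ('k, 'e) rep_fun set) salg" by (rule ring_K_SRep)
  from assms show ?thesis
  proof induction
    case (smult x c)
    then show ?case unfolding K_SRep_def by (intro Sym_smult_closed)
  qed (auto intro: path_str_closed)
qed

lemma eval_path_matrix_transform:
  fixes A :: "('k::field, 'a, 'm) salg_scheme"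
  assumes A: "supercommutative_superalgebra A" and Q: "wf_digraph Q"
    and \<phi>: "\<phi> \<in> salg_hom (K_SRep Q \<alpha> b) A" and \<psi>: "\<psi> \<in> salg_hom (K_SRep Q \<alpha> b) A"
    and gh: "(g, h) \<in> GL_points A Q \<alpha>" and tr: "is_transform A Q \<alpha> b (g, h) \<phi> \<psi>"
    and p: "p \<noteq> []" "quiver_path Q p"
  shows "mat_eq (sdim \<alpha> (head Q (hd p))) (sdim \<alpha> (tail Q (last p)))
    (\<lambda>i j. \<psi> (path_matrix Q \<alpha> b p i j))
    (mat_mult A (sdim \<alpha> (head Q (hd p))) (g (head Q (hd p)))
      (mat_mult A (sdim \<alpha> (tail Q (last p))) (\<lambda>i j. \<phi> (path_matrix Q \<alpha> b p i j)) (h (tail Q (last p)))))"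
proof -
  interpret supercommutative_superalgebra A by (rule A)
  interpret wf_digraph Q by (rule Q)
  have G: "mat_over A (sdim \<alpha> a) (sdim \<alpha> a) (g a)" "mat_over A (sdim \<alpha> a) (sdim \<alpha> a) (h a)"
    "mat_eq (sdim \<alpha> a) (sdim \<alpha> a) (mat_mult A (sdim \<alpha> a) (h a) (g a)) (mat_one A)"
    if "a \<in> verts Q" for a
  proof -
    have *: "even_endo A \<alpha> a (g a)" "even_endo A \<alpha> a (h a)"
      "mat_eq (sdim \<alpha> a) (sdim \<alpha> a) (mat_mult A (sdim \<alpha> a) (h a) (g a)) (mat_one A)"
      using gh that unfolding GL_points_def Let_def by auto
    then show "mat_over A (sdim \<alpha> a) (sdim \<alpha> a) (g a)" "mat_over A (sdim \<alpha> a) (sdim \<alpha> a) (h a)"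
      unfolding even_endo_def mat_over_def using homog_carrier by blast+
    show "mat_eq (sdim \<alpha> a) (sdim \<alpha> a) (mat_mult A (sdim \<alpha> a) (h a) (g a)) (mat_one A)" by fact
  qed
  have M: "mat_over A (sdim \<alpha> (head Q e)) (sdim \<alpha> (tail Q e)) (\<lambda>i j. \<phi> (generic_matrix Q \<alpha> b e i j))"
    if "e \<in> arcs Q" for e
    using eval_generic_matrix_homog[OF A \<phi> that] by (auto simp: mat_over_def intro: homog_carrier)
  have P: "mat_over A (sdim \<alpha> (head Q (hd p))) (sdim \<alpha> (tail Q (last p))) (\<lambda>i j. \<phi> (path_matrix Q \<alpha> b p i j))"
    if "p \<noteq> []" "quiver_path Q p" for p
    using eval_path_matrix_homog[OF A \<phi> that] by (auto simp: mat_over_def intro: homog_carrier)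
  have T: "mat_eq (sdim \<alpha> (head Q e)) (sdim \<alpha> (tail Q e)) (\<lambda>i j. \<psi> (generic_matrix Q \<alpha> b e i j))
      (mat_mult A (sdim \<alpha> (head Q e)) (g (head Q e))
         (mat_mult A (sdim \<alpha> (tail Q e)) (\<lambda>i j. \<phi> (generic_matrix Q \<alpha> b e i j)) (h (tail Q e))))"
    if "e \<in> arcs Q" for e
    using tr that unfolding is_transform_def by auto
  show ?thesis using p
  proof (induction p rule: list_nonempty_induct)
    case (single e)
    then have e: "e \<in> arcs Q" by (simp add: quiver_path_def)
    let ?m = "sdim \<alpha> (head Q e)" and ?n = "sdim \<alpha> (tail Q e)"
    have v: "head Q e \<in> verts Q" "tail Q e \<in> verts Q" using e by auto
    have "mat_eq ?m ?n (\<lambda>i j. \<psi> (path_matrix Q \<alpha> b [e] i j)) (\<lambda>i j. \<psi> (generic_matrix Q \<alpha> b e i j))"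
      by (rule eval_path_matrix_single[OF A \<psi> e])
    also note T[OF e]
    also have "mat_eq ?m ?n (mat_mult A ?m (g (head Q e))
         (mat_mult A ?n (\<lambda>i j. \<phi> (generic_matrix Q \<alpha> b e i j)) (h (tail Q e))))
       (mat_mult A ?m (g (head Q e))
         (mat_mult A ?n (\<lambda>i j. \<phi> (path_matrix Q \<alpha> b [e] i j)) (h (tail Q e))))"
      using eval_path_matrix_single[OF A \<phi> e] P[of "[e]"] single
      by (intro mat_mult_cong mat_eq_refl G v mat_over_mult)
        (auto intro: mat_eq_sym simp del: path_matrix.simps)
    finally show ?case by simp
  next
    case (cons e p)
    have q: "e \<in> arcs Q" "head Q (hd p) = tail Q e" "quiver_path Q p" "last (e # p) = last p"
      using cons.prems(1) cons.hyps by (auto simp: quiver_path_Cons)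
    let ?m = "sdim \<alpha> (head Q e)" and ?n = "sdim \<alpha> (tail Q e)" and ?c = "tail Q (last p)"
    have "last p \<in> arcs Q" using q(3) cons.hyps by (auto simp: quiver_path_def)
    then have v: "head Q e \<in> verts Q" "tail Q e \<in> verts Q" "?c \<in> verts Q" using q(1) by auto
    have IH: "mat_eq ?n (sdim \<alpha> ?c) (\<lambda>i j. \<psi> (path_matrix Q \<alpha> b p i j))
      (mat_mult A ?n (g (tail Q e)) (mat_mult A (sdim \<alpha> ?c) (\<lambda>i j. \<phi> (path_matrix Q \<alpha> b p i j)) (h ?c)))"
      using cons.IH q by simp
    note Pp = P[OF cons.hyps(1) q(3), unfolded q(2)]
    have "mat_eq ?m (sdim \<alpha> ?c) (\<lambda>i j. \<psi> (path_matrix Q \<alpha> b (e # p) i j))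
      (mat_mult A ?n (\<lambda>i j. \<psi> (generic_matrix Q \<alpha> b e i j)) (\<lambda>i j. \<psi> (path_matrix Q \<alpha> b p i j)))"
      by (rule eval_path_matrix_Cons[OF A \<psi> cons.hyps(1) cons.prems(1)])
    also have "mat_eq ?m (sdim \<alpha> ?c) \<dots>
      (mat_mult A ?n (mat_mult A ?m (g (head Q e)) (mat_mult A ?n (\<lambda>i j. \<phi> (generic_matrix Q \<alpha> b e i j)) (h (tail Q e))))
        (mat_mult A ?n (g (tail Q e)) (mat_mult A (sdim \<alpha> ?c) (\<lambda>i j. \<phi> (path_matrix Q \<alpha> b p i j)) (h ?c))))"
      by (rule mat_mult_cong[OF T[OF q(1)] IH]) (intro mat_over_mult G M Pp v q(1))+
    also have "mat_eq ?m (sdim \<alpha> ?c) \<dots> (mat_mult A ?m (g (head Q e)) (mat_mult A (sdim \<alpha> ?c)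
        (mat_mult A ?n (\<lambda>i j. \<phi> (generic_matrix Q \<alpha> b e i j)) (\<lambda>i j. \<phi> (path_matrix Q \<alpha> b p i j))) (h ?c)))"
      by (rule mat_mult_conjugates) (intro G M Pp v q(1))+
    also have "mat_eq ?m (sdim \<alpha> ?c) \<dots> (mat_mult A ?m (g (head Q e)) (mat_mult A (sdim \<alpha> ?c)
        (\<lambda>i j. \<phi> (path_matrix Q \<alpha> b (e # p) i j)) (h ?c)))"
      using eval_path_matrix_Cons[OF A \<phi> cons.hyps(1) cons.prems(1)] P[OF _ cons.prems(1)] q(4)
      by (intro mat_mult_cong mat_eq_refl G v mat_over_mult) (auto intro: mat_eq_sym)
    finally show ?case using q(4) by simp
  qed
qed

text \<open>
  The matrices of \<open>g\<close> are even with respect to the parities of \<open>V(a)\<close>. They are also even with respect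
  to those of \<open>\<Pi>\<^bsup>b(a)\<^esup>V(a)\<close>, which differ by a constant, and the supertrace is taken for the latter.
\<close>

lemma path_str_invariant:
  fixes A :: "('k::field, 'a, 'm) salg_scheme"
  assumes A: "supercommutative_superalgebra A" and Q: "wf_digraph Q"
    and \<phi>: "\<phi> \<in> salg_hom (K_SRep Q \<alpha> b) A" and \<psi>: "\<psi> \<in> salg_hom (K_SRep Q \<alpha> b) A"
    and gh: "(g, h) \<in> GL_points A Q \<alpha>" and tr: "is_transform A Q \<alpha> b (g, h) \<phi> \<psi>"
    and p: "closed_path Q p"
  shows "\<psi> (path_str Q \<alpha> b p) = \<phi> (path_str Q \<alpha> b p)"
proof -
  interpret supercommutative_superalgebra A by (rule A)
  interpret wf_digraph Q by (rule Q)
  have p': "p \<noteq> []" "quiver_path Q p" "tail Q (last p) = head Q (hd p)"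
    using p by (auto simp: closed_path_def quiver_path_def)
  define a where "a = head Q (hd p)"
  let ?n = "sdim \<alpha> a" and ?\<pi> = "basis_parity \<alpha> b a"
  let ?M = "\<lambda>i j. \<phi> (path_matrix Q \<alpha> b p i j)"
  have a: "a \<in> verts Q" using p'(1,2) by (auto simp: quiver_path_def a_def intro!: head_in_verts dest: hd_in_set)
  have par: "basis_parity \<alpha> (\<lambda>_. 0) a i + basis_parity \<alpha> (\<lambda>_. 0) a j = ?\<pi> i + ?\<pi> j" for i j
    by (simp add: basis_parity_def add_ac)
  have gH: "g a i j \<in> homog A (?\<pi> i + ?\<pi> j)" "h a i j \<in> homog A (?\<pi> i + ?\<pi> j)" if "i < ?n" "j < ?n" for i j
    using gh a that unfolding GL_points_def even_endo_def Let_def par[symmetric] by auto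
  have hg: "mat_eq ?n ?n (mat_mult A ?n (h a) (g a)) (mat_one A)"
    using gh a unfolding GL_points_def Let_def by auto
  have MH: "?M i j \<in> homog A (?\<pi> i + ?\<pi> j)" if "i < ?n" "j < ?n" for i j
    using eval_path_matrix_homog[OF A \<phi> p'(1,2), of i j] that unfolding p'(3) a_def by simp
  have over: "mat_over A ?n ?n (g a)" "mat_over A ?n ?n (h a)" "mat_over A ?n ?n ?M"
    using gH[THEN homog_carrier] MH[THEN homog_carrier] by (auto simp: mat_over_def)
  note over' = mat_over_mult[OF over(3,2)]
  have "\<psi> (path_str Q \<alpha> b p) = supertrace A ?n ?\<pi> (\<lambda>i j. \<psi> (path_matrix Q \<alpha> b p i j))"
    using eval_path_str[OF A \<psi> p] by (simp add: a_def)
  also have "\<dots> = supertrace A ?n ?\<pi> (mat_mult A ?n (g a) (mat_mult A ?n ?M (h a)))"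
    using eval_path_matrix_transform[OF A Q \<phi> \<psi> gh tr p'(1,2)] over over'
    by (intro supertrace_cong mat_over_mult) (simp_all add: p'(3) a_def)
  also have "\<dots> = supertrace A ?n ?\<pi> (mat_mult A ?n (mat_mult A ?n ?M (h a)) (g a))"
    by (rule supertrace_commute) (use gH MH in \<open>auto intro!: mat_mult_homog[where p = ?\<pi>]\<close>)
  also have "\<dots> = supertrace A ?n ?\<pi> ?M"
  proof (rule supertrace_cong[OF _ over(3)])
    have "mat_eq ?n ?n (mat_mult A ?n (mat_mult A ?n ?M (h a)) (g a)) (mat_mult A ?n ?M (mat_mult A ?n (h a) (g a)))"
      by (rule mat_mult_assoc[OF over(3,2,1)])
    also have "mat_eq ?n ?n \<dots> (mat_mult A ?n ?M (mat_one A))"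
      by (rule mat_mult_cong[OF mat_eq_refl hg over(3) mat_over_one])
    also have "mat_eq ?n ?n \<dots> ?M" by (rule mat_mult_one_right[OF over(3)])
    finally show "mat_eq ?n ?n (mat_mult A ?n (mat_mult A ?n ?M (h a)) (g a)) ?M" .
  qed
  also have "\<dots> = \<phi> (path_str Q \<alpha> b p)"
    using eval_path_str[OF A \<phi> p] by (simp add: a_def)
  finally show ?thesis .
qed

theorem generated_subset_SI:
  assumes Q: "wf_digraph Q"
  shows "generated_subalgebra (K_SRep Q \<alpha> b) {path_str Q \<alpha> b p | p. closed_path Q p} \<subseteq>
    (SI Q \<alpha> b :: ('k::field, 'e) rep_fun set set)"
proof
  fix F :: "('k, 'e) rep_fun set"
  let ?P = "K_SRep Q \<alpha> b :: ('k, ('k, 'e) rep_fun set) salg"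
  let ?G = "generated_subalgebra ?P {path_str Q \<alpha> b p | p. closed_path Q p}"
  assume F: "F \<in> ?G"
  have "invariant_over TYPE(nat \<Rightarrow> 'k) Q \<alpha> b F"
    unfolding invariant_over_def
  proof (intro allI impI ballI)
    fix A :: "('k, nat \<Rightarrow> 'k) salg" and \<phi> \<psi> gh
    assume A: "supercommutative_superalgebra A" and \<phi>: "\<phi> \<in> salg_hom ?P A" and \<psi>: "\<psi> \<in> salg_hom ?P A"
      and gh: "gh \<in> GL_points A Q \<alpha>" and tr: "is_transform A Q \<alpha> b gh \<phi> \<psi>"
    have hom: "\<chi> (x \<oplus>\<^bsub>?P\<^esub> y) = \<chi> x \<oplus>\<^bsub>A\<^esub> \<chi> y" "\<chi> (x \<otimes>\<^bsub>?P\<^esub> y) = \<chi> x \<otimes>\<^bsub>A\<^esub> \<chi> y"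
      "\<chi> (c \<odot>\<^bsub>?P\<^esub> x) = c \<odot>\<^bsub>A\<^esub> \<chi> x" "\<chi> \<one>\<^bsub>?P\<^esub> = \<one>\<^bsub>A\<^esub>"
      if "\<chi> \<in> salg_hom ?P A" "x \<in> carrier ?P" "y \<in> carrier ?P" for \<chi> x y c
      using that by (auto simp: salg_hom_def ring_hom_def)
    have unit: "\<one>\<^bsub>?P\<^esub> \<in> carrier ?P" using ring_K_SRep[THEN ring.ring_simprules(6)] .
    have gc: "x \<in> carrier ?P" if "x \<in> ?G" for x using that by (rule generated_closed)
    show "\<psi> F = \<phi> F" using F
    proof induction
      case one
      show ?case using hom(4)[OF \<phi> unit unit] hom(4)[OF \<psi> unit unit] by simp
    next
      case (gen x)
      obtain g h where "gh = (g, h)" by fastforce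
      then show ?case using gen path_str_invariant[OF A Q \<phi> \<psi>] gh tr by auto
    next
      case (add x y)
      then show ?case using hom(1)[OF \<phi>] hom(1)[OF \<psi>] gc by simp
    next
      case (mult x y)
      then show ?case using hom(2)[OF \<phi>] hom(2)[OF \<psi>] gc by simp
    next
      case (smult x c)
      then show ?case using hom(3)[OF \<phi> _ unit] hom(3)[OF \<psi> _ unit] gc by simp
    qed
  qed
  then show "F \<in> SI Q \<alpha> b" using generated_closed[OF F] by (simp add: SI_def)
qed

end

section \<open>The double centralizer of the symmetric group\<close>

text \<open>
  Projection onto a span in coordinates: the linear functionals \<open>\<gamma> \<sigma>\<close> express every \<open>\<rho> \<tau>\<close> through
  the family \<open>\<rho>\<close>, which may be linearly dependent. In the induction, the new vector \<open>\<rho> t\<close> either lies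
  in the span of the old ones, or it differs from its projection at some point \<open>z0\<close>, and the
  value at \<open>z0\<close> yields the additional functional.
\<close>

lemma spanning_functionals:
  fixes \<rho> :: "'s \<Rightarrow> 'z \<Rightarrow> 'k::field"
  assumes "finite S" "finite Z"
  shows "\<exists>\<gamma>. \<forall>\<tau>\<in>S. \<forall>z\<in>Z. (\<Sum>\<sigma>\<in>S. (\<Sum>y\<in>Z. \<gamma> \<sigma> y * \<rho> \<tau> y) * \<rho> \<sigma> z) = \<rho> \<tau> z"
  using assms(1)
proof (induction S rule: finite_induct)
  case empty
  then show ?case by simp
next
  case (insert t S)
  then obtain \<gamma> where \<gamma>: "\<And>\<tau> z. \<tau> \<in> S \<Longrightarrow> z \<in> Z \<Longrightarrow>
      (\<Sum>\<sigma>\<in>S. (\<Sum>y\<in>Z. \<gamma> \<sigma> y * \<rho> \<tau> y) * \<rho> \<sigma> z) = \<rho> \<tau> z" by blast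
  define a where "a \<sigma> M = (\<Sum>y\<in>Z. \<gamma> \<sigma> y * M y)" for \<sigma> and M :: "'z \<Rightarrow> 'k"
  define P where "P M z = (\<Sum>\<sigma>\<in>S. a \<sigma> M * \<rho> \<sigma> z)" for M z
  have P: "P (\<rho> \<tau>) z = \<rho> \<tau> z" if "\<tau> \<in> S" "z \<in> Z" for \<tau> z
    using \<gamma>[OF that] by (simp add: P_def a_def)
  show ?case
  proof (cases "\<forall>z\<in>Z. P (\<rho> t) z = \<rho> t z")
    case True
    have "(\<Sum>\<sigma>\<in>insert t S. (\<Sum>y\<in>Z. (\<gamma>(t := \<lambda>_. 0)) \<sigma> y * \<rho> \<tau> y) * \<rho> \<sigma> z) = P (\<rho> \<tau>) z" for \<tau> z
      using insert.hyps by (auto simp: P_def a_def intro!: sum.cong)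
    then show ?thesis using True P by (intro exI[of _ "\<gamma>(t := \<lambda>_. 0)"]) auto
  next
    case False
    then obtain z0 where z0: "z0 \<in> Z" "P (\<rho> t) z0 \<noteq> \<rho> t z0" by blast
    define v where "v z = \<rho> t z - P (\<rho> t) z" for z
    define \<kappa> where "\<kappa> y = ((if y = z0 then 1 else 0) - (\<Sum>\<sigma>\<in>S. \<gamma> \<sigma> y * \<rho> \<sigma> z0)) / v z0" for y
    define \<gamma>' where "\<gamma>' \<sigma> y = (if \<sigma> = t then \<kappa> y else \<gamma> \<sigma> y - a \<sigma> (\<rho> t) * \<kappa> y)" for \<sigma> y
    define c where "c M = (\<Sum>y\<in>Z. \<kappa> y * M y)" for M
    have c: "c M = (M z0 - P M z0) / v z0" for M
    proof -
      have "(\<Sum>y\<in>Z. (\<Sum>\<sigma>\<in>S. \<gamma> \<sigma> y * \<rho> \<sigma> z0) * M y) = P M z0"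
        unfolding P_def a_def sum_distrib_right by (subst sum.swap) (simp add: mult_ac)
      moreover have "(\<Sum>y\<in>Z. (if y = z0 then 1 else 0) * M y) = M z0"
        using z0(1) assms(2) by (simp add: if_distrib[of "\<lambda>x. x * _"] cong: if_cong)
      moreover have "c M = (\<Sum>y\<in>Z. (if y = z0 then 1 else 0) * M y - (\<Sum>\<sigma>\<in>S. \<gamma> \<sigma> y * \<rho> \<sigma> z0) * M y) / v z0"
        by (simp add: c_def \<kappa>_def sum_divide_distrib algebra_simps)
      ultimately show ?thesis by (simp add: sum_subtractf)
    qed
    have "(\<Sum>\<sigma>\<in>insert t S. (\<Sum>y\<in>Z. \<gamma>' \<sigma> y * M y) * \<rho> \<sigma> z) = P M z + c M * v z" for M z
    proof -
      have "(\<Sum>\<sigma>\<in>S. (\<Sum>y\<in>Z. \<gamma>' \<sigma> y * M y) * \<rho> \<sigma> z) = (\<Sum>\<sigma>\<in>S. (a \<sigma> M - a \<sigma> (\<rho> t) * c M) * \<rho> \<sigma> z)"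
      proof (rule sum.cong[OF refl])
        fix \<sigma> assume "\<sigma> \<in> S"
        then have "\<gamma>' \<sigma> y * M y = \<gamma> \<sigma> y * M y - a \<sigma> (\<rho> t) * (\<kappa> y * M y)" for y
          using insert.hyps(2) by (auto simp: \<gamma>'_def algebra_simps)
        then show "(\<Sum>y\<in>Z. \<gamma>' \<sigma> y * M y) * \<rho> \<sigma> z = (a \<sigma> M - a \<sigma> (\<rho> t) * c M) * \<rho> \<sigma> z"
          by (simp add: sum_subtractf sum_distrib_left[symmetric] a_def[symmetric] c_def[symmetric])
      qed
      also have "\<dots> = P M z - c M * P (\<rho> t) z"
        by (simp add: P_def algebra_simps sum_subtractf sum_distrib_left)
      finally have "(\<Sum>\<sigma>\<in>S. (\<Sum>y\<in>Z. \<gamma>' \<sigma> y * M y) * \<rho> \<sigma> z) = P M z - c M * P (\<rho> t) z" .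
      moreover have "(\<Sum>y\<in>Z. \<gamma>' t y * M y) = c M" by (simp add: \<gamma>'_def c_def)
      ultimately have "(\<Sum>\<sigma>\<in>insert t S. (\<Sum>y\<in>Z. \<gamma>' \<sigma> y * M y) * \<rho> \<sigma> z) =
          c M * \<rho> t z + (P M z - c M * P (\<rho> t) z)"
        using insert.hyps by simp
      then show ?thesis by (simp add: v_def algebra_simps)
    qed
    moreover have "c (\<rho> t) = 1" using z0(2) by (simp add: c v_def)
    moreover have "c (\<rho> \<tau>) = 0" if "\<tau> \<in> S" for \<tau> using P[OF that z0(1)] by (simp add: c)
    ultimately show ?thesis using P insert.hyps(2)
      by (intro exI[of _ \<gamma>']) (auto simp: v_def)
  qed
qed

lemma sum_mult_swap:
  "(\<Sum>y\<in>Y. a y * (\<Sum>t\<in>G. b t y * x t)) = (\<Sum>t\<in>G. (\<Sum>y\<in>Y. a y * b t y) * (x t :: 'k::comm_semiring_0))"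
  by (simp add: sum_distrib_left sum_distrib_right mult.assoc) (rule sum.swap)

lemma permutes_comp_bij: "\<sigma> permutes S \<Longrightarrow> bij_betw (\<lambda>\<mu>. \<sigma> \<circ> \<mu>) {\<mu>. \<mu> permutes S} {\<tau>. \<tau> permutes S}"
  by (rule bij_betwI[where g = "\<lambda>\<tau>. inv_into UNIV \<sigma> \<circ> \<tau>"])
    (auto simp: permutes_compose permutes_inv permutes_inv_o o_assoc)

lemma comp_permutes_eq_iff:
  assumes "\<tau> permutes S"
  shows "p \<circ> \<tau> = w \<longleftrightarrow> p = w \<circ> inv_into UNIV \<tau>"
  using permutes_inv_o[OF assms] by (metis comp_assoc comp_id)

text \<open>
  Words \<open>w\<close> of length \<open>r\<close> index a basis of a tensor power, and permutations act on them by
  \<open>w \<mapsto> w \<circ> \<tau>\<close> with a sign \<open>sg\<close> subject to the cocycle rule. The hypothesis \<open>commute\<close> compares,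
  entry by entry, the products of \<open>T\<close> with the symmetrization
  \<open>\<Sum>\<^sub>\<tau> \<plusminus> E\<^bsub>q\<circ>\<tau>, p\<circ>\<tau>\<^esub>\<close> of a matrix unit on both sides; on the right only the places where
  \<open>p \<circ> \<tau> = j\<close> survive, and the values \<open>D\<close> stand for the remaining factors. The conclusion is
  that \<open>T\<close> is a combination of signed permutations, up to a factor \<open>\<epsilon>\<close> which depends only on the
  column.

  The proof rests on the vectors \<open>\<rho> \<tau>\<close>, where \<open>\<rho> \<tau> (q, i)\<close> is the matrix
  entry of the signed permutation \<open>\<tau>\<close>. Functionals \<open>\<gamma>\<close> as in \<open>spanning_functionals\<close> combine the
  symmetrized matrix units into a resolution of the identity on these vectors. Applied to it, the
  hypothesis gives \<open>r! T\<close> as a combination of the \<open>\<rho> \<mu>\<close>.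

  Rows and columns of \<open>T\<close> range over the words \<open>Wh\<close> and \<open>Wt\<close> of two prescribed types, where the
  type of a word lists the vertices of its letters. Matrix units are available only for \<open>p\<close> and \<open>q\<close>
  of the same type, and \<open>Wh\<close> is not stable under permutations. By \<open>type1\<close>, words of the same type
  are moved into \<open>Wh\<close> by the same permutations; by \<open>type2\<close>, one such permutation in common
  implies the same type.
\<close>

theorem double_centralizer:
  fixes sg :: "(nat \<Rightarrow> nat) \<Rightarrow> (nat \<Rightarrow> 'b) \<Rightarrow> 'k::field_char_0" and type :: "(nat \<Rightarrow> 'b) \<Rightarrow> 't"
  assumes W: "finite W" "\<And>\<tau> w. \<tau> permutes {..<r} \<Longrightarrow> w \<in> W \<Longrightarrow> w \<circ> \<tau> \<in> W" "Wh \<subseteq> W" "Wt \<subseteq> W"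
    and sg2: "\<And>\<tau> w. sg \<tau> w * sg \<tau> w = 1"
    and cocycle: "\<And>\<sigma> \<mu> w. \<sigma> permutes {..<r} \<Longrightarrow> \<mu> permutes {..<r} \<Longrightarrow> w \<in> W \<Longrightarrow>
      sg (\<sigma> \<circ> \<mu>) w = sg \<sigma> w * sg \<mu> (w \<circ> \<sigma>)"
    and type1: "\<And>p q \<tau>. p \<in> W \<Longrightarrow> q \<in> W \<Longrightarrow> type p = type q \<Longrightarrow> \<tau> permutes {..<r} \<Longrightarrow>
      p \<circ> \<tau> \<in> Wh \<Longrightarrow> q \<circ> \<tau> \<in> Wh"
    and type2: "\<And>p q \<tau>. p \<in> W \<Longrightarrow> q \<in> W \<Longrightarrow> \<tau> permutes {..<r} \<Longrightarrow>
      p \<circ> \<tau> \<in> Wh \<Longrightarrow> q \<circ> \<tau> \<in> Wh \<Longrightarrow> type p = type q"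
    and commute: "\<And>i j p q. i \<in> Wh \<Longrightarrow> j \<in> Wt \<Longrightarrow> p \<in> W \<Longrightarrow> q \<in> W \<Longrightarrow> type p = type q \<Longrightarrow>
      (\<Sum>\<tau> | \<tau> permutes {..<r}. (if q \<circ> \<tau> = i then sg \<tau> q else 0) * (sg \<tau> p * T (p \<circ> \<tau>) j)) =
      \<epsilon> j * (\<Sum>\<tau> | \<tau> permutes {..<r}. (if p \<circ> \<tau> = j then sg \<tau> p else 0) * D \<tau> i q)"
  shows "\<exists>c. \<forall>i\<in>Wh. \<forall>j\<in>Wt. T i j = \<epsilon> j * (\<Sum>\<mu> | \<mu> permutes {..<r}. if i \<circ> \<mu> = j then c \<mu> * sg \<mu> i else 0)"
proof -
  define G where "G = {\<tau>. \<tau> permutes {..<r}}"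
  have G: "finite G" "card G = fact r" by (auto simp: G_def finite_permutations card_permutations)
  have finWh: "finite Wh" using W finite_subset by blast
  define \<rho> where "\<rho> \<tau> = (\<lambda>(q, i). if q \<circ> \<tau> = i then sg \<tau> q else 0)" for \<tau> :: "nat \<Rightarrow> nat"
  obtain \<gamma> where \<gamma>: "\<And>\<tau> z. \<tau> \<in> G \<Longrightarrow> z \<in> W \<times> Wh \<Longrightarrow>
      (\<Sum>\<sigma>\<in>G. (\<Sum>y\<in>W \<times> Wh. \<gamma> \<sigma> y * \<rho> \<tau> y) * \<rho> \<sigma> z) = \<rho> \<tau> z"
    using spanning_functionals[OF G(1), of "W \<times> Wh" \<rho>] W(1) finWh by blast
  \<comment> \<open>Restricting the functionals to words of the type that \<open>\<sigma>\<close> moves into \<open>Wh\<close> ensures that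
    only pairs \<open>p\<close>, \<open>q\<close> of equal type enter below. The reproducing property survives as \<open>N\<close>.\<close>
  define \<gamma>' where "\<gamma>' \<sigma> y = (if fst y \<circ> \<sigma> \<in> Wh then \<gamma> \<sigma> y else 0)" for \<sigma> y
  define N where "N \<sigma> \<tau> = (\<Sum>y\<in>W \<times> Wh. \<gamma>' \<sigma> y * \<rho> \<tau> y)" for \<sigma> \<tau>
  have N: "(\<Sum>\<sigma>\<in>G. N \<sigma> \<tau> * \<rho> \<sigma> (p, i)) = \<rho> \<tau> (p, i)" if "\<tau> \<in> G" "p \<in> W" "i \<in> Wh" for \<tau> p i
  proof (cases "p \<circ> \<tau> \<in> Wh")
    case True
    have "N \<sigma> \<tau> * \<rho> \<sigma> (p, i) = (\<Sum>y\<in>W \<times> Wh. \<gamma> \<sigma> y * \<rho> \<tau> y) * \<rho> \<sigma> (p, i)" if "\<sigma> \<in> G" for \<sigma>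
    proof (cases "p \<circ> \<sigma> = i")
      case p: True
      have "\<gamma>' \<sigma> (q, i') * \<rho> \<tau> (q, i') = \<gamma> \<sigma> (q, i') * \<rho> \<tau> (q, i')" if q: "q \<in> W" "i' \<in> Wh" for q i'
      proof (cases "q \<circ> \<tau> = i'")
        case True
        then have "type p = type q"
          using type2[of p q \<tau>] \<open>p \<circ> \<tau> \<in> Wh\<close> q \<open>\<tau> \<in> G\<close> \<open>p \<in> W\<close> by (simp add: G_def)
        then have "q \<circ> \<sigma> \<in> Wh"
          using type1[of p q \<sigma>] p q \<open>\<sigma> \<in> G\<close> \<open>p \<in> W\<close> \<open>i \<in> Wh\<close> by (simp add: G_def)
        then show ?thesis by (simp add: \<gamma>'_def)
      qed (simp add: \<rho>_def)
      then have "N \<sigma> \<tau> = (\<Sum>y\<in>W \<times> Wh. \<gamma> \<sigma> y * \<rho> \<tau> y)"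
        unfolding N_def by (intro sum.cong refl) (metis SigmaE)
      then show ?thesis by simp
    qed (simp add: \<rho>_def)
    then have "(\<Sum>\<sigma>\<in>G. N \<sigma> \<tau> * \<rho> \<sigma> (p, i)) =
        (\<Sum>\<sigma>\<in>G. (\<Sum>y\<in>W \<times> Wh. \<gamma> \<sigma> y * \<rho> \<tau> y) * \<rho> \<sigma> (p, i))"
      by (intro sum.cong refl)
    then show ?thesis using \<gamma>[OF that(1), of "(p, i)"] that by simp
  next
    case False
    have 0: "N \<sigma> \<tau> * \<rho> \<sigma> (p, i) = 0" if "\<sigma> \<in> G" for \<sigma>
    proof (cases "p \<circ> \<sigma> = i")
      case p: True
      have "\<gamma>' \<sigma> (q, i') * \<rho> \<tau> (q, i') = 0" if q: "q \<in> W" "i' \<in> Wh" for q i'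
      proof (cases "q \<circ> \<tau> = i' \<and> q \<circ> \<sigma> \<in> Wh")
        case True
        then have "type q = type p"
          using type2[of q p \<sigma>] p q \<open>\<sigma> \<in> G\<close> \<open>p \<in> W\<close> \<open>i \<in> Wh\<close> by (simp add: G_def)
        then have "p \<circ> \<tau> \<in> Wh"
          using type1[of q p \<tau>] True q \<open>\<tau> \<in> G\<close> \<open>p \<in> W\<close> by (simp add: G_def)
        then show ?thesis using False by simp
      qed (auto simp: \<rho>_def \<gamma>'_def)
      then have "N \<sigma> \<tau> = 0" unfolding N_def by (intro sum.neutral) auto
      then show ?thesis by simp
    qed (simp add: \<rho>_def)
    have "(\<Sum>\<sigma>\<in>G. N \<sigma> \<tau> * \<rho> \<sigma> (p, i)) = 0"
      by (intro sum.neutral ballI 0)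
    moreover have "\<rho> \<tau> (p, i) = 0" using False that by (auto simp: \<rho>_def)
    ultimately show ?thesis by simp
  qed
  define C where "C \<sigma> \<tau> = (\<Sum>(q, i)\<in>W \<times> Wh. \<gamma>' \<sigma> (q, i) * D \<tau> i q)" for \<sigma> \<tau>
  have unique: "(\<Sum>p\<in>W. if p \<circ> \<tau> = i then f p else 0) = f (i \<circ> inv_into UNIV \<tau>)"
    if "\<tau> \<in> G" "i \<in> W" for \<tau> i and f :: "_ \<Rightarrow> 'k"
  proof -
    have "\<tau> permutes {..<r}" using that by (simp add: G_def)
    then have "i \<circ> inv_into UNIV \<tau> \<in> W" "\<And>p. p \<circ> \<tau> = i \<longleftrightarrow> p = i \<circ> inv_into UNIV \<tau>"
      using W(2)[OF permutes_inv that(2)] comp_permutes_eq_iff by blast+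
    then show ?thesis using W(1) by simp
  qed
  have main: "T i j * fact r = \<epsilon> j * (\<Sum>\<mu>\<in>G. if i \<circ> \<mu> = j then (\<Sum>\<sigma>\<in>G. C \<sigma> (\<sigma> \<circ> \<mu>)) * sg \<mu> i else 0)"
    if ij: "i \<in> Wh" "j \<in> Wt" for i j
  proof -
    have iW: "i \<in> W" using ij W by blast
    define E where "E p q i' = (\<Sum>\<tau>\<in>G. \<rho> \<tau> (q, i') * (sg \<tau> p * T (p \<circ> \<tau>) j))" for p q i'
    \<comment> \<open>The sum \<open>S\<close> is computed in two ways: by the reproducing property it is \<open>r! T i j\<close>, and by the
      hypothesis it is a combination of permutations.\<close>
    define S where "S = (\<Sum>\<sigma>\<in>G. \<Sum>p\<in>W. \<rho> \<sigma> (p, i) * (\<Sum>(q, i')\<in>W \<times> Wh. \<gamma>' \<sigma> (q, i') * E p q i'))"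
    have 1: "(\<Sum>(q, i')\<in>W \<times> Wh. \<gamma>' \<sigma> (q, i') * E p q i') = (\<Sum>\<tau>\<in>G. N \<sigma> \<tau> * (sg \<tau> p * T (p \<circ> \<tau>) j))" for \<sigma> p
      unfolding E_def N_def split_def prod.collapse by (rule sum_mult_swap)
    have "S = (\<Sum>\<sigma>\<in>G. \<Sum>p\<in>W. \<Sum>\<tau>\<in>G. \<rho> \<sigma> (p, i) * (N \<sigma> \<tau> * (sg \<tau> p * T (p \<circ> \<tau>) j)))"
      unfolding S_def 1 sum_distrib_left ..
    also have "\<dots> = (\<Sum>p\<in>W. \<Sum>\<sigma>\<in>G. \<Sum>\<tau>\<in>G. \<rho> \<sigma> (p, i) * (N \<sigma> \<tau> * (sg \<tau> p * T (p \<circ> \<tau>) j)))"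
      by (rule sum.swap)
    also have "\<dots> = (\<Sum>p\<in>W. \<Sum>\<tau>\<in>G. \<Sum>\<sigma>\<in>G. \<rho> \<sigma> (p, i) * (N \<sigma> \<tau> * (sg \<tau> p * T (p \<circ> \<tau>) j)))"
      by (intro sum.cong refl sum.swap)
    also have "\<dots> = (\<Sum>p\<in>W. \<Sum>\<tau>\<in>G. (\<Sum>\<sigma>\<in>G. N \<sigma> \<tau> * \<rho> \<sigma> (p, i)) * (sg \<tau> p * T (p \<circ> \<tau>) j))"
      unfolding sum_distrib_right by (simp only: mult_ac)
    also have "\<dots> = (\<Sum>p\<in>W. \<Sum>\<tau>\<in>G. \<rho> \<tau> (p, i) * (sg \<tau> p * T (p \<circ> \<tau>) j))"
      using N ij by (intro sum.cong refl) simp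
    also have "\<dots> = (\<Sum>\<tau>\<in>G. \<Sum>p\<in>W. \<rho> \<tau> (p, i) * (sg \<tau> p * T (p \<circ> \<tau>) j))"
      by (rule sum.swap)
    also have "\<dots> = (\<Sum>\<tau>\<in>G. \<Sum>p\<in>W. if p \<circ> \<tau> = i then T i j else 0)"
      by (intro sum.cong refl) (auto simp: \<rho>_def sg2 mult.assoc[symmetric])
    also have "\<dots> = T i j * fact r"
      using G iW by (simp add: unique)
    finally have S1: "S = T i j * fact r" .
    have "\<rho> \<sigma> (p, i) * (\<gamma>' \<sigma> (q, i') * E p q i') = \<rho> \<sigma> (p, i) * (\<gamma>' \<sigma> (q, i') *
        (\<epsilon> j * (\<Sum>\<tau>\<in>G. (if p \<circ> \<tau> = j then sg \<tau> p else 0) * D \<tau> i' q)))"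
      if "\<sigma> \<in> G" "p \<in> W" "q \<in> W" "i' \<in> Wh" for \<sigma> p q i'
    proof (cases "p \<circ> \<sigma> = i \<and> q \<circ> \<sigma> \<in> Wh")
      case True
      then have "type p = type q"
        using type2[of p q \<sigma>] that ij by (simp add: G_def)
      then show ?thesis using commute[of i' j p q] that ij by (simp add: E_def \<rho>_def G_def)
    qed (auto simp: \<rho>_def \<gamma>'_def)
    then have "S = (\<Sum>\<sigma>\<in>G. \<Sum>p\<in>W. \<Sum>(q, i')\<in>W \<times> Wh. \<rho> \<sigma> (p, i) * (\<gamma>' \<sigma> (q, i') *
        (\<epsilon> j * (\<Sum>\<tau>\<in>G. (if p \<circ> \<tau> = j then sg \<tau> p else 0) * D \<tau> i' q))))"
      unfolding S_def sum_distrib_left by (intro sum.cong refl) auto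
    also have "\<dots> = (\<Sum>\<sigma>\<in>G. \<Sum>p\<in>W. \<Sum>\<tau>\<in>G. \<rho> \<sigma> (p, i) * (\<epsilon> j * ((if p \<circ> \<tau> = j then sg \<tau> p else 0) * C \<sigma> \<tau>)))"
    proof (intro sum.cong refl)
      fix \<sigma> p
      let ?k = "\<lambda>\<tau>. if p \<circ> \<tau> = j then sg \<tau> p else 0"
      have "(\<Sum>(q, i')\<in>W \<times> Wh. \<rho> \<sigma> (p, i) * (\<gamma>' \<sigma> (q, i') * (\<epsilon> j * (\<Sum>\<tau>\<in>G. ?k \<tau> * D \<tau> i' q)))) =
        \<rho> \<sigma> (p, i) * \<epsilon> j * (\<Sum>y\<in>W \<times> Wh. \<gamma>' \<sigma> y * (\<Sum>\<tau>\<in>G. D \<tau> (snd y) (fst y) * ?k \<tau>))"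
        unfolding sum_distrib_left[of "\<rho> \<sigma> (p, i) * \<epsilon> j"] by (intro sum.cong refl) (auto simp: mult_ac)
      also have "\<dots> = (\<Sum>\<tau>\<in>G. \<rho> \<sigma> (p, i) * (\<epsilon> j * (?k \<tau> * C \<sigma> \<tau>)))"
        unfolding sum_mult_swap C_def split_def prod.collapse
        by (simp only: sum_distrib_left[of "\<rho> \<sigma> (p, i) * \<epsilon> j"]) (simp only: mult_ac)
      finally show "(\<Sum>(q, i')\<in>W \<times> Wh. \<rho> \<sigma> (p, i) * (\<gamma>' \<sigma> (q, i') * (\<epsilon> j * (\<Sum>\<tau>\<in>G. ?k \<tau> * D \<tau> i' q)))) =
        (\<Sum>\<tau>\<in>G. \<rho> \<sigma> (p, i) * (\<epsilon> j * (?k \<tau> * C \<sigma> \<tau>)))" .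
    qed
    also have "\<dots> = (\<Sum>\<sigma>\<in>G. \<Sum>\<tau>\<in>G. \<Sum>p\<in>W. \<rho> \<sigma> (p, i) * (\<epsilon> j * ((if p \<circ> \<tau> = j then sg \<tau> p else 0) * C \<sigma> \<tau>)))"
      by (intro sum.cong refl sum.swap)
    \<comment> \<open>The substitution \<open>\<tau> = \<sigma> \<circ> \<mu>\<close> makes the conditions \<open>p \<circ> \<sigma> = i\<close> and \<open>p \<circ> \<tau> = j\<close> into \<open>i \<circ> \<mu> = j\<close>.\<close>
    also have "\<dots> = (\<Sum>\<sigma>\<in>G. \<Sum>\<mu>\<in>G. \<Sum>p\<in>W. \<rho> \<sigma> (p, i) *
        (\<epsilon> j * ((if p \<circ> (\<sigma> \<circ> \<mu>) = j then sg (\<sigma> \<circ> \<mu>) p else 0) * C \<sigma> (\<sigma> \<circ> \<mu>))))"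
      by (intro sum.cong refl sum.reindex_bij_betw[symmetric]) (auto simp: G_def intro: permutes_comp_bij)
    also have "\<dots> = (\<Sum>\<sigma>\<in>G. \<Sum>\<mu>\<in>G. \<epsilon> j * (if i \<circ> \<mu> = j then C \<sigma> (\<sigma> \<circ> \<mu>) * sg \<mu> i else 0))"
    proof (intro sum.cong refl)
      fix \<sigma> \<mu> assume \<sigma>\<mu>: "\<sigma> \<in> G" "\<mu> \<in> G"
      have "(\<Sum>p\<in>W. \<rho> \<sigma> (p, i) * (\<epsilon> j * ((if p \<circ> (\<sigma> \<circ> \<mu>) = j then sg (\<sigma> \<circ> \<mu>) p else 0) * C \<sigma> (\<sigma> \<circ> \<mu>))))
        = (\<Sum>p\<in>W. if p \<circ> \<sigma> = i then \<epsilon> j * (if i \<circ> \<mu> = j then C \<sigma> (\<sigma> \<circ> \<mu>) * sg \<mu> i else 0) else 0)"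
      proof (intro sum.cong refl)
        fix p assume p: "p \<in> W"
        show "\<rho> \<sigma> (p, i) * (\<epsilon> j * ((if p \<circ> (\<sigma> \<circ> \<mu>) = j then sg (\<sigma> \<circ> \<mu>) p else 0) * C \<sigma> (\<sigma> \<circ> \<mu>)))
          = (if p \<circ> \<sigma> = i then \<epsilon> j * (if i \<circ> \<mu> = j then C \<sigma> (\<sigma> \<circ> \<mu>) * sg \<mu> i else 0) else 0)"
        proof (cases "p \<circ> \<sigma> = i")
          case True
          have "sg \<sigma> p * sg (\<sigma> \<circ> \<mu>) p = sg \<mu> i"
            using cocycle[of \<sigma> \<mu> p] \<sigma>\<mu> p True by (simp add: G_def mult.assoc[symmetric] sg2)
          then show ?thesis using True by (auto simp: \<rho>_def comp_assoc[symmetric] mult_ac)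
        qed (simp add: \<rho>_def)
      qed
      also have "\<dots> = \<epsilon> j * (if i \<circ> \<mu> = j then C \<sigma> (\<sigma> \<circ> \<mu>) * sg \<mu> i else 0)"
        by (rule unique[OF \<sigma>\<mu>(1) iW])
      finally show "(\<Sum>p\<in>W. \<rho> \<sigma> (p, i) * (\<epsilon> j * ((if p \<circ> (\<sigma> \<circ> \<mu>) = j then sg (\<sigma> \<circ> \<mu>) p else 0) * C \<sigma> (\<sigma> \<circ> \<mu>))))
        = \<epsilon> j * (if i \<circ> \<mu> = j then C \<sigma> (\<sigma> \<circ> \<mu>) * sg \<mu> i else 0)" .
    qed
    also have "\<dots> = \<epsilon> j * (\<Sum>\<mu>\<in>G. if i \<circ> \<mu> = j then (\<Sum>\<sigma>\<in>G. C \<sigma> (\<sigma> \<circ> \<mu>)) * sg \<mu> i else 0)"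
      by (subst sum.swap) (auto simp: sum_distrib_left sum_distrib_right intro!: sum.cong)
    finally show ?thesis using S1 by simp
  qed
  have final: "T i j = \<epsilon> j * (\<Sum>\<mu>\<in>G. if i \<circ> \<mu> = j then (\<Sum>\<sigma>\<in>G. C \<sigma> (\<sigma> \<circ> \<mu>)) / fact r * sg \<mu> i else 0)"
    if "i \<in> Wh" "j \<in> Wt" for i j
  proof -
    let ?X = "\<Sum>\<mu>\<in>G. if i \<circ> \<mu> = j then (\<Sum>\<sigma>\<in>G. C \<sigma> (\<sigma> \<circ> \<mu>)) * sg \<mu> i else 0"
    have "T i j = \<epsilon> j * (?X / fact r)"
      unfolding times_divide_eq_right main[OF that, symmetric] by simp
    also have "?X / fact r = (\<Sum>\<mu>\<in>G. if i \<circ> \<mu> = j then (\<Sum>\<sigma>\<in>G. C \<sigma> (\<sigma> \<circ> \<mu>)) / fact r * sg \<mu> i else 0)"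
      by (subst sum_divide_distrib) (intro sum.cong refl, simp)
    finally show ?thesis by simp
  qed
  show ?thesis
    by (intro exI[of _ "\<lambda>\<mu>. (\<Sum>\<sigma>\<in>G. C \<sigma> (\<sigma> \<circ> \<mu>)) / fact r"] ballI)
      (unfold G_def[symmetric], rule final)
qed

section \<open>Unipotent matrices over a Grassmann algebra\<close>

lemma grassmann_finite:
  assumes "finite I" "f \<in> carrier (grassmann I p)" "f S \<noteq> 0"
  shows "finite S" "card S \<le> card I"
proof -
  have "S \<subseteq> I" using assms(2,3) by (simp add: grassmann_simps)
  then show "finite S" "card S \<le> card I"
    using assms(1) by (simp_all add: finite_subset card_mono)
qed

lemma grassmann_mult_agree:
  assumes f: "f {} = 0" and g: "\<And>S. finite S \<Longrightarrow> card S < m \<Longrightarrow> g S = g' S"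
    and S: "finite S" "card S < Suc m"
  shows "monoid.mult (grassmann I p) f g S = monoid.mult (grassmann I p) f g' S"
  unfolding grassmann_simps
proof (rule sum.cong[OF refl])
  fix A assume A: "A \<in> Pow S"
  show "split_sign p A (S - A) * f A * g (S - A) = split_sign p A (S - A) * f A * g' (S - A)"
  proof (cases "A = {}")
    case False
    then have "card (S - A) < card S" using A S(1) by (intro psubset_card_mono) auto
    then show ?thesis using g[of "S - A"] S by simp
  qed (simp add: f)
qed

lemma grassmann_mult_add:
  "monoid.mult (grassmann I p) (\<lambda>S. f S + f' S) g S =
    (monoid.mult (grassmann I p) f g S + monoid.mult (grassmann I p) f' g S :: 'k::field)"
  by (simp add: grassmann_simps sum.distrib algebra_simps)

lemma grassmann_mult_sum:
  "monoid.mult (grassmann I p) (\<lambda>S. \<Sum>n\<in>N. f n S) (\<lambda>S. \<Sum>k\<in>K. g k S) S =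
    (\<Sum>n\<in>N. \<Sum>k\<in>K. monoid.mult (grassmann I p) (f n) (g k) S :: 'k::field)"
proof -
  have "monoid.mult (grassmann I p) (\<lambda>S. \<Sum>n\<in>N. f n S) (\<lambda>S. \<Sum>k\<in>K. g k S) S =
    (\<Sum>A\<in>Pow S. \<Sum>n\<in>N. \<Sum>k\<in>K. split_sign p A (S - A) * f n A * g k (S - A))"
    by (simp add: grassmann_simps sum_distrib_left sum_distrib_right)
  also have "\<dots> = (\<Sum>n\<in>N. \<Sum>A\<in>Pow S. \<Sum>k\<in>K. split_sign p A (S - A) * f n A * g k (S - A))"
    by (rule sum.swap)
  also have "\<dots> = (\<Sum>n\<in>N. \<Sum>k\<in>K. \<Sum>A\<in>Pow S. split_sign p A (S - A) * f n A * g k (S - A))"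
    by (intro sum.cong refl sum.swap)
  finally show ?thesis by (simp add: grassmann_simps)
qed

lemma grassmann_mat_mult:
  fixes M N :: "nat \<Rightarrow> nat \<Rightarrow> 'i::linorder set \<Rightarrow> 'k::field"
  assumes "finite I" "\<And>k. k < n \<Longrightarrow> M i k \<in> carrier (grassmann I p)"
    "\<And>k. k < n \<Longrightarrow> N k j \<in> carrier (grassmann I p)"
  shows "mat_mult (grassmann I p) n M N i j =
    (\<lambda>S. \<Sum>k<n. monoid.mult (grassmann I p) (M i k) (N k j) S)"
  unfolding mat_mult_def
  by (rule grassmann_finsum) (use assms in \<open>auto intro: grassmann_closed\<close>)

text \<open>
  A matrix \<open>1 + N\<close>, where \<open>N\<close> has no constant term, is invertible: the iteration
  \<open>H \<mapsto> 1 - N H\<close> becomes stationary, because the Grassmann algebra has finitely many generators.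
\<close>

lemma unipotent_right_inverse:
  fixes G :: "nat \<Rightarrow> nat \<Rightarrow> 'i::linorder set \<Rightarrow> 'k::field"
  assumes I: "finite I"
    and G: "\<And>i j. i < n \<Longrightarrow> j < n \<Longrightarrow> G i j \<in> homog (grassmann I p) (s i + s j)"
    and G1: "\<And>i j. i < n \<Longrightarrow> j < n \<Longrightarrow> G i j {} = (if i = j then 1 else 0)"
  shows "\<exists>H. (\<forall>i<n. \<forall>j<n. H i j \<in> homog (grassmann I p) (s i + s j)) \<and>
    (\<forall>i<n. \<forall>j<n. H i j {} = (if i = j then 1 else 0)) \<and>
    mat_eq n n (mat_mult (grassmann I p) n G H) (mat_one (grassmann I p))"
proof -
  let ?A = "grassmann I p :: ('k, 'i set \<Rightarrow> 'k) salg"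
  interpret supercommutative_superalgebra ?A by (rule supercommutative_grassmann[OF I])
  define E where "E i j = (mat_one ?A i j :: 'i set \<Rightarrow> 'k)" for i j
  define N where "N i j S = G i j S - E i j S" for i j S
  have E: "E i j \<in> homog ?A (s i + s j)" "E i j {} = (if i = j then 1 else 0)" for i j
    using homog_one homog_zero by (auto simp: E_def mat_one_def) (auto simp: grassmann_simps)
  have diff: "(\<lambda>S. f S - g S) \<in> homog ?A q" if "f \<in> homog ?A q" "g \<in> homog ?A q" for f g q
    using homog_add[OF that(1) homog_smult[OF that(2), of "-1"]] by (simp add: grassmann_simps(5,6))
  have N: "N i j \<in> homog ?A (s i + s j)" "N i j {} = 0" if "i < n" "j < n" for i j
  proof -
    have "N i j = (\<lambda>S. G i j S - E i j S)" by (rule ext) (rule N_def)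
    then show "N i j \<in> homog ?A (s i + s j)" using diff[OF G[OF that] E(1)[of i j]] by simp
    show "N i j {} = 0" using G1[OF that] E(2)[of i j] by (simp add: N_def)
  qed
  define H where "H = rec_nat E (\<lambda>_ h i j S. E i j S - (\<Sum>k<n. (N i k \<otimes>\<^bsub>?A\<^esub> h k j) S))"
  have H0: "H 0 = E" and HS: "H (Suc m) i j S = E i j S - (\<Sum>k<n. (N i k \<otimes>\<^bsub>?A\<^esub> H m k j) S)" for m i j S
    by (simp_all add: H_def)
  have Hh: "H m i j \<in> homog ?A (s i + s j)" if "i < n" "j < n" for m i j
    using that
  proof (induction m arbitrary: i j)
    case 0
    then show ?case using E(1) by (simp add: H0)
  next
    case (Suc m)
    have "mat_mult ?A n N (H m) i j \<in> homog ?A (s i + s j)"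
      by (rule mat_mult_homog[where p = s]) (use Suc N in auto)
    moreover have "mat_mult ?A n N (H m) i j = (\<lambda>S. \<Sum>k<n. (N i k \<otimes>\<^bsub>?A\<^esub> H m k j) S)"
      by (rule grassmann_mat_mult[OF I]) (use Suc N(1)[THEN homog_carrier] Suc.IH[THEN homog_carrier] in auto)
    ultimately have "(\<lambda>S. E i j S - (\<Sum>k<n. (N i k \<otimes>\<^bsub>?A\<^esub> H m k j) S)) \<in> homog ?A (s i + s j)"
      using diff[OF E(1)] by simp
    moreover have "H (Suc m) i j = (\<lambda>S. E i j S - (\<Sum>k<n. (N i k \<otimes>\<^bsub>?A\<^esub> H m k j) S))"
      by (rule ext) (rule HS)
    ultimately show ?case by simp
  qed
  \<comment> \<open>The iteration is stationary in degrees below the step number, since \<open>N\<close> has no constant term.\<close>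
  have stable: "H (Suc m) i j S = H m i j S" if "i < n" "j < n" "finite S" "card S < m" for m i j S
    using that
  proof (induction m arbitrary: i j S)
    case (Suc m)
    have "(N i k \<otimes>\<^bsub>?A\<^esub> H (Suc m) k j) S = (N i k \<otimes>\<^bsub>?A\<^esub> H m k j) S" if "k < n" for k
      by (rule grassmann_mult_agree[where m = m]) (use Suc that N in auto)
    then show ?case by (simp add: HS[of "Suc m"] HS[of m])
  qed simp
  let ?m = "Suc (card I)"
  have fixpt: "H ?m i j S = E i j S - (\<Sum>k<n. (N i k \<otimes>\<^bsub>?A\<^esub> H ?m k j) S)" if ij: "i < n" "j < n" for i j S
  proof -
    have "H (Suc ?m) i j S = H ?m i j S"
    proof (cases "H (Suc ?m) i j S = 0 \<and> H ?m i j S = 0")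
      case False
      then have "finite S" "card S \<le> card I"
        using grassmann_finite[OF I homog_carrier[OF Hh[OF ij]]] by blast+
      then show ?thesis using stable[OF ij, of S ?m] by simp
    qed simp
    then show ?thesis by (simp only: HS[of ?m])
  qed
  show ?thesis
  proof (intro exI[of _ "H ?m"] conjI allI impI)
    show "H ?m i j \<in> homog ?A (s i + s j)" if "i < n" "j < n" for i j by (rule Hh[OF that])
    show "H ?m i j {} = (if i = j then 1 else 0)" if ij: "i < n" "j < n" for i j
    proof -
      have "(N i k \<otimes>\<^bsub>?A\<^esub> H ?m k j) {} = 0" if "k < n" for k
        using N(2)[OF ij(1) that] by (simp add: grassmann_simps)
      then show ?thesis using fixpt[OF ij, of "{}"] E(2)[of i j] by simp
    qed
    show "mat_eq n n (mat_mult ?A n G (H ?m)) (mat_one ?A)"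
      unfolding mat_eq_def
    proof (intro allI impI ext)
      fix i j S assume ij: "i < n" "j < n"
      have "mat_mult ?A n G (H ?m) i j S = (\<Sum>k<n. (G i k \<otimes>\<^bsub>?A\<^esub> H ?m k j) S)"
        using ij by (subst grassmann_mat_mult[OF I]) (auto intro: G[THEN homog_carrier] Hh[THEN homog_carrier])
      also have "\<dots> = (\<Sum>k<n. (E i k \<otimes>\<^bsub>?A\<^esub> H ?m k j) S + (N i k \<otimes>\<^bsub>?A\<^esub> H ?m k j) S)"
        by (simp add: grassmann_mult_add[symmetric] N_def)
      also have "\<dots> = (\<Sum>k<n. (E i k \<otimes>\<^bsub>?A\<^esub> H ?m k j) S) + (\<Sum>k<n. (N i k \<otimes>\<^bsub>?A\<^esub> H ?m k j) S)"
        by (rule sum.distrib)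
      also have "(\<Sum>k<n. (E i k \<otimes>\<^bsub>?A\<^esub> H ?m k j) S) = mat_mult ?A n (mat_one ?A) (H ?m) i j S"
        unfolding E_def using ij mat_over_one[of n n]
        by (subst grassmann_mat_mult[OF I]) (auto simp: mat_over_def intro: Hh[THEN homog_carrier])
      also have "\<dots> = H ?m i j S"
        using mat_mult_one_left[of n n "H ?m"] Hh[THEN homog_carrier] ij
        by (auto simp: mat_over_def mat_eq_def)
      finally show "mat_mult ?A n G (H ?m) i j S = mat_one ?A i j S"
        using fixpt[OF ij] by (simp add: E_def)
    qed
  qed
qed

lemma unipotent_inverse:
  fixes G :: "nat \<Rightarrow> nat \<Rightarrow> 'i::linorder set \<Rightarrow> 'k::field"
  assumes I: "finite I"
    and G: "\<And>i j. i < n \<Longrightarrow> j < n \<Longrightarrow> G i j \<in> homog (grassmann I p) (s i + s j)"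
    and G1: "\<And>i j. i < n \<Longrightarrow> j < n \<Longrightarrow> G i j {} = (if i = j then 1 else 0)"
  shows "\<exists>H. (\<forall>i<n. \<forall>j<n. H i j \<in> homog (grassmann I p) (s i + s j)) \<and>
    mat_eq n n (mat_mult (grassmann I p) n G H) (mat_one (grassmann I p)) \<and>
    mat_eq n n (mat_mult (grassmann I p) n H G) (mat_one (grassmann I p))"
proof -
  let ?A = "grassmann I p :: ('k, 'i set \<Rightarrow> 'k) salg"
  interpret supercommutative_superalgebra ?A by (rule supercommutative_grassmann[OF I])
  obtain H where H': "\<forall>i<n. \<forall>j<n. H i j \<in> homog ?A (s i + s j)"
    "\<forall>i<n. \<forall>j<n. H i j {} = (if i = j then 1 else 0)"
    "mat_eq n n (mat_mult ?A n G H) (mat_one ?A)"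
    using unipotent_right_inverse[of I n G p s, OF I G G1] by blast
  note H = H'(1)[rule_format] H'(2)[rule_format] H'(3)
  obtain K where K': "\<forall>i<n. \<forall>j<n. K i j \<in> homog ?A (s i + s j)"
    "mat_eq n n (mat_mult ?A n H K) (mat_one ?A)"
    using unipotent_right_inverse[of I n H p s, OF I H(1,2)] by blast
  note K = K'(1)[rule_format] K'(2)
  have o: "mat_over ?A n n G" "mat_over ?A n n H" "mat_over ?A n n K"
    unfolding mat_over_def using G[THEN homog_carrier] H(1)[THEN homog_carrier] K(1)[THEN homog_carrier]
    by auto
  \<comment> \<open>\<open>H\<close> has the left inverse \<open>G\<close> and the right inverse \<open>K\<close>, so that \<open>G = K\<close>.\<close>
  have "mat_eq n n G (mat_mult ?A n G (mat_one ?A))"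
    by (rule mat_eq_sym[OF mat_mult_one_right[OF o(1)]])
  also have "mat_eq n n \<dots> (mat_mult ?A n G (mat_mult ?A n H K))"
    by (rule mat_mult_cong[OF mat_eq_refl mat_eq_sym[OF K(2)] o(1) mat_over_mult[OF o(2,3)]])
  also have "mat_eq n n \<dots> (mat_mult ?A n (mat_mult ?A n G H) K)"
    by (rule mat_eq_sym[OF mat_mult_assoc[OF o]])
  also have "mat_eq n n \<dots> (mat_mult ?A n (mat_one ?A) K)"
    by (rule mat_mult_cong[OF H(3) mat_eq_refl mat_over_one o(3)])
  also have "mat_eq n n \<dots> K" by (rule mat_mult_one_left[OF o(3)])
  finally have "mat_eq n n (mat_mult ?A n H G) (mat_mult ?A n H K)"
    by (rule mat_mult_cong[OF mat_eq_refl _ o(2,3)])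
  from mat_eq_trans[OF this K(2)] H(1,3) show ?thesis by auto
qed

section \<open>The multilinear part of an evaluation\<close>

lemma grassmann_conditional_sum:
  fixes h :: "'n \<Rightarrow> 'i::linorder set \<Rightarrow> 'k::field"
  assumes I: "finite I" and N: "finite N" and h: "\<And>n. n \<in> N \<Longrightarrow> P n \<Longrightarrow> h n \<in> homog (grassmann I p) t"
  shows "(\<lambda>S. \<Sum>n\<in>N. if P n then h n S else 0) \<in> homog (grassmann I p) t"
proof -
  let ?A = "grassmann I p :: ('k, 'i set \<Rightarrow> 'k) salg"
  interpret supercommutative_superalgebra ?A by (rule supercommutative_grassmann[OF I])
  have "(\<Oplus>\<^bsub>?A\<^esub>n\<in>{n\<in>N. P n}. h n) \<in> homog ?A t"
    using N h by (intro finsum_homog) auto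
  moreover have "(\<Oplus>\<^bsub>?A\<^esub>n\<in>{n\<in>N. P n}. h n) = (\<lambda>S. \<Sum>n\<in>{n\<in>N. P n}. h n S)"
    by (rule grassmann_finsum[OF I]) (use N h[THEN homog_carrier] in auto)
  ultimately show ?thesis by (simp add: sum.inter_filter[OF N])
qed

text \<open>
  The factors are sums of terms \<open>m n\<close> over labels \<open>n\<close>, sorted by the letter \<open>\<xi> n\<close> to which they
  belong. A word of labels picks a term from each factor.
\<close>

lemma lprod_sum_words:
  fixes m :: "'n \<Rightarrow> 'i::linorder set \<Rightarrow> 'k::field"
  assumes N: "finite N"
  shows "lprod (grassmann I p) (map (\<lambda>x S. \<Sum>n\<in>N. if \<xi> n = x then m n S else 0) w) =
    (\<lambda>S. \<Sum>ns | set ns \<subseteq> N \<and> map \<xi> ns = w. lprod (grassmann I p) (map m ns) S)"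
proof (induction w)
  case Nil
  have "{ns. set ns \<subseteq> N \<and> map \<xi> ns = []} = {[]}" by auto
  then show ?case by simp
next
  case (Cons x w)
  let ?A = "grassmann I p :: ('k, 'i set \<Rightarrow> 'k) salg"
  let ?L = "\<lambda>w. {ns. set ns \<subseteq> N \<and> map \<xi> ns = w}"
  have b: "(\<lambda>S. \<Sum>n\<in>N. if \<xi> n = x then m n S else 0) = (\<lambda>S. \<Sum>n\<in>{n\<in>N. \<xi> n = x}. m n S)"
    by (simp add: sum.inter_filter[OF N])
  have L: "?L (x # w) = (\<lambda>(n, ns). n # ns) ` ({n\<in>N. \<xi> n = x} \<times> ?L w)"
  proof (intro equalityI subsetI)
    fix ns assume "ns \<in> ?L (x # w)"
    then show "ns \<in> (\<lambda>(n, ns). n # ns) ` ({n\<in>N. \<xi> n = x} \<times> ?L w)"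
      by (cases ns) (auto intro!: image_eqI[of _ _ "(hd ns, tl ns)"])
  qed auto
  show ?case
  proof
    fix S
    have "lprod ?A (map (\<lambda>x S. \<Sum>n\<in>N. if \<xi> n = x then m n S else 0) (x # w)) S =
      ((\<lambda>S. \<Sum>n\<in>{n\<in>N. \<xi> n = x}. m n S) \<otimes>\<^bsub>?A\<^esub> (\<lambda>S. \<Sum>ns\<in>?L w. lprod ?A (map m ns) S)) S"
      unfolding list.map lprod.simps Cons.IH b ..
    also have "\<dots> = (\<Sum>n\<in>{n\<in>N. \<xi> n = x}. \<Sum>ns\<in>?L w. (m n \<otimes>\<^bsub>?A\<^esub> lprod ?A (map m ns)) S)"
      by (rule grassmann_mult_sum[of I p m "{n\<in>N. \<xi> n = x}" "\<lambda>ns. lprod ?A (map m ns)" "?L w" S])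
    also have "\<dots> = (\<Sum>(n, ns)\<in>{n\<in>N. \<xi> n = x} \<times> ?L w. lprod ?A (map m (n # ns)) S)"
      by (simp add: sum.cartesian_product)
    also have "\<dots> = (\<Sum>ns\<in>?L (x # w). lprod ?A (map m ns) S)"
      unfolding L by (subst sum.reindex) (auto simp: inj_on_def intro!: sum.cong)
    finally show "lprod ?A (map (\<lambda>x S. \<Sum>n\<in>N. if \<xi> n = x then m n S else 0) (x # w)) S =
      (\<Sum>ns\<in>?L (x # w). lprod ?A (map m ns) S)" .
  qed
qed

text \<open>
  The coefficient of \<open>t\<^sub>0 t\<^sub>1 \<dots> t\<^sub>r\<^sub>-\<^sub>1\<close> in the value of \<open>f\<close> when each letter \<open>x\<close> is replaced by the sum of the
  \<open>t\<^sub>k\<close> with \<open>u k = x\<close>, where the \<open>t\<^sub>k\<close> supercommute and \<open>t\<^sub>k\<close> has the parity of \<open>u k\<close>.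
\<close>

definition full_polarization ::
  "nat \<Rightarrow> ('x \<Rightarrow> bit) \<Rightarrow> ('x list \<Rightarrow> 'k::field) \<Rightarrow> (nat \<Rightarrow> 'x) \<Rightarrow> 'k" where
  "full_polarization r par f u = (\<Sum>\<sigma> | \<sigma> permutes {..<r}.
     koszul_sign (\<lambda>k. par (u k)) (map \<sigma> [0..<r]) * f (map (u \<circ> \<sigma>) [0..<r]))"

lemma tensor_eval_sum_words:
  fixes m :: "'n \<Rightarrow> 'i::linorder set \<Rightarrow> 'k::field"
  assumes I: "finite I" and N: "finite N"
    and f: "f \<in> carrier (tensor_salg X par)"
    and hom: "\<forall>x\<in>X. (\<lambda>S. \<Sum>n\<in>N. if \<xi> n = x then m n S else 0) \<in> homog (grassmann I p) (par x)"
    and M: "finite M" "M \<subseteq> lists N"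
      "\<And>ns. set ns \<subseteq> N \<Longrightarrow> lprod (grassmann I p) (map m ns) S \<noteq> 0 \<Longrightarrow> ns \<in> M"
  shows "tensor_eval (grassmann I p) (\<lambda>x S. \<Sum>n\<in>N. if \<xi> n = x then m n S else 0) f S =
    (\<Sum>ns\<in>M. f (map \<xi> ns) * lprod (grassmann I p) (map m ns) S)"
proof -
  let ?A = "grassmann I p :: ('k, 'i set \<Rightarrow> 'k) salg"
  let ?b = "\<lambda>x S. \<Sum>n\<in>N. if \<xi> n = x then m n S else 0"
  let ?L = "\<lambda>w. {ns. set ns \<subseteq> N \<and> map \<xi> ns = w}"
  let ?W = "{w. f w \<noteq> 0}"
  interpret supercommutative_superalgebra ?A by (rule supercommutative_grassmann[OF I])
  have W: "finite ?W" "?W \<subseteq> lists X" using f by (auto simp: tensor_salg_simps)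
  have "tensor_eval ?A ?b f = (\<lambda>S. \<Sum>w\<in>?W. (f w \<odot>\<^bsub>?A\<^esub> lprod ?A (map ?b w)) S)"
    unfolding tensor_eval_def
  proof (rule grassmann_finsum[OF I W(1)])
    fix w assume "w \<in> ?W"
    then have "w \<in> lists X" using W(2) by blast
    then show "f w \<odot>\<^bsub>?A\<^esub> lprod ?A (map ?b w) \<in> carrier ?A"
      using lprod_word_closed[OF hom] smult_closed by blast
  qed
  then have "tensor_eval ?A ?b f S = (\<Sum>w\<in>?W. f w * (\<Sum>ns\<in>?L w. lprod ?A (map m ns) S))"
    by (simp add: grassmann_simps(6) lprod_sum_words[OF N])
  also have "\<dots> = (\<Sum>w\<in>?W. \<Sum>ns\<in>?L w. f (map \<xi> ns) * lprod ?A (map m ns) S)"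
    unfolding sum_distrib_left by (intro sum.cong refl) auto
  also have "\<dots> = (\<Sum>ns\<in>(\<Union>w\<in>?W. ?L w). f (map \<xi> ns) * lprod ?A (map m ns) S)"
  proof (rule sum.UNION_disjoint[symmetric])
    show "\<forall>w\<in>?W. finite (?L w)"
    proof
      fix w
      have "?L w \<subseteq> {ns. set ns \<subseteq> N \<and> length ns = length w}" by auto
      then show "finite (?L w)" using finite_lists_length_eq[OF N] finite_subset by blast
    qed
  qed (use W in auto)
  also have "\<dots> = (\<Sum>ns\<in>M. f (map \<xi> ns) * lprod ?A (map m ns) S)"
  proof (rule sum.mono_neutral_cong)
    show "finite (\<Union>w\<in>?W. ?L w)"
    proof (rule finite_UN_I[OF W(1)])
      fix w
      have "?L w \<subseteq> {ns. set ns \<subseteq> N \<and> length ns = length w}" by auto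
      then show "finite (?L w)" using finite_lists_length_eq[OF N] finite_subset by blast
    qed
  qed (use M in auto)
  finally show ?thesis .
qed

lemma distinct_list_permutation:
  assumes "distinct xs" "set xs = {..<r}"
  obtains \<sigma> where "\<sigma> permutes {..<r}" "xs = map \<sigma> [0..<r]"
proof
  have len: "length xs = r" using distinct_card[OF assms(1)] assms(2) by simp
  define \<sigma> where "\<sigma> k = (if k < r then xs ! k else k)" for k
  have "bij_betw ((!) xs) {..<r} {..<r}"
    using bij_betw_nth[OF assms(1)] len assms(2) by simp
  then have "bij_betw \<sigma> {..<r} {..<r}"
    by (rule bij_betw_cong[THEN iffD1, rotated]) (simp add: \<sigma>_def)
  then show "\<sigma> permutes {..<r}" by (rule bij_imp_permutes) (simp add: \<sigma>_def)
  show "xs = map \<sigma> [0..<r]" using len by (intro nth_equalityI) (auto simp: \<sigma>_def)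
qed

lemma sort_map_permutation: "\<sigma> permutes {..<r} \<Longrightarrow> sort (map \<sigma> [0..<r]) = [0..<r]"
  by (intro sorted_distinct_set_unique)
    (auto simp: distinct_map permutes_inj_on permutes_image atLeast0LessThan)

text \<open>
  There are \<open>4 * r\<close> generators, in four blocks of length \<open>r\<close>. The monomial of the label \<open>(k, l)\<close> with
  \<open>l < r\<close> uses the \<open>k\<close>-th generators of the second and fourth blocks, and the \<open>l\<close>-th generators of the
  first and third; the value \<open>l = r\<close> is used for a monomial with only the former two generators. If a
  list of labels uses every generator exactly once, then each \<open>k\<close> and each \<open>l < r\<close> occurs once. By
  counting, \<open>l = r\<close> does not occur, and the labels form the graph of a permutation.
\<close>

lemma pairing_list_permutations:
  assumes ns: "set ns \<subseteq> {..<r} \<times> {..r}"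
    and v: "\<forall>k<r. \<forall>l\<le>r. set (v (k, l)) = {r + k, 3 * r + k} \<union> (if l < r then {l, 2 * r + l} else {})"
    and d: "distinct (concat (map v ns))" "set (concat (map v ns)) = {..<4 * r}"
  obtains \<sigma> \<tau> where "\<sigma> permutes {..<r}" "\<tau> permutes {..<r}"
    "ns = map (\<lambda>j. (\<sigma> j, \<tau> (\<sigma> j))) [0..<r]"
proof -
  have v': "set (v n) = {r + fst n, 3 * r + fst n} \<union> (if snd n < r then {snd n, 2 * r + snd n} else {})"
    if "n \<in> set ns" for n
  proof -
    have "fst n < r" "snd n \<le> r" using that ns by auto
    then show ?thesis using v by (metis prod.collapse)
  qed
  then have ne: "[] \<notin> set (map v ns)" by fastforce
  have dv: "distinct (map v ns)" using d(1) ne by (simp add: distinct_concat_iff removeAll_id)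
  have inj: "inj_on fst (set ns)"
  proof (rule inj_onI)
    fix n n' assume n: "n \<in> set ns" "n' \<in> set ns" "fst n = fst n'"
    then have "r + fst n \<in> set (v n) \<inter> set (v n')" using v' by auto
    then have "v n = v n'" using d(1) n by (auto simp: distinct_concat_iff)
    then show "n = n'" using dv n by (auto simp: distinct_map dest: inj_onD)
  qed
  have dn: "distinct ns" using dv by (simp add: distinct_map)
  have k: "fst ` set ns = {..<r}"
  proof
    show "{..<r} \<subseteq> fst ` set ns"
    proof
      fix k assume "k \<in> {..<r}"
      then have "r + k \<in> set (concat (map v ns))" "k < r" unfolding d(2) by auto
      then obtain n where n: "n \<in> set ns" "r + k \<in> set (v n)" by auto
      then have "fst n < r" "r + k \<in> {r + fst n, 3 * r + fst n} \<union> (if snd n < r then {snd n, 2 * r + snd n} else {})"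
        using v' ns by auto
      then have "fst n = k" using \<open>k < r\<close> by (auto split: if_splits)
      then show "k \<in> fst ` set ns" using n(1) by blast
    qed
  qed (use ns in auto)
  have card: "card (set ns) = r" using card_image[OF inj] k by simp
  have l: "{..<r} \<subseteq> snd ` set ns"
  proof
    fix l assume "l \<in> {..<r}"
    then have "2 * r + l \<in> set (concat (map v ns))" "l < r" unfolding d(2) by auto
    then obtain n where n: "n \<in> set ns" "2 * r + l \<in> set (v n)" by auto
    then have "fst n < r" "2 * r + l \<in> {r + fst n, 3 * r + fst n} \<union> (if snd n < r then {snd n, 2 * r + snd n} else {})"
      using v' ns by auto
    then have "snd n = l" using \<open>l < r\<close> by (auto split: if_splits)
    then show "l \<in> snd ` set ns" using n(1) by blast
  qed
  then have cl: "card (snd ` set ns) = card (set ns)"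
    using card_image_le[of "set ns" snd] card_mono[of "snd ` set ns" "{..<r}"] card by simp
  then have l': "snd ` set ns = {..<r}" using card_subset_eq[of "snd ` set ns" "{..<r}"] l card by simp
  have injs: "inj_on snd (set ns)" using cl by (intro eq_card_imp_inj_on) auto
  obtain \<sigma> where \<sigma>: "\<sigma> permutes {..<r}" "map fst ns = map \<sigma> [0..<r]"
    using distinct_list_permutation[of "map fst ns" r] dn inj k by (auto simp: distinct_map)
  obtain \<rho> where \<rho>: "\<rho> permutes {..<r}" "map snd ns = map \<rho> [0..<r]"
    using distinct_list_permutation[of "map snd ns" r] dn injs l' by (auto simp: distinct_map)
  show ?thesis
  proof (rule that[OF \<sigma>(1)])
    show "\<rho> \<circ> inv_into UNIV \<sigma> permutes {..<r}" by (intro permutes_compose permutes_inv \<sigma> \<rho>)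
    have "ns = zip (map fst ns) (map snd ns)" by (simp add: zip_map_fst_snd)
    also have "\<dots> = map (\<lambda>j. (\<sigma> j, \<rho> j)) [0..<r]" unfolding \<sigma> \<rho> by (simp add: zip_map_map zip_same_conv_map)
    finally show "ns = map (\<lambda>j. (\<sigma> j, (\<rho> \<circ> inv_into UNIV \<sigma>) (\<sigma> j))) [0..<r]"
      using permutes_inverses(2)[OF \<sigma>(1)] by simp
  qed
qed

text \<open>
  The coefficient of the product of all generators, in an evaluation at points whose terms are the
  monomials of the preceding lemma: a sum over the pairings \<open>k \<mapsto> \<tau> k\<close>. The order in which the letters
  occur in a word of \<open>f\<close> is summed over in the full polarization.
\<close>

lemma multilinear_coefficient:
  fixes f :: "'x list \<Rightarrow> 'k::field" and r :: nat and p :: "nat \<Rightarrow> bit" and v :: "nat \<times> nat \<Rightarrow> nat list"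
  defines "A \<equiv> grassmann {..<4 * r} p :: ('k, nat set \<Rightarrow> 'k) salg"
  defines "m \<equiv> \<lambda>n. lprod A (map gvar (v n))"
  assumes N: "N \<subseteq> {..<r} \<times> {..r}"
    and f: "f \<in> carrier (tensor_salg X par)" and \<xi>: "\<xi> ` N \<subseteq> X"
    and v: "\<forall>k<r. \<forall>l\<le>r. set (v (k, l)) = {r + k, 3 * r + k} \<union> (if l < r then {l, 2 * r + l} else {})"
    and m: "\<And>n. n \<in> N \<Longrightarrow> m n \<in> homog A (par (\<xi> n))"
  shows "tensor_eval A (\<lambda>x S. \<Sum>n\<in>N. if \<xi> n = x then m n S else 0) f {..<4 * r} =
    (\<Sum>\<tau> | \<tau> permutes {..<r} \<and> (\<forall>k<r. (k, \<tau> k) \<in> N).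
      full_polarization r par f (\<lambda>k. \<xi> (k, \<tau> k)) * lprod A (map (\<lambda>k. m (k, \<tau> k)) [0..<r]) {..<4 * r})"
proof -
  interpret supercommutative_superalgebra A unfolding A_def by (rule supercommutative_grassmann) simp
  let ?G = "{\<sigma>. \<sigma> permutes {..<r}}"
  let ?T = "{\<tau>. \<tau> permutes {..<r} \<and> (\<forall>k<r. (k, \<tau> k) \<in> N)}"
  define \<Phi> :: "(nat \<Rightarrow> nat) \<times> (nat \<Rightarrow> nat) \<Rightarrow> (nat \<times> nat) list"
    where "\<Phi> = (\<lambda>(\<sigma>, \<tau>). map (\<lambda>j. (\<sigma> j, \<tau> (\<sigma> j))) [0..<r])"
  have finG: "finite ?G" by (simp add: finite_permutations)
  have finT: "finite ?T" by (rule finite_subset[OF _ finG]) auto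
  have finN: "finite N" using N finite_subset by blast
  have gc: "gvar k \<in> carrier A" if "k < 4 * r" for k
    using gvar_homog[of k "{..<4 * r}" p] that homog_carrier by (auto simp: A_def)
  have vr: "set (v n) \<subseteq> {..<4 * r}" if "n \<in> N" for n
  proof -
    obtain k l where n: "n = (k, l)" "k < r" "l \<le> r" using N \<open>n \<in> N\<close> by auto
    then have "set (v n) = {r + k, 3 * r + k} \<union> (if l < r then {l, 2 * r + l} else {})" using v by simp
    then show ?thesis using n by (auto split: if_splits)
  qed
  have mons: "lprod A (map m ns) {..<4 * r} = (if distinct (concat (map v ns)) \<and>
      {..<4 * r} = set (concat (map v ns)) then koszul_sign p (concat (map v ns)) else 0)"
    if "set ns \<subseteq> N" for ns
  proof -
    have "lprod A (map m ns) = lprod A (concat (map (\<lambda>n. map gvar (v n)) ns))"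
      using that vr gc by (subst lprod_concat) (fastforce simp: m_def comp_def)+
    also have "concat (map (\<lambda>n. map gvar (v n)) ns) = map gvar (concat (map v ns))"
      by (simp add: map_concat comp_def)
    finally show ?thesis unfolding A_def lprod_gvar by simp
  qed
  have perm: "\<sigma> j < r" if "\<sigma> permutes {..<r}" "j < r" for \<sigma> j
    using permutes_in_image[OF that(1)] that(2) by (metis lessThan_iff)
  have \<Phi>N: "set (\<Phi> (\<sigma>, \<tau>)) \<subseteq> N" if "\<sigma> \<in> ?G" "\<tau> \<in> ?T" for \<sigma> \<tau>
    using that perm by (auto simp: \<Phi>_def)
  have "tensor_eval A (\<lambda>x S. \<Sum>n\<in>N. if \<xi> n = x then m n S else 0) f {..<4 * r} =
    (\<Sum>ns\<in>\<Phi> ` (?G \<times> ?T). f (map \<xi> ns) * lprod A (map m ns) {..<4 * r})"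
  proof (rule tensor_eval_sum_words[where I = "{..<4 * r}" and p = p, OF _ finN f, folded A_def])
    show "\<forall>x\<in>X. (\<lambda>S. \<Sum>n\<in>N. if \<xi> n = x then m n S else 0) \<in> homog A (par x)"
      unfolding A_def by (intro ballI grassmann_conditional_sum) (use finN m in \<open>auto simp: A_def\<close>)
    show "\<Phi> ` (?G \<times> ?T) \<subseteq> lists N" using \<Phi>N by (auto simp: in_lists_conv_set)
    fix ns assume ns: "set ns \<subseteq> N" "lprod A (map m ns) {..<4 * r} \<noteq> 0"
    then have d: "distinct (concat (map v ns))" "set (concat (map v ns)) = {..<4 * r}"
      unfolding mons[OF ns(1)] by (simp_all split: if_splits)
    obtain \<sigma> \<tau> where \<sigma>\<tau>: "\<sigma> permutes {..<r}" "\<tau> permutes {..<r}"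
      "ns = map (\<lambda>j. (\<sigma> j, \<tau> (\<sigma> j))) [0..<r]"
      by (rule pairing_list_permutations[OF subset_trans[OF ns(1) N] v d])
    have "(k, \<tau> k) \<in> N" if "k < r" for k
    proof -
      have "k = \<sigma> (inv_into UNIV \<sigma> k)" "inv_into UNIV \<sigma> k < r"
        using permutes_inverses(1)[OF \<sigma>\<tau>(1)] perm[OF permutes_inv[OF \<sigma>\<tau>(1)] that] by simp_all
      then have "(k, \<tau> k) \<in> set ns" unfolding \<sigma>\<tau>(3) by (auto intro!: image_eqI[of _ _ "inv_into UNIV \<sigma> k"])
      then show ?thesis using ns(1) by blast
    qed
    then show "ns \<in> \<Phi> ` (?G \<times> ?T)"
      using \<sigma>\<tau> by (auto simp: \<Phi>_def intro!: image_eqI[of _ _ "(\<sigma>, \<tau>)"])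
  qed (use finG finT in auto)
  also have "\<dots> = (\<Sum>(\<sigma>, \<tau>)\<in>?G \<times> ?T. f (map \<xi> (\<Phi> (\<sigma>, \<tau>))) * lprod A (map m (\<Phi> (\<sigma>, \<tau>))) {..<4 * r})"
  proof (subst sum.reindex)
    show "inj_on \<Phi> (?G \<times> ?T)"
    proof (rule inj_onI, clarify)
      fix \<sigma> \<tau> \<sigma>' \<tau>' assume *: "\<sigma> permutes {..<r}" "\<sigma>' permutes {..<r}" "\<tau> permutes {..<r}" "\<tau>' permutes {..<r}"
        and "\<Phi> (\<sigma>, \<tau>) = \<Phi> (\<sigma>', \<tau>')"
      then have all: "\<forall>j\<in>{0..<r}. \<sigma> j = \<sigma>' j \<and> \<tau> (\<sigma> j) = \<tau>' (\<sigma>' j)"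
        unfolding \<Phi>_def prod.case map_eq_conv prod.inject set_upt by blast
      have e: "\<sigma> j = \<sigma>' j" "\<tau> (\<sigma> j) = \<tau>' (\<sigma>' j)" if "j < r" for j
        using bspec[OF all, of j] that by auto
      have 1: "\<sigma> = \<sigma>'"
        using e(1) *(1,2) by (intro ext) (metis lessThan_iff permutes_not_in)
      have "\<tau> k = \<tau>' k" for k
      proof (cases "k < r")
        case True
        then show ?thesis using e(2)[of "inv_into UNIV \<sigma> k"] perm[OF permutes_inv[OF *(1)] True]
            permutes_inverses(1)[OF *(1)] by (simp add: 1)
      next
        case False
        then show ?thesis using *(3,4) by (simp add: permutes_not_in)
      qed
      then show "\<sigma> = \<sigma>' \<and> \<tau> = \<tau>'" using 1 by auto
    qed
  qed (auto intro!: sum.cong)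
  also have "\<dots> = (\<Sum>\<sigma>\<in>?G. \<Sum>\<tau>\<in>?T. f (map \<xi> (\<Phi> (\<sigma>, \<tau>))) * lprod A (map m (\<Phi> (\<sigma>, \<tau>))) {..<4 * r})"
    by (rule sum.cartesian_product[symmetric])
  also have "\<dots> = (\<Sum>\<tau>\<in>?T. \<Sum>\<sigma>\<in>?G. f (map \<xi> (\<Phi> (\<sigma>, \<tau>))) * lprod A (map m (\<Phi> (\<sigma>, \<tau>))) {..<4 * r})"
    by (rule sum.swap)
  also have "\<dots> = (\<Sum>\<tau>\<in>?T. full_polarization r par f (\<lambda>k. \<xi> (k, \<tau> k)) *
      lprod A (map (\<lambda>k. m (k, \<tau> k)) [0..<r]) {..<4 * r})"
    unfolding full_polarization_def sum_distrib_right
  proof (intro sum.cong refl)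
    fix \<tau> \<sigma> assume \<tau>: "\<tau> \<in> ?T" and \<sigma>: "\<sigma> \<in> ?G"
    have "lprod A (map (\<lambda>k. m (k, \<tau> k)) (map \<sigma> [0..<r])) =
      koszul_sign (\<lambda>k. par (\<xi> (k, \<tau> k))) (map \<sigma> [0..<r]) \<odot>\<^bsub>A\<^esub>
        lprod A (map (\<lambda>k. m (k, \<tau> k)) (sort (map \<sigma> [0..<r])))"
      by (rule lprod_reorder) (use \<tau> \<sigma> m perm in \<open>auto simp: distinct_map permutes_inj_on\<close>)
    then show "f (map \<xi> (\<Phi> (\<sigma>, \<tau>))) * lprod A (map m (\<Phi> (\<sigma>, \<tau>))) {..<4 * r} =
      koszul_sign (\<lambda>k. par (\<xi> (k, \<tau> k))) (map \<sigma> [0..<r]) * f (map ((\<lambda>k. \<xi> (k, \<tau> k)) \<circ> \<sigma>) [0..<r]) *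
        lprod A (map (\<lambda>k. m (k, \<tau> k)) [0..<r]) {..<4 * r}"
      using \<sigma> by (simp add: sort_map_permutation \<Phi>_def comp_def A_def grassmann_simps(6))
  qed
  finally show ?thesis .
qed

section \<open>Signs of permutations and contractions\<close>

definition perm_sign :: "nat \<Rightarrow> ('b \<Rightarrow> bit) \<Rightarrow> (nat \<Rightarrow> nat) \<Rightarrow> (nat \<Rightarrow> 'b) \<Rightarrow> 'k::field" where
  "perm_sign r \<pi> \<tau> w = koszul_sign (\<lambda>k. \<pi> (w k)) (map \<tau> [0..<r])"

lemma permutes_lessThan: "\<sigma> permutes {..<r} \<Longrightarrow> j < r \<Longrightarrow> \<sigma> j < (r :: nat)"
  by (metis lessThan_iff permutes_in_image)

lemma distinct_map_permutation: "\<sigma> permutes {..<r} \<Longrightarrow> distinct (map \<sigma> [0..<r])"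
  by (simp add: distinct_map permutes_inj_on)

lemma (in supercommutative_superalgebra) lprod_permute:
  assumes "\<tau> permutes {..<r}" "\<And>k. k < r \<Longrightarrow> b k \<in> homog A (p k)"
  shows "lprod A (map (\<lambda>k. b (\<tau> k)) [0..<r]) = koszul_sign p (map \<tau> [0..<r]) \<odot> lprod A (map b [0..<r])"
proof -
  have "lprod A (map b (map \<tau> [0..<r])) =
      koszul_sign p (map \<tau> [0..<r]) \<odot> lprod A (map b (sort (map \<tau> [0..<r])))"
    by (rule lprod_reorder)
      (use assms permutes_lessThan in \<open>auto simp: distinct_map_permutation\<close>)
  then show ?thesis by (simp add: sort_map_permutation[OF assms(1)] comp_def)
qed

text \<open>
  Permuting a product of generators by \<open>\<sigma> \<circ> \<mu>\<close> can be done in two steps; the parities met by \<open>\<mu>\<close> are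
  those already rearranged by \<open>\<sigma>\<close>.
\<close>

lemma perm_sign_compose:
  assumes \<sigma>: "\<sigma> permutes {..<r}" and \<mu>: "\<mu> permutes {..<r}"
  shows "perm_sign r \<pi> (\<sigma> \<circ> \<mu>) w = perm_sign r \<pi> \<sigma> w * (perm_sign r \<pi> \<mu> (w \<circ> \<sigma>) :: 'k::field)"
proof -
  let ?p = "\<lambda>k. \<pi> (w k)"
  let ?A = "grassmann {..<r} ?p :: ('k, nat set \<Rightarrow> 'k) salg"
  interpret supercommutative_superalgebra ?A by (rule supercommutative_grassmann) simp
  have top: "lprod ?A (map gvar (map \<rho> [0..<r])) {..<r} = koszul_sign ?p (map \<rho> [0..<r])"
    if "\<rho> permutes {..<r}" for \<rho>
    using that unfolding lprod_gvar by (auto simp: distinct_map_permutation permutes_image atLeast0LessThan)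
  have "lprod ?A (map (\<lambda>k. gvar (\<sigma> (\<mu> k))) [0..<r]) =
      koszul_sign (\<lambda>k. \<pi> (w (\<sigma> k))) (map \<mu> [0..<r]) \<odot>\<^bsub>?A\<^esub> lprod ?A (map (\<lambda>k. gvar (\<sigma> k)) [0..<r])"
    by (rule lprod_permute[OF \<mu>])
      (use permutes_lessThan[OF \<sigma>] in \<open>auto intro!: gvar_homog[where p = ?p and I = "{..<r}"]\<close>)
  then show ?thesis
    using top[OF permutes_compose[OF \<mu> \<sigma>]] top[OF \<sigma>]
    by (simp add: perm_sign_def comp_def grassmann_simps(6) mult.commute)
qed

text \<open>
  The parities of the four blocks of \<open>r\<close> generators. In the application they are \<open>Q\<close>, \<open>y\<close>, \<open>P\<close>, \<open>z\<close> in
  this order, where \<open>P\<^sub>l Q\<^sub>l\<close> are entries of a group element and \<open>y\<^sub>k z\<^sub>k\<close> entries of a representation.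
\<close>

definition block_parity ::
  "nat \<Rightarrow> (nat \<Rightarrow> bit) \<Rightarrow> (nat \<Rightarrow> bit) \<Rightarrow> (nat \<Rightarrow> bit) \<Rightarrow> (nat \<Rightarrow> bit) \<Rightarrow> nat \<Rightarrow> bit" where
  "block_parity r a b c d n = (if n < r then a n else if n < 2 * r then b (n - r)
     else if n < 3 * r then c (n - 2 * r) else d (n - 3 * r))"

context
  fixes r :: nat and a b c d :: "nat \<Rightarrow> bit" and A :: "('k::field, nat set \<Rightarrow> 'k) salg" and \<tau> :: "nat \<Rightarrow> nat"
  assumes A_eq: "A = grassmann {..<4 * r} (block_parity r a b c d)" and \<tau>: "\<tau> permutes {..<r}"
begin

interpretation supercommutative_superalgebra A
  unfolding A_eq by (rule supercommutative_grassmann) simp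

lemma block_homog:
  "k < r \<Longrightarrow> gvar k \<in> homog A (a k)"
  "k < r \<Longrightarrow> gvar (r + k) \<in> homog A (b k)"
  "k < r \<Longrightarrow> gvar (2 * r + k) \<in> homog A (c k)"
  "k < r \<Longrightarrow> gvar (3 * r + k) \<in> homog A (d k)"
proof -
  have g: "gvar n \<in> homog A (block_parity r a b c d n)" if "n < 4 * r" for n
    unfolding A_eq by (rule gvar_homog) (use that in simp)
  show "gvar k \<in> homog A (a k)" "gvar (r + k) \<in> homog A (b k)"
    "gvar (2 * r + k) \<in> homog A (c k)" "gvar (3 * r + k) \<in> homog A (d k)" if "k < r"
    using g[of k] g[of "r + k"] g[of "2 * r + k"] g[of "3 * r + k"] that
    by (simp_all add: block_parity_def)
qed

private abbreviation "L \<equiv> [0..<r]"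
private abbreviation "blk s \<equiv> lprod A (map (\<lambda>k. gvar (s + k)) L)"

lemma block_closed:
  "blk 0 \<in> homog A (\<Sum>k\<leftarrow>L. a k)" "blk r \<in> homog A (\<Sum>k\<leftarrow>L. b k)"
  "blk (2 * r) \<in> homog A (\<Sum>k\<leftarrow>L. c k)" "blk (3 * r) \<in> homog A (\<Sum>k\<leftarrow>L. d k)"
  by (rule lprod_homog; use block_homog in simp)+

lemma block_top: "((blk 0 \<otimes>\<^bsub>A\<^esub> blk r) \<otimes>\<^bsub>A\<^esub> (blk (2 * r) \<otimes>\<^bsub>A\<^esub> blk (3 * r))) {..<4 * r} = 1"
proof -
  have s: "map (\<lambda>k. gvar (s + k)) L = map gvar [s..<s + r]" for s
    by (rule nth_equalityI) auto
  have c: "set (map gvar [s..<s + r]) \<subseteq> carrier A" if "s + r \<le> 4 * r" for s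
  proof -
    have "gvar n \<in> carrier A" if "n < 4 * r" for n
      unfolding A_eq using that by (auto simp: grassmann_simps gvar_def)
    then show ?thesis using that by auto
  qed
  have "[0..<4 * r] = [0..<3 * r] @ [3 * r..<3 * r + r]" "[0..<3 * r] = [0..<2 * r] @ [2 * r..<2 * r + r]"
    "[0..<2 * r] = [0..<0 + r] @ [r..<r + r]"
  proof -
    have e: "3 * r + r = 4 * r" "2 * r + r = 3 * r" "r + r = 2 * r" by simp_all
    show "[0..<4 * r] = [0..<3 * r] @ [3 * r..<3 * r + r]" "[0..<3 * r] = [0..<2 * r] @ [2 * r..<2 * r + r]"
      "[0..<2 * r] = [0..<0 + r] @ [r..<r + r]"
      using upt_add_eq_append[of 0 "3 * r" r] upt_add_eq_append[of 0 "2 * r" r] upt_add_eq_append[of 0 r r]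
      unfolding e by simp_all
  qed
  then have "lprod A (map gvar [0..<4 * r]) = lprod A ((map gvar [0..<0+r] @ map gvar [r..<r+r]) @
      (map gvar [2*r..<2*r+r] @ map gvar [3*r..<3*r+r]))"
    by simp
  also have "\<dots> = (blk 0 \<otimes>\<^bsub>A\<^esub> blk r) \<otimes>\<^bsub>A\<^esub> (blk (2 * r) \<otimes>\<^bsub>A\<^esub> blk (3 * r))"
    unfolding s using c[of 0] c[of r] c[of "2 * r"] c[of "3 * r"]
    by (simp add: lprod_append m_assoc lprod_closed)
  moreover have "lprod A (map gvar [0..<4 * r]) {..<4 * r} = 1"
    unfolding A_eq lprod_gvar by (simp add: koszul_sign_sorted atLeast0LessThan)
  ultimately show ?thesis by simp
qed

lemma homog_gvar_perm:
  "k < r \<Longrightarrow> gvar (\<tau> k) \<in> homog A (a (\<tau> k))"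
  "k < r \<Longrightarrow> gvar (2 * r + \<tau> k) \<in> homog A (c (\<tau> k))"
  using block_homog(1,3)[OF permutes_lessThan[OF \<tau>]] by auto

text \<open>
  For a permutation \<open>\<tau>\<close> with matching parities, the product of the entries \<open>P\<^bsub>\<tau> k\<^esub> Q\<^bsub>\<tau> k\<^esub> y\<^sub>k z\<^sub>k\<close> of \<open>g Y\<close>:
  the inner pairs \<open>Q\<^bsub>\<tau> k\<^esub> y\<^sub>k\<close> are even and can be moved to the front, then each of the two
  products of pairs is separated and sorted.
\<close>

lemma contraction_coefficient_left:
  assumes ab: "\<And>k. k < r \<Longrightarrow> a (\<tau> k) = b k"
  shows "lprod A (map (\<lambda>k. lprod A (map gvar [2 * r + \<tau> k, \<tau> k, r + k, 3 * r + k])) L) {..<4 * r} =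
    shuffle_sign b b L * koszul_sign a (map \<tau> L) *
      (koszul_sign c (map \<tau> L) * shuffle_sign (\<lambda>k. c (\<tau> k)) d L)"
proof -
  have h: "gvar k \<in> homog A (a k)" "gvar (r + k) \<in> homog A (b k)" "gvar (2 * r + k) \<in> homog A (c k)"
    "gvar (3 * r + k) \<in> homog A (d k)" "gvar (\<tau> k) \<in> homog A (b k)" "gvar (2 * r + \<tau> k) \<in> homog A (c (\<tau> k))"
    if "k < r" for k
    using block_homog[OF that] homog_gvar_perm[OF that] ab[OF that] by simp_all
  note hc = h[THEN homog_carrier]
  have even: "gvar (\<tau> k) \<otimes>\<^bsub>A\<^esub> gvar (r + k) \<in> homog A 0" if "k < r" for k
    using homog_mult[OF h(5,2)[OF that]] by simp
  note bc = block_closed[THEN homog_carrier]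
  have "lprod A (map (\<lambda>k. lprod A (map gvar [2 * r + \<tau> k, \<tau> k, r + k, 3 * r + k])) L) =
    lprod A (map (\<lambda>k. gvar (2 * r + \<tau> k) \<otimes>\<^bsub>A\<^esub> ((gvar (\<tau> k) \<otimes>\<^bsub>A\<^esub> gvar (r + k)) \<otimes>\<^bsub>A\<^esub> gvar (3 * r + k))) L)"
    using hc by (intro arg_cong[of _ _ "lprod A"] map_cong refl) (simp add: m_assoc)
  also have "\<dots> = lprod A (map (\<lambda>k. gvar (\<tau> k) \<otimes>\<^bsub>A\<^esub> gvar (r + k)) L) \<otimes>\<^bsub>A\<^esub>
      lprod A (map (\<lambda>k. gvar (2 * r + \<tau> k) \<otimes>\<^bsub>A\<^esub> gvar (3 * r + k)) L)"
    by (rule lprod_pull_even) (use hc even in auto)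
  also have "lprod A (map (\<lambda>k. gvar (\<tau> k) \<otimes>\<^bsub>A\<^esub> gvar (r + k)) L) = shuffle_sign b b L \<odot>\<^bsub>A\<^esub>
      (lprod A (map (\<lambda>k. gvar (\<tau> k)) L) \<otimes>\<^bsub>A\<^esub> blk r)"
    by (rule lprod_shuffle) (use h in auto)
  also have "lprod A (map (\<lambda>k. gvar (\<tau> k)) L) = koszul_sign a (map \<tau> L) \<odot>\<^bsub>A\<^esub> blk 0"
    using lprod_permute[OF \<tau>, of gvar a] h(1) by simp
  also have "lprod A (map (\<lambda>k. gvar (2 * r + \<tau> k) \<otimes>\<^bsub>A\<^esub> gvar (3 * r + k)) L) =
      shuffle_sign (\<lambda>k. c (\<tau> k)) d L \<odot>\<^bsub>A\<^esub>
      (lprod A (map (\<lambda>k. gvar (2 * r + \<tau> k)) L) \<otimes>\<^bsub>A\<^esub> blk (3 * r))"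
    by (rule lprod_shuffle) (use h in auto)
  also have "lprod A (map (\<lambda>k. gvar (2 * r + \<tau> k)) L) = koszul_sign c (map \<tau> L) \<odot>\<^bsub>A\<^esub> blk (2 * r)"
    by (rule lprod_permute[OF \<tau>]) (use h in auto)
  finally have "lprod A (map (\<lambda>k. lprod A (map gvar [2 * r + \<tau> k, \<tau> k, r + k, 3 * r + k])) L) =
    (shuffle_sign b b L * koszul_sign a (map \<tau> L) * (koszul_sign c (map \<tau> L) * shuffle_sign (\<lambda>k. c (\<tau> k)) d L)) \<odot>\<^bsub>A\<^esub>
      ((blk 0 \<otimes>\<^bsub>A\<^esub> blk r) \<otimes>\<^bsub>A\<^esub> (blk (2 * r) \<otimes>\<^bsub>A\<^esub> blk (3 * r)))"
    using bc by (simp add: smult_mult_left smult_mult_right smult_assoc[symmetric] smult_closed mult_ac)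
  then show ?thesis using block_top by (simp add: A_eq grassmann_simps(6))
qed

text \<open>
  The same for the entries \<open>y\<^sub>k z\<^sub>k P\<^bsub>\<tau> k\<^esub> Q\<^bsub>\<tau> k\<^esub>\<close> of \<open>Y g\<close>. The blocks come out in a different order, whence
  the additional signs.
\<close>

lemma contraction_coefficient_right:
  assumes cd: "\<And>k. k < r \<Longrightarrow> c (\<tau> k) = d k"
  shows "lprod A (map (\<lambda>k. lprod A (map gvar [r + k, 3 * r + k, 2 * r + \<tau> k, \<tau> k])) L) {..<4 * r} =
    shuffle_sign d d L * koszul (\<Sum>k\<leftarrow>L. d k) * koszul_sign c (map \<tau> L) *
      (koszul_sign a (map \<tau> L) * shuffle_sign b (\<lambda>k. a (\<tau> k)) L * koszul ((\<Sum>k\<leftarrow>L. b k) * (\<Sum>k\<leftarrow>L. a k)))"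
proof -
  have h: "gvar k \<in> homog A (a k)" "gvar (r + k) \<in> homog A (b k)" "gvar (2 * r + k) \<in> homog A (c k)"
    "gvar (3 * r + k) \<in> homog A (d k)" "gvar (\<tau> k) \<in> homog A (a (\<tau> k))" "gvar (2 * r + \<tau> k) \<in> homog A (d k)"
    if "k < r" for k
    using block_homog[OF that] homog_gvar_perm[OF that] cd[OF that] by simp_all
  note hc = h[THEN homog_carrier]
  have even: "gvar (3 * r + k) \<otimes>\<^bsub>A\<^esub> gvar (2 * r + \<tau> k) \<in> homog A 0" if "k < r" for k
    using homog_mult[OF h(4,6)[OF that]] by simp
  note bc = block_closed[THEN homog_carrier]
  let ?Q = "blk 0" and ?Y = "blk r" and ?P = "blk (2 * r)" and ?Z = "blk (3 * r)"
  have cs: "(\<Sum>k\<leftarrow>L. c k) = (\<Sum>k\<leftarrow>L. d k)"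
  proof -
    have "(\<Sum>k\<leftarrow>L. d k) = (\<Sum>k<r. c (\<tau> k))"
      using cd by (simp add: interv_sum_list_conv_sum_set_nat atLeast0LessThan)
    also have "\<dots> = (\<Sum>k<r. c k)" using sum.permute[OF \<tau>, of c] by (simp add: comp_def)
    finally show ?thesis by (simp add: interv_sum_list_conv_sum_set_nat atLeast0LessThan)
  qed
  let ?d = "\<Sum>k\<leftarrow>L. d k" and ?b = "\<Sum>k\<leftarrow>L. b k" and ?a = "\<Sum>k\<leftarrow>L. a k"
  have ZP: "?Z \<otimes>\<^bsub>A\<^esub> ?P = koszul ?d \<odot>\<^bsub>A\<^esub> (?P \<otimes>\<^bsub>A\<^esub> ?Z)"
    using supercommute[OF block_closed(4,3)] by (simp add: cs)
  have YQ: "?Y \<otimes>\<^bsub>A\<^esub> ?Q = koszul (?b * ?a) \<odot>\<^bsub>A\<^esub> (?Q \<otimes>\<^bsub>A\<^esub> ?Y)"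
    by (rule supercommute[OF block_closed(2,1)])
  have "?P \<otimes>\<^bsub>A\<^esub> ?Z \<in> homog A 0"
    using homog_mult[OF block_closed(3,4)] by (simp add: cs)
  then have PZQY: "(?P \<otimes>\<^bsub>A\<^esub> ?Z) \<otimes>\<^bsub>A\<^esub> (?Q \<otimes>\<^bsub>A\<^esub> ?Y) = (?Q \<otimes>\<^bsub>A\<^esub> ?Y) \<otimes>\<^bsub>A\<^esub> (?P \<otimes>\<^bsub>A\<^esub> ?Z)"
    by (rule even_commute) (use bc in simp)
  have "lprod A (map (\<lambda>k. lprod A (map gvar [r + k, 3 * r + k, 2 * r + \<tau> k, \<tau> k])) L) =
    lprod A (map (\<lambda>k. gvar (r + k) \<otimes>\<^bsub>A\<^esub> ((gvar (3 * r + k) \<otimes>\<^bsub>A\<^esub> gvar (2 * r + \<tau> k)) \<otimes>\<^bsub>A\<^esub> gvar (\<tau> k))) L)"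
    using hc by (intro arg_cong[of _ _ "lprod A"] map_cong refl) (simp add: m_assoc)
  also have "\<dots> = lprod A (map (\<lambda>k. gvar (3 * r + k) \<otimes>\<^bsub>A\<^esub> gvar (2 * r + \<tau> k)) L) \<otimes>\<^bsub>A\<^esub>
      lprod A (map (\<lambda>k. gvar (r + k) \<otimes>\<^bsub>A\<^esub> gvar (\<tau> k)) L)"
    by (rule lprod_pull_even) (use hc even in auto)
  also have "lprod A (map (\<lambda>k. gvar (3 * r + k) \<otimes>\<^bsub>A\<^esub> gvar (2 * r + \<tau> k)) L) = shuffle_sign d d L \<odot>\<^bsub>A\<^esub>
      (?Z \<otimes>\<^bsub>A\<^esub> lprod A (map (\<lambda>k. gvar (2 * r + \<tau> k)) L))"
    by (rule lprod_shuffle) (use h in auto)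
  also have "lprod A (map (\<lambda>k. gvar (2 * r + \<tau> k)) L) = koszul_sign c (map \<tau> L) \<odot>\<^bsub>A\<^esub> ?P"
    by (rule lprod_permute[OF \<tau>]) (use h in auto)
  also have "lprod A (map (\<lambda>k. gvar (r + k) \<otimes>\<^bsub>A\<^esub> gvar (\<tau> k)) L) =
      shuffle_sign b (\<lambda>k. a (\<tau> k)) L \<odot>\<^bsub>A\<^esub> (?Y \<otimes>\<^bsub>A\<^esub> lprod A (map (\<lambda>k. gvar (\<tau> k)) L))"
    by (rule lprod_shuffle) (use h in auto)
  also have "lprod A (map (\<lambda>k. gvar (\<tau> k)) L) = koszul_sign a (map \<tau> L) \<odot>\<^bsub>A\<^esub> ?Q"
    using lprod_permute[OF \<tau>, of gvar a] h(1) by simp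
  finally have "lprod A (map (\<lambda>k. lprod A (map gvar [r + k, 3 * r + k, 2 * r + \<tau> k, \<tau> k])) L) =
    (shuffle_sign d d L * koszul_sign c (map \<tau> L) * (koszul_sign a (map \<tau> L) * shuffle_sign b (\<lambda>k. a (\<tau> k)) L)) \<odot>\<^bsub>A\<^esub>
      ((?Z \<otimes>\<^bsub>A\<^esub> ?P) \<otimes>\<^bsub>A\<^esub> (?Y \<otimes>\<^bsub>A\<^esub> ?Q))"
    using bc by (simp add: smult_mult_left smult_mult_right smult_assoc[symmetric] smult_closed mult_ac)
  also have "(?Z \<otimes>\<^bsub>A\<^esub> ?P) \<otimes>\<^bsub>A\<^esub> (?Y \<otimes>\<^bsub>A\<^esub> ?Q) = (koszul ?d * koszul (?b * ?a)) \<odot>\<^bsub>A\<^esub>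
      ((?Q \<otimes>\<^bsub>A\<^esub> ?Y) \<otimes>\<^bsub>A\<^esub> (?P \<otimes>\<^bsub>A\<^esub> ?Z))"
    unfolding ZP YQ PZQY[symmetric] using bc
    by (simp add: smult_mult_left smult_mult_right smult_assoc[symmetric] smult_closed mult_ac)
  finally show ?thesis using block_top by (simp add: A_eq grassmann_simps(6))
qed

end

section \<open>Invariants commute with symmetrized matrix units\<close>

lemma full_polarization_cong:
  fixes f :: "'x list \<Rightarrow> 'k::field"
  assumes "\<And>k. k < r \<Longrightarrow> u k = v k"
  shows "full_polarization r par f u = full_polarization r par f v"
  unfolding full_polarization_def
proof (rule sum.cong[OF refl])
  fix \<sigma> assume "\<sigma> \<in> {\<sigma>. \<sigma> permutes {..<r}}"
  then have 1: "map (u \<circ> \<sigma>) [0..<r] = map (v \<circ> \<sigma>) [0..<r]"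
    and 2: "\<And>k. k \<in> set (map \<sigma> [0..<r]) \<Longrightarrow> par (u k) = par (v k)"
    using assms permutes_lessThan[of \<sigma> r] by auto
  have 3: "(koszul_sign (\<lambda>k. par (u k)) (map \<sigma> [0..<r]) :: 'k) = koszul_sign (\<lambda>k. par (v k)) (map \<sigma> [0..<r])"
    by (rule koszul_sign_cong) (rule 2)
  show "koszul_sign (\<lambda>k. par (u k)) (map \<sigma> [0..<r]) * f (map (u \<circ> \<sigma>) [0..<r]) =
      koszul_sign (\<lambda>k. par (v k)) (map \<sigma> [0..<r]) * f (map (v \<circ> \<sigma>) [0..<r])"
    unfolding 1 3 ..
qed

text \<open>
  Matrices given by lists of labelled entries \<open>\<mu> x\<close>, where \<open>C x i k\<close> tells at which places \<open>(i, k)\<close>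
  the entry \<open>\<mu> x\<close> occurs.
\<close>

lemma mat_mult_conditional:
  fixes \<mu> :: "'x \<Rightarrow> 'i::linorder set \<Rightarrow> 'k::field" and \<nu> :: "'y \<Rightarrow> 'i set \<Rightarrow> 'k"
  assumes I: "finite I" and fin: "finite U" "finite V"
    and U: "\<And>x. x \<in> U \<Longrightarrow> \<mu> x \<in> carrier (grassmann I p)" and V: "\<And>y. y \<in> V \<Longrightarrow> \<nu> y \<in> carrier (grassmann I p)"
  shows "mat_mult (grassmann I p) n (\<lambda>i k S. \<Sum>x\<in>U. if C x i k then \<mu> x S else 0)
      (\<lambda>k j S. \<Sum>y\<in>V. if C' y k j then \<nu> y S else 0) i j =
    (\<lambda>S. \<Sum>x\<in>U. \<Sum>y\<in>V. \<Sum>k<n. if C x i k \<and> C' y k j then monoid.mult (grassmann I p) (\<mu> x) (\<nu> y) S else 0)"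
proof -
  let ?A = "grassmann I p :: ('k, 'i set \<Rightarrow> 'k) salg"
  have car: "(\<lambda>S. \<Sum>x\<in>W. if P x then h x S else 0) \<in> carrier ?A"
    if "\<And>x. x \<in> W \<Longrightarrow> h x \<in> carrier ?A" for W P and h :: "'z \<Rightarrow> 'i set \<Rightarrow> 'k"
  proof -
    have "S \<subseteq> I" if nz: "(\<Sum>x\<in>W. if P x then h x S else 0) \<noteq> 0" for S
    proof -
      obtain x where x: "x \<in> W" "(if P x then h x S else 0) \<noteq> 0"
        using sum.not_neutral_contains_not_neutral[OF nz] .
      then have "h x S \<noteq> 0" by (simp split: if_splits)
      with \<open>\<And>x. x \<in> W \<Longrightarrow> h x \<in> carrier ?A\<close>[OF x(1)] show ?thesis by (simp add: grassmann_simps(1))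
    qed
    then show ?thesis by (simp add: grassmann_simps(1))
  qed
  have if_mult: "monoid.mult ?A (\<lambda>S. if P then f S else 0) (\<lambda>S. if P' then g S else 0) S =
      (if P \<and> P' then monoid.mult ?A f g S else 0)" for P P' f g S
    by (cases P; cases P'; simp add: grassmann_simps)
  show ?thesis
  proof
    fix S
    have "mat_mult ?A n (\<lambda>i k S. \<Sum>x\<in>U. if C x i k then \<mu> x S else 0)
        (\<lambda>k j S. \<Sum>y\<in>V. if C' y k j then \<nu> y S else 0) i j S =
      (\<Sum>k<n. monoid.mult ?A (\<lambda>S. \<Sum>x\<in>U. if C x i k then \<mu> x S else 0)
        (\<lambda>S. \<Sum>y\<in>V. if C' y k j then \<nu> y S else 0) S)"
      by (subst grassmann_mat_mult[OF I]) (auto intro!: car U V)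
    also have "\<dots> = (\<Sum>k<n. \<Sum>x\<in>U. \<Sum>y\<in>V. if C x i k \<and> C' y k j then monoid.mult ?A (\<mu> x) (\<nu> y) S else 0)"
    proof (intro sum.cong refl)
      fix k
      show "monoid.mult ?A (\<lambda>S. \<Sum>x\<in>U. if C x i k then \<mu> x S else 0)
          (\<lambda>S. \<Sum>y\<in>V. if C' y k j then \<nu> y S else 0) S =
        (\<Sum>x\<in>U. \<Sum>y\<in>V. if C x i k \<and> C' y k j then monoid.mult ?A (\<mu> x) (\<nu> y) S else 0)"
        unfolding grassmann_mult_sum[of I p "\<lambda>x S. if C x i k then \<mu> x S else 0" U
            "\<lambda>y S. if C' y k j then \<nu> y S else 0" V S] if_mult ..
    qed
    also have "\<dots> = (\<Sum>x\<in>U. \<Sum>k<n. \<Sum>y\<in>V. if C x i k \<and> C' y k j then monoid.mult ?A (\<mu> x) (\<nu> y) S else 0)"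
      by (rule sum.swap)
    also have "\<dots> = (\<Sum>x\<in>U. \<Sum>y\<in>V. \<Sum>k<n. if C x i k \<and> C' y k j then monoid.mult ?A (\<mu> x) (\<nu> y) S else 0)"
      by (intro sum.cong refl sum.swap)
    finally show "mat_mult ?A n (\<lambda>i k S. \<Sum>x\<in>U. if C x i k then \<mu> x S else 0)
        (\<lambda>k j S. \<Sum>y\<in>V. if C' y k j then \<nu> y S else 0) i j S =
      (\<Sum>x\<in>U. \<Sum>y\<in>V. \<Sum>k<n. if C x i k \<and> C' y k j then monoid.mult ?A (\<mu> x) (\<nu> y) S else 0)" .
  qed
qed

text \<open>
  A basis vector is a pair of a vertex and a number. Letting words of basis vectors mix the vertices
  puts the whole family \<open>V(a)\<close> into one tensor power, on which all permutations act.
\<close>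

definition vector_parity :: "'v superdim \<Rightarrow> ('v \<Rightarrow> bit) \<Rightarrow> 'v \<times> nat \<Rightarrow> bit" where
  "vector_parity \<alpha> b = (\<lambda>(a, n). basis_parity \<alpha> b a n)"

definition index_words :: "('v, 'e) pre_digraph \<Rightarrow> 'v superdim \<Rightarrow> nat \<Rightarrow> (nat \<Rightarrow> 'v \<times> nat) set" where
  "index_words Q \<alpha> r = {..<r} \<rightarrow>\<^sub>E {(a, n). a \<in> verts Q \<and> n < sdim \<alpha> a}"

definition index_words_at ::
  "('v, 'e) pre_digraph \<Rightarrow> 'v superdim \<Rightarrow> nat \<Rightarrow> (nat \<Rightarrow> 'v) \<Rightarrow> (nat \<Rightarrow> 'v \<times> nat) set" where
  "index_words_at Q \<alpha> r a = {w \<in> index_words Q \<alpha> r. \<forall>k<r. fst (w k) = a k}"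

text \<open>
  The matrix entry, in row \<open>i\<close> and column \<open>j\<close>, of the tensor defined by \<open>f\<close> and the edges \<open>e\<close>. The
  generators \<open>v\<^sub>i\<^sup>* \<otimes> v\<^sub>j\<close> mix row and column indices; the sign moves all row indices to the left.
\<close>

definition tensor_entry ::
  "('v, 'e) pre_digraph \<Rightarrow> 'v superdim \<Rightarrow> ('v \<Rightarrow> bit) \<Rightarrow> (('e \<times> nat \<times> nat) list \<Rightarrow> 'k::field) \<Rightarrow>
    nat \<Rightarrow> (nat \<Rightarrow> 'e) \<Rightarrow> (nat \<Rightarrow> 'v \<times> nat) \<Rightarrow> (nat \<Rightarrow> 'v \<times> nat) \<Rightarrow> 'k" where
  "tensor_entry Q \<alpha> b f r e i j =
    shuffle_sign (\<lambda>k. vector_parity \<alpha> b (i k)) (\<lambda>k. vector_parity \<alpha> b (j k)) [0..<r] *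
    full_polarization r (rep_parity Q \<alpha> b) f (\<lambda>k. (e k, snd (i k), snd (j k)))"

lemma index_word_fst:
  assumes "w \<in> index_words Q \<alpha> r" "k < r"
  shows "fst (w k) \<in> verts Q" "snd (w k) < sdim \<alpha> (fst (w k))"
proof -
  have "w k \<in> {(a, n). a \<in> verts Q \<and> n < sdim \<alpha> a}"
    using assms by (auto simp: index_words_def PiE_iff)
  then show "fst (w k) \<in> verts Q" "snd (w k) < sdim \<alpha> (fst (w k))" by auto
qed

lemma finite_index_words:
  assumes "fin_digraph Q"
  shows "finite (index_words Q \<alpha> r)" "finite (index_words_at Q \<alpha> r a)"
proof -
  interpret fin_digraph Q by (rule assms)
  have "finite {(a, n). a \<in> verts Q \<and> n < sdim \<alpha> a}"
    by (rule finite_subset[of _ "SIGMA a:verts Q. {..<sdim \<alpha> a}"]) auto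
  then show "finite (index_words Q \<alpha> r)" unfolding index_words_def by (intro finite_PiE) auto
  then show "finite (index_words_at Q \<alpha> r a)"
    by (rule finite_subset[rotated]) (auto simp: index_words_at_def)
qed

lemma index_word_permute:
  assumes "\<tau> permutes {..<r}" "w \<in> index_words Q \<alpha> r"
  shows "w \<circ> \<tau> \<in> index_words Q \<alpha> r"
  using assms(2) permutes_lessThan[OF assms(1)] permutes_not_in[OF assms(1)]
  by (auto simp: index_words_def PiE_iff extensional_def)

lemma index_word_comp_eq:
  assumes "w \<in> index_words Q \<alpha> r" "i \<in> index_words Q \<alpha> r" "\<tau> permutes {..<r}"
  shows "w \<circ> \<tau> = i \<longleftrightarrow> (\<forall>k<r. w (\<tau> k) = i k)"
proof
  assume *: "\<forall>k<r. w (\<tau> k) = i k"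
  show "w \<circ> \<tau> = i"
  proof
    fix k
    show "(w \<circ> \<tau>) k = i k"
    proof (cases "k < r")
      case False
      then have "\<tau> k = k" using assms(3) by (simp add: permutes_not_in)
      then show ?thesis using False assms(1,2) by (auto simp: index_words_def PiE_def extensional_def)
    qed (use * in simp)
  qed
qed auto

text \<open>
  Let \<open>Y\<close> be the representation with the entry \<open>y\<^sub>k z\<^sub>k\<close> at the place \<open>(i k, j k)\<close> of \<open>e k\<close>, for
  every \<open>k\<close>, and let \<open>g = 1 + \<Sum>\<^sub>l P\<^sub>l Q\<^sub>l E\<close> with the matrix unit \<open>E\<close> at \<open>(p l, q l)\<close>. All entries are even in
  the sense of supermatrices when the parities of \<open>y\<^sub>k, z\<^sub>k, P\<^sub>l, Q\<^sub>l\<close> are those of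
  \<open>i k, j k, p l, q l\<close>. Since \<open>g (Y g) g\<inverse> = g Y\<close>, an invariant takes the same value at \<open>Y g\<close> and at
  \<open>g Y\<close>. The two sides of the identity are, up to a common sign, the coefficients of the product of
  all generators in these values, \<open>g Y\<close> on the left and \<open>Y g\<close> on the right.
\<close>

theorem invariant_commutes:
  fixes f :: "('e \<times> nat \<times> nat) list \<Rightarrow> 'k::field_char_0" and Q :: "('v, 'e) pre_digraph"
  assumes Q: "fin_digraph Q"
    and f: "f \<in> carrier (tensor_salg (rep_gens Q \<alpha>) (rep_parity Q \<alpha> b))"
    and inv: "sym_class (rep_gens Q \<alpha>) (rep_parity Q \<alpha> b) f \<in> SI Q \<alpha> b"
    and e: "\<And>k. k < r \<Longrightarrow> e k \<in> arcs Q"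
    and i: "i \<in> index_words_at Q \<alpha> r (\<lambda>k. head Q (e k))"
    and j: "j \<in> index_words_at Q \<alpha> r (\<lambda>k. tail Q (e k))"
    and p: "p \<in> index_words Q \<alpha> r" and q: "q \<in> index_words Q \<alpha> r"
    and pq: "\<And>k. k < r \<Longrightarrow> fst (p k) = fst (q k)"
  defines "\<pi> \<equiv> vector_parity \<alpha> b"
  defines "sg \<equiv> perm_sign r \<pi>"
  defines "sh \<equiv> \<lambda>i j. shuffle_sign (\<lambda>k. \<pi> (i k)) (\<lambda>k. \<pi> (j k)) [0..<r]"
  defines "T \<equiv> tensor_entry Q \<alpha> b f r e"
  shows "(\<Sum>\<tau> | \<tau> permutes {..<r}. (if q \<circ> \<tau> = i then sg \<tau> q else 0) * (sg \<tau> p * T (p \<circ> \<tau>) j)) =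
    (sh j j * koszul (\<Sum>k\<leftarrow>[0..<r]. \<pi> (j k))) *
    (\<Sum>\<tau> | \<tau> permutes {..<r}. (if p \<circ> \<tau> = j then sg \<tau> p else 0) *
      (sh i i * koszul ((\<Sum>k\<leftarrow>[0..<r]. \<pi> (i k)) * (\<Sum>k\<leftarrow>[0..<r]. \<pi> (q k))) * sg \<tau> q * T i (q \<circ> \<tau>)))"
proof -
  interpret fin_digraph Q by (rule Q)
  define bp where "bp = block_parity r (\<lambda>k. \<pi> (q k)) (\<lambda>k. \<pi> (i k)) (\<lambda>k. \<pi> (p k)) (\<lambda>k. \<pi> (j k))"
  define A where "A = (grassmann {..<4 * r} bp :: ('k, nat set \<Rightarrow> 'k) salg)"
  define X where "X = rep_gens Q \<alpha>"
  define par where "par = rep_parity Q \<alpha> b"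
  have SA: "supercommutative_superalgebra A" unfolding A_def by (rule supercommutative_grassmann) simp
  interpret supercommutative_superalgebra A by (rule SA)
  note bl = block_homog[OF A_def[unfolded bp_def] permutes_id]
  have iW: "i \<in> index_words Q \<alpha> r" "\<And>k. k < r \<Longrightarrow> fst (i k) = head Q (e k)"
    and jW: "j \<in> index_words Q \<alpha> r" "\<And>k. k < r \<Longrightarrow> fst (j k) = tail Q (e k)"
    using i j by (auto simp: index_words_at_def)
  have dim: "snd (i k) < sdim \<alpha> (head Q (e k))" "snd (j k) < sdim \<alpha> (tail Q (e k))" if "k < r" for k
    using index_word_fst(2)[OF iW(1) that] index_word_fst(2)[OF jW(1) that] iW(2)[OF that] jW(2)[OF that]
    by simp_all
  have dimpq: "snd (p k) < sdim \<alpha> (fst (p k))" "snd (q k) < sdim \<alpha> (fst (p k))" if "k < r" for k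
    using index_word_fst(2)[OF p that] index_word_fst(2)[OF q that] pq[OF that] by simp_all
  \<comment> \<open>The term \<open>g l = P\<^sub>l Q\<^sub>l\<close> of the group element; the label \<open>l = r\<close> stands for the term 1.\<close>
  define u where "u l = (if l < r then [2 * r + l, l] else [])" for l
  define g where "g l = lprod A (map gvar (u l))" for l
  define yz where "yz k = lprod A (map gvar [r + k, 3 * r + k])" for k
  \<comment> \<open>The label \<open>(k, l)\<close> stands for the product of the \<open>l\<close>-th term of \<open>g\<close> and the \<open>k\<close>-th term of \<open>Y\<close>, in
    the order of \<open>g Y\<close> for the suffix \<open>L\<close> and of \<open>Y g\<close> for the suffix \<open>R\<close>. The sets \<open>NL\<close> and \<open>NR\<close> contain the
    labels of the nonzero products, and \<open>\<xi>L\<close> and \<open>\<xi>R\<close> give their places.\<close>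
  define vL where "vL = (\<lambda>(k, l). u l @ [r + k, 3 * r + k])"
  define vR where "vR = (\<lambda>(k, l). [r + k, 3 * r + k] @ u l)"
  define NL where "NL = {(k, l). k < r \<and> l \<le> r \<and> (l < r \<longrightarrow> q l = i k)}"
  define NR where "NR = {(k, l). k < r \<and> l \<le> r \<and> (l < r \<longrightarrow> p l = j k)}"
  define \<xi>L where "\<xi>L = (\<lambda>(k, l). (e k, if l < r then snd (p l) else snd (i k), snd (j k)))"
  define \<xi>R where "\<xi>R = (\<lambda>(k, l). (e k, snd (i k), if l < r then snd (q l) else snd (j k)))"
  define mL where "mL n = lprod A (map gvar (vL n))" for n
  define mR where "mR n = lprod A (map gvar (vR n))" for n
  define bL where "bL x = (\<lambda>S. \<Sum>n\<in>NL. if \<xi>L n = x then mL n S else 0)" for x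
  define bR where "bR x = (\<lambda>S. \<Sum>n\<in>NR. if \<xi>R n = x then mR n S else 0)" for x
  have gc: "set (map gvar (u l)) \<subseteq> carrier A" "set (map gvar [r + k, 3 * r + k]) \<subseteq> carrier A" if "k < r" for k l
    using bl[THEN homog_carrier] that by (auto simp: u_def)
  have mLg: "mL (k, l) = g l \<otimes>\<^bsub>A\<^esub> yz k" and mRg: "mR (k, l) = yz k \<otimes>\<^bsub>A\<^esub> g l" if "k < r" for k l
    using gc[OF that] unfolding mL_def mR_def g_def yz_def vL_def vR_def prod.case map_append
    by (simp_all only: lprod_append)
  have gh: "g l \<in> homog A (\<pi> (p l) + \<pi> (q l))" if "l < r" for l
    using bl(1,3)[OF that] homog_carrier[OF bl(1)[OF that]] that by (simp add: g_def u_def homog_mult)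
  have yzh: "yz k \<in> homog A (\<pi> (i k) + \<pi> (j k))" if "k < r" for k
    using bl(2,4)[OF that] homog_carrier[OF bl(4)[OF that]] by (simp add: yz_def homog_mult)
  have g1: "g r = \<one>\<^bsub>A\<^esub>" by (simp add: g_def u_def)
  have gc': "g l \<in> carrier A" if "l \<le> r" for l
    using gh[THEN homog_carrier] g1 that by (cases "l = r") auto
  have par_eq: "par (e', m, n) = \<pi> (head Q e', m) + \<pi> (tail Q e', n)" for e' m n
    by (simp add: par_def \<pi>_def rep_parity_def vector_parity_def)
  have hi: "(head Q (e k), snd (i k)) = i k" and tj: "(tail Q (e k), snd (j k)) = j k" if "k < r" for k
    using iW(2)[OF that] jW(2)[OF that] by (simp_all add: prod_eq_iff)
  have hp: "(head Q (e k), snd (p l)) = p l" if "k < r" "l < r" "q l = i k" for k l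
    using that iW(2) pq by (simp add: prod_eq_iff)
  have tq: "(tail Q (e k), snd (q l)) = q l" if "k < r" "l < r" "p l = j k" for k l
    using that jW(2) pq by (simp add: prod_eq_iff)
  have parL: "mL n \<in> homog A (par (\<xi>L n))" if nN: "n \<in> NL" for n
  proof -
    obtain k l where n: "n = (k, l)" "k < r" "l \<le> r" "l < r \<longrightarrow> q l = i k"
      using nN by (cases n) (auto simp: NL_def)
    show ?thesis
    proof (cases "l < r")
      case True
      have "g l \<otimes>\<^bsub>A\<^esub> yz k \<in> homog A ((\<pi> (p l) + \<pi> (q l)) + (\<pi> (i k) + \<pi> (j k)))"
        by (rule homog_mult[OF gh[OF True] yzh[OF n(2)]])
      then show ?thesis using n True by (simp add: mLg \<xi>L_def par_eq hp tj add.assoc)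
    next
      case False
      then show ?thesis
        using n yzh[OF n(2)] homog_carrier[OF yzh[OF n(2)]] by (simp add: mLg \<xi>L_def par_eq hi tj g1)
    qed
  qed
  have parR: "mR n \<in> homog A (par (\<xi>R n))" if nN: "n \<in> NR" for n
  proof -
    obtain k l where n: "n = (k, l)" "k < r" "l \<le> r" "l < r \<longrightarrow> p l = j k"
      using nN by (cases n) (auto simp: NR_def)
    show ?thesis
    proof (cases "l < r")
      case True
      have "yz k \<otimes>\<^bsub>A\<^esub> g l \<in> homog A ((\<pi> (i k) + \<pi> (j k)) + (\<pi> (p l) + \<pi> (q l)))"
        by (rule homog_mult[OF yzh[OF n(2)] gh[OF True]])
      then show ?thesis using n True by (simp add: mRg \<xi>R_def par_eq hi tq add.assoc)
    next
      case False
      then show ?thesis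
        using n yzh[OF n(2)] homog_carrier[OF yzh[OF n(2)]] by (simp add: mRg \<xi>R_def par_eq hi tj g1)
    qed
  qed
  have XL: "\<xi>L n \<in> X" if nN: "n \<in> NL" for n
  proof -
    obtain k l where n: "n = (k, l)" "k < r" "l \<le> r" "l < r \<longrightarrow> q l = i k"
      using nN by (cases n) (auto simp: NL_def)
    have "snd (p l) < sdim \<alpha> (head Q (e k))" if "l < r"
      using dimpq(1)[OF that] pq[OF that] iW(2)[OF n(2)] n(4) that by simp
    then show ?thesis using e[OF n(2)] dim[OF n(2)] n(1) by (auto simp: \<xi>L_def X_def rep_gens_def)
  qed
  have XR: "\<xi>R n \<in> X" if nN: "n \<in> NR" for n
  proof -
    obtain k l where n: "n = (k, l)" "k < r" "l \<le> r" "l < r \<longrightarrow> p l = j k"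
      using nN by (cases n) (auto simp: NR_def)
    have "snd (q l) < sdim \<alpha> (tail Q (e k))" if "l < r"
      using dimpq(2)[OF that] jW(2)[OF n(2)] n(4) that by simp
    then show ?thesis using e[OF n(2)] dim[OF n(2)] n(1) by (auto simp: \<xi>R_def X_def rep_gens_def)
  qed
  have vLs: "\<forall>k<r. \<forall>l\<le>r. set (vL (k, l)) = {r + k, 3 * r + k} \<union> (if l < r then {l, 2 * r + l} else {})"
    and vRs: "\<forall>k<r. \<forall>l\<le>r. set (vR (k, l)) = {r + k, 3 * r + k} \<union> (if l < r then {l, 2 * r + l} else {})"
    by (auto simp: vL_def vR_def u_def)
  have NLs: "NL \<subseteq> {..<r} \<times> {..r}" and NRs: "NR \<subseteq> {..<r} \<times> {..r}" by (auto simp: NL_def NR_def)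
  have finN: "finite NL" "finite NR" using NLs NRs finite_subset by (metis finite_SigmaI finite_lessThan finite_atMost)+
  have fT: "f \<in> carrier (tensor_salg X par)" using f by (simp add: X_def par_def)
  have bL_eq: "bL = (\<lambda>x S. \<Sum>n\<in>NL. if \<xi>L n = x then mL n S else 0)"
    and bR_eq: "bR = (\<lambda>x S. \<Sum>n\<in>NR. if \<xi>R n = x then mR n S else 0)"
    by (intro ext, simp add: bL_def bR_def)+
  have evL: "tensor_eval A bL f {..<4 * r} = (\<Sum>\<tau> | \<tau> permutes {..<r} \<and> (\<forall>k<r. (k, \<tau> k) \<in> NL).
      full_polarization r par f (\<lambda>k. \<xi>L (k, \<tau> k)) * lprod A (map (\<lambda>k. mL (k, \<tau> k)) [0..<r]) {..<4 * r})"
    unfolding bL_eq A_def mL_def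
    by (rule multilinear_coefficient[OF NLs fT _ vLs]) (use XL parL in \<open>auto simp: mL_def A_def\<close>)
  have evR: "tensor_eval A bR f {..<4 * r} = (\<Sum>\<tau> | \<tau> permutes {..<r} \<and> (\<forall>k<r. (k, \<tau> k) \<in> NR).
      full_polarization r par f (\<lambda>k. \<xi>R (k, \<tau> k)) * lprod A (map (\<lambda>k. mR (k, \<tau> k)) [0..<r]) {..<4 * r})"
    unfolding bR_eq A_def mR_def
    by (rule multilinear_coefficient[OF NRs fT _ vRs]) (use XR parR in \<open>auto simp: mR_def A_def\<close>)
  have bLh: "\<forall>x\<in>X. bL x \<in> homog A (par x)"
  proof (intro ballI)
    fix x
    show "bL x \<in> homog A (par x)"
      unfolding bL_def A_def
    proof (rule grassmann_conditional_sum)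
      fix n assume "n \<in> NL" "\<xi>L n = x"
      then show "mL n \<in> homog (grassmann {..<4 * r} bp) (par x)" using parL[of n] by (simp add: A_def)
    qed (simp_all add: finN)
  qed
  have bRh: "\<forall>x\<in>X. bR x \<in> homog A (par x)"
  proof (intro ballI)
    fix x
    show "bR x \<in> homog A (par x)"
      unfolding bR_def A_def
    proof (rule grassmann_conditional_sum)
      fix n assume "n \<in> NR" "\<xi>R n = x"
      then show "mR n \<in> homog (grassmann {..<4 * r} bp) (par x)" using parR[of n] by (simp add: A_def)
    qed (simp_all add: finN)
  qed
  \<comment> \<open>Here \<open>bL\<close> and \<open>bR\<close> are the entries of \<open>g Y\<close> and \<open>Y g\<close>, and invariance is applied.\<close>
  have same: "tensor_eval A bL f = tensor_eval A bR f"
  proof -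
    define G where "G a m n = (\<lambda>S. \<Sum>l\<in>{..r}.
        if (if l < r then p l = (a, m) \<and> q l = (a, n) else m = n) then g l S else 0)" for a m n
    define Y where "Y e' m n = (\<lambda>S. \<Sum>k<r. if e k = e' \<and> snd (i k) = m \<and> snd (j k) = n then yz k S else 0)"
      for e' m n
    let ?s = "basis_parity \<alpha> (\<lambda>_. 0)"
    have ps: "\<pi> (a, m) + \<pi> (a, n) = ?s a m + ?s a n" for a m n
      by (simp add: \<pi>_def vector_parity_def basis_parity_def add_ac)
    have Gh: "G a m n \<in> homog A (?s a m + ?s a n)" for a m n
      unfolding G_def A_def
    proof (rule grassmann_conditional_sum)
      fix l assume l: "l \<in> {..r}" "if l < r then p l = (a, m) \<and> q l = (a, n) else m = n"
      show "g l \<in> homog (grassmann {..<4 * r} bp) (?s a m + ?s a n)"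
      proof (cases "l < r")
        case True
        then show ?thesis using gh[OF True] l(2) ps[of a m n] by (simp add: A_def)
      next
        case False
        then show ?thesis using l g1 homog_one by (simp add: A_def)
      qed
    qed simp_all
    have g0: "g l {} = 0" if "l < r" for l
      using that unfolding g_def A_def lprod_gvar by (simp add: u_def)
    have G0: "G a m n {} = (if m = n then 1 else 0)" for a m n
    proof -
      have "G a m n {} = (\<Sum>l\<in>{..<r}. 0) + (if m = n then g r {} else 0)"
        unfolding G_def lessThan_Suc_atMost[symmetric] sum.lessThan_Suc
        by (intro arg_cong2[of _ _ _ _ "(+)"] sum.cong) (simp_all add: g0)
      then show ?thesis by (simp add: g1 A_def grassmann_simps)
    qed
    have "\<exists>H. (\<forall>m<sdim \<alpha> a. \<forall>n<sdim \<alpha> a. H m n \<in> homog A (?s a m + ?s a n)) \<and>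
        mat_eq (sdim \<alpha> a) (sdim \<alpha> a) (mat_mult A (sdim \<alpha> a) (G a) H) (mat_one A) \<and>
        mat_eq (sdim \<alpha> a) (sdim \<alpha> a) (mat_mult A (sdim \<alpha> a) H (G a)) (mat_one A)" for a
      unfolding A_def by (rule unipotent_inverse) (use Gh G0 in \<open>simp_all add: A_def\<close>)
    then obtain H where H: "\<And>a m n. m < sdim \<alpha> a \<Longrightarrow> n < sdim \<alpha> a \<Longrightarrow> H a m n \<in> homog A (?s a m + ?s a n)"
      "\<And>a. mat_eq (sdim \<alpha> a) (sdim \<alpha> a) (mat_mult A (sdim \<alpha> a) (G a) (H a)) (mat_one A)"
      "\<And>a. mat_eq (sdim \<alpha> a) (sdim \<alpha> a) (mat_mult A (sdim \<alpha> a) (H a) (G a)) (mat_one A)"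
      by metis
    have GL: "(G, H) \<in> GL_points A Q \<alpha>"
      unfolding GL_points_def even_endo_def Let_def using Gh H by auto
    have gcar: "\<And>l. l \<in> {..r} \<Longrightarrow> g l \<in> carrier (grassmann {..<4 * r} bp)"
      and yzcar: "\<And>k. k \<in> {..<r} \<Longrightarrow> yz k \<in> carrier (grassmann {..<4 * r} bp)"
      using gc' yzh[THEN homog_carrier] by (simp_all add: A_def)
    have GY: "mat_mult A (sdim \<alpha> (head Q e')) (G (head Q e')) (Y e') m n = bL (e', m, n)" for e' m n
    proof
      fix S
      let ?d = "sdim \<alpha> (head Q e')"
      let ?C = "\<lambda>l m m'. if l < r then p l = (head Q e', m) \<and> q l = (head Q e', m') else m = m'"
      let ?C' = "\<lambda>k m' n. e k = e' \<and> snd (i k) = m' \<and> snd (j k) = n"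
      have "mat_mult A ?d (G (head Q e')) (Y e') m n S =
        (\<Sum>l\<in>{..r}. \<Sum>k<r. \<Sum>m'<?d. if ?C l m m' \<and> ?C' k m' n then (g l \<otimes>\<^bsub>A\<^esub> yz k) S else 0)"
        unfolding G_def[abs_def] Y_def[abs_def] A_def
        by (subst mat_mult_conditional) (use gcar yzcar in auto)
      also have "\<dots> = (\<Sum>l\<in>{..r}. \<Sum>k<r. if (k, l) \<in> NL \<and> \<xi>L (k, l) = (e', m, n) then mL (k, l) S else 0)"
      proof (intro sum.cong refl)
        fix l k assume lk: "l \<in> {..r}" "k \<in> {..<r}"
        have "(\<Sum>m'<?d. if ?C l m m' \<and> ?C' k m' n then (g l \<otimes>\<^bsub>A\<^esub> yz k) S else 0) =
          (\<Sum>m'<?d. if m' = snd (i k) then (if ?C l m (snd (i k)) \<and> e k = e' \<and> snd (j k) = n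
            then (g l \<otimes>\<^bsub>A\<^esub> yz k) S else 0) else 0)"
          by (intro sum.cong refl) auto
        also have "\<dots> = (if snd (i k) < ?d \<and> ?C l m (snd (i k)) \<and> e k = e' \<and> snd (j k) = n
            then (g l \<otimes>\<^bsub>A\<^esub> yz k) S else 0)" by simp
        also have "(snd (i k) < ?d \<and> ?C l m (snd (i k)) \<and> e k = e' \<and> snd (j k) = n) \<longleftrightarrow>
            (k, l) \<in> NL \<and> \<xi>L (k, l) = (e', m, n)"
          using lk dim(1)[of k] iW(2)[of k] pq[of l]
          by (auto simp: NL_def \<xi>L_def prod_eq_iff split: if_splits)
        finally show "(\<Sum>m'<?d. if ?C l m m' \<and> ?C' k m' n then (g l \<otimes>\<^bsub>A\<^esub> yz k) S else 0) =
          (if (k, l) \<in> NL \<and> \<xi>L (k, l) = (e', m, n) then mL (k, l) S else 0)"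
          using lk mLg by simp
      qed
      also have "\<dots> = (\<Sum>k<r. \<Sum>l\<in>{..r}. if (k, l) \<in> NL \<and> \<xi>L (k, l) = (e', m, n) then mL (k, l) S else 0)"
        by (rule sum.swap)
      also have "\<dots> = (\<Sum>x\<in>{..<r} \<times> {..r}. if x \<in> NL \<and> \<xi>L x = (e', m, n) then mL x S else 0)"
        unfolding sum.cartesian_product by (intro sum.cong refl) auto
      also have "\<dots> = bL (e', m, n) S"
        unfolding bL_def using NLs finN by (intro sum.mono_neutral_cong_right) auto
      finally show "mat_mult A ?d (G (head Q e')) (Y e') m n S = bL (e', m, n) S" .
    qed
    have YG: "mat_mult A (sdim \<alpha> (tail Q e')) (Y e') (G (tail Q e')) m n = bR (e', m, n)" for e' m n
    proof
      fix S
      let ?d = "sdim \<alpha> (tail Q e')"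
      let ?C = "\<lambda>l m' n. if l < r then p l = (tail Q e', m') \<and> q l = (tail Q e', n) else m' = n"
      let ?C' = "\<lambda>k m m'. e k = e' \<and> snd (i k) = m \<and> snd (j k) = m'"
      have "mat_mult A ?d (Y e') (G (tail Q e')) m n S =
        (\<Sum>k<r. \<Sum>l\<in>{..r}. \<Sum>m'<?d. if ?C' k m m' \<and> ?C l m' n then (yz k \<otimes>\<^bsub>A\<^esub> g l) S else 0)"
        unfolding G_def[abs_def] Y_def[abs_def] A_def
        by (subst mat_mult_conditional) (use gcar yzcar in auto)
      also have "\<dots> = (\<Sum>k<r. \<Sum>l\<in>{..r}. if (k, l) \<in> NR \<and> \<xi>R (k, l) = (e', m, n) then mR (k, l) S else 0)"
      proof (intro sum.cong refl)
        fix l k assume lk: "l \<in> {..r}" "k \<in> {..<r}"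
        have "(\<Sum>m'<?d. if ?C' k m m' \<and> ?C l m' n then (yz k \<otimes>\<^bsub>A\<^esub> g l) S else 0) =
          (\<Sum>m'<?d. if m' = snd (j k) then (if ?C l (snd (j k)) n \<and> e k = e' \<and> snd (i k) = m
            then (yz k \<otimes>\<^bsub>A\<^esub> g l) S else 0) else 0)"
          by (intro sum.cong refl) auto
        also have "\<dots> = (if snd (j k) < ?d \<and> ?C l (snd (j k)) n \<and> e k = e' \<and> snd (i k) = m
            then (yz k \<otimes>\<^bsub>A\<^esub> g l) S else 0)" by simp
        also have "(snd (j k) < ?d \<and> ?C l (snd (j k)) n \<and> e k = e' \<and> snd (i k) = m) \<longleftrightarrow>
            (k, l) \<in> NR \<and> \<xi>R (k, l) = (e', m, n)"
          using lk dim(2)[of k] jW(2)[of k] pq[of l]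
          by (auto simp: NR_def \<xi>R_def prod_eq_iff split: if_splits)
        finally show "(\<Sum>m'<?d. if ?C' k m m' \<and> ?C l m' n then (yz k \<otimes>\<^bsub>A\<^esub> g l) S else 0) =
          (if (k, l) \<in> NR \<and> \<xi>R (k, l) = (e', m, n) then mR (k, l) S else 0)"
          using lk mRg by simp
      qed
      also have "\<dots> = (\<Sum>x\<in>{..<r} \<times> {..r}. if x \<in> NR \<and> \<xi>R x = (e', m, n) then mR x S else 0)"
        unfolding sum.cartesian_product by (intro sum.cong refl) auto
      also have "\<dots> = bR (e', m, n) S"
        unfolding bR_def using NRs finN by (intro sum.mono_neutral_cong_right) auto
      finally show "mat_mult A ?d (Y e') (G (tail Q e')) m n S = bR (e', m, n) S" .
    qed
    have GO: "mat_over A (sdim \<alpha> a) (sdim \<alpha> a) (G a)" "mat_over A (sdim \<alpha> a) (sdim \<alpha> a) (H a)" for a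
      using Gh[THEN homog_carrier] H(1)[THEN homog_carrier] by (auto simp: mat_over_def)
    have "Y e' m n \<in> carrier A" for e' m n
    proof -
      have "Y e' m n \<in> homog A (\<pi> (head Q e', m) + \<pi> (tail Q e', n))"
        unfolding Y_def A_def
      proof (rule grassmann_conditional_sum)
        fix k assume k: "k \<in> {..<r}" "e k = e' \<and> snd (i k) = m \<and> snd (j k) = n"
        then have "i k = (head Q e', m)" "j k = (tail Q e', n)"
          using iW(2) jW(2) by (auto simp: prod_eq_iff)
        then show "yz k \<in> homog (grassmann {..<4 * r} bp) (\<pi> (head Q e', m) + \<pi> (tail Q e', n))"
          using yzh[of k] k(1) by (simp add: A_def)
      qed simp_all
      then show ?thesis by (rule homog_carrier)
    qed
    then have YO: "mat_over A (sdim \<alpha> (head Q e')) (sdim \<alpha> (tail Q e')) (Y e')" for e'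
      by (simp add: mat_over_def)
    let ?\<phi> = "sym_lift A bR" and ?\<psi> = "sym_lift A bL"
    have \<phi>: "?\<phi> \<in> salg_hom (K_SRep Q \<alpha> b) A" "\<And>x. x \<in> X \<Longrightarrow> ?\<phi> (Sym_gen X par x) = bR x"
      and \<psi>: "?\<psi> \<in> salg_hom (K_SRep Q \<alpha> b) A" "\<And>x. x \<in> X \<Longrightarrow> ?\<psi> (Sym_gen X par x) = bL x"
      using sym_lift_hom[OF SA bRh] sym_lift_hom[OF SA bLh] by (simp_all add: K_SRep_def X_def par_def)
    have "is_transform A Q \<alpha> b (G, H) ?\<phi> ?\<psi>"
      unfolding is_transform_def prod.case
    proof
      fix e' assume e': "e' \<in> arcs Q"
      let ?h = "sdim \<alpha> (head Q e')" and ?t = "sdim \<alpha> (tail Q e')"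
      have gen: "generic_matrix Q \<alpha> b e' m n = Sym_gen X par (e', m, n)" for m n
        by (simp add: generic_matrix_def X_def par_def)
      have inX: "(e', m, n) \<in> X" if "m < ?h" "n < ?t" for m n
        using that e' by (simp add: X_def rep_gens_def)
      have 1: "mat_eq ?h ?t (\<lambda>m n. ?\<phi> (generic_matrix Q \<alpha> b e' m n)) (mat_mult A ?t (Y e') (G (tail Q e')))"
        using \<phi>(2) inX by (auto simp: mat_eq_def gen YG)
      have "mat_eq ?h ?t (mat_mult A ?t (\<lambda>m n. ?\<phi> (generic_matrix Q \<alpha> b e' m n)) (H (tail Q e')))
          (mat_mult A ?t (mat_mult A ?t (Y e') (G (tail Q e'))) (H (tail Q e')))"
        by (rule mat_mult_cong[OF 1 mat_eq_refl mat_over_mult[OF YO GO(1)] GO(2)])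
      also have "mat_eq ?h ?t \<dots> (mat_mult A ?t (Y e') (mat_mult A ?t (G (tail Q e')) (H (tail Q e'))))"
        by (rule mat_mult_assoc[OF YO GO])
      also have "mat_eq ?h ?t \<dots> (mat_mult A ?t (Y e') (mat_one A))"
        by (rule mat_mult_cong[OF mat_eq_refl H(2) YO mat_over_one])
      also have "mat_eq ?h ?t \<dots> (Y e')" by (rule mat_mult_one_right[OF YO])
      finally have 2: "mat_eq ?h ?t (mat_mult A ?t (\<lambda>m n. ?\<phi> (generic_matrix Q \<alpha> b e' m n)) (H (tail Q e'))) (Y e')" .
      have "mat_eq ?h ?t (\<lambda>m n. ?\<psi> (generic_matrix Q \<alpha> b e' m n)) (mat_mult A ?h (G (head Q e')) (Y e'))"
        using \<psi>(2) inX by (auto simp: mat_eq_def gen GY)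
      also have "mat_eq ?h ?t \<dots> (mat_mult A ?h (G (head Q e'))
          (mat_mult A ?t (\<lambda>m n. ?\<phi> (generic_matrix Q \<alpha> b e' m n)) (H (tail Q e'))))"
        by (rule mat_mult_cong[OF mat_eq_refl mat_eq_sym[OF 2] GO(1) mat_over_cong[OF 2 YO]])
      finally show "mat_eq ?h ?t (\<lambda>m n. ?\<psi> (generic_matrix Q \<alpha> b e' m n)) (mat_mult A ?h (G (head Q e'))
          (mat_mult A ?t (\<lambda>m n. ?\<phi> (generic_matrix Q \<alpha> b e' m n)) (H (tail Q e'))))" .
    qed
    then have "?\<psi> (sym_class X par f) = ?\<phi> (sym_class X par f)"
      \<comment> \<open>The carrier of the Grassmann algebra consists of functions on sets of naturals, not on
        naturals, hence the change of the type over which invariance is tested.\<close>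
      using invariant_over_any[OF Q inv, where ?'a = "nat set \<Rightarrow> 'k"] SA GL \<phi>(1) \<psi>(1)
      unfolding invariant_over_def X_def par_def by blast
    then show ?thesis
      using sym_lift_class[OF SA bRh fT] sym_lift_class[OF SA bLh fT] by simp
  qed
  have L: "tensor_eval A bL f {..<4 * r} =
    sh i i * (\<Sum>\<tau> | \<tau> permutes {..<r}. (if q \<circ> \<tau> = i then sg \<tau> q else 0) * (sg \<tau> p * T (p \<circ> \<tau>) j))"
  proof -
    have s: "{\<tau>. \<tau> permutes {..<r} \<and> (\<forall>k<r. (k, \<tau> k) \<in> NL)} = {\<tau>. \<tau> permutes {..<r} \<and> q \<circ> \<tau> = i}"
    proof (intro Collect_cong conj_cong refl)
      fix \<tau> :: "nat \<Rightarrow> nat" assume "\<tau> permutes {..<r}"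
      then show "(\<forall>k<r. (k, \<tau> k) \<in> NL) \<longleftrightarrow> q \<circ> \<tau> = i"
        using index_word_comp_eq[OF q iW(1)] permutes_lessThan[of \<tau> r] by (simp add: NL_def less_imp_le)
    qed
    have t: "full_polarization r par f (\<lambda>k. \<xi>L (k, \<tau> k)) * lprod A (map (\<lambda>k. mL (k, \<tau> k)) [0..<r]) {..<4 * r} =
        sh i i * (sg \<tau> q * (sg \<tau> p * T (p \<circ> \<tau>) j))" if \<tau>: "\<tau> permutes {..<r}" "q \<circ> \<tau> = i" for \<tau>
    proof -
      have "full_polarization r par f (\<lambda>k. \<xi>L (k, \<tau> k)) =
          full_polarization r par f (\<lambda>k. (e k, snd ((p \<circ> \<tau>) k), snd (j k)))"
        by (rule full_polarization_cong) (use permutes_lessThan[OF \<tau>(1)] in \<open>simp add: \<xi>L_def\<close>)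
      moreover have "lprod A (map (\<lambda>k. mL (k, \<tau> k)) [0..<r]) =
          lprod A (map (\<lambda>k. lprod A (map gvar [2 * r + \<tau> k, \<tau> k, r + k, 3 * r + k])) [0..<r])"
        by (intro arg_cong[of _ _ "lprod A"] map_cong refl)
          (use permutes_lessThan[OF \<tau>(1)] in \<open>simp add: mL_def vL_def u_def\<close>)
      moreover have "\<pi> (q (\<tau> k)) = \<pi> (i k)" for k using fun_cong[OF \<tau>(2), of k] by simp
      ultimately show ?thesis
        using contraction_coefficient_left[OF A_def[unfolded bp_def] \<tau>(1)]
        by (simp add: sh_def sg_def perm_sign_def T_def tensor_entry_def \<pi>_def par_def mult_ac)
    qed
    show ?thesis unfolding evL s sum_distrib_left
      by (rule sum.mono_neutral_cong_left) (auto simp: finite_permutations t)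
  qed
  have R: "tensor_eval A bR f {..<4 * r} =
    (sh j j * koszul (\<Sum>k\<leftarrow>[0..<r]. \<pi> (j k))) *
    (\<Sum>\<tau> | \<tau> permutes {..<r}. (if p \<circ> \<tau> = j then sg \<tau> p else 0) *
      (koszul ((\<Sum>k\<leftarrow>[0..<r]. \<pi> (i k)) * (\<Sum>k\<leftarrow>[0..<r]. \<pi> (q k))) * sg \<tau> q * T i (q \<circ> \<tau>)))"
  proof -
    have s: "{\<tau>. \<tau> permutes {..<r} \<and> (\<forall>k<r. (k, \<tau> k) \<in> NR)} = {\<tau>. \<tau> permutes {..<r} \<and> p \<circ> \<tau> = j}"
    proof (intro Collect_cong conj_cong refl)
      fix \<tau> :: "nat \<Rightarrow> nat" assume "\<tau> permutes {..<r}"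
      then show "(\<forall>k<r. (k, \<tau> k) \<in> NR) \<longleftrightarrow> p \<circ> \<tau> = j"
        using index_word_comp_eq[OF p jW(1)] permutes_lessThan[of \<tau> r] by (simp add: NR_def less_imp_le)
    qed
    have t: "full_polarization r par f (\<lambda>k. \<xi>R (k, \<tau> k)) * lprod A (map (\<lambda>k. mR (k, \<tau> k)) [0..<r]) {..<4 * r} =
        (sh j j * koszul (\<Sum>k\<leftarrow>[0..<r]. \<pi> (j k))) * (sg \<tau> p *
      (koszul ((\<Sum>k\<leftarrow>[0..<r]. \<pi> (i k)) * (\<Sum>k\<leftarrow>[0..<r]. \<pi> (q k))) * sg \<tau> q * T i (q \<circ> \<tau>)))"
      if \<tau>: "\<tau> permutes {..<r}" "p \<circ> \<tau> = j" for \<tau>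
    proof -
      have "full_polarization r par f (\<lambda>k. \<xi>R (k, \<tau> k)) =
          full_polarization r par f (\<lambda>k. (e k, snd (i k), snd ((q \<circ> \<tau>) k)))"
        by (rule full_polarization_cong) (use permutes_lessThan[OF \<tau>(1)] in \<open>simp add: \<xi>R_def\<close>)
      moreover have "lprod A (map (\<lambda>k. mR (k, \<tau> k)) [0..<r]) =
          lprod A (map (\<lambda>k. lprod A (map gvar [r + k, 3 * r + k, 2 * r + \<tau> k, \<tau> k])) [0..<r])"
        by (intro arg_cong[of _ _ "lprod A"] map_cong refl)
          (use permutes_lessThan[OF \<tau>(1)] in \<open>simp add: mR_def vR_def u_def\<close>)
      moreover have "\<pi> (p (\<tau> k)) = \<pi> (j k)" for k using fun_cong[OF \<tau>(2), of k] by simp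
      moreover note contraction_coefficient_right[OF A_def[unfolded bp_def] \<tau>(1)]
      ultimately have "full_polarization r par f (\<lambda>k. \<xi>R (k, \<tau> k)) *
          lprod A (map (\<lambda>k. mR (k, \<tau> k)) [0..<r]) {..<4 * r} =
        full_polarization r par f (\<lambda>k. (e k, snd (i k), snd ((q \<circ> \<tau>) k))) *
          (sh j j * koszul (\<Sum>k\<leftarrow>[0..<r]. \<pi> (j k)) * sg \<tau> p * (sg \<tau> q * sh i (q \<circ> \<tau>) *
            koszul ((\<Sum>k\<leftarrow>[0..<r]. \<pi> (i k)) * (\<Sum>k\<leftarrow>[0..<r]. \<pi> (q k)))))"
        by (simp add: sh_def sg_def perm_sign_def)
      moreover have "T i (q \<circ> \<tau>) = sh i (q \<circ> \<tau>) *
          full_polarization r par f (\<lambda>k. (e k, snd (i k), snd ((q \<circ> \<tau>) k)))"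
        by (simp only: T_def tensor_entry_def sh_def \<pi>_def par_def)
      ultimately show ?thesis by (simp only: mult_ac)
    qed
    show ?thesis unfolding evR s sum_distrib_left
      by (rule sum.mono_neutral_cong_left) (auto simp: finite_permutations t)
  qed
  have sq: "sh i i * sh i i = 1" unfolding sh_def by (rule shuffle_sign_square)
  show ?thesis (is "?l = ?e * ?r")
  proof -
    have "?l = sh i i * (sh i i * ?l)" by (simp only: mult.assoc[symmetric] sq) simp
    also have "sh i i * ?l = tensor_eval A bR f {..<4 * r}" using L same by simp
    also have "sh i i * \<dots> = ?e * ?r"
      unfolding R sum_distrib_left by (intro sum.cong refl) (simp add: mult_ac)
    finally show ?thesis .
  qed
qed

section \<open>Tensors which represent polynomials in supertraces\<close>

lemma sum_PiE_insert:
  assumes "x \<notin> S"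
  shows "(\<Sum>I\<in>PiE (insert x S) D. g I) = (\<Sum>m\<in>D x. \<Sum>I\<in>PiE S D. g (I(x := m)))"
proof -
  have "(\<Sum>I\<in>PiE (insert x S) D. g I) = (\<Sum>(m, I)\<in>D x \<times> PiE S D. g (I(x := m)))"
    unfolding PiE_insert_eq by (subst sum.reindex[OF inj_combinator[OF assms]]) (simp add: comp_def split_def)
  then show ?thesis by (simp add: sum.cartesian_product)
qed

lemma sum_PiE_Un:
  assumes "A \<inter> B = {}"
  shows "(\<Sum>K\<in>PiE (A \<union> B) D. g K) = (\<Sum>I\<in>PiE A D. \<Sum>J\<in>PiE B D. g (\<lambda>k. if k \<in> A then I k else J k))"
proof -
  have "(\<Sum>K\<in>PiE (A \<union> B) D. g K) =
      (\<Sum>(I, J)\<in>PiE A D \<times> PiE B D. g (\<lambda>k. if k \<in> A then I k else J k))"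
  proof (rule sum.reindex_bij_witness[of _ "\<lambda>(I, J) k. if k \<in> A then I k else J k"
        "\<lambda>K. (restrict K A, restrict K B)"], goal_cases)
    case (1 K)
    then show ?case by (auto simp: PiE_def extensional_def)
  next
    case (2 K)
    then show ?case by (auto simp: PiE_def)
  next
    case (3 IJ)
    have "restrict (\<lambda>k. if k \<in> A then I k else J k) A = I" "restrict (\<lambda>k. if k \<in> A then I k else J k) B = J"
      if "I \<in> PiE A D" "J \<in> PiE B D" for I J
      by (intro ext; use that assms in \<open>auto simp: PiE_def extensional_def restrict_def\<close>)+
    then show ?case using 3 by auto
  next
    case (4 IJ)
    then show ?case by (auto simp: PiE_def extensional_def)
  next
    case (5 K)
    have "(\<lambda>k. if k \<in> A then restrict K A k else restrict K B k) = K"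
      using 5 by (auto simp: PiE_def extensional_def)
    then show ?case by simp
  qed
  then show ?thesis by (simp add: sum.cartesian_product)
qed

lemma tensor_zero_closed: "(\<lambda>w. 0) \<in> carrier (tensor_salg X par)"
  by (simp add: tensor_salg_simps)

lemma tensor_sum_closed:
  assumes "finite N" "\<And>n. n \<in> N \<Longrightarrow> g n \<in> carrier (tensor_salg X par)"
  shows "(\<lambda>w. \<Sum>n\<in>N. g n w :: 'k::field) \<in> carrier (tensor_salg X par)"
  using assms
proof (induction N rule: finite_induct)
  case (insert n N)
  then show ?case using tensor_add_closed[of "g n" X par "\<lambda>w. \<Sum>n\<in>N. g n w"] by simp
qed (simp add: tensor_zero_closed)

lemma sym_class_zero: "sym_class X par (\<lambda>w. 0 :: 'k::field) = \<zero>\<^bsub>Sym_salg X par\<^esub>"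
proof -
  have "(\<lambda>w. 0 :: 'k) \<in> supercommutator_ideal X par"
    using additive_subgroup.zero_closed[OF ideal.axioms(1)[OF ideal_supercommutator[of X par]]]
    by (simp add: tensor_salg_simps)
  then show ?thesis by (rule sym_class_ideal)
qed

lemma sym_class_one: "sym_class X par (word [] :: _ \<Rightarrow> 'k::field) = \<one>\<^bsub>Sym_salg X par\<^esub>"
  unfolding sym_class_simps(2)[symmetric] by (simp add: tensor_salg_simps word_def)

lemma sym_class_sum:
  fixes g :: "'n \<Rightarrow> 'x list \<Rightarrow> 'k::field"
  assumes "finite N" "\<And>n. n \<in> N \<Longrightarrow> g n \<in> carrier (tensor_salg X par)"
  shows "sym_class X par (\<lambda>w. \<Sum>n\<in>N. g n w) = (\<Oplus>\<^bsub>Sym_salg X par\<^esub>n\<in>N. sym_class X par (g n))"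
proof -
  interpret ring "Sym_salg X par :: ('k, ('x list \<Rightarrow> 'k) set) salg" by (rule ring_Sym)
  show ?thesis using assms
  proof (induction N rule: finite_induct)
    case empty
    then show ?case by (simp add: sym_class_zero)
  next
    case (insert n N)
    then have "(\<lambda>w. \<Sum>n\<in>N. g n w) \<in> carrier (tensor_salg X par)" by (intro tensor_sum_closed) auto
    then have "sym_class X par (\<lambda>w. \<Sum>n\<in>insert n N. g n w) =
        sym_class X par (g n) \<oplus>\<^bsub>Sym_salg X par\<^esub> sym_class X par (\<lambda>w. \<Sum>n\<in>N. g n w)"
      using insert by (simp add: sym_class_simps(4))
    then show ?case using insert by (simp add: sym_class_closed)
  qed
qed

lemma sym_class_sum_cong:
  fixes g h :: "'n \<Rightarrow> 'x list \<Rightarrow> 'k::field"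
  assumes "finite N" "\<And>n. n \<in> N \<Longrightarrow> g n \<in> carrier (tensor_salg X par)"
    "\<And>n. n \<in> N \<Longrightarrow> h n \<in> carrier (tensor_salg X par)"
    "\<And>n. n \<in> N \<Longrightarrow> sym_class X par (g n) = sym_class X par (h n)"
  shows "sym_class X par (\<lambda>w. \<Sum>n\<in>N. g n w) = sym_class X par (\<lambda>w. \<Sum>n\<in>N. h n w)"
proof -
  interpret ring "Sym_salg X par :: ('k, ('x list \<Rightarrow> 'k) set) salg" by (rule ring_Sym)
  have "sym_class X par (\<lambda>w. \<Sum>n\<in>N. g n w) = (\<Oplus>\<^bsub>Sym_salg X par\<^esub>n\<in>N. sym_class X par (g n))"
    by (rule sym_class_sum) (use assms in auto)
  also have "\<dots> = (\<Oplus>\<^bsub>Sym_salg X par\<^esub>n\<in>N. sym_class X par (h n))"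
    by (rule finsum_cong') (auto simp: assms(4) assms(3)[THEN sym_class_closed])
  also have "\<dots> = sym_class X par (\<lambda>w. \<Sum>n\<in>N. h n w)"
    by (rule sym_class_sum[symmetric]) (use assms in auto)
  finally show ?thesis .
qed

text \<open>
  Calculations take place among tensors, where sums and signs are explicit; only the class in \<open>Sym\<close>
  has to lie in the subalgebra generated by \<open>S\<close>.
\<close>

definition represents :: "'x set \<Rightarrow> ('x \<Rightarrow> bit) \<Rightarrow> ('x list \<Rightarrow> 'k::field) set set \<Rightarrow> ('x list \<Rightarrow> 'k) set" where
  "represents X par S = {g \<in> carrier (tensor_salg X par).
     sym_class X par g \<in> generated_subalgebra (Sym_salg X par) S}"

lemma represents_scale: "g \<in> represents X par S \<Longrightarrow> (\<lambda>w. c * g w) \<in> represents X par S"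
  by (auto simp: represents_def tensor_scale_closed sym_class_simps(5) intro: generated_subalgebra.smult)

lemma represents_word_Nil: "word [] \<in> represents X par S"
  by (auto simp: represents_def word_closed sym_class_one intro: generated_subalgebra.one)

lemma represents_zero: "(\<lambda>w. 0) \<in> represents X par S"
  using represents_scale[OF represents_word_Nil, of 0] by simp

lemma represents_add:
  "g \<in> represents X par S \<Longrightarrow> h \<in> represents X par S \<Longrightarrow> (\<lambda>w. g w + h w) \<in> represents X par S"
  by (auto simp: represents_def tensor_add_closed sym_class_simps(4) intro: generated_subalgebra.add)

lemma represents_conv:
  "g \<in> represents X par S \<Longrightarrow> h \<in> represents X par S \<Longrightarrow> conv g h \<in> represents X par S"
  by (auto simp: represents_def conv_closed sym_class_simps(3) intro: generated_subalgebra.mult)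

lemma represents_sum:
  assumes "\<And>n. n \<in> N \<Longrightarrow> g n \<in> represents X par S"
  shows "(\<lambda>w. \<Sum>n\<in>N. g n w) \<in> represents X par S"
  using assms
proof (induction N rule: infinite_finite_induct)
  case (insert n N)
  then show ?case using represents_add[of "g n" X par S "\<lambda>w. \<Sum>n\<in>N. g n w"] by simp
qed (simp_all add: represents_zero)

lemma represents_cong:
  "g \<in> represents X par S \<Longrightarrow> h \<in> carrier (tensor_salg X par) \<Longrightarrow>
    sym_class X par h = sym_class X par g \<Longrightarrow> h \<in> represents X par S"
  by (simp add: represents_def)

lemma conv_sum_left: "conv (\<lambda>w. \<Sum>n\<in>N. f n w) g w = (\<Sum>n\<in>N. conv (f n) g w :: 'k::field)"
  by (simp add: conv_def sum_distrib_right sum.swap[of _ N])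

lemma conv_sum_right: "conv g (\<lambda>w. \<Sum>n\<in>N. f n w) w = (\<Sum>n\<in>N. conv g (f n) w :: 'k::field)"
  by (simp add: conv_def sum_distrib_left sum.swap[of _ N])

text \<open>
  The noncommutative polynomial obtained by multiplying out the entry of a path matrix.
\<close>

primrec path_tensor ::
  "('v, 'e) pre_digraph \<Rightarrow> 'v superdim \<Rightarrow> 'e list \<Rightarrow> nat \<Rightarrow> nat \<Rightarrow> ('e \<times> nat \<times> nat) list \<Rightarrow> 'k::field" where
  "path_tensor Q \<alpha> [] i j = (\<lambda>w. if i = j then word [] w else 0)"
| "path_tensor Q \<alpha> (e # p) i j =
    (\<lambda>w. \<Sum>k<sdim \<alpha> (tail Q e). conv (word [(e, i, k)]) (path_tensor Q \<alpha> p k j) w)"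

lemma path_tensor_class:
  fixes Q :: "('v, 'e) pre_digraph" and \<alpha> :: "'v superdim" and b :: "'v \<Rightarrow> bit"
  defines "X \<equiv> rep_gens Q \<alpha>" and "par \<equiv> rep_parity Q \<alpha> b"
  assumes "p \<noteq> [] \<Longrightarrow> quiver_path Q p \<and> i < sdim \<alpha> (head Q (hd p)) \<and> j < sdim \<alpha> (tail Q (last p))"
  shows "(path_tensor Q \<alpha> p i j :: _ \<Rightarrow> 'k::field) \<in> carrier (tensor_salg X par) \<and>
    sym_class X par (path_tensor Q \<alpha> p i j :: _ \<Rightarrow> 'k) = path_matrix Q \<alpha> b p i j"
  using assms(3)
proof (induction p arbitrary: i)
  case Nil
  then show ?case
    by (simp add: word_closed tensor_zero_closed sym_class_zero sym_class_one mat_one_def K_SRep_def X_def par_def)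
next
  case (Cons e p)
  let ?S = "Sym_salg X par :: ('k, (('e \<times> nat \<times> nat) list \<Rightarrow> 'k) set) salg"
  interpret ring ?S by (rule ring_Sym)
  have e: "e \<in> arcs Q" "i < sdim \<alpha> (head Q e)" and j: "p = [] \<Longrightarrow> j < sdim \<alpha> (tail Q e)"
    using Cons.prems by (auto simp: quiver_path_def)
  have IH: "(path_tensor Q \<alpha> p k j :: _ \<Rightarrow> 'k) \<in> carrier (tensor_salg X par)"
    "sym_class X par (path_tensor Q \<alpha> p k j :: _ \<Rightarrow> 'k) = path_matrix Q \<alpha> b p k j"
    if "k < sdim \<alpha> (tail Q e)" for k
  proof -
    have "p \<noteq> [] \<Longrightarrow> quiver_path Q p \<and> k < sdim \<alpha> (head Q (hd p)) \<and> j < sdim \<alpha> (tail Q (last p))"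
      using Cons.prems that quiver_path_Cons[of p Q e] by auto
    from Cons.IH[OF this] show "(path_tensor Q \<alpha> p k j :: _ \<Rightarrow> 'k) \<in> carrier (tensor_salg X par)"
      "sym_class X par (path_tensor Q \<alpha> p k j :: _ \<Rightarrow> 'k) = path_matrix Q \<alpha> b p k j" by blast+
  qed
  have w: "(word [(e, i, k)] :: _ \<Rightarrow> 'k) \<in> carrier (tensor_salg X par)" if "k < sdim \<alpha> (tail Q e)" for k
    using that e by (auto simp: X_def rep_gens_def intro!: word_closed)
  have c: "conv (word [(e, i, k)]) (path_tensor Q \<alpha> p k j :: _ \<Rightarrow> 'k) \<in> carrier (tensor_salg X par)"
    "sym_class X par (conv (word [(e, i, k)]) (path_tensor Q \<alpha> p k j :: _ \<Rightarrow> 'k)) =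
      generic_matrix Q \<alpha> b e i k \<otimes>\<^bsub>?S\<^esub> path_matrix Q \<alpha> b p k j"
    if "k < sdim \<alpha> (tail Q e)" for k
  proof -
    have "sym_class X par (word [(e, i, k)] :: _ \<Rightarrow> 'k) = generic_matrix Q \<alpha> b e i k"
      by (simp only: generic_matrix_def Sym_gen_def sym_class_def X_def par_def)
    then show "conv (word [(e, i, k)]) (path_tensor Q \<alpha> p k j :: _ \<Rightarrow> 'k) \<in> carrier (tensor_salg X par)"
      "sym_class X par (conv (word [(e, i, k)]) (path_tensor Q \<alpha> p k j :: _ \<Rightarrow> 'k)) =
        generic_matrix Q \<alpha> b e i k \<otimes>\<^bsub>?S\<^esub> path_matrix Q \<alpha> b p k j"
      using w[OF that] IH[OF that] by (simp_all add: conv_closed sym_class_simps(3))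
  qed
  have "sym_class X par (path_tensor Q \<alpha> (e # p) i j :: _ \<Rightarrow> 'k) =
      (\<Oplus>\<^bsub>?S\<^esub>k\<in>{..<sdim \<alpha> (tail Q e)}. sym_class X par (conv (word [(e, i, k)]) (path_tensor Q \<alpha> p k j)))"
    unfolding path_tensor.simps by (rule sym_class_sum) (use c in auto)
  also have "\<dots> = (\<Oplus>\<^bsub>?S\<^esub>k\<in>{..<sdim \<alpha> (tail Q e)}. generic_matrix Q \<alpha> b e i k \<otimes>\<^bsub>?S\<^esub> path_matrix Q \<alpha> b p k j)"
    by (rule finsum_cong') (use c sym_class_closed[OF c(1)] in auto)
  also have "\<dots> = path_matrix Q \<alpha> b (e # p) i j"
    by (simp add: mat_mult_def K_SRep_def X_def par_def)
  finally have "sym_class X par (path_tensor Q \<alpha> (e # p) i j :: _ \<Rightarrow> 'k) = path_matrix Q \<alpha> b (e # p) i j" .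
  moreover have "(path_tensor Q \<alpha> (e # p) i j :: _ \<Rightarrow> 'k) \<in> carrier (tensor_salg X par)"
    unfolding path_tensor.simps by (rule tensor_sum_closed) (use c in auto)
  ultimately show ?case by blast
qed

lemma supertrace_tensor_represents:
  fixes Q :: "('v, 'e) pre_digraph" and b :: "'v \<Rightarrow> bit"
  assumes p: "closed_path Q p"
  shows "(\<lambda>w. \<Sum>i<sdim \<alpha> (head Q (hd p)). koszul (basis_parity \<alpha> b (head Q (hd p)) i) *
      (path_tensor Q \<alpha> p i i w :: 'k::field)) \<in>
    represents (rep_gens Q \<alpha>) (rep_parity Q \<alpha> b) {path_str Q \<alpha> b p | p. closed_path Q p}"
proof -
  let ?X = "rep_gens Q \<alpha>" and ?par = "rep_parity Q \<alpha> b" and ?a = "head Q (hd p)"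
  let ?S = "Sym_salg ?X ?par :: ('k, (('e \<times> nat \<times> nat) list \<Rightarrow> 'k) set) salg"
  interpret ring ?S by (rule ring_Sym)
  have p': "quiver_path Q p" "?a = tail Q (last p)" using p by (auto simp: closed_path_def)
  have t: "(path_tensor Q \<alpha> p i i :: _ \<Rightarrow> 'k) \<in> carrier (tensor_salg ?X ?par)"
    "sym_class ?X ?par (path_tensor Q \<alpha> p i i :: _ \<Rightarrow> 'k) = path_matrix Q \<alpha> b p i i" if "i < sdim \<alpha> ?a" for i
  proof -
    have "(path_tensor Q \<alpha> p i i :: _ \<Rightarrow> 'k) \<in> carrier (tensor_salg ?X ?par) \<and>
      sym_class ?X ?par (path_tensor Q \<alpha> p i i :: _ \<Rightarrow> 'k) = path_matrix Q \<alpha> b p i i"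
      by (rule path_tensor_class) (use p' that in auto)
    then show "(path_tensor Q \<alpha> p i i :: _ \<Rightarrow> 'k) \<in> carrier (tensor_salg ?X ?par)"
      "sym_class ?X ?par (path_tensor Q \<alpha> p i i :: _ \<Rightarrow> 'k) = path_matrix Q \<alpha> b p i i" by blast+
  qed
  have pm: "path_matrix Q \<alpha> b p i i \<in> carrier ?S" if "i < sdim \<alpha> ?a" for i
    using sym_class_closed[OF t(1)[OF that]] t(2)[OF that] by simp
  have "sym_class ?X ?par (\<lambda>w. \<Sum>i<sdim \<alpha> ?a. koszul (basis_parity \<alpha> b ?a i) * (path_tensor Q \<alpha> p i i w :: 'k)) =
    (\<Oplus>\<^bsub>?S\<^esub>i\<in>{..<sdim \<alpha> ?a}. sym_class ?X ?par (\<lambda>w. koszul (basis_parity \<alpha> b ?a i) * path_tensor Q \<alpha> p i i w))"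
    by (rule sym_class_sum) (use t in \<open>auto intro: tensor_scale_closed\<close>)
  also have "\<dots> = (\<Oplus>\<^bsub>?S\<^esub>i\<in>{..<sdim \<alpha> ?a}. koszul (basis_parity \<alpha> b ?a i) \<odot>\<^bsub>?S\<^esub> path_matrix Q \<alpha> b p i i)"
    by (rule finsum_cong')
      (use t pm in \<open>auto simp: sym_class_simps(5) intro!: Sym_smult_closed\<close>)
  also have "\<dots> = path_str Q \<alpha> b p" by (simp add: path_str_def Let_def K_SRep_def)
  finally have c: "sym_class ?X ?par (\<lambda>w. \<Sum>i<sdim \<alpha> ?a. koszul (basis_parity \<alpha> b ?a i) * (path_tensor Q \<alpha> p i i w :: 'k)) =
    path_str Q \<alpha> b p" .
  have "(\<lambda>w. \<Sum>i<sdim \<alpha> ?a. koszul (basis_parity \<alpha> b ?a i) * (path_tensor Q \<alpha> p i i w :: 'k)) \<in> carrier (tensor_salg ?X ?par)"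
    by (rule tensor_sum_closed) (use t in \<open>auto intro: tensor_scale_closed\<close>)
  then show ?thesis using p by (auto simp: represents_def c intro: generated_subalgebra.gen)
qed

text \<open>
  A monomial of a path matrix. The path visits the edges \<open>e k\<close> for \<open>k\<close> in a list of distinct positions,
  the index at the head of \<open>e k\<close> is \<open>I k\<close>, and the index at the final tail is \<open>j\<close>. Indexing by positions
  instead of edges allows a path to pass an edge more than once.
\<close>

primrec chain_word :: "(nat \<Rightarrow> 'e) \<Rightarrow> (nat \<Rightarrow> nat) \<Rightarrow> nat list \<Rightarrow> nat \<Rightarrow> ('e \<times> nat \<times> nat) list" where
  "chain_word e I [] j = []"
| "chain_word e I (k # c) j = (e k, I k, if c = [] then j else I (hd c)) # chain_word e I c j"

lemma chain_word_cong: "(\<And>k. k \<in> set c \<Longrightarrow> I k = J k) \<Longrightarrow> chain_word e I c j = chain_word e J c j"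
  by (induction c) auto

lemma path_tensor_expand:
  assumes "distinct (k # c)" "quiver_path Q (map e (k # c))" "j < sdim \<alpha> (tail Q (e (last (k # c))))"
  shows "(path_tensor Q \<alpha> (map e (k # c)) i j w :: 'k::field) =
    (\<Sum>I\<in>PiE (set c) (\<lambda>k. {..<sdim \<alpha> (head Q (e k))}). word (chain_word e (I(k := i)) (k # c) j) w)"
  using assms
proof (induction c arbitrary: k i w)
  case Nil
  have "(path_tensor Q \<alpha> (map e [k]) i j w :: 'k) =
    (\<Sum>m<sdim \<alpha> (tail Q (e k)). if m = j then conv (word [(e k, i, j)]) (word []) w else 0)"
    unfolding path_tensor.simps list.map by (intro sum.cong refl) (simp add: conv_def)
  also have "\<dots> = word [(e k, i, j)] w"
    using Nil.prems(3) by (simp add: word_append[symmetric])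
  finally show ?case by simp
next
  case (Cons k' c)
  let ?D = "\<lambda>k. {..<sdim \<alpha> (head Q (e k))}"
  have q: "quiver_path Q (map e (k' # c))" "tail Q (e k) = head Q (e k')"
    using Cons.prems(2) quiver_path_Cons[of "map e (k' # c)" Q "e k"] by auto
  have IH: "path_tensor Q \<alpha> (map e (k' # c)) m j =
    (\<lambda>w. \<Sum>I\<in>PiE (set c) ?D. word (chain_word e (I(k' := m)) (k' # c) j) w :: 'k)" for m
    by (rule ext) (rule Cons.IH; use Cons.prems q in simp)
  have "(path_tensor Q \<alpha> (map e (k # k' # c)) i j w :: 'k) =
    (\<Sum>m<sdim \<alpha> (head Q (e k')). conv (word [(e k, i, m)]) (path_tensor Q \<alpha> (map e (k' # c)) m j) w)"
    by (simp add: q(2))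
  also have "\<dots> = (\<Sum>m<sdim \<alpha> (head Q (e k')). \<Sum>I\<in>PiE (set c) ?D.
      word ((e k, i, m) # chain_word e (I(k' := m)) (k' # c) j) w)"
    unfolding IH conv_sum_right word_Cons[symmetric] ..
  also have "\<dots> = (\<Sum>m<sdim \<alpha> (head Q (e k')). \<Sum>I\<in>PiE (set c) ?D.
      word (chain_word e (I(k' := m, k := i)) (k # k' # c) j) w)"
  proof (intro sum.cong refl)
    fix m I
    have "chain_word e (I(k' := m)) (k' # c) j = chain_word e (I(k' := m, k := i)) (k' # c) j"
      by (rule chain_word_cong) (use Cons.prems(1) in auto)
    then have "(e k, i, m) # chain_word e (I(k' := m)) (k' # c) j = chain_word e (I(k' := m, k := i)) (k # k' # c) j"
      using Cons.prems(1) by simp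
    then show "(word ((e k, i, m) # chain_word e (I(k' := m)) (k' # c) j) w :: 'k) =
      word (chain_word e (I(k' := m, k := i)) (k # k' # c) j) w" by simp
  qed
  also have "\<dots> = (\<Sum>I\<in>PiE (insert k' (set c)) ?D. word (chain_word e (I(k := i)) (k # k' # c) j) w)"
    by (rule sum_PiE_insert[symmetric]) (use Cons.prems(1) in auto)
  finally show ?case unfolding list.set .
qed

definition cycles_word :: "(nat \<Rightarrow> 'e) \<Rightarrow> (nat \<Rightarrow> nat) \<Rightarrow> nat list list \<Rightarrow> ('e \<times> nat \<times> nat) list" where
  "cycles_word e I cs = concat (map (\<lambda>c. chain_word e I c (I (hd c))) cs)"

text \<open>
  The summation indices of the factors belong to disjoint sets of positions and are
  collected in one index \<open>I\<close>.
\<close>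

lemma supertrace_product_represents:
  fixes Q :: "('v, 'e) pre_digraph" and b :: "'v \<Rightarrow> bit"
  assumes "distinct (concat cs)" "\<And>c. c \<in> set cs \<Longrightarrow> closed_path Q (map e c)"
  shows "(\<lambda>w. \<Sum>I\<in>PiE (set (concat cs)) (\<lambda>k. {..<sdim \<alpha> (head Q (e k))}).
      (\<Prod>c\<leftarrow>cs. koszul (basis_parity \<alpha> b (head Q (e (hd c))) (I (hd c)))) * (word (cycles_word e I cs) w :: 'k::field)) \<in>
    represents (rep_gens Q \<alpha>) (rep_parity Q \<alpha> b) {path_str Q \<alpha> b p | p. closed_path Q p}"
  using assms
proof (induction cs)
  case Nil
  show ?case by (simp add: cycles_word_def represents_word_Nil)
next
  case (Cons c cs)
  let ?R = "represents (rep_gens Q \<alpha>) (rep_parity Q \<alpha> b) {path_str Q \<alpha> b p | p. closed_path Q p}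
    :: (('e \<times> nat \<times> nat) list \<Rightarrow> 'k) set"
  let ?D = "\<lambda>k. {..<sdim \<alpha> (head Q (e k))}"
  let ?s = "\<lambda>I c. koszul (basis_parity \<alpha> b (head Q (e (hd c))) (I (hd c))) :: 'k"
  have cp: "closed_path Q (map e c)" using Cons.prems by simp
  then have ne: "c \<noteq> []" by (auto simp: closed_path_def quiver_path_def)
  then obtain k c' where c: "c = k # c'" by (cases c) auto
  have hd: "head Q (hd (map e c)) = head Q (e k)" by (simp add: c)
  define g where "g = (\<lambda>w. \<Sum>I\<in>PiE (set (concat cs)) ?D. (\<Prod>c\<leftarrow>cs. ?s I c) * word (cycles_word e I cs) w)"
  define h where "h = (\<lambda>w. \<Sum>I\<in>PiE (set c) ?D. ?s I c * word (chain_word e I c (I (hd c))) w)"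
  have g: "g \<in> ?R" unfolding g_def using Cons by simp
  have "h = (\<lambda>w. \<Sum>i<sdim \<alpha> (head Q (e k)). koszul (basis_parity \<alpha> b (head Q (e k)) i) *
      path_tensor Q \<alpha> (map e c) i i w)"
  proof
    fix w
    have "h w = (\<Sum>i<sdim \<alpha> (head Q (e k)). \<Sum>I\<in>PiE (set c') ?D. ?s (I(k := i)) c * word (chain_word e (I(k := i)) c i) w)"
      unfolding h_def c using Cons.prems(1) by (simp add: sum_PiE_insert c cong: if_cong)
    also have "\<dots> = (\<Sum>i<sdim \<alpha> (head Q (e k)). koszul (basis_parity \<alpha> b (head Q (e k)) i) *
      path_tensor Q \<alpha> (map e c) i i w)"
    proof (intro sum.cong refl)
      fix i assume "i \<in> {..<sdim \<alpha> (head Q (e k))}"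
      moreover have "tail Q (e (last (k # c'))) = head Q (e k)"
        using cp ne unfolding closed_path_def hd by (simp add: last_map c)
      moreover have "quiver_path Q (map e (k # c'))" using cp by (simp add: closed_path_def c)
      ultimately show "(\<Sum>I\<in>PiE (set c') ?D. ?s (I(k := i)) c * word (chain_word e (I(k := i)) c i) w) =
          koszul (basis_parity \<alpha> b (head Q (e k)) i) * path_tensor Q \<alpha> (map e c) i i w"
        unfolding c using Cons.prems(1) by (subst path_tensor_expand) (auto simp: sum_distrib_left c)
    qed
    finally show "h w = (\<Sum>i<sdim \<alpha> (head Q (e k)). koszul (basis_parity \<alpha> b (head Q (e k)) i) *
      path_tensor Q \<alpha> (map e c) i i w)" .
  qed
  then have h: "h \<in> ?R" using supertrace_tensor_represents[OF cp, of \<alpha> b] unfolding hd by simp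
  have disj: "set c \<inter> set (concat cs) = {}" using Cons.prems(1) by auto
  have "conv h g = (\<lambda>w. \<Sum>I\<in>PiE (set (concat (c # cs))) ?D.
      (\<Prod>c\<leftarrow>c # cs. ?s I c) * word (cycles_word e I (c # cs)) w)"
  proof
    fix w
    have "conv h g w = (\<Sum>I\<in>PiE (set c) ?D. \<Sum>J\<in>PiE (set (concat cs)) ?D. (?s I c * (\<Prod>c\<leftarrow>cs. ?s J c)) *
        word (chain_word e I c (I (hd c)) @ cycles_word e J cs) w)"
      unfolding h_def g_def conv_sum_left conv_sum_right conv_scale_left conv_scale_right word_append
      by (simp only: mult.assoc)
    also have "\<dots> = (\<Sum>I\<in>PiE (set c) ?D. \<Sum>J\<in>PiE (set (concat cs)) ?D.
        (\<Prod>d\<leftarrow>c # cs. ?s (\<lambda>k. if k \<in> set c then I k else J k) d) *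
        word (cycles_word e (\<lambda>k. if k \<in> set c then I k else J k) (c # cs)) w)"
    proof (intro sum.cong refl)
      fix I J :: "nat \<Rightarrow> nat"
      let ?K = "\<lambda>k. if k \<in> set c then I k else J k"
      have hc: "hd d \<in> set (concat cs)" "set d \<subseteq> set (concat cs)" if "d \<in> set cs" for d
      proof -
        have "d \<noteq> []" using Cons.prems(2)[of d] that by (auto simp: closed_path_def quiver_path_def)
        then show "hd d \<in> set (concat cs)" "set d \<subseteq> set (concat cs)" using that hd_in_set by auto
      qed
      have K: "?K k = J k" if "k \<in> set (concat cs)" for k using disj that by auto
      have 1: "map (?s J) cs = map (?s ?K) cs" by (rule map_cong[OF refl]) (simp add: K[OF hc(1)])
      have m: "map (\<lambda>d. chain_word e J d (J (hd d))) cs = map (\<lambda>d. chain_word e ?K d (?K (hd d))) cs"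
      proof (rule map_cong[OF refl])
        fix d assume d: "d \<in> set cs"
        have "chain_word e J d (J (hd d)) = chain_word e ?K d (J (hd d))"
          by (rule chain_word_cong) (rule K[symmetric], rule subsetD[OF hc(2)[OF d]])
        then show "chain_word e J d (J (hd d)) = chain_word e ?K d (?K (hd d))"
          unfolding K[OF hc(1)[OF d]] .
      qed
      have n: "chain_word e I c (I (hd c)) = chain_word e ?K c (?K (hd c))"
      proof -
        have "chain_word e I c (I (hd c)) = chain_word e ?K c (I (hd c))"
          by (rule chain_word_cong) simp
        then show ?thesis using ne by simp
      qed
      have 2: "chain_word e I c (I (hd c)) @ cycles_word e J cs = cycles_word e ?K (c # cs)"
        by (simp only: cycles_word_def list.map concat.simps m n)
      have 3: "?s I c = ?s ?K c" using ne by simp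
      show "(?s I c * (\<Prod>c\<leftarrow>cs. ?s J c)) * word (chain_word e I c (I (hd c)) @ cycles_word e J cs) w =
        (\<Prod>d\<leftarrow>c # cs. ?s ?K d) * word (cycles_word e ?K (c # cs)) w"
        unfolding 2 list.map prod_list.Cons 1 3 ..
    qed
    also have "\<dots> = (\<Sum>I\<in>PiE (set c \<union> set (concat cs)) ?D.
        (\<Prod>c\<leftarrow>c # cs. ?s I c) * word (cycles_word e I (c # cs)) w)"
      by (rule sum_PiE_Un[OF disj, symmetric])
    finally show "conv h g w = (\<Sum>I\<in>PiE (set (concat (c # cs))) ?D.
      (\<Prod>c\<leftarrow>c # cs. ?s I c) * word (cycles_word e I (c # cs)) w)" by simp
  qed
  then show ?case using represents_conv[OF h g] by simp
qed

section \<open>Invariants are combinations of permutations\<close>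

text \<open>
  The sign in front depends on the column \<open>j\<close> only; it is the factor \<open>\<epsilon>\<close> that
  \<open>invariant_commutes\<close> leaves over.
\<close>

theorem invariant_tensor_permutations:
  fixes f :: "('e \<times> nat \<times> nat) list \<Rightarrow> 'k::field_char_0" and Q :: "('v, 'e) pre_digraph"
  assumes Q: "fin_digraph Q"
    and f: "f \<in> carrier (tensor_salg (rep_gens Q \<alpha>) (rep_parity Q \<alpha> b))"
    and inv: "sym_class (rep_gens Q \<alpha>) (rep_parity Q \<alpha> b) f \<in> SI Q \<alpha> b"
    and e: "\<And>k. k < r \<Longrightarrow> e k \<in> arcs Q"
  defines "\<pi> \<equiv> vector_parity \<alpha> b"
  shows "\<exists>c. \<forall>i\<in>index_words_at Q \<alpha> r (\<lambda>k. head Q (e k)). \<forall>j\<in>index_words_at Q \<alpha> r (\<lambda>k. tail Q (e k)).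
    tensor_entry Q \<alpha> b f r e i j =
    (shuffle_sign (\<lambda>k. \<pi> (j k)) (\<lambda>k. \<pi> (j k)) [0..<r] * koszul (\<Sum>k\<leftarrow>[0..<r]. \<pi> (j k))) *
    (\<Sum>\<mu> | \<mu> permutes {..<r}. if i \<circ> \<mu> = j then c \<mu> * perm_sign r \<pi> \<mu> i else 0)"
proof -
  interpret fin_digraph Q by (rule Q)
  let ?W = "index_words Q \<alpha> r"
  define Wh where "Wh = index_words_at Q \<alpha> r (\<lambda>k. head Q (e k))"
  define Wt where "Wt = index_words_at Q \<alpha> r (\<lambda>k. tail Q (e k))"
  define type where "type w = (\<lambda>k. if k < r then fst (w k) else undefined)" for w :: "nat \<Rightarrow> 'v \<times> nat"
  have type_eq: "type p = type q \<longleftrightarrow> (\<forall>k<r. fst (p k) = fst (q k))" for p q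
    unfolding type_def fun_eq_iff by auto
  note closed = index_word_permute[where Q = Q and \<alpha> = \<alpha> and r = r]
  note fin = finite_index_words(1)[OF Q, of \<alpha> r]
  have "\<exists>c. \<forall>i\<in>Wh. \<forall>j\<in>Wt. tensor_entry Q \<alpha> b f r e i j =
    (shuffle_sign (\<lambda>k. \<pi> (j k)) (\<lambda>k. \<pi> (j k)) [0..<r] * koszul (\<Sum>k\<leftarrow>[0..<r]. \<pi> (j k))) *
    (\<Sum>\<mu> | \<mu> permutes {..<r}. if i \<circ> \<mu> = j then c \<mu> * perm_sign r \<pi> \<mu> i else 0)"
  proof (rule double_centralizer[where W = ?W and type = type and
        D = "\<lambda>\<tau> i q. shuffle_sign (\<lambda>k. \<pi> (i k)) (\<lambda>k. \<pi> (i k)) [0..<r] *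
          koszul ((\<Sum>k\<leftarrow>[0..<r]. \<pi> (i k)) * (\<Sum>k\<leftarrow>[0..<r]. \<pi> (q k))) * perm_sign r \<pi> \<tau> q *
          tensor_entry Q \<alpha> b f r e i (q \<circ> \<tau>)"])
    fix \<tau> :: "nat \<Rightarrow> nat" and w :: "nat \<Rightarrow> 'v \<times> nat"
    show "perm_sign r \<pi> \<tau> w * perm_sign r \<pi> \<tau> w = (1 :: 'k)"
      by (simp add: perm_sign_def koszul_sign_square)
  next
    fix \<sigma> \<mu> :: "nat \<Rightarrow> nat" and w
    assume "\<sigma> permutes {..<r}" "\<mu> permutes {..<r}"
    then show "perm_sign r \<pi> (\<sigma> \<circ> \<mu>) w = perm_sign r \<pi> \<sigma> w * (perm_sign r \<pi> \<mu> (w \<circ> \<sigma>) :: 'k)"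
      by (rule perm_sign_compose)
  next
    fix p q \<tau> assume *: "p \<in> ?W" "q \<in> ?W" "type p = type q" "\<tau> permutes {..<r}" "p \<circ> \<tau> \<in> Wh"
    then show "q \<circ> \<tau> \<in> Wh"
      using closed[OF *(4,2)] permutes_lessThan[OF *(4)] by (auto simp: Wh_def index_words_at_def type_eq)
  next
    fix p q \<tau> assume *: "p \<in> ?W" "q \<in> ?W" "\<tau> permutes {..<r}" "p \<circ> \<tau> \<in> Wh" "q \<circ> \<tau> \<in> Wh"
    have "fst (p k) = fst (q k)" if "k < r" for k
    proof -
      have "k \<in> \<tau> ` {..<r}" unfolding permutes_image[OF *(3)] using that by simp
      then obtain l where l: "l < r" "k = \<tau> l" by blast
      then show ?thesis using *(4,5) by (simp add: Wh_def index_words_at_def)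
    qed
    then show "type p = type q" by (simp add: type_eq)
  next
    fix i j p q assume *: "i \<in> Wh" "j \<in> Wt" "p \<in> ?W" "q \<in> ?W" "type p = type q"
    show "(\<Sum>\<tau> | \<tau> permutes {..<r}. (if q \<circ> \<tau> = i then perm_sign r \<pi> \<tau> q else 0) *
        (perm_sign r \<pi> \<tau> p * tensor_entry Q \<alpha> b f r e (p \<circ> \<tau>) j)) =
      (shuffle_sign (\<lambda>k. \<pi> (j k)) (\<lambda>k. \<pi> (j k)) [0..<r] * koszul (\<Sum>k\<leftarrow>[0..<r]. \<pi> (j k))) *
      (\<Sum>\<tau> | \<tau> permutes {..<r}. (if p \<circ> \<tau> = j then perm_sign r \<pi> \<tau> p else 0) *
       (shuffle_sign (\<lambda>k. \<pi> (i k)) (\<lambda>k. \<pi> (i k)) [0..<r] *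
          koszul ((\<Sum>k\<leftarrow>[0..<r]. \<pi> (i k)) * (\<Sum>k\<leftarrow>[0..<r]. \<pi> (q k))) * perm_sign r \<pi> \<tau> q *
          tensor_entry Q \<alpha> b f r e i (q \<circ> \<tau>)))"
      unfolding \<pi>_def
      by (rule invariant_commutes[OF Q f inv])
        (use e * in \<open>auto simp: Wh_def Wt_def type_eq\<close>)
  qed (use fin closed in \<open>auto simp: Wh_def Wt_def index_words_at_def\<close>)
  then show ?thesis unfolding Wh_def Wt_def .
qed

section \<open>The closed paths of a permutation\<close>

lemma cycle_support:
  assumes "permutation \<mu>"
  shows "support \<mu> x \<noteq> []" "distinct (support \<mu> x)" "map \<mu> (support \<mu> x) = tl (support \<mu> x) @ [hd (support \<mu> x)]"
    "hd (support \<mu> x) = x"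
proof -
  let ?n = "least_power \<mu> x"
  have n: "(\<mu> ^^ ?n) x = x" "?n > 0" using least_power_of_permutation[OF assms] by auto
  obtain m where m: "?n = Suc m" using n(2) by (cases ?n) auto
  show "support \<mu> x \<noteq> []" using n(2) by simp
  show "distinct (support \<mu> x)" using cycle_of_permutation[OF assms] .
  have 1: "support \<mu> x = x # map (\<lambda>i. (\<mu> ^^ i) x) [1..<?n]"
    unfolding m by (simp add: upt_conv_Cons del: upt_Suc)
  have "map \<mu> (support \<mu> x) = map (\<lambda>i. (\<mu> ^^ Suc i) x) [0..<?n]" by simp
  also have "\<dots> = map (\<lambda>i. (\<mu> ^^ i) x) (map Suc [0..<?n])" by (simp del: map_Suc_upt)
  also have "\<dots> = map (\<lambda>i. (\<mu> ^^ i) x) [1..<Suc ?n]" by (simp only: map_Suc_upt One_nat_def)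
  also have "\<dots> = map (\<lambda>i. (\<mu> ^^ i) x) [1..<?n] @ [x]" using n by simp
  finally show "map \<mu> (support \<mu> x) = tl (support \<mu> x) @ [hd (support \<mu> x)]"
    unfolding 1 by simp
  show "hd (support \<mu> x) = x" unfolding 1 by simp
qed

text \<open>
  A cycle is a list which \<open>\<mu>\<close> rotates by one place.
\<close>

definition cycle_lists :: "('a \<Rightarrow> 'a) \<Rightarrow> 'a set \<Rightarrow> 'a list list \<Rightarrow> bool" where
  "cycle_lists \<mu> S cs \<longleftrightarrow> distinct (concat cs) \<and> set (concat cs) = S \<and>
     (\<forall>c\<in>set cs. c \<noteq> [] \<and> map \<mu> c = tl c @ [hd c])"

lemma cycle_lists_exist:
  assumes "finite S" "\<mu> permutes S"
  shows "\<exists>cs. cycle_lists \<mu> S cs"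
proof -
  have perm: "permutation \<mu>" using assms by (auto simp: permutation_permutes)
  have "\<exists>cs. cycle_lists \<mu> R cs" if "finite R" "\<mu> ` R = R" for R
    using that
  proof (induction "card R" arbitrary: R rule: less_induct)
    case less
    show ?case
    proof (cases "R = {}")
      case True
      then show ?thesis by (auto simp: cycle_lists_def intro!: exI[of _ "[]"])
    next
      case False
      then obtain x where x: "x \<in> R" by blast
      let ?c = "support \<mu> x"
      note c = cycle_support[OF perm, of x]
      have pow: "(\<mu> ^^ n) x \<in> R" for n
        using x less.prems(2) by (induction n) auto
      have cR: "set ?c \<subseteq> R" using pow by auto
      have xc: "x \<in> set ?c" using hd_in_set[OF c(1)] unfolding c(4) .
      have "\<mu> ` set ?c = set (map \<mu> ?c)" by (rule set_map[symmetric])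
      also have "\<dots> = set ?c" unfolding c(3) using c(1) by (cases ?c) auto
      finally have "\<mu> ` (R - set ?c) = R - set ?c"
        using image_set_diff[OF permutes_inj[OF assms(2)]] less.prems(2) by metis
      moreover have "card (R - set ?c) < card R"
        by (rule psubset_card_mono) (use less.prems(1) x xc in blast)+
      ultimately obtain cs where "cycle_lists \<mu> (R - set ?c) cs"
        using less.hyps[of "R - set ?c"] less.prems(1) by auto
      then have "cycle_lists \<mu> R (?c # cs)"
        unfolding cycle_lists_def using c cR by auto
      then show ?thesis by blast
    qed
  qed
  then show ?thesis using assms permutes_image[OF assms(2)] by blast
qed

lemma chain_word_cycle:
  "map \<mu> c = tl c @ [m] \<Longrightarrow> chain_word e I c (I m) = map (\<lambda>k. (e k, I k, I (\<mu> k))) c"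
proof (induction c)
  case (Cons k c)
  show ?case
  proof (cases c)
    case Nil
    then show ?thesis using Cons.prems by simp
  next
    case (Cons k' c')
    then show ?thesis using Cons.IH Cons.prems by simp
  qed
qed simp

lemma cycles_word_cycle_lists:
  assumes "cycle_lists \<mu> S cs"
  shows "cycles_word e I cs = map (\<lambda>k. (e k, I k, I (\<mu> k))) (concat cs)"
  unfolding cycles_word_def map_concat
  by (intro arg_cong[of _ _ concat] map_cong refl chain_word_cycle) (use assms in \<open>auto simp: cycle_lists_def\<close>)

text \<open>
  Neighbouring positions of a cycle are of the form \<open>k\<close>, \<open>\<mu> k\<close>, cyclically. The condition on heads and tails
  is what the contraction along \<open>\<mu>\<close> of the tensor product of the matrices requires.
\<close>

lemma cycle_closed_path:
  assumes c: "c \<noteq> []" "map \<mu> c = tl c @ [hd c]"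
    and e: "\<And>k. k \<in> set c \<Longrightarrow> e k \<in> arcs Q \<and> head Q (e (\<mu> k)) = tail Q (e k)"
  shows "closed_path Q (map e c)"
proof -
  have nx: "\<mu> (c ! l) = (tl c @ [hd c]) ! l" if "l < length c" for l
    using that c(2) by (metis nth_map)
  have "head Q (e (c ! Suc l)) = tail Q (e (c ! l))" if "Suc l < length c" for l
  proof -
    have "l < length c - Suc 0" using that by simp
    then have "\<mu> (c ! l) = c ! Suc l" using nx[of l] that by (simp add: nth_append nth_tl)
    then show ?thesis using e[of "c ! l"] that by simp
  qed
  moreover have "\<mu> (last c) = hd c"
    using nx[of "length c - 1"] c(1) by (simp add: last_conv_nth nth_append)
  then have "head Q (e (hd c)) = tail Q (e (last c))"
    using e[of "last c"] c(1) by simp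
  ultimately show ?thesis
    using c(1) e by (auto simp: closed_path_def quiver_path_def hd_map last_map)
qed

section \<open>The sign of a product of supertraces\<close>

context supercommutative_superalgebra
begin

lemma lprod_regroup:
  assumes "\<And>k. k \<in> set (k0 # c) \<Longrightarrow> y (\<mu> k) \<in> carrier A" "\<And>k. k \<in> set (k0 # c) \<Longrightarrow> y k \<in> carrier A"
    "\<And>k. k \<in> set (k0 # c) \<Longrightarrow> z k \<in> carrier A" "map \<mu> (k0 # c) = c @ [m]"
  shows "lprod A (map (\<lambda>k. z k \<otimes> y (\<mu> k)) (k0 # c)) =
    (z k0 \<otimes> lprod A (map (\<lambda>k. y k \<otimes> z k) c)) \<otimes> y m"
  using assms
proof (induction c arbitrary: k0)
  case (Cons k1 c)
  have "lprod A (map (\<lambda>k. y k \<otimes> z k) c) \<in> carrier A" "y m \<in> carrier A"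
    using Cons.prems(1)[of "last (k0 # k1 # c)"] Cons.prems(2,3)
      arg_cong[OF Cons.prems(4), of last] by (auto intro!: lprod_closed simp: last_map split: if_splits)
  then show ?case
    using Cons.IH[of k1] Cons.prems by (simp add: m_assoc)
qed simp

text \<open>
  Moving the first factor \<open>y\<close> of a cyclic product \<open>y z y z \<dots> z\<close> to the end, where it meets the last \<open>z\<close>,
  costs the sign of its parity, for the product of all factors is even. It is the sign
  in the definition of the supertrace.
\<close>

lemma lprod_cycle:
  assumes y: "\<And>k. k \<in> set c \<Longrightarrow> y k \<in> homog A (a k)"
    and z: "\<And>k. k \<in> set c \<Longrightarrow> z k \<in> homog A (a (\<mu> k))"
    and c: "c \<noteq> []" "map \<mu> c = tl c @ [hd c]"
  shows "lprod A (map (\<lambda>k. y k \<otimes> z k) c) = koszul (a (hd c)) \<odot> lprod A (map (\<lambda>k. z k \<otimes> y (\<mu> k)) c)"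
proof -
  obtain k c' where c': "c = k # c'" using c(1) by (cases c) auto
  let ?W = "z k \<otimes> lprod A (map (\<lambda>k. y k \<otimes> z k) c')"
  have "set (map \<mu> c) = set c" unfolding c(2) using c(1) by (cases c) auto
  then have \<mu>: "\<mu> l \<in> set c" if "l \<in> set c" for l using that by auto
  have "(\<Sum>l\<leftarrow>c. a (\<mu> l)) = sum_list (map a (map \<mu> c))" by (simp add: comp_def)
  also have "\<dots> = (\<Sum>l\<leftarrow>c. a l)" unfolding c(2) by (simp add: c' add.commute)
  finally have s: "a (\<mu> k) + (\<Sum>l\<leftarrow>c'. a (\<mu> l)) = a k + (\<Sum>l\<leftarrow>c'. a l)" by (simp add: c')
  have "?W \<in> homog A (a (\<mu> k) + (\<Sum>l\<leftarrow>c'. a l + a (\<mu> l)))"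
    by (intro homog_mult lprod_homog) (use y z c' in \<open>auto intro: homog_mult\<close>)
  also have "a (\<mu> k) + (\<Sum>l\<leftarrow>c'. a l + a (\<mu> l)) = (a (\<mu> k) + (\<Sum>l\<leftarrow>c'. a (\<mu> l))) + (\<Sum>l\<leftarrow>c'. a l)"
    by (simp add: sum_list_addf add_ac)
  also have "\<dots> = a k" unfolding s by (simp add: add.assoc)
  finally have W: "?W \<in> homog A (a k)" .
  have car: "y l \<in> carrier A" "z l \<in> carrier A" if "l \<in> set c" for l
    using y z that homog_carrier by auto
  have "lprod A (map (\<lambda>k. y k \<otimes> z k) c) = y k \<otimes> ?W"
    using car by (simp add: c' m_assoc lprod_closed image_subset_iff)
  also have "\<dots> = koszul (a k) \<odot> (?W \<otimes> y k)"
    using supercommute[OF y W, of k] by (simp add: c')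
  also have "?W \<otimes> y k = lprod A (map (\<lambda>k. z k \<otimes> y (\<mu> k)) c)"
    unfolding c' by (rule lprod_regroup[symmetric]) (use car \<mu> c in \<open>auto simp: c'\<close>)
  finally show ?thesis by (simp add: c')
qed

lemma lprod_cycles:
  assumes y: "\<And>k. k \<in> set (concat cs) \<Longrightarrow> y k \<in> homog A (a k)"
    and z: "\<And>k. k \<in> set (concat cs) \<Longrightarrow> z k \<in> homog A (a (\<mu> k))"
    and c: "\<And>c. c \<in> set cs \<Longrightarrow> c \<noteq> [] \<and> map \<mu> c = tl c @ [hd c]"
  shows "lprod A (map (\<lambda>k. y k \<otimes> z k) (concat cs)) =
    (\<Prod>c\<leftarrow>cs. koszul (a (hd c))) \<odot> lprod A (map (\<lambda>k. z k \<otimes> y (\<mu> k)) (concat cs))"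
  using assms
proof (induction cs)
  case Nil
  then show ?case by (simp add: smult_one)
next
  case (Cons c cs)
  have c: "c \<noteq> []" "map \<mu> c = tl c @ [hd c]" using Cons.prems(3) by auto
  have \<mu>: "\<mu> k \<in> set (concat (c # cs))" if k: "k \<in> set (concat (c # cs))" for k
  proof -
    obtain d where d: "d \<in> set (c # cs)" "k \<in> set d" using k by auto
    then have "d \<noteq> []" "map \<mu> d = tl d @ [hd d]" using Cons.prems(3) by blast+
    then have "set (map \<mu> d) = set d" by (cases d) auto
    then show ?thesis using d by auto
  qed
  have car: "y k \<in> carrier A" "z k \<in> carrier A" "y (\<mu> k) \<in> carrier A" if "k \<in> set (concat (c # cs))" for k
    using Cons.prems(1)[OF that] Cons.prems(2)[OF that] Cons.prems(1)[OF \<mu>[OF that]] homog_carrier by auto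
  have L: "lprod A (map (\<lambda>k. z k \<otimes> y (\<mu> k)) d) \<in> carrier A" "set (map (\<lambda>k. z k \<otimes> y (\<mu> k)) d) \<subseteq> carrier A"
    "set (map (\<lambda>k. y k \<otimes> z k) d) \<subseteq> carrier A"
    if "set d \<subseteq> set (concat (c # cs))" for d
    using car that by (auto intro!: lprod_closed simp: subset_iff)
  have sub: "set c \<subseteq> set (concat (c # cs))" "set (concat cs) \<subseteq> set (concat (c # cs))" by auto
  have "lprod A (map (\<lambda>k. y k \<otimes> z k) c) = koszul (a (hd c)) \<odot> lprod A (map (\<lambda>k. z k \<otimes> y (\<mu> k)) c)"
    by (rule lprod_cycle) (use Cons.prems c in auto)
  moreover have "lprod A (map (\<lambda>k. y k \<otimes> z k) (concat cs)) =
      (\<Prod>c\<leftarrow>cs. koszul (a (hd c))) \<odot> lprod A (map (\<lambda>k. z k \<otimes> y (\<mu> k)) (concat cs))"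
    by (rule Cons.IH) (use Cons.prems in auto)
  ultimately show ?case
    using L[OF sub(1)] L[OF sub(2)]
    unfolding concat.simps map_append list.map prod_list.Cons mult.commute[of "koszul (a (hd c))"]
    by (simp add: lprod_append smult_mult_left smult_mult_right smult_assoc m_closed smult_closed del: set_map)
qed

end

text \<open>
  The product of the pairs \<open>y\<^sub>k z\<^sub>k\<close>, where \<open>z\<^sub>k\<close> has the parity of \<open>y\<^bsub>\<mu> k\<^esub>\<close>, is taken in the order of the
  cycles. On the left, the pairs are sorted and then separated. On the right, they are first
  regrouped along the cycles into the pairs \<open>z\<^sub>k y\<^bsub>\<mu> k\<^esub>\<close>, which are even and may be sorted without a
  sign. The latter signs are those of the tensor of a permutation in
  \<open>invariant_tensor_permutations\<close>.
\<close>

lemma cycle_sign: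
  fixes a :: "nat \<Rightarrow> bit"
  assumes \<mu>: "\<mu> permutes {..<r}" and cs: "cycle_lists \<mu> {..<r} cs"
  shows "koszul_sign (\<lambda>k. a k + a (\<mu> k)) (concat cs) * shuffle_sign a (\<lambda>k. a (\<mu> k)) [0..<r] =
    (\<Prod>c\<leftarrow>cs. koszul (a (hd c))) * (shuffle_sign (\<lambda>k. a (\<mu> k)) (\<lambda>k. a (\<mu> k)) [0..<r] *
      koszul (\<Sum>k\<leftarrow>[0..<r]. a (\<mu> k)) * koszul_sign a (map \<mu> [0..<r]) :: 'k::field)"
proof -
  define p where "p n = (if n < r then a n else a (\<mu> (n - r)))" for n
  define A where "A = (grassmann {..<2 * r} p :: ('k, nat set \<Rightarrow> 'k) salg)"
  interpret supercommutative_superalgebra A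
    unfolding A_def by (rule supercommutative_grassmann) simp
  let ?L = "[0..<r]"
  define y where "y = (\<lambda>k. gvar k :: nat set \<Rightarrow> 'k)"
  define z where "z = (\<lambda>k. gvar (r + k) :: nat set \<Rightarrow> 'k)"
  have y: "y k \<in> homog A (a k)" and z: "z k \<in> homog A (a (\<mu> k))" if "k < r" for k
    using gvar_homog[of k "{..<2 * r}" p] gvar_homog[of "r + k" "{..<2 * r}" p] that
    by (simp_all add: y_def z_def A_def p_def)
  have y\<mu>: "y (\<mu> k) \<in> homog A (a (\<mu> k))" if "k < r" for k
    using y permutes_lessThan[OF \<mu> that] by blast
  have car: "y k \<in> carrier A" "z k \<in> carrier A" if "k < r" for k
    using y[OF that] z[OF that] homog_carrier by blast+
  let ?Y = "lprod A (map y ?L)" and ?Z = "lprod A (map z ?L)"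
  have YZ: "?Y \<in> carrier A" "?Z \<in> carrier A"
    by (rule lprod_closed; use car in auto)+
  have cs': "distinct (concat cs)" "set (concat cs) = {..<r}"
    "\<And>c. c \<in> set cs \<Longrightarrow> c \<noteq> [] \<and> map \<mu> c = tl c @ [hd c]"
    using cs by (auto simp: cycle_lists_def)
  have csr: "k < r" if "k \<in> set (concat cs)" for k
    using that unfolding cs'(2) by simp
  have sort: "sort (concat cs) = ?L"
    by (rule sorted_distinct_set_unique) (use cs' in auto)
  have sum: "(\<Sum>k\<leftarrow>?L. a (\<mu> k)) = (\<Sum>k\<leftarrow>?L. a k)"
    using sum.permute[OF \<mu>, of a] by (simp add: interv_sum_list_conv_sum_set_nat atLeast0LessThan comp_def)
  let ?K = "koszul_sign (\<lambda>k. a k + a (\<mu> k)) (concat cs) :: 'k"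
  let ?P = "(\<Prod>c\<leftarrow>cs. koszul (a (hd c))) :: 'k"
  let ?s = "shuffle_sign a (\<lambda>k. a (\<mu> k)) ?L :: 'k"
  let ?t = "shuffle_sign (\<lambda>k. a (\<mu> k)) (\<lambda>k. a (\<mu> k)) ?L :: 'k"
  have "lprod A (map (\<lambda>k. y k \<otimes>\<^bsub>A\<^esub> z k) (concat cs)) = ?K \<odot>\<^bsub>A\<^esub> lprod A (map (\<lambda>k. y k \<otimes>\<^bsub>A\<^esub> z k) ?L)"
    unfolding sort[symmetric]
    by (rule lprod_reorder) (rule cs'(1), blast intro: homog_mult y z csr)
  also have "lprod A (map (\<lambda>k. y k \<otimes>\<^bsub>A\<^esub> z k) ?L) = ?s \<odot>\<^bsub>A\<^esub> (?Y \<otimes>\<^bsub>A\<^esub> ?Z)"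
    by (rule lprod_shuffle) (use y z in auto)
  finally have 1: "lprod A (map (\<lambda>k. y k \<otimes>\<^bsub>A\<^esub> z k) (concat cs)) = (?K * ?s) \<odot>\<^bsub>A\<^esub> (?Y \<otimes>\<^bsub>A\<^esub> ?Z)"
    using YZ by (simp add: smult_assoc)
  have "lprod A (map (\<lambda>k. y k \<otimes>\<^bsub>A\<^esub> z k) (concat cs)) = ?P \<odot>\<^bsub>A\<^esub> lprod A (map (\<lambda>k. z k \<otimes>\<^bsub>A\<^esub> y (\<mu> k)) (concat cs))"
    by (rule lprod_cycles) (rule y[OF csr] z[OF csr] cs'(3); assumption)+
  also have "lprod A (map (\<lambda>k. z k \<otimes>\<^bsub>A\<^esub> y (\<mu> k)) (concat cs)) =
      koszul_sign (\<lambda>k. a (\<mu> k) + a (\<mu> k)) (concat cs) \<odot>\<^bsub>A\<^esub> lprod A (map (\<lambda>k. z k \<otimes>\<^bsub>A\<^esub> y (\<mu> k)) ?L)"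
    unfolding sort[symmetric]
    by (rule lprod_reorder) (rule cs'(1), blast intro: homog_mult y\<mu> z csr)
  also have "koszul_sign (\<lambda>k. a (\<mu> k) + a (\<mu> k)) w = (1 :: 'k)" for w :: "nat list"
    by (induction w) (simp_all add: map_replicate_const cong: if_cong)
  also have "lprod A (map (\<lambda>k. z k \<otimes>\<^bsub>A\<^esub> y (\<mu> k)) ?L) = ?t \<odot>\<^bsub>A\<^esub> (?Z \<otimes>\<^bsub>A\<^esub> lprod A (map (\<lambda>k. y (\<mu> k)) ?L))"
    by (rule lprod_shuffle) (use y\<mu> z in auto)
  also have "lprod A (map (\<lambda>k. y (\<mu> k)) ?L) = koszul_sign a (map \<mu> ?L) \<odot>\<^bsub>A\<^esub> ?Y"
    by (rule lprod_permute[OF \<mu>]) (use y in auto)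
  also have "?Z \<otimes>\<^bsub>A\<^esub> (koszul_sign a (map \<mu> ?L) \<odot>\<^bsub>A\<^esub> ?Y) = koszul_sign a (map \<mu> ?L) \<odot>\<^bsub>A\<^esub> (?Z \<otimes>\<^bsub>A\<^esub> ?Y)"
    using YZ by (simp add: smult_mult_right)
  also have "?Z \<otimes>\<^bsub>A\<^esub> ?Y = koszul (\<Sum>k\<leftarrow>?L. a (\<mu> k)) \<odot>\<^bsub>A\<^esub> (?Y \<otimes>\<^bsub>A\<^esub> ?Z)"
    using supercommute[OF lprod_homog[of ?L z "\<lambda>k. a (\<mu> k)"] lprod_homog[of ?L y a]] y z
    by (simp add: sum)
  finally have 2: "lprod A (map (\<lambda>k. y k \<otimes>\<^bsub>A\<^esub> z k) (concat cs)) =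
      (?P * (?t * koszul (\<Sum>k\<leftarrow>?L. a (\<mu> k)) * koszul_sign a (map \<mu> ?L))) \<odot>\<^bsub>A\<^esub> (?Y \<otimes>\<^bsub>A\<^esub> ?Z)"
    using YZ by (simp add: smult_assoc[symmetric] smult_closed smult_one mult_ac)
  have "?Y \<otimes>\<^bsub>A\<^esub> ?Z = lprod A (map gvar [0..<2 * r])"
  proof -
    have "[0..<2 * r] = ?L @ map (\<lambda>k. r + k) ?L"
      using map_add_upt[of r r] upt_add_eq_append[of 0 r r] by (simp add: mult_2 add.commute)
    then have "lprod A (map gvar [0..<2 * r]) = lprod A (map y ?L @ map z ?L)"
      by (simp add: y_def z_def comp_def)
    also have "\<dots> = ?Y \<otimes>\<^bsub>A\<^esub> ?Z" by (rule lprod_append) (use car in auto)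
    finally show ?thesis ..
  qed
  then have top: "(?Y \<otimes>\<^bsub>A\<^esub> ?Z) {..<2 * r} = 1"
    by (simp add: A_def lprod_gvar atLeast0LessThan koszul_sign_sorted)
  have "((?K * ?s) \<odot>\<^bsub>A\<^esub> (?Y \<otimes>\<^bsub>A\<^esub> ?Z)) {..<2 * r} =
    ((?P * (?t * koszul (\<Sum>k\<leftarrow>?L. a (\<mu> k)) * koszul_sign a (map \<mu> ?L))) \<odot>\<^bsub>A\<^esub> (?Y \<otimes>\<^bsub>A\<^esub> ?Z)) {..<2 * r}"
    using 1 2 by simp
  moreover have sm: "(c \<odot>\<^bsub>A\<^esub> x) S = c * x S" for c x S by (simp add: A_def grassmann_simps)
  ultimately show ?thesis by (simp only: sm top mult_1_right)
qed

section \<open>Contractions along a permutation\<close>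

lemma sym_class_scale_cong:
  fixes g h :: "'x list \<Rightarrow> 'k::field"
  assumes "g \<in> carrier (tensor_salg X par)" "h \<in> carrier (tensor_salg X par)" "sym_class X par g = sym_class X par h"
  shows "sym_class X par (\<lambda>w. c * g w) = sym_class X par (\<lambda>w. c * h w)"
  using assms by (simp add: sym_class_simps(5))

lemma sym_class_word_reorder_sign:
  fixes u :: "'i::linorder \<Rightarrow> 'x"
  assumes "distinct w" "u ` set w \<subseteq> X"
  shows "(sym_class X par (word (map u w)) :: ('x list \<Rightarrow> 'k::field) set) =
    sym_class X par (\<lambda>v. koszul_sign (\<lambda>k. par (u k)) w * word (map u (sort w)) v)"
proof -
  have "(word (map u (sort w)) :: _ \<Rightarrow> 'k) \<in> carrier (tensor_salg X par)"
    by (rule word_closed) (use assms in auto)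
  then show ?thesis unfolding sym_class_word_reorder[OF assms] by (simp add: sym_class_simps(5))
qed

text \<open>
  Sorting the letters of the monomials in the product of supertraces from the order of the cycles
  into the order of the positions produces the sign computed in \<open>cycle_sign\<close>.
\<close>

lemma permutation_contraction_represents:
  fixes Q :: "('v, 'e) pre_digraph" and \<alpha> :: "'v superdim" and b :: "'v \<Rightarrow> bit"
  assumes wf: "wf_digraph Q" and \<mu>: "\<mu> permutes {..<r}"
    and e: "\<And>k. k < r \<Longrightarrow> e k \<in> arcs Q" and con: "\<And>k. k < r \<Longrightarrow> head Q (e (\<mu> k)) = tail Q (e k)"
  defines "\<pi> \<equiv> vector_parity \<alpha> b"
  shows "(\<lambda>w. \<Sum>i\<in>index_words_at Q \<alpha> r (\<lambda>k. head Q (e k)).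
      (shuffle_sign (\<lambda>k. \<pi> (i k)) (\<lambda>k. \<pi> (i (\<mu> k))) [0..<r] *
       (shuffle_sign (\<lambda>k. \<pi> (i (\<mu> k))) (\<lambda>k. \<pi> (i (\<mu> k))) [0..<r] * koszul (\<Sum>k\<leftarrow>[0..<r]. \<pi> (i (\<mu> k)))) *
       perm_sign r \<pi> \<mu> i) *
      (word (map (\<lambda>k. (e k, snd (i k), snd (i (\<mu> k)))) [0..<r]) w :: 'k::field)) \<in>
    represents (rep_gens Q \<alpha>) (rep_parity Q \<alpha> b) {path_str Q \<alpha> b p | p. closed_path Q p}"
    (is "(\<lambda>w. \<Sum>i\<in>?Wh. ?s i * ?m i w) \<in> _")
proof -
  interpret wf_digraph Q by (rule wf)
  let ?X = "rep_gens Q \<alpha>" and ?par = "rep_parity Q \<alpha> b"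
  let ?D = "\<lambda>k. {..<sdim \<alpha> (head Q (e k))}"
  obtain cs where cs: "cycle_lists \<mu> {..<r} cs" using cycle_lists_exist[OF _ \<mu>] by auto
  then have cs': "distinct (concat cs)" "set (concat cs) = {..<r}"
    "\<And>c. c \<in> set cs \<Longrightarrow> c \<noteq> [] \<and> map \<mu> c = tl c @ [hd c]"
    by (auto simp: cycle_lists_def)
  have csr: "k < r" if "c \<in> set cs" "k \<in> set c" for c k
    using that cs'(2) by auto
  have sort: "sort (concat cs) = [0..<r]"
    by (rule sorted_distinct_set_unique) (use cs' in auto)
  have cyc: "closed_path Q (map e c)" if "c \<in> set cs" for c
    using cycle_closed_path[of c \<mu> e Q] cs'(3)[OF that] csr[OF that] e con by blast
  \<comment> \<open>The index \<open>I\<close> of the supertraces has no vertices; \<open>\<iota>\<close> supplies them.\<close>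
  define \<iota> where "\<iota> I k = (if k < r then (head Q (e k), I k) else undefined)" for I :: "nat \<Rightarrow> nat" and k
  define x where "x I k = (e k, I k, I (\<mu> k))" for I :: "nat \<Rightarrow> nat" and k
  have bij: "bij_betw \<iota> (PiE {..<r} ?D) ?Wh"
  proof (rule bij_betw_byWitness[where f' = "\<lambda>i. restrict (\<lambda>k. snd (i k)) {..<r}"])
    show "\<forall>I\<in>PiE {..<r} ?D. restrict (\<lambda>k. snd (\<iota> I k)) {..<r} = I"
      by (auto simp: \<iota>_def fun_eq_iff PiE_def extensional_def)
    show "\<forall>i\<in>?Wh. \<iota> (restrict (\<lambda>k. snd (i k)) {..<r}) = i"
    proof
      fix i assume i: "i \<in> ?Wh"
      show "\<iota> (restrict (\<lambda>k. snd (i k)) {..<r}) = i"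
      proof
        fix k
        show "\<iota> (restrict (\<lambda>k. snd (i k)) {..<r}) k = i k"
        proof (cases "k < r")
          case True
          then have "fst (i k) = head Q (e k)" using i by (simp add: index_words_at_def)
          then show ?thesis using True by (simp add: \<iota>_def prod_eq_iff)
        next
          case False
          then show ?thesis using i by (simp add: \<iota>_def index_words_at_def index_words_def PiE_def extensional_def)
        qed
      qed
    qed
    show "\<iota> ` PiE {..<r} ?D \<subseteq> ?Wh"
      using e by (auto simp: \<iota>_def index_words_at_def index_words_def PiE_def extensional_def)
    show "(\<lambda>i. restrict (\<lambda>k. snd (i k)) {..<r}) ` ?Wh \<subseteq> PiE {..<r} ?D"
    proof
      fix I assume "I \<in> (\<lambda>i. restrict (\<lambda>k. snd (i k)) {..<r}) ` ?Wh"
      then obtain i where i: "i \<in> ?Wh" "I = restrict (\<lambda>k. snd (i k)) {..<r}" by blast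
      have "snd (i k) < sdim \<alpha> (head Q (e k))" if "k < r" for k
        using i(1) that index_word_fst(2)[of i Q \<alpha> r k] by (simp add: index_words_at_def)
      then show "I \<in> PiE {..<r} ?D" unfolding i(2) by simp
    qed
  qed
  define P where "P I = (\<Prod>c\<leftarrow>cs. koszul (basis_parity \<alpha> b (head Q (e (hd c))) (I (hd c))) :: 'k)" for I
  have rep: "(\<lambda>w. \<Sum>I\<in>PiE {..<r} ?D. P I * (word (map (x I) (concat cs)) w :: 'k)) \<in>
      represents ?X ?par {path_str Q \<alpha> b p | p. closed_path Q p}"
    using supertrace_product_represents[OF cs'(1) cyc, where 'k = 'k and \<alpha> = \<alpha> and b = b]
    unfolding cs'(2) cycles_word_cycle_lists[OF cs] P_def x_def .
  have eq: "(\<lambda>w. \<Sum>i\<in>?Wh. ?s i * ?m i w) = (\<lambda>w. \<Sum>I\<in>PiE {..<r} ?D. ?s (\<iota> I) * ?m (\<iota> I) w)"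
    by (intro ext sum.reindex_bij_betw[OF bij, symmetric])
  have xX: "x I ` {..<r} \<subseteq> ?X" if I: "I \<in> PiE {..<r} ?D" for I
  proof
    fix y assume "y \<in> x I ` {..<r}"
    then obtain k where k: "k < r" "y = x I k" by auto
    have "I k \<in> ?D k" "I (\<mu> k) \<in> ?D (\<mu> k)" using I k(1) permutes_lessThan[OF \<mu> k(1)] by (auto simp: PiE_iff)
    then show "y \<in> ?X" using e k con[OF k(1)] by (simp add: x_def rep_gens_def)
  qed
  have m: "?m (\<iota> I) = word (map (x I) [0..<r])" for I
  proof -
    have "map (\<lambda>k. (e k, snd (\<iota> I k), snd (\<iota> I (\<mu> k)))) [0..<r] = map (x I) [0..<r]"
      using permutes_lessThan[OF \<mu>] by (auto simp: \<iota>_def x_def)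
    then show ?thesis by (rule arg_cong)
  qed
  have closed: "?m (\<iota> I) \<in> carrier (tensor_salg ?X ?par)"
    "(word (map (x I) (concat cs)) :: _ \<Rightarrow> 'k) \<in> carrier (tensor_salg ?X ?par)" if "I \<in> PiE {..<r} ?D" for I
  proof -
    have "map (x I) ks \<in> lists ?X" if "set ks = {..<r}" for ks
      unfolding in_lists_conv_set set_map that using xX[OF \<open>I \<in> PiE {..<r} ?D\<close>] by blast
    from this[of "[0..<r]"] this[OF cs'(2)]
    show "?m (\<iota> I) \<in> carrier (tensor_salg ?X ?par)"
      "(word (map (x I) (concat cs)) :: _ \<Rightarrow> 'k) \<in> carrier (tensor_salg ?X ?par)"
      unfolding m by (auto intro!: word_closed simp del: map_concat in_listsI simp: atLeast0LessThan)
  qed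
  have fin: "finite (PiE {..<r} ?D)" by (intro finite_PiE) auto
  have cls: "sym_class ?X ?par (\<lambda>w. ?s (\<iota> I) * ?m (\<iota> I) w) =
      sym_class ?X ?par (\<lambda>w. P I * (word (map (x I) (concat cs)) w :: 'k))" if I: "I \<in> PiE {..<r} ?D" for I
  proof -
    define a where "a = (\<lambda>k. \<pi> (\<iota> I k))"
    let ?K = "koszul_sign (\<lambda>k. a k + a (\<mu> k)) (concat cs) :: 'k"
    have "P I = (\<Prod>c\<leftarrow>cs. koszul (a (hd c)))"
      unfolding P_def a_def \<pi>_def vector_parity_def \<iota>_def
      by (intro arg_cong[of _ _ prod_list] map_cong refl) (use cs'(3) csr hd_in_set in auto)
    then have sg: "?K * shuffle_sign a (\<lambda>k. a (\<mu> k)) [0..<r] =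
      P I * (shuffle_sign (\<lambda>k. a (\<mu> k)) (\<lambda>k. a (\<mu> k)) [0..<r] *
        koszul (\<Sum>k\<leftarrow>[0..<r]. a (\<mu> k)) * koszul_sign a (map \<mu> [0..<r]))"
      using cycle_sign[OF \<mu> cs, of a, where 'k = 'k] by simp
    have PP: "P I * P I = 1" unfolding P_def by (rule prod_list_sign_square) simp
    have "P I * ?s (\<iota> I) = shuffle_sign a (\<lambda>k. a (\<mu> k)) [0..<r] *
      (P I * (shuffle_sign (\<lambda>k. a (\<mu> k)) (\<lambda>k. a (\<mu> k)) [0..<r] *
        koszul (\<Sum>k\<leftarrow>[0..<r]. a (\<mu> k)) * koszul_sign a (map \<mu> [0..<r])))"
      by (simp only: a_def perm_sign_def mult_ac)
    also have "\<dots> = ?K * (shuffle_sign a (\<lambda>k. a (\<mu> k)) [0..<r] * shuffle_sign a (\<lambda>k. a (\<mu> k)) [0..<r])"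
      unfolding sg[symmetric] by (simp only: mult_ac)
    finally have "P I * ?s (\<iota> I) = ?K" by (simp add: shuffle_sign_square)
    then have "P I * P I * ?s (\<iota> I) = P I * ?K" by (simp only: mult.assoc)
    then have s: "?s (\<iota> I) = P I * ?K" unfolding PP by simp
    have "?K = koszul_sign (\<lambda>k. ?par (x I k)) (concat cs)"
    proof (rule koszul_sign_cong)
      fix k assume "k \<in> set (concat cs)"
      then have k: "k < r" unfolding cs'(2) by simp
      then show "a k + a (\<mu> k) = ?par (x I k)"
        using permutes_lessThan[OF \<mu> k] con[OF k]
        by (simp add: a_def \<pi>_def \<iota>_def x_def vector_parity_def rep_parity_def)
    qed
    then have "sym_class ?X ?par (word (map (x I) (concat cs)) :: _ \<Rightarrow> 'k) =
        sym_class ?X ?par (\<lambda>w. ?K * word (map (x I) [0..<r]) w)"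
      using sym_class_word_reorder_sign[OF cs'(1), of "x I" ?X ?par, where 'k = 'k] xX[OF I]
      unfolding cs'(2) sort by simp
    then have "sym_class ?X ?par (\<lambda>w. P I * (word (map (x I) (concat cs)) w :: 'k)) =
        sym_class ?X ?par (\<lambda>w. P I * (?K * word (map (x I) [0..<r]) w))"
      by (intro sym_class_scale_cong tensor_scale_closed closed[OF I] closed(1)[OF I, unfolded m])
    then show ?thesis unfolding s m by (simp only: mult.assoc)
  qed
  show ?thesis
    unfolding eq
  proof (rule represents_cong[OF rep])
    show "(\<lambda>w. \<Sum>I\<in>PiE {..<r} ?D. ?s (\<iota> I) * ?m (\<iota> I) w) \<in> carrier (tensor_salg ?X ?par)"
      by (intro tensor_sum_closed fin tensor_scale_closed closed)
    show "sym_class ?X ?par (\<lambda>w. \<Sum>I\<in>PiE {..<r} ?D. ?s (\<iota> I) * ?m (\<iota> I) w) =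
      sym_class ?X ?par (\<lambda>w. \<Sum>I\<in>PiE {..<r} ?D. P I * (word (map (x I) (concat cs)) w :: 'k))"
      by (intro sym_class_sum_cong fin tensor_scale_closed closed cls)
  qed
qed

text \<open>
  A permutation \<open>\<mu>\<close> contributes only if \<open>i \<circ> \<mu>\<close> has the type required of \<open>j\<close>, and this is the
  condition that its cycles are closed paths.
\<close>

lemma polarized_invariant_represents:
  fixes f :: "('e \<times> nat \<times> nat) list \<Rightarrow> 'k::field_char_0" and Q :: "('v, 'e) pre_digraph"
  assumes Q: "fin_digraph Q"
    and f: "f \<in> carrier (tensor_salg (rep_gens Q \<alpha>) (rep_parity Q \<alpha> b))"
    and inv: "sym_class (rep_gens Q \<alpha>) (rep_parity Q \<alpha> b) f \<in> SI Q \<alpha> b"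
    and e: "\<And>k. k < r \<Longrightarrow> e k \<in> arcs Q"
  shows "(\<lambda>w. \<Sum>i\<in>index_words_at Q \<alpha> r (\<lambda>k. head Q (e k)). \<Sum>j\<in>index_words_at Q \<alpha> r (\<lambda>k. tail Q (e k)).
      full_polarization r (rep_parity Q \<alpha> b) f (\<lambda>k. (e k, snd (i k), snd (j k))) *
      word (map (\<lambda>k. (e k, snd (i k), snd (j k))) [0..<r]) w) \<in>
    represents (rep_gens Q \<alpha>) (rep_parity Q \<alpha> b) {path_str Q \<alpha> b p | p. closed_path Q p}"
    (is "(\<lambda>w. \<Sum>i\<in>?Wh. \<Sum>j\<in>?Wt. ?F i j * word (?m i j) w) \<in> ?R")
proof -
  interpret fin_digraph Q by (rule Q)
  define \<pi> where "\<pi> = vector_parity \<alpha> b"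
  define sh where "sh i j = (shuffle_sign (\<lambda>k. \<pi> (i k)) (\<lambda>k. \<pi> (j k)) [0..<r] :: 'k)"
    for i j :: "nat \<Rightarrow> 'v \<times> nat"
  define \<epsilon> where "\<epsilon> j = sh j j * koszul (\<Sum>k\<leftarrow>[0..<r]. \<pi> (j k))" for j
  have fin: "finite ?Wt" by (rule finite_index_words(2)[OF Q])
  have "\<exists>c. \<forall>i\<in>?Wh. \<forall>j\<in>?Wt. tensor_entry Q \<alpha> b f r e i j =
      \<epsilon> j * (\<Sum>\<mu> | \<mu> permutes {..<r}. if i \<circ> \<mu> = j then c \<mu> * perm_sign r \<pi> \<mu> i else 0)"
    unfolding \<pi>_def \<epsilon>_def sh_def by (rule invariant_tensor_permutations[OF Q f inv e])
  then obtain c where c: "\<And>i j. i \<in> ?Wh \<Longrightarrow> j \<in> ?Wt \<Longrightarrow> tensor_entry Q \<alpha> b f r e i j =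
      \<epsilon> j * (\<Sum>\<mu> | \<mu> permutes {..<r}. if i \<circ> \<mu> = j then c \<mu> * perm_sign r \<pi> \<mu> i else 0)"
    by blast
  have F: "?F i j = sh i j * tensor_entry Q \<alpha> b f r e i j" for i j
  proof -
    have "sh i j * (sh i j * ?F i j) = ?F i j"
      by (simp only: sh_def mult.assoc[symmetric] shuffle_sign_square mult_1_left)
    then show ?thesis by (simp only: tensor_entry_def sh_def \<pi>_def)
  qed
  define con where "con \<mu> \<longleftrightarrow> (\<forall>k<r. head Q (e (\<mu> k)) = tail Q (e k))" for \<mu>
  define s where "s \<mu> i = sh i (i \<circ> \<mu>) * \<epsilon> (i \<circ> \<mu>) * perm_sign r \<pi> \<mu> i" for \<mu> i
  have Wt: "i \<circ> \<mu> \<in> ?Wt \<longleftrightarrow> con \<mu>" if \<mu>: "\<mu> permutes {..<r}" and i: "i \<in> ?Wh" for \<mu> i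
  proof -
    have "i \<circ> \<mu> \<in> index_words Q \<alpha> r"
      by (rule index_word_permute[OF \<mu>]) (use i in \<open>simp add: index_words_at_def\<close>)
    then show ?thesis
      using i permutes_lessThan[OF \<mu>] by (auto simp: index_words_at_def con_def)
  qed
  have "(\<Sum>i\<in>?Wh. \<Sum>j\<in>?Wt. ?F i j * word (?m i j) w) =
      (\<Sum>\<mu> | \<mu> permutes {..<r}. if con \<mu> then c \<mu> * (\<Sum>i\<in>?Wh. s \<mu> i * word (?m i (i \<circ> \<mu>)) w) else 0)" for w
  proof -
    have "(\<Sum>i\<in>?Wh. \<Sum>j\<in>?Wt. ?F i j * word (?m i j) w) =
      (\<Sum>i\<in>?Wh. \<Sum>j\<in>?Wt. \<Sum>\<mu> | \<mu> permutes {..<r}.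
        if i \<circ> \<mu> = j then c \<mu> * (s \<mu> i * word (?m i (i \<circ> \<mu>)) w) else 0)"
    proof (intro sum.cong refl)
      fix i j assume ij: "i \<in> ?Wh" "j \<in> ?Wt"
      show "?F i j * word (?m i j) w = (\<Sum>\<mu> | \<mu> permutes {..<r}.
        if i \<circ> \<mu> = j then c \<mu> * (s \<mu> i * word (?m i (i \<circ> \<mu>)) w) else 0)"
        unfolding F c[OF ij] sum_distrib_left sum_distrib_right
        by (intro sum.cong refl) (auto simp: s_def)
    qed
    also have "\<dots> = (\<Sum>i\<in>?Wh. \<Sum>\<mu> | \<mu> permutes {..<r}. \<Sum>j\<in>?Wt.
        if i \<circ> \<mu> = j then c \<mu> * (s \<mu> i * word (?m i (i \<circ> \<mu>)) w) else 0)"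
      by (intro sum.cong refl sum.swap)
    also have "\<dots> = (\<Sum>i\<in>?Wh. \<Sum>\<mu> | \<mu> permutes {..<r}.
        if con \<mu> then c \<mu> * (s \<mu> i * word (?m i (i \<circ> \<mu>)) w) else 0)"
      by (intro sum.cong refl) (simp add: sum.delta'[OF fin] Wt cong: if_cong)
    also have "\<dots> = (\<Sum>\<mu> | \<mu> permutes {..<r}. \<Sum>i\<in>?Wh.
        if con \<mu> then c \<mu> * (s \<mu> i * word (?m i (i \<circ> \<mu>)) w) else 0)"
      by (rule sum.swap)
    also have "\<dots> = (\<Sum>\<mu> | \<mu> permutes {..<r}. if con \<mu> then c \<mu> * (\<Sum>i\<in>?Wh. s \<mu> i * word (?m i (i \<circ> \<mu>)) w) else 0)"
      by (intro sum.cong refl) (simp add: sum_distrib_left)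
    finally show ?thesis .
  qed
  moreover have "(\<lambda>w. \<Sum>\<mu> | \<mu> permutes {..<r}. if con \<mu> then c \<mu> * (\<Sum>i\<in>?Wh. s \<mu> i * word (?m i (i \<circ> \<mu>)) w) else 0) \<in> ?R"
  proof (rule represents_sum)
    fix \<mu> assume "\<mu> \<in> {\<mu>. \<mu> permutes {..<r}}"
    then have \<mu>: "\<mu> permutes {..<r}" by simp
    show "(\<lambda>w. if con \<mu> then c \<mu> * (\<Sum>i\<in>?Wh. s \<mu> i * word (?m i (i \<circ> \<mu>)) w) else 0) \<in> ?R"
    proof (cases "con \<mu>")
      case True
      have "(\<lambda>w. \<Sum>i\<in>?Wh. s \<mu> i * word (?m i (i \<circ> \<mu>)) w) \<in> ?R"
        unfolding s_def \<epsilon>_def sh_def \<pi>_def comp_apply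
        by (rule permutation_contraction_represents[OF wf_digraph_axioms \<mu>])
          (use e True[unfolded con_def] in auto)
      then show ?thesis using represents_scale True by simp
    qed (simp add: represents_zero)
  qed
  ultimately show ?thesis by simp
qed

section \<open>Symmetrization\<close>

lemma index_map_in_lists:
  assumes "u \<in> {..<r} \<rightarrow>\<^sub>E X"
  shows "map u [0..<r] \<in> lists X"
proof -
  have "\<forall>k\<in>set [0..<r]. u k \<in> X" using PiE_mem[OF assms] by simp
  then show ?thesis unfolding in_lists_conv_set set_map by blast
qed

lemma sum_monomials:
  fixes f :: "'x list \<Rightarrow> 'k::field"
  assumes f: "f \<in> carrier (tensor_salg X par)" and X: "finite X"
  shows "(\<Sum>u\<in>{..<r} \<rightarrow>\<^sub>E X. f (map u [0..<r]) * word (map u [0..<r]) w) = (if length w = r then f w else 0)"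
proof (cases "length w = r \<and> w \<in> lists X")
  case True
  define v where "v = restrict (\<lambda>k. w ! k) {..<r}"
  have v: "v \<in> {..<r} \<rightarrow>\<^sub>E X" "map v [0..<r] = w"
    using True by (auto simp: v_def intro!: nth_equalityI)
  have "(w = map u [0..<r]) = (u = v)" if "u \<in> {..<r} \<rightarrow>\<^sub>E X" for u
  proof
    assume *: "w = map u [0..<r]"
    show "u = v"
    proof
      fix k show "u k = v k"
        using that unfolding v_def by (cases "k < r") (auto simp: * PiE_def extensional_def)
    qed
  qed (simp add: v)
  note * = this
  have "(\<Sum>u\<in>{..<r} \<rightarrow>\<^sub>E X. f (map u [0..<r]) * word (map u [0..<r]) w) =
      (\<Sum>u\<in>{..<r} \<rightarrow>\<^sub>E X. if u = v then f w else 0)"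
    by (intro sum.cong refl) (simp add: word_def * v(2))
  also have "\<dots> = f w" using v(1) X by (subst sum.delta) (auto intro: finite_PiE)
  finally show ?thesis using True by simp
next
  case False
  have zero: "word (map u [0..<r]) w = (0 :: 'k)" if u: "u \<in> {..<r} \<rightarrow>\<^sub>E X" for u
  proof -
    have "length (map u [0..<r]) = r" by simp
    then have "w \<noteq> map u [0..<r]" using index_map_in_lists[OF u] False by blast
    then show ?thesis by (simp add: word_def)
  qed
  have "(\<Sum>u\<in>{..<r} \<rightarrow>\<^sub>E X. f (map u [0..<r]) * word (map u [0..<r]) w) = 0"
    by (rule sum.neutral) (simp add: zero)
  moreover have "f w = 0" if "w \<notin> lists X"
  proof -
    have "{w. f w \<noteq> 0} \<subseteq> lists X" using f by (simp add: tensor_salg_simps(1))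
    then show ?thesis using that by blast
  qed
  ultimately show ?thesis using False by (cases "length w = r") simp_all
qed

text \<open>
  Each permutation in the full polarization permutes the letters of \<open>f\<close>, with the very
  sign by which \<open>Sym\<close> rearranges them. Hence all \<open>r!\<close> terms have the class of the component of degree \<open>r\<close>.
\<close>

lemma sym_class_full_polarization:
  fixes f :: "'x list \<Rightarrow> 'k::field_char_0"
  assumes f: "f \<in> carrier (tensor_salg X par)" and X: "finite X"
  shows "sym_class X par (\<lambda>w. \<Sum>u\<in>{..<r} \<rightarrow>\<^sub>E X. full_polarization r par f u * word (map u [0..<r]) w) =
    sym_class X par (\<lambda>w. fact r * (if length w = r then f w else 0))"
proof -
  let ?U = "{..<r} \<rightarrow>\<^sub>E X" and ?G = "{\<sigma>. \<sigma> permutes {..<r}}" and ?L = "[0..<r]"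
  let ?k = "\<lambda>u \<sigma>. koszul_sign (\<lambda>k. par (u k)) (map \<sigma> ?L) :: 'k"
  have fin: "finite ?U" "finite ?G" using X by (simp_all add: finite_PiE finite_permutations)
  have wc: "(word (map u ?L) :: _ \<Rightarrow> 'k) \<in> carrier (tensor_salg X par)" if "u \<in> ?U" for u
    by (rule word_closed[OF index_map_in_lists[OF that]])
  have perm: "u \<circ> \<sigma> \<in> ?U" if "u \<in> ?U" "\<sigma> \<in> ?G" for u \<sigma>
  proof -
    have \<sigma>: "\<sigma> permutes {..<r}" using that(2) by simp
    show ?thesis
      using that(1) permutes_lessThan[OF \<sigma>] permutes_not_in[OF \<sigma>] by (auto simp: PiE_iff extensional_def)
  qed
  have 1: "(\<lambda>w. \<Sum>u\<in>?U. full_polarization r par f u * word (map u ?L) w) =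
      (\<lambda>w. \<Sum>\<sigma>\<in>?G. \<Sum>u\<in>?U. f (map (u \<circ> \<sigma>) ?L) * (?k u \<sigma> * word (map u ?L) w))"
    unfolding full_polarization_def sum_distrib_right
    by (rule ext, subst sum.swap) (intro sum.cong refl, simp only: mult_ac)
  have 2: "sym_class X par (\<lambda>w. \<Sum>\<sigma>\<in>?G. \<Sum>u\<in>?U. f (map (u \<circ> \<sigma>) ?L) * (?k u \<sigma> * word (map u ?L) w)) =
      sym_class X par (\<lambda>w. \<Sum>\<sigma>\<in>?G. \<Sum>u\<in>?U. f (map (u \<circ> \<sigma>) ?L) * word (map (u \<circ> \<sigma>) ?L) w)"
  proof (intro sym_class_sum_cong fin tensor_sum_closed tensor_scale_closed wc perm sym_class_scale_cong)
    fix \<sigma> u assume \<sigma>: "\<sigma> \<in> ?G" and u: "u \<in> ?U"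
    then have \<sigma>': "\<sigma> permutes {..<r}" by simp
    have "set (map (u \<circ> \<sigma>) ?L) \<subseteq> X"
      using index_map_in_lists[OF perm[OF u \<sigma>]] unfolding in_lists_conv_set by blast
    then have "u ` set (map \<sigma> ?L) \<subseteq> X" unfolding set_map image_comp .
    then show "sym_class X par (\<lambda>w. ?k u \<sigma> * word (map u ?L) w) = sym_class X par (word (map (u \<circ> \<sigma>) ?L) :: _ \<Rightarrow> 'k)"
      using sym_class_word_reorder_sign[of "map \<sigma> ?L" u X par, OF distinct_map_permutation[OF \<sigma>'], where 'k = 'k]
      by (simp add: sort_map_permutation[OF \<sigma>'] del: set_map)
  qed
  have 3: "(\<lambda>w. \<Sum>\<sigma>\<in>?G. \<Sum>u\<in>?U. f (map (u \<circ> \<sigma>) ?L) * word (map (u \<circ> \<sigma>) ?L) w) =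
      (\<lambda>w. \<Sum>\<sigma>\<in>?G. if length w = r then f w else 0)"
  proof (intro ext sum.cong refl)
    fix w \<sigma> assume "\<sigma> \<in> ?G"
    then have \<sigma>: "\<sigma> permutes {..<r}" by simp
    have "bij_betw (\<lambda>u. u \<circ> \<sigma>) ?U ?U"
    proof (rule bij_betw_byWitness[where f' = "\<lambda>u. u \<circ> inv_into UNIV \<sigma>"])
      show "\<forall>u\<in>?U. u \<circ> \<sigma> \<circ> inv_into UNIV \<sigma> = u" "\<forall>u\<in>?U. u \<circ> inv_into UNIV \<sigma> \<circ> \<sigma> = u"
        unfolding comp_assoc permutes_inv_o[OF \<sigma>] by simp_all
      show "(\<lambda>u. u \<circ> \<sigma>) ` ?U \<subseteq> ?U" "(\<lambda>u. u \<circ> inv_into UNIV \<sigma>) ` ?U \<subseteq> ?U"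
        using \<sigma> permutes_inv[OF \<sigma>] by (auto intro!: perm simp del: comp_apply)
    qed
    then have "(\<Sum>u\<in>?U. f (map (u \<circ> \<sigma>) ?L) * word (map (u \<circ> \<sigma>) ?L) w) =
        (\<Sum>u\<in>?U. f (map u ?L) * word (map u ?L) w)"
      by (rule sum.reindex_bij_betw[of "\<lambda>u. u \<circ> \<sigma>" ?U ?U "\<lambda>u. f (map u ?L) * word (map u ?L) w"])
    then show "(\<Sum>u\<in>?U. f (map (u \<circ> \<sigma>) ?L) * word (map (u \<circ> \<sigma>) ?L) w) = (if length w = r then f w else 0)"
      unfolding sum_monomials[OF f X] .
  qed
  have 4: "(\<lambda>w. \<Sum>\<sigma>\<in>?G. if length w = r then f w else 0) = (\<lambda>w. fact r * (if length w = r then f w else 0))"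
    by (simp add: card_permutations)
  show ?thesis unfolding 1 2 3 4 ..
qed

lemma sum_generator_words:
  assumes Q: "fin_digraph Q"
  shows "(\<Sum>u\<in>{..<r} \<rightarrow>\<^sub>E rep_gens Q \<alpha>. g u) =
    (\<Sum>e\<in>{..<r} \<rightarrow>\<^sub>E arcs Q. \<Sum>i\<in>index_words_at Q \<alpha> r (\<lambda>k. head Q (e k)).
      \<Sum>j\<in>index_words_at Q \<alpha> r (\<lambda>k. tail Q (e k)). g (restrict (\<lambda>k. (e k, snd (i k), snd (j k))) {..<r}))"
proof -
  interpret fin_digraph Q by (rule Q)
  let ?Wh = "\<lambda>e. index_words_at Q \<alpha> r (\<lambda>k. head Q (e k))" and ?Wt = "\<lambda>e. index_words_at Q \<alpha> r (\<lambda>k. tail Q (e k))"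
  note fin = finite_index_words(2)[OF Q]
  have "(\<Sum>u\<in>{..<r} \<rightarrow>\<^sub>E rep_gens Q \<alpha>. g u) =
    (\<Sum>(e, i, j)\<in>(SIGMA e:{..<r} \<rightarrow>\<^sub>E arcs Q. ?Wh e \<times> ?Wt e). g (restrict (\<lambda>k. (e k, snd (i k), snd (j k))) {..<r}))"
  proof (rule sum.reindex_bij_witness[where
        i = "\<lambda>(e, i, j). restrict (\<lambda>k. (e k, snd (i k), snd (j k))) {..<r}" and
        j = "\<lambda>u. (restrict (\<lambda>k. fst (u k)) {..<r},
          restrict (\<lambda>k. (head Q (fst (u k)), fst (snd (u k)))) {..<r},
          restrict (\<lambda>k. (tail Q (fst (u k)), snd (snd (u k)))) {..<r})"], goal_cases)
    case (1 u)
    show ?case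
      by (rule ext) (use 1 in \<open>auto simp: PiE_def extensional_def\<close>)
  next
    case (2 u)
    have u: "u k \<in> rep_gens Q \<alpha>" if "k < r" for k using 2 that by auto
    have "fst (u k) \<in> arcs Q" "fst (snd (u k)) < sdim \<alpha> (head Q (fst (u k)))"
      "snd (snd (u k)) < sdim \<alpha> (tail Q (fst (u k)))" if "k < r" for k
      using u[OF that] by (auto simp: rep_gens_def)
    then show ?case by (auto simp: index_words_at_def index_words_def)
  next
    case (3 t)
    obtain e i j where t: "t = (e, i, j)" by (cases t)
    have e: "e \<in> {..<r} \<rightarrow>\<^sub>E arcs Q" and i: "i \<in> ?Wh e" and j: "j \<in> ?Wt e" using 3 t by auto
    have out: "e k = undefined" "i k = undefined" "j k = undefined" if "\<not> k < r" for k
      using e i j that by (auto simp: index_words_at_def index_words_def PiE_def extensional_def)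
    have "fst (i k) = head Q (e k)" "fst (j k) = tail Q (e k)" if "k < r" for k
      using i j that by (auto simp: index_words_at_def)
    then show ?case
      unfolding t by (auto simp: fun_eq_iff restrict_def out prod_eq_iff)
  next
    case (4 t)
    obtain e i j where t: "t = (e, i, j)" by (cases t)
    have e: "e \<in> {..<r} \<rightarrow>\<^sub>E arcs Q" and i: "i \<in> ?Wh e" and j: "j \<in> ?Wt e" using 4 t by auto
    have "(e k, snd (i k), snd (j k)) \<in> rep_gens Q \<alpha>" if "k < r" for k
      using e i j that index_word_fst(2)[of i Q \<alpha> r k] index_word_fst(2)[of j Q \<alpha> r k]
      by (auto simp: index_words_at_def rep_gens_def)
    then show ?case unfolding t by auto
  next
    case (5 u)
    have "restrict (\<lambda>k. (restrict (\<lambda>k. fst (u k)) {..<r} k,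
        snd (restrict (\<lambda>k. (head Q (fst (u k)), fst (snd (u k)))) {..<r} k),
        snd (restrict (\<lambda>k. (tail Q (fst (u k)), snd (snd (u k)))) {..<r} k))) {..<r} = u"
      by (rule ext) (use 5 in \<open>auto simp: PiE_def extensional_def\<close>)
    then show ?case by simp
  qed
  also have "\<dots> = (\<Sum>e\<in>{..<r} \<rightarrow>\<^sub>E arcs Q. \<Sum>(i, j)\<in>?Wh e \<times> ?Wt e. g (restrict (\<lambda>k. (e k, snd (i k), snd (j k))) {..<r}))"
    by (rule sum.Sigma[symmetric]) (auto intro: finite_PiE fin)
  finally show ?thesis by (simp only: sum.cartesian_product[symmetric])
qed

section \<open>Generation by supertraces\<close>

theorem invariant_represents:
  fixes f :: "('e \<times> nat \<times> nat) list \<Rightarrow> 'k::field_char_0" and Q :: "('v, 'e) pre_digraph"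
  assumes Q: "fin_digraph Q"
    and f: "f \<in> carrier (tensor_salg (rep_gens Q \<alpha>) (rep_parity Q \<alpha> b))"
    and inv: "sym_class (rep_gens Q \<alpha>) (rep_parity Q \<alpha> b) f \<in> SI Q \<alpha> b"
  shows "f \<in> represents (rep_gens Q \<alpha>) (rep_parity Q \<alpha> b) {path_str Q \<alpha> b p | p. closed_path Q p}"
    (is "f \<in> ?R")
proof -
  interpret fin_digraph Q by (rule Q)
  let ?X = "rep_gens Q \<alpha>" and ?par = "rep_parity Q \<alpha> b"
  have "?X = (\<Union>e\<in>arcs Q. \<Union>i<sdim \<alpha> (head Q e). \<Union>j<sdim \<alpha> (tail Q e). {(e, i, j)})"
    by (auto simp: rep_gens_def)
  then have X: "finite ?X" by simp
  have part: "(\<lambda>w. if length w = r then f w else 0) \<in> ?R" for r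
  proof -
    let ?h = "\<lambda>w. \<Sum>u\<in>{..<r} \<rightarrow>\<^sub>E ?X. full_polarization r ?par f u * word (map u [0..<r]) w"
    have pol: "full_polarization r ?par f (restrict v {..<r}) = full_polarization r ?par f v"
      "map (restrict v {..<r}) [0..<r] = map v [0..<r]" for v
      by (auto intro: full_polarization_cong)
    have h: "?h \<in> ?R"
      unfolding sum_generator_words[OF Q] pol
    proof (rule represents_sum)
      fix e assume e: "e \<in> {..<r} \<rightarrow>\<^sub>E arcs Q"
      have "e k \<in> arcs Q" if "k < r" for k using PiE_mem[OF e] that by simp
      then show "(\<lambda>w. \<Sum>i\<in>index_words_at Q \<alpha> r (\<lambda>k. head Q (e k)). \<Sum>j\<in>index_words_at Q \<alpha> r (\<lambda>k. tail Q (e k)).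
          full_polarization r ?par f (\<lambda>k. (e k, snd (i k), snd (j k))) *
          word (map (\<lambda>k. (e k, snd (i k), snd (j k))) [0..<r]) w) \<in> ?R"
        by (rule polarized_invariant_represents[OF Q f inv])
    qed
    have closed: "(\<lambda>w. if length w = r then f w else 0) \<in> carrier (tensor_salg ?X ?par)"
    proof -
      have sub: "{w. (if length w = r then f w else 0) \<noteq> 0} \<subseteq> {w. f w \<noteq> 0}" by auto
      have "finite {w. f w \<noteq> 0}" "{w. f w \<noteq> 0} \<subseteq> lists ?X" using f by (simp_all add: tensor_salg_simps(1))
      then show ?thesis
        using finite_subset[OF sub] subset_trans[OF sub] by (simp only: tensor_salg_simps(1) mem_Collect_eq)
    qed
    have "(\<lambda>w. fact r * (if length w = r then f w else 0)) \<in> ?R"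
      by (rule represents_cong[OF h tensor_scale_closed[OF closed]])
        (rule sym_class_full_polarization[OF f X, symmetric])
    then have "(\<lambda>w. 1 / fact r * (fact r * (if length w = r then f w else 0))) \<in> ?R"
      by (rule represents_scale)
    moreover have "1 / fact r * (fact r * x) = x" for x :: 'k by simp
    ultimately show ?thesis by (simp only:)
  qed
  have fin: "finite {w. f w \<noteq> 0}" using f by (simp add: tensor_salg_simps)
  have eq: "(\<lambda>w. \<Sum>r\<in>length ` {w. f w \<noteq> 0}. if length w = r then f w else 0) = f"
  proof
    fix w
    have "(\<Sum>r\<in>length ` {w. f w \<noteq> 0}. if length w = r then f w else 0) =
        (if length w \<in> length ` {w. f w \<noteq> 0} then f w else 0)"
      by (rule sum.delta') (rule finite_imageI[OF fin])
    then show "(\<Sum>r\<in>length ` {w. f w \<noteq> 0}. if length w = r then f w else 0) = f w" by auto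
  qed
  have "(\<lambda>w. \<Sum>r\<in>length ` {w. f w \<noteq> 0}. if length w = r then f w else 0) \<in> ?R"
    by (rule represents_sum) (rule part)
  then show ?thesis unfolding eq .
qed

theorem corollary4p5:
  fixes Q :: "('v, 'e) pre_digraph"
    and \<alpha> :: "'v superdim"
    and b :: "'v \<Rightarrow> bit"
  assumes "fin_digraph Q"
  shows "(SI Q \<alpha> b :: ('k::field_char_0, 'e) rep_fun set set) =
    generated_subalgebra (K_SRep Q \<alpha> b) {path_str Q \<alpha> b p | p. closed_path Q p}"
proof
  interpret fin_digraph Q by (rule assms)
  show "generated_subalgebra (K_SRep Q \<alpha> b) {path_str Q \<alpha> b p | p. closed_path Q p} \<subseteq>
      (SI Q \<alpha> b :: ('k, 'e) rep_fun set set)"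
    by (rule generated_subset_SI) (rule wf_digraph_axioms)
  show "(SI Q \<alpha> b :: ('k, 'e) rep_fun set set) \<subseteq>
      generated_subalgebra (K_SRep Q \<alpha> b) {path_str Q \<alpha> b p | p. closed_path Q p}"
  proof
    fix F :: "('k, 'e) rep_fun set" assume F: "F \<in> SI Q \<alpha> b"
    then have "F \<in> carrier (Sym_salg (rep_gens Q \<alpha>) (rep_parity Q \<alpha> b))"
      by (simp add: SI_def K_SRep_def)
    then obtain f where f: "f \<in> carrier (tensor_salg (rep_gens Q \<alpha>) (rep_parity Q \<alpha> b))"
      "F = sym_class (rep_gens Q \<alpha>) (rep_parity Q \<alpha> b) f"
      unfolding sym_class_simps(1) by blast
    then show "F \<in> generated_subalgebra (K_SRep Q \<alpha> b) {path_str Q \<alpha> b p | p. closed_path Q p}"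
      using invariant_represents[OF assms f(1)] F by (simp add: represents_def K_SRep_def)
  qed
qed

end
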